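(* Let $M^n$ be a Riemannian manifold of dimension $n$ and let $\nabla$ be a metric connection on a Riemannian vector bundle $E\to M^n$. Fix constants $c\ge 0$ and $c_*\ge 0$. Let $\phi$ be a section of $\Lambda^kT^*M\otimes E$ and let $x$ be a point in $M$ such that $\phi(x)\neq 0$. Then at $x$ the following pointwise inequality holds: $$|\nabla\phi|^{2}+c\,|d^\nabla\phi|^{2}+c_*\,|(d^\nabla)^*\phi|^{2}\ \geq\ \bigl(1+\min\{\tilde c,\tilde c_*\}\bigr)\,\bigl|d|\phi|\bigr|^{2},$$ where $$\tilde c=\begin{cases}\dfrac1k & \text{if } (d^\nabla\phi)_x=0,\\[2mm] \dfrac{c}{1+kc} & \text{if } (d^\nabla\phi)_x\neq 0,\end{cases}\qquad \tilde c_*=\begin{cases}\dfrac1{n-k} & \text{if } ((d^\nabla)^*\phi)_x=0,\\[2mm] \dfrac{c_*}{1+(n-k)c_*} & \text{if } ((d^\nabla)^*\phi)_x\neq 0.\end{cases}$$ Here $d^\nabla$ is the covariant exterior derivative of $\nabla$ and $(d^\nabla)^*$ is the (formal) adjoint of $d^\nabla$.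
   Context: Sections are smooth. In $\nabla\phi$, $\nabla$ denotes the tensor product connection on $\Lambda^kT^*M\otimes E$ of the Levi-Civita connection on $\Lambda^kT^*M$ and the given connection $\nabla^E=\nabla$ on $E$. The operator $d^\nabla:\Gamma(\Lambda^kT^*M\otimes E)\to\Gamma(\Lambda^{k+1}T^*M\otimes E)$ is determined by $d^\nabla(\omega\otimes s)=d\omega\otimes s+(-1)^{|\omega|}\omega\wedge\nabla^Es$; $(d^\nabla)^*:\Gamma(\Lambda^kT^*M\otimes E)\to\Gamma(\Lambda^{k-1}T^*M\otimes E)$ is its formal $L^2$-adjoint. The inner product on $\Lambda^kT^*M$ is the one for which $e_{i_1}^*\wedge\dots\wedge e_{i_k}^*$, $i_1<\dots<i_k$, is orthonormal whenever $\{e_i^*\}$ is an orthonormal basis of $T_x^*M$; tensor products carry the tensor product inner product. Here $0\le k\le n$, and $1/0$ is read as $+\infty$, with $\infty\cdot 0=0$. *)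

theory Defs
  imports
    "HOL-Analysis.Analysis"
    "HOL-Library.Function_Algebras"
    "Jordan_Normal_Form.Determinant"
begin

text \<open>
  Tangent vectors are derivations acting on functions, and \<open>E\<close>-valued \<open>k\<close>-forms at a point are
  functions on lists of tangent vectors; both live in function spaces, which are
  therefore made real vector spaces with the pointwise operations.
\<close>

instantiation "fun" :: (type, real_vector) real_vector
begin

definition scaleR_fun :: "real \<Rightarrow> ('a \<Rightarrow> 'b) \<Rightarrow> 'a \<Rightarrow> 'b"
  where "scaleR_fun a f = (\<lambda>x. a *\<^sub>R f x)"

instance
  by standard (auto simp: scaleR_fun_def plus_fun_def fun_eq_iff scaleR_add_right scaleR_add_left)

end


section \<open>Calculus on open subsets of \<open>n\<close>-space\<close>

text \<open>
  The model space of dimension \<open>n\<close> consists of the sequences vanishing from index \<open>n\<close> on, with the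
  subspace topology of the product topology; \<open>n = 0\<close> is allowed.
\<close>

definition Rn :: "nat \<Rightarrow> (nat \<Rightarrow> real) set"
  where "Rn n = {y. \<forall>i\<ge>n. y i = 0}"

definition partial :: "nat \<Rightarrow> ((nat \<Rightarrow> real) \<Rightarrow> real) \<Rightarrow> (nat \<Rightarrow> real) \<Rightarrow> real"
  where "partial i f y = deriv (\<lambda>t. f (y(i := t))) (y i)"

primrec Ck_on :: "nat \<Rightarrow> nat \<Rightarrow> (nat \<Rightarrow> real) set \<Rightarrow> ((nat \<Rightarrow> real) \<Rightarrow> real) \<Rightarrow> bool"
  where
    "Ck_on n 0 S f \<longleftrightarrow> continuous_on S f"
  | "Ck_on n (Suc m) S f \<longleftrightarrow> continuous_on S f \<and>
       (\<forall>i<n. (\<forall>y\<in>S. (\<lambda>t. f (y(i := t))) differentiable (at (y i))) \<and> Ck_on n m S (partial i f))"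

definition smooth_on_Rn :: "nat \<Rightarrow> (nat \<Rightarrow> real) set \<Rightarrow> ((nat \<Rightarrow> real) \<Rightarrow> real) \<Rightarrow> bool"
  where "smooth_on_Rn n S f \<longleftrightarrow> (\<forall>m. Ck_on n m S f)"


section \<open>Smooth manifolds\<close>

text \<open>
  The manifold is the whole type \<open>'m\<close>, whose type class supplies the Hausdorff and second countable
  topology. A chart is an open set together with a coordinate map; the atlas need not be maximal.
\<close>

type_synonym 'm chart = "'m set \<times> ('m \<Rightarrow> nat \<Rightarrow> real)"

record 'm manifold =
  mdim :: nat
  atlas :: "'m chart set"

definition chart_inv :: "'m chart \<Rightarrow> (nat \<Rightarrow> real) \<Rightarrow> 'm"
  where "chart_inv c = inv_into (fst c) (snd c)"

definition smooth_manifold :: "'m::{t2_space,second_countable_topology} manifold \<Rightarrow> bool"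
  where "smooth_manifold M \<longleftrightarrow>
    (\<Union>c\<in>atlas M. fst c) = UNIV \<and>
    (\<forall>c\<in>atlas M. open (fst c) \<and>
       openin (top_of_set (Rn (mdim M))) (snd c ` fst c) \<and>
       homeomorphism (fst c) (snd c ` fst c) (snd c) (chart_inv c)) \<and>
    (\<forall>c\<in>atlas M. \<forall>d\<in>atlas M. \<forall>i<mdim M.
       smooth_on_Rn (mdim M) (snd c ` (fst c \<inter> fst d)) (\<lambda>y. snd d (chart_inv c y) i))"

definition smooth_fun_on :: "'m::topological_space manifold \<Rightarrow> 'm set \<Rightarrow> ('m \<Rightarrow> real) \<Rightarrow> bool"
  where "smooth_fun_on M W f \<longleftrightarrow>
    (\<forall>c\<in>atlas M. smooth_on_Rn (mdim M) (snd c ` (fst c \<inter> W)) (f \<circ> chart_inv c))"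

definition smooth_near :: "'m::topological_space manifold \<Rightarrow> 'm \<Rightarrow> ('m \<Rightarrow> real) \<Rightarrow> bool"
  where "smooth_near M x f \<longleftrightarrow> (\<exists>W. open W \<and> x \<in> W \<and> smooth_fun_on M W f)"


section \<open>Vector bundles\<close>

text \<open>
  The fibres are linear subspaces of one real vector space type \<open>'e\<close>; this is only an encoding, no
  trivialization of the bundle is implied, and fibres over different points are never compared.
  The smooth structure is given by a family of local frames, i.e. of local trivializations.
\<close>

record ('m, 'e) vbundle =
  brank :: nat
  fibre :: "'m \<Rightarrow> 'e set"
  frames :: "('m set \<times> (nat \<Rightarrow> 'm \<Rightarrow> 'e)) set"

definition smooth_section_on ::
    "'m::topological_space manifold \<Rightarrow> ('m, 'e::real_vector) vbundle \<Rightarrow> 'm set \<Rightarrow> ('m \<Rightarrow> 'e) \<Rightarrow> bool"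
  where "smooth_section_on M E W \<sigma> \<longleftrightarrow>
    (\<forall>x\<in>W. \<sigma> x \<in> fibre E x) \<and>
    (\<forall>(V, s)\<in>frames E. \<exists>a. (\<forall>i<brank E. smooth_fun_on M (V \<inter> W) (a i)) \<and>
       (\<forall>x\<in>V \<inter> W. \<sigma> x = (\<Sum>i<brank E. a i x *\<^sub>R s i x)))"

text \<open>The last conjunct says that the transition matrices between frames are smooth.\<close>

definition vector_bundle ::
    "'m::topological_space manifold \<Rightarrow> ('m, 'e::real_vector) vbundle \<Rightarrow> bool"
  where "vector_bundle M E \<longleftrightarrow>
    (\<Union>(V, s)\<in>frames E. V) = UNIV \<and>
    (\<forall>(V, s)\<in>frames E. open V \<and>
       (\<forall>x\<in>V. inj_on (\<lambda>i. s i x) {..<brank E} \<and>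
          independent ((\<lambda>i. s i x) ` {..<brank E}) \<and>
          span ((\<lambda>i. s i x) ` {..<brank E}) = fibre E x) \<and>
       (\<forall>i<brank E. smooth_section_on M E V (s i)))"

definition trivial_line :: "('m, real) vbundle"
  where "trivial_line = \<lparr>brank = 1, fibre = (\<lambda>_. UNIV), frames = {(UNIV, \<lambda>_ _. 1)}\<rparr>"

definition fibre_metric ::
    "'m::topological_space manifold \<Rightarrow> ('m, 'e::real_vector) vbundle \<Rightarrow> ('m \<Rightarrow> 'e \<Rightarrow> 'e \<Rightarrow> real) \<Rightarrow> bool"
  where "fibre_metric M E h \<longleftrightarrow>
    (\<forall>x. \<forall>u\<in>fibre E x. \<forall>v\<in>fibre E x. \<forall>w\<in>fibre E x. \<forall>a b.
       h x (a *\<^sub>R u + b *\<^sub>R v) w = a * h x u w + b * h x v w \<and>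
       h x u v = h x v u \<and>
       (u \<noteq> 0 \<longrightarrow> h x u u > 0)) \<and>
    (\<forall>W \<sigma> \<tau>. open W \<and> smooth_section_on M E W \<sigma> \<and> smooth_section_on M E W \<tau> \<longrightarrow>
       smooth_fun_on M W (\<lambda>x. h x (\<sigma> x) (\<tau> x)))"


section \<open>The tangent bundle\<close>

type_synonym 'm tvec = "('m \<Rightarrow> real) \<Rightarrow> real"

text \<open>
  The derivation \<open>\<partial>/\<partial>\<xi>\<^sup>i\<close> at \<open>x\<close> of a chart. Functions that are not smooth near \<open>x\<close> are sent to \<open>0\<close>, so
  that a tangent vector is determined by its values on germs of smooth functions.
\<close>

definition coord_vec :: "'m::topological_space manifold \<Rightarrow> 'm chart \<Rightarrow> nat \<Rightarrow> 'm \<Rightarrow> 'm tvec"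
  where "coord_vec M c i x =
    (\<lambda>f. if smooth_near M x f then partial i (f \<circ> chart_inv c) (snd c x) else 0)"

definition tangent_space :: "'m::topological_space manifold \<Rightarrow> 'm \<Rightarrow> 'm tvec set"
  where "tangent_space M x =
    span {coord_vec M c i x | c i. c \<in> atlas M \<and> x \<in> fst c \<and> i < mdim M}"

definition tangent_bundle :: "'m::topological_space manifold \<Rightarrow> ('m, 'm tvec) vbundle"
  where "tangent_bundle M =
    \<lparr>brank = mdim M, fibre = tangent_space M,
     frames = (\<lambda>c. (fst c, coord_vec M c)) ` atlas M\<rparr>"

abbreviation vector_field_on ::
    "'m::topological_space manifold \<Rightarrow> 'm set \<Rightarrow> ('m \<Rightarrow> 'm tvec) \<Rightarrow> bool"
  where "vector_field_on M \<equiv> smooth_section_on M (tangent_bundle M)"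

definition lie_bracket ::
    "'m::topological_space manifold \<Rightarrow> ('m \<Rightarrow> 'm tvec) \<Rightarrow> ('m \<Rightarrow> 'm tvec) \<Rightarrow> 'm \<Rightarrow> 'm tvec"
  where "lie_bracket M X Y x =
    (\<lambda>f. if smooth_near M x f then X x (\<lambda>y. Y y f) - Y x (\<lambda>y. X y f) else 0)"

definition riemannian_metric ::
    "'m::topological_space manifold \<Rightarrow> ('m \<Rightarrow> 'm tvec \<Rightarrow> 'm tvec \<Rightarrow> real) \<Rightarrow> bool"
  where "riemannian_metric M g \<longleftrightarrow> fibre_metric M (tangent_bundle M) g"


section \<open>Connections\<close>

text \<open>
  \<open>nab x v \<sigma>\<close> is the derivative at \<open>x\<close>, in direction \<open>v\<close>, of a section \<open>\<sigma>\<close> defined near \<open>x\<close>. A connection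
  is thus presented together with its (unique) extension to sections over open sets.
\<close>

type_synonym ('m, 'e) conn = "'m \<Rightarrow> 'm tvec \<Rightarrow> ('m \<Rightarrow> 'e) \<Rightarrow> 'e"

definition connection ::
    "'m::topological_space manifold \<Rightarrow> ('m, 'e::real_vector) vbundle \<Rightarrow> ('m, 'e) conn \<Rightarrow> bool"
  where "connection M E nab \<longleftrightarrow>
    (\<forall>W \<sigma>. open W \<and> smooth_section_on M E W \<sigma> \<longrightarrow>
       (\<forall>x\<in>W. \<forall>v\<in>tangent_space M x.
          nab x v \<sigma> \<in> fibre E x \<and>
          (\<forall>w\<in>tangent_space M x. \<forall>a b.
             nab x (a *\<^sub>R v + b *\<^sub>R w) \<sigma> = a *\<^sub>R nab x v \<sigma> + b *\<^sub>R nab x w \<sigma>) \<and>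
          (\<forall>\<tau>. smooth_section_on M E W \<tau> \<longrightarrow>
             nab x v (\<lambda>y. \<sigma> y + \<tau> y) = nab x v \<sigma> + nab x v \<tau>) \<and>
          (\<forall>f. smooth_fun_on M W f \<longrightarrow>
             nab x v (\<lambda>y. f y *\<^sub>R \<sigma> y) = v f *\<^sub>R \<sigma> x + f x *\<^sub>R nab x v \<sigma>) \<and>
          (\<forall>\<tau>. (\<forall>y\<in>W. \<tau> y = \<sigma> y) \<longrightarrow> nab x v \<tau> = nab x v \<sigma>)) \<and>
       (\<forall>X. vector_field_on M W X \<longrightarrow> smooth_section_on M E W (\<lambda>x. nab x (X x) \<sigma>)))"

definition metric_connection ::
    "'m::topological_space manifold \<Rightarrow> ('m, 'e::real_vector) vbundle \<Rightarrow>
     ('m \<Rightarrow> 'e \<Rightarrow> 'e \<Rightarrow> real) \<Rightarrow> ('m, 'e) conn \<Rightarrow> bool"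
  where "metric_connection M E h nab \<longleftrightarrow>
    connection M E nab \<and>
    (\<forall>W \<sigma> \<tau>. open W \<and> smooth_section_on M E W \<sigma> \<and> smooth_section_on M E W \<tau> \<longrightarrow>
       (\<forall>x\<in>W. \<forall>v\<in>tangent_space M x.
          v (\<lambda>y. h y (\<sigma> y) (\<tau> y)) = h x (nab x v \<sigma>) (\<tau> x) + h x (\<sigma> x) (nab x v \<tau>)))"

definition levi_civita ::
    "'m::topological_space manifold \<Rightarrow> ('m \<Rightarrow> 'm tvec \<Rightarrow> 'm tvec \<Rightarrow> real) \<Rightarrow> ('m, 'm tvec) conn \<Rightarrow> bool"
  where "levi_civita M g D \<longleftrightarrow>
    metric_connection M (tangent_bundle M) g D \<and>
    (\<forall>W X Y. open W \<and> vector_field_on M W X \<and> vector_field_on M W Y \<longrightarrow>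
       (\<forall>x\<in>W. D x (X x) Y - D x (Y x) X = lie_bracket M X Y x))"


section \<open>Bundle-valued forms\<close>

text \<open>
  \<open>\<Lambda>\<^sup>kT\<^sub>x\<^sup>*M \<otimes> E\<^sub>x\<close> is realized as the space of alternating \<open>k\<close>-linear maps from \<open>T\<^sub>xM\<close> to \<open>E\<^sub>x\<close>, where
  \<open>\<omega> \<otimes> e\<close> is the map \<open>vs \<mapsto> \<omega>(vs) e\<close> and a wedge product of covectors evaluates to the
  determinant (no factorials). Arguments are lists of length \<open>k\<close>; elsewhere the value is \<open>0\<close>.
\<close>

definition tlists :: "'m::topological_space manifold \<Rightarrow> nat \<Rightarrow> 'm \<Rightarrow> 'm tvec list set"
  where "tlists M k x = {vs. length vs = k \<and> set vs \<subseteq> tangent_space M x}"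

definition alt_forms ::
    "'m::topological_space manifold \<Rightarrow> ('m, 'e::real_vector) vbundle \<Rightarrow> nat \<Rightarrow> 'm \<Rightarrow> ('m tvec list \<Rightarrow> 'e) set"
  where "alt_forms M E k x = {\<alpha>.
    (\<forall>vs. vs \<notin> tlists M k x \<longrightarrow> \<alpha> vs = 0) \<and>
    (\<forall>vs\<in>tlists M k x.
       \<alpha> vs \<in> fibre E x \<and>
       (\<forall>i<k. \<forall>v\<in>tangent_space M x. \<forall>w\<in>tangent_space M x. \<forall>a b.
          \<alpha> (vs[i := a *\<^sub>R v + b *\<^sub>R w]) = a *\<^sub>R \<alpha> (vs[i := v]) + b *\<^sub>R \<alpha> (vs[i := w])) \<and>
       (\<forall>i j. i < j \<and> j < k \<and> vs ! i = vs ! j \<longrightarrow> \<alpha> vs = 0))}"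

definition eval_form :: "('m \<Rightarrow> 'm tvec list \<Rightarrow> 'e) \<Rightarrow> ('m \<Rightarrow> 'm tvec) list \<Rightarrow> 'm \<Rightarrow> 'e"
  where "eval_form \<phi> Ys y = \<phi> y (map (\<lambda>Y. Y y) Ys)"

definition smooth_form_on ::
    "'m::topological_space manifold \<Rightarrow> ('m, 'e::real_vector) vbundle \<Rightarrow> nat \<Rightarrow> 'm set \<Rightarrow>
     ('m \<Rightarrow> 'm tvec list \<Rightarrow> 'e) \<Rightarrow> bool"
  where "smooth_form_on M E k W \<phi> \<longleftrightarrow>
    (\<forall>x\<in>W. \<phi> x \<in> alt_forms M E k x) \<and>
    (\<forall>V Ys. open V \<and> V \<subseteq> W \<and> length Ys = k \<and> (\<forall>Y\<in>set Ys. vector_field_on M V Y) \<longrightarrow>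
       smooth_section_on M E V (eval_form \<phi> Ys))"

text \<open>
  Some vector fields near \<open>x\<close> with prescribed values at \<open>x\<close>. The tensorial expressions below that
  use them do not depend on the choice.
\<close>

definition extend :: "'m::topological_space manifold \<Rightarrow> 'm \<Rightarrow> 'm tvec list \<Rightarrow> ('m \<Rightarrow> 'm tvec) list"
  where "extend M x vs = (SOME Ys. map (\<lambda>Y. Y x) Ys = vs \<and>
    (\<exists>W. open W \<and> x \<in> W \<and> (\<forall>Y\<in>set Ys. vector_field_on M W Y)))"

text \<open>
  The tensor product connection:
  \<open>(\<nabla>\<^sub>v\<phi>)(Y\<^sub>1,\<dots>,Y\<^sub>k) = \<nabla>\<^sup>E\<^sub>v(\<phi>(Y\<^sub>1,\<dots>,Y\<^sub>k)) - \<Sum>\<^sub>i \<phi>(Y\<^sub>1,\<dots>,D\<^sub>vY\<^sub>i,\<dots>,Y\<^sub>k)\<close>.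
\<close>

definition form_nabla ::
    "'m::topological_space manifold \<Rightarrow> ('m, 'm tvec) conn \<Rightarrow> ('m, 'e::real_vector) conn \<Rightarrow> nat \<Rightarrow>
     ('m \<Rightarrow> 'm tvec list \<Rightarrow> 'e) \<Rightarrow> 'm \<Rightarrow> 'm tvec \<Rightarrow> 'm tvec list \<Rightarrow> 'e"
  where "form_nabla M D nab k \<phi> x v = (\<lambda>vs.
    if vs \<in> tlists M k x then
      (let Ys = extend M x vs in
        nab x v (eval_form \<phi> Ys) - (\<Sum>i<k. \<phi> x (vs[i := D x v (Ys ! i)])))
    else 0)"

definition omit :: "nat \<Rightarrow> 'a list \<Rightarrow> 'a list"
  where "omit p xs = take p xs @ drop (Suc p) xs"

text \<open>The exterior derivative of real-valued forms, by the invariant (Cartan) formula.\<close>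

definition ext_deriv ::
    "'m::topological_space manifold \<Rightarrow> nat \<Rightarrow> ('m \<Rightarrow> 'm tvec list \<Rightarrow> real) \<Rightarrow>
     'm \<Rightarrow> 'm tvec list \<Rightarrow> real"
  where "ext_deriv M k \<omega> x = (\<lambda>vs.
    if vs \<in> tlists M (Suc k) x then
      (let Ys = extend M x vs in
        (\<Sum>p\<le>k. (- 1) ^ p * (vs ! p) (eval_form \<omega> (omit p Ys))) +
        (\<Sum>q\<le>k. \<Sum>p<q. (- 1) ^ (p + q) *
           \<omega> x (lie_bracket M (Ys ! p) (Ys ! q) x # omit p (omit q vs))))
    else 0)"

definition wedge1 ::
    "'m::topological_space manifold \<Rightarrow> nat \<Rightarrow> 'm \<Rightarrow> ('m tvec list \<Rightarrow> real) \<Rightarrow> ('m tvec \<Rightarrow> 'e::real_vector) \<Rightarrow>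
     'm tvec list \<Rightarrow> 'e"
  where "wedge1 M k x \<alpha> \<theta> = (\<lambda>vs.
    if vs \<in> tlists M (Suc k) x then
      (\<Sum>p\<le>k. ((- 1) ^ (k - p) * \<alpha> (omit p vs)) *\<^sub>R \<theta> (vs ! p))
    else 0)"

text \<open>
  \<open>d\<^sup>\<nabla>\<phi>\<close> at \<open>x\<close>: write \<open>\<phi> = \<Sum>\<^sub>j \<omega>\<^sub>j \<otimes> s\<^sub>j\<close> near \<open>x\<close> (for instance using a local frame) and apply
  \<open>d\<^sup>\<nabla>(\<omega> \<otimes> s) = d\<omega> \<otimes> s + (-1)\<^sup>k \<omega> \<and> \<nabla>s\<close> to each term. The result does not depend on the
  decomposition.
\<close>

definition d_nabla ::
    "'m::topological_space manifold \<Rightarrow> ('m, 'e::real_vector) vbundle \<Rightarrow> ('m, 'e) conn \<Rightarrow> nat \<Rightarrow>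
     ('m \<Rightarrow> 'm tvec list \<Rightarrow> 'e) \<Rightarrow> 'm \<Rightarrow> 'm tvec list \<Rightarrow> 'e"
  where "d_nabla M E nab k \<phi> x = (SOME \<alpha>. \<exists>W (N::nat) \<omega> s.
    open W \<and> x \<in> W \<and>
    (\<forall>j<N. smooth_form_on M trivial_line k W (\<omega> j) \<and> smooth_section_on M E W (s j)) \<and>
    (\<forall>y\<in>W. \<phi> y = (\<lambda>vs. \<Sum>j<N. \<omega> j y vs *\<^sub>R s j y)) \<and>
    \<alpha> = (\<lambda>vs. \<Sum>j<N. ext_deriv M k (\<omega> j) x vs *\<^sub>R s j x +
            (- 1) ^ k *\<^sub>R wedge1 M k x (\<omega> j x) (\<lambda>v. nab x v (s j)) vs))"


section \<open>Norms\<close>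

definition onb ::
    "'m::topological_space manifold \<Rightarrow> ('m \<Rightarrow> 'm tvec \<Rightarrow> 'm tvec \<Rightarrow> real) \<Rightarrow> 'm \<Rightarrow> nat \<Rightarrow> 'm tvec"
  where "onb M g x = (SOME e.
    (\<forall>i<mdim M. e i \<in> tangent_space M x) \<and>
    (\<forall>i<mdim M. \<forall>j<mdim M. g x (e i) (e j) = (if i = j then 1 else 0)))"

text \<open>
  With \<open>\<phi> = \<Sum>\<^sub>I e\<^sub>I\<^sup>* \<otimes> \<phi>(e\<^sub>I)\<close>, \<open>I\<close> ranging over the increasing multi-indices, this is the inner product
  for which the \<open>e\<^sub>I\<^sup>*\<close> are orthonormal, tensored with the metric of \<open>E\<close>.
\<close>

definition form_inner ::
    "'m::topological_space manifold \<Rightarrow> ('m \<Rightarrow> 'm tvec \<Rightarrow> 'm tvec \<Rightarrow> real) \<Rightarrow> ('m \<Rightarrow> 'e \<Rightarrow> 'e \<Rightarrow> real) \<Rightarrow>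
     nat \<Rightarrow> 'm \<Rightarrow> ('m tvec list \<Rightarrow> 'e) \<Rightarrow> ('m tvec list \<Rightarrow> 'e) \<Rightarrow> real"
  where "form_inner M g h k x \<alpha> \<beta> =
    (\<Sum>I | length I = k \<and> sorted_wrt (<) I \<and> set I \<subseteq> {..<mdim M}.
       h x (\<alpha> (map (onb M g x) I)) (\<beta> (map (onb M g x) I)))"

definition form_norm ::
    "'m::topological_space manifold \<Rightarrow> ('m \<Rightarrow> 'm tvec \<Rightarrow> 'm tvec \<Rightarrow> real) \<Rightarrow> ('m \<Rightarrow> 'e \<Rightarrow> 'e \<Rightarrow> real) \<Rightarrow>
     nat \<Rightarrow> 'm \<Rightarrow> ('m tvec list \<Rightarrow> 'e) \<Rightarrow> real"
  where "form_norm M g h k x \<alpha> = sqrt (form_inner M g h k x \<alpha> \<alpha>)"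

definition norm_sq_nabla ::
    "'m::topological_space manifold \<Rightarrow> ('m \<Rightarrow> 'm tvec \<Rightarrow> 'm tvec \<Rightarrow> real) \<Rightarrow> ('m \<Rightarrow> 'e \<Rightarrow> 'e \<Rightarrow> real) \<Rightarrow>
     nat \<Rightarrow> 'm \<Rightarrow> ('m tvec \<Rightarrow> 'm tvec list \<Rightarrow> 'e) \<Rightarrow> real"
  where "norm_sq_nabla M g h k x \<Phi> = (\<Sum>i<mdim M. (form_norm M g h k x (\<Phi> (onb M g x i)))\<^sup>2)"

definition norm_sq_d ::
    "'m::topological_space manifold \<Rightarrow> ('m \<Rightarrow> 'm tvec \<Rightarrow> 'm tvec \<Rightarrow> real) \<Rightarrow> ('m \<Rightarrow> real) \<Rightarrow> 'm \<Rightarrow> real"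
  where "norm_sq_d M g f x = (\<Sum>i<mdim M. (onb M g x i f)\<^sup>2)"


section \<open>The formal adjoint\<close>

text \<open>
  The Riemannian measure, which has density \<open>\<surd>det(g\<^sub>i\<^sub>j)\<close> with respect to Lebesgue measure in every
  chart; no orientation is needed. Lebesgue measure on \<open>n\<close>-space is \<open>\<Pi>\<^sub>M i\<in>{..<n}. lborel\<close>, whose points
  are extended by zero to points of the model space.
\<close>

definition zero_ext :: "nat \<Rightarrow> (nat \<Rightarrow> real) \<Rightarrow> nat \<Rightarrow> real"
  where "zero_ext n z = (\<lambda>i. if i < n then z i else 0)"

definition gram_det ::
    "'m::topological_space manifold \<Rightarrow> ('m \<Rightarrow> 'm tvec \<Rightarrow> 'm tvec \<Rightarrow> real) \<Rightarrow> 'm chart \<Rightarrow> 'm \<Rightarrow> real"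
  where "gram_det M g c x = Determinant.det
    (Matrix.mat (mdim M) (mdim M) (\<lambda>(i, j). g x (coord_vec M c i x) (coord_vec M c j x)))"

definition riemannian_measure ::
    "'m::topological_space manifold \<Rightarrow> ('m \<Rightarrow> 'm tvec \<Rightarrow> 'm tvec \<Rightarrow> real) \<Rightarrow> 'm measure \<Rightarrow> bool"
  where "riemannian_measure M g vol \<longleftrightarrow>
    sets vol = sets borel \<and>
    (\<forall>c\<in>atlas M. \<forall>B\<in>sets borel. B \<subseteq> fst c \<longrightarrow>
       emeasure vol B =
         (\<integral>\<^sup>+ z. indicator (snd c ` B) (zero_ext (mdim M) z) *
               ennreal (sqrt (gram_det M g c (chart_inv c (zero_ext (mdim M) z))))
          \<partial>(\<Pi>\<^sub>M i\<in>{..<mdim M}. lborel)))"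

definition compactly_supported :: "('m::topological_space \<Rightarrow> 'b::zero) \<Rightarrow> bool"
  where "compactly_supported \<eta> \<longleftrightarrow> (\<exists>K. compact K \<and> (\<forall>x. x \<notin> K \<longrightarrow> \<eta> x = 0))"

text \<open>
  \<open>dstar\<close> maps \<open>k\<close>-forms to \<open>(k-1)\<close>-forms and is the formal \<open>L\<^sup>2\<close>-adjoint of \<open>d\<^sup>\<nabla>\<close> on \<open>(k-1)\<close>-forms; for
  \<open>k = 0\<close> it is zero, as there are no forms of degree \<open>-1\<close>.
\<close>

definition formal_adjoint ::
    "'m::topological_space manifold \<Rightarrow> ('m \<Rightarrow> 'm tvec \<Rightarrow> 'm tvec \<Rightarrow> real) \<Rightarrow> 'm measure \<Rightarrow>
     ('m, 'e::real_vector) vbundle \<Rightarrow> ('m \<Rightarrow> 'e \<Rightarrow> 'e \<Rightarrow> real) \<Rightarrow> ('m, 'e) conn \<Rightarrow> nat \<Rightarrow>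
     (('m \<Rightarrow> 'm tvec list \<Rightarrow> 'e) \<Rightarrow> 'm \<Rightarrow> 'm tvec list \<Rightarrow> 'e) \<Rightarrow> bool"
  where "formal_adjoint M g vol E h nab k dstar \<longleftrightarrow>
    (\<forall>\<phi>. smooth_form_on M E k UNIV \<phi> \<longrightarrow>
       (if k = 0 then dstar \<phi> = 0
        else smooth_form_on M E (k - 1) UNIV (dstar \<phi>) \<and>
          (\<forall>\<eta>. smooth_form_on M E (k - 1) UNIV \<eta> \<and> compactly_supported \<eta> \<longrightarrow>
             (\<integral>x. form_inner M g h k x (d_nabla M E nab (k - 1) \<eta> x) (\<phi> x) \<partial>vol) =
             (\<integral>x. form_inner M g h (k - 1) x (\<eta> x) (dstar \<phi> x) \<partial>vol))))"

end

theory Submission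
  imports Defs "HOL-Combinatorics.Multiset_Permutations"
begin

text \<open>
  Let \<open>T\<^sub>i = \<nabla>\<^bsub>e\<^sub>i\<^esub>\<phi>\<close> in an orthonormal frame, \<open>f = \<phi>/|\<phi>|\<close> and \<open>v\<^sub>i = \<langle>T\<^sub>i, f\<rangle>\<close>;
  as the connections are metric, \<open>v = d|\<phi>|\<close>.
  Antisymmetrizing \<open>T\<close> gives \<open>d\<^sup>\<nabla>\<phi>\<close> and contracting it gives \<open>-(d\<^sup>\<nabla>)\<^sup>*\<phi>\<close>, so the
  theorem is an inequality for a family of alternating forms \<open>T\<^sub>i\<close>. The excess \<open>|T|\<^sup>2 - |v|\<^sup>2\<close> is the square norm of \<open>T - v \<otimes> f\<close>, which the
  Cauchy--Schwarz inequality bounds below by testing against \<open>v \<and> \<iota>\<^sub>if - e\<^sub>i \<and> \<iota>\<^sub>vf\<close>, because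
  \<open>|v \<and> f|\<^sup>2 + |\<iota>\<^sub>vf|\<^sup>2 = |v|\<^sup>2\<close>.

  That the \<open>L\<^sup>2\<close>-adjoint is the pointwise contraction \<open>\<delta>\<phi> = -\<Sum>\<^sub>i \<iota>\<^sub>i T\<^sub>i\<close> rests on the divergence theorem:
  \<open>\<langle>d\<^sup>\<nabla>\<eta>, \<phi>\<rangle> - \<langle>\<eta>, \<delta>\<phi>\<rangle>\<close> is the divergence of a vector field \<open>X\<close>, and for \<open>\<eta>\<close> supported in a chart
  \<open>\<surd>det g \<cdot> div X = \<Sum>\<^sub>l \<partial>\<^sub>l(\<surd>det g \<cdot> X\<^sup>l)\<close> integrates to zero. Taking \<open>\<eta> = \<chi> \<cdot> ((d\<^sup>\<nabla>)\<^sup>*\<phi> - \<delta>\<phi>)\<close> with a bump function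
  \<open>\<chi>\<close> shows \<open>(d\<^sup>\<nabla>)\<^sup>*\<phi> = \<delta>\<phi>\<close>.
\<close>

section \<open>Calculus on open subsets of the model space\<close>

text \<open>Both constants come from one quadratic in a free coefficient m. Subtracting m times the
  test family from \<open>T - v \<otimes> f\<close> leaves a nonnegative square whose m^2 term is
  \<open>k |v \<and> f|\<^sup>2 + (n - k) |\<iota>\<^sub>v f|\<^sup>2\<close>. As these two squares
  add up to |v|^2, the estimate splits in two: one half sees only the exterior derivative, k and c,
  the other only the contraction, n - k and \<open>cs\<close>. The first half holds once m (k + 1/c)
  is at most 1, or m k at most 1 if the exterior derivative vanishes; likewise the second. Hence the
  minimum. The obstacle is that the notions are given by choices or by a property: \<nabla>\<phi> by
  chosen extensions of vectors, the exterior derivative by a chosen decomposition, norms by a basis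
  chosen point by point that need not vary continuously, the adjoint only by integrals. Independence
  of all these choices has to be shown before smooth local frames can be used. An infinite minimum
  occurs only for n = 0; otherwise m is real.\<close>

abbreviation open_Rn :: "nat \<Rightarrow> (nat \<Rightarrow> real) set \<Rightarrow> bool"
  where "open_Rn n S \<equiv> openin (top_of_set (Rn n)) S"

definition box_Rn :: "nat \<Rightarrow> (nat \<Rightarrow> real) \<Rightarrow> real \<Rightarrow> (nat \<Rightarrow> real) set"
  where "box_Rn n y r = {z\<in>Rn n. \<forall>i<n. \<bar>z i - y i\<bar> < r}"

lemma box_Rn_mono: "r \<le> s \<Longrightarrow> box_Rn n y r \<subseteq> box_Rn n y s"
  by (fastforce simp: box_Rn_def)

lemma ex_uniform_radius:
  assumes "\<And>i. i < n \<Longrightarrow> \<exists>r>0. P i (r::real)"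
    and mono: "\<And>i r s. i < n \<Longrightarrow> P i r \<Longrightarrow> 0 < s \<Longrightarrow> s \<le> r \<Longrightarrow> P i s"
  shows "\<exists>r>0. \<forall>i<(n::nat). P i r"
proof -
  obtain R where R: "\<And>i. i < n \<Longrightarrow> R i > 0 \<and> P i (R i)"
    using assms(1) by metis
  \<comment> \<open>The inserted 1 keeps the minimum defined when n is 0.\<close>
  define r where "r = Min (insert 1 (R ` {..<n}))"
  have "r > 0" using R by (auto simp: r_def)
  moreover have "r \<le> R i" if "i < n" for i
    using that by (auto simp: r_def)
  ultimately show ?thesis using R mono by blast
qed

lemma open_box_Rn: "open_Rn n (box_Rn n y r)"
proof -
  have "open (\<Inter>i\<in>{..<n}. {z::nat\<Rightarrow>real. \<bar>z i - y i\<bar> < r})"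
    by (intro open_INT ballI open_Collect_less continuous_intros
        continuous_on_product_coordinates) auto
  moreover have "box_Rn n y r = Rn n \<inter> (\<Inter>i\<in>{..<n}. {z::nat\<Rightarrow>real. \<bar>z i - y i\<bar> < r})"
    by (auto simp: box_Rn_def)
  ultimately show ?thesis by (auto simp: openin_open)
qed

text \<open>A product-open set may also restrict coordinates from index n on, but every point of
  \<open>Rn n\<close> vanishes there, so the first n radii decide and their minimum serves.\<close>

lemma open_Rn_iff:
  "open_Rn n S \<longleftrightarrow> S \<subseteq> Rn n \<and> (\<forall>y\<in>S. \<exists>r>0. box_Rn n y r \<subseteq> S)"
proof (intro iffI conjI ballI)
  assume S: "open_Rn n S"
  then show "S \<subseteq> Rn n" using openin_imp_subset by blast
  fix y assume y: "y \<in> S"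
  obtain T where T: "open T" "S = Rn n \<inter> T" using S by (auto simp: openin_open)
  have yT: "y \<in> T" using y T by auto
  have "openin (product_topology (\<lambda>i. euclidean) UNIV) T" using T
    by (simp add: open_fun_def)
  from product_topology_open_contains_basis[OF this yT]
  obtain X where X: "y \<in> (\<Pi>\<^sub>E i\<in>UNIV. X i)" "\<And>i. open (X i)" "(\<Pi>\<^sub>E i\<in>UNIV. X i) \<subseteq> T"
    by (auto simp: open_openin[symmetric])
  have "\<exists>r>0. ball (y i) r \<subseteq> X i" for i
    using X(1) X(2)[of i] by (auto simp: PiE_iff open_contains_ball)
  then have "\<exists>r>0. \<forall>i<n. ball (y i) r \<subseteq> X i"
    by (intro ex_uniform_radius) (auto simp: subset_iff)
  then obtain r where r: "r > 0" "\<And>i. i < n \<Longrightarrow> ball (y i) r \<subseteq> X i" by blast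
  have "box_Rn n y r \<subseteq> S"
  proof
    fix z assume z: "z \<in> box_Rn n y r"
    have "z i \<in> X i" for i
    proof (cases "i < n")
      case True
      then have "z i \<in> ball (y i) r" using z by (auto simp: box_Rn_def dist_real_def)
      then show ?thesis using r(2)[OF True] by blast
    next
      case False
      then have "z i = y i" using z y T by (auto simp: box_Rn_def Rn_def)
      then show ?thesis using X(1) by (auto simp: PiE_iff)
    qed
    then have "z \<in> T" using X(3) by (auto simp: PiE_iff)
    then show "z \<in> S" using z T by (auto simp: box_Rn_def)
  qed
  then show "\<exists>r>0. box_Rn n y r \<subseteq> S" using r by blast
next
  assume S: "S \<subseteq> Rn n \<and> (\<forall>y\<in>S. \<exists>r>0. box_Rn n y r \<subseteq> S)"
  have "\<exists>T. open_Rn n T \<and> y \<in> T \<and> T \<subseteq> S" if "y \<in> S" for y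
  proof -
    obtain r where r: "r > 0" "box_Rn n y r \<subseteq> S" using S \<open>y \<in> S\<close> by blast
    have "y \<in> box_Rn n y r" using S \<open>y \<in> S\<close> r(1) by (auto simp: box_Rn_def)
    then show ?thesis using r(2) open_box_Rn by blast
  qed
  then show "open_Rn n S" by (subst openin_subopen) blast
qed

lemma continuous_on_open_Rn_iff:
  fixes f :: "(nat \<Rightarrow> real) \<Rightarrow> real"
  assumes S: "open_Rn n S"
  shows "continuous_on S f \<longleftrightarrow>
    (\<forall>y\<in>S. \<forall>e>0. \<exists>r>0. \<forall>z\<in>box_Rn n y r \<inter> S. \<bar>f z - f y\<bar> < e)"
proof (intro iffI ballI allI impI)
  fix y e assume f: "continuous_on S f" and y: "y \<in> S" and e: "(e::real) > 0"
  have "openin (top_of_set S) (S \<inter> f -` ball (f y) e)"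
    using f by (intro continuous_openin_preimage_gen) auto
  then have "open_Rn n (S \<inter> f -` ball (f y) e)" using S openin_trans by blast
  then obtain r where "r > 0" "box_Rn n y r \<subseteq> S \<inter> f -` ball (f y) e"
    using y e unfolding open_Rn_iff by (metis IntI centre_in_ball vimageI)
  then show "\<exists>r>0. \<forall>z\<in>box_Rn n y r \<inter> S. \<bar>f z - f y\<bar> < e"
    by (intro exI[of _ r]) (auto simp: dist_real_def abs_minus_commute)
next
  assume *: "\<forall>y\<in>S. \<forall>e>0. \<exists>r>0. \<forall>z\<in>box_Rn n y r \<inter> S. \<bar>f z - f y\<bar> < e"
  have "openin (top_of_set S) (S \<inter> f -` T)" if T: "open T" for T
  proof -
    have "open_Rn n (S \<inter> f -` T)"
      unfolding open_Rn_iff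
    proof (intro conjI ballI)
      show "S \<inter> f -` T \<subseteq> Rn n" using S by (auto simp: open_Rn_iff)
      fix y assume y: "y \<in> S \<inter> f -` T"
      then obtain e where e: "e > 0" "ball (f y) e \<subseteq> T" using T by (auto simp: open_contains_ball)
      obtain r where r: "r > 0" "\<forall>z\<in>box_Rn n y r \<inter> S. \<bar>f z - f y\<bar> < e" using * e y by blast
      obtain s where s: "s > 0" "box_Rn n y s \<subseteq> S" using S y by (auto simp: open_Rn_iff)
      have "box_Rn n y (min r s) \<subseteq> S \<inter> f -` T"
      proof
        fix z assume z: "z \<in> box_Rn n y (min r s)"
        then have "z \<in> S" "z \<in> box_Rn n y r"
          using s(2) box_Rn_mono[of "min r s" s n y] box_Rn_mono[of "min r s" r n y] by auto
        then have "f z \<in> ball (f y) e" using r by (auto simp: dist_real_def abs_minus_commute)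
        then show "z \<in> S \<inter> f -` T" using \<open>z \<in> S\<close> e by auto
      qed
      then show "\<exists>r>0. box_Rn n y r \<subseteq> S \<inter> f -` T" using r s by (intro exI[of _ "min r s"]) auto
    qed
    moreover have "S \<subseteq> Rn n" using S by (auto simp: open_Rn_iff)
    ultimately show ?thesis by (rule openin_subset_trans[OF _ Int_lower1])
  qed
  then show "continuous_on S f"
    by (simp add: continuous_openin_preimage_eq)
qed

section \<open>Partial derivatives and the classes \<open>Ck_on\<close>\<close>

lemma eventually_fun_upd_open_Rn:
  assumes "open_Rn n S" "y \<in> S" "i < n"
  shows "\<forall>\<^sub>F t in nhds (y i). y(i := t) \<in> S"
proof -
  obtain r where r: "r > 0" "box_Rn n y r \<subseteq> S" using assms by (auto simp: open_Rn_iff)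
  have "y \<in> Rn n" using assms by (auto simp: open_Rn_iff)
  then have "y(i := t) \<in> S" if "dist t (y i) < r" for t
    using that r assms(3) by (intro subsetD[OF r(2)]) (auto simp: box_Rn_def Rn_def dist_real_def)
  then show ?thesis using r(1) by (auto simp: eventually_nhds_metric)
qed

lemma Ck_on_continuous: "Ck_on n m S f \<Longrightarrow> continuous_on S f"
  by (cases m) auto

lemma Ck_on_partial:
  assumes "Ck_on n (Suc m) S f" "y \<in> S" "i < n"
  shows "((\<lambda>t. f (y(i := t))) has_real_derivative partial i f y) (at (y i))"
  using assms by (auto simp: partial_def DERIV_deriv_iff_real_differentiable)

lemma Ck_on_subset: "Ck_on n m S f \<Longrightarrow> T \<subseteq> S \<Longrightarrow> Ck_on n m T f"
  by (induction m arbitrary: f) (auto intro: continuous_on_subset)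

lemma Ck_on_Suc_D: "Ck_on n (Suc m) S f \<Longrightarrow> Ck_on n m S f"
  by (induction m arbitrary: f) auto

lemma has_partial_cong:
  assumes "open_Rn n S" "\<And>z. z \<in> S \<Longrightarrow> f z = g z" "y \<in> S" "i < n"
  shows "((\<lambda>t. f (y(i := t))) has_real_derivative d) (at (y i)) \<longleftrightarrow>
         ((\<lambda>t. g (y(i := t))) has_real_derivative d) (at (y i))"
proof -
  have "\<forall>\<^sub>F t in nhds (y i). f (y(i := t)) = g (y(i := t))"
    using eventually_fun_upd_open_Rn[OF assms(1,3,4)] by eventually_elim (use assms in auto)
  then show ?thesis by (intro DERIV_cong_ev) auto
qed

lemma partial_cong:
  assumes "open_Rn n S" "\<And>z. z \<in> S \<Longrightarrow> f z = g z" "y \<in> S" "i < n"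
  shows "partial i f y = partial i g y"
  unfolding partial_def deriv_def using has_partial_cong[of n S f g y i] assms by simp

lemma Ck_on_cong:
  assumes "open_Rn n S" "\<And>z. z \<in> S \<Longrightarrow> f z = g z" "Ck_on n m S f"
  shows "Ck_on n m S g"
  using assms(2,3)
proof (induction m arbitrary: f g)
  case 0
  then show ?case by (auto intro: continuous_on_eq)
next
  case (Suc m)
  have "Ck_on n m S (partial i g)" if "i < n" for i
  proof (rule Suc.IH[of "partial i f"])
    show "partial i f z = partial i g z" if "z \<in> S" for z
      by (rule partial_cong[OF assms(1) Suc.prems(1) that \<open>i < n\<close>])
  qed (use Suc that in auto)
  moreover have "(\<lambda>t. g (y(i := t))) differentiable (at (y i))" if "i < n" "y \<in> S" for i y
    using Ck_on_partial[OF Suc.prems(2) that(2,1)] has_partial_cong[of n S f g y i] assms(1) Suc.prems(1) that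
    by (auto simp: real_differentiable_def simp del: fun_upd_apply)
  moreover have "continuous_on S g"
    using Suc.prems by (auto intro: continuous_on_eq)
  ultimately show ?case by auto
qed

text \<open>Lets a smoothness proof name a formula for each partial derivative instead of handling
  \<open>partial\<close>, which is a \<open>deriv\<close>; on an open set the two may be
  exchanged.\<close>

lemma Ck_on_SucI:
  assumes "open_Rn n S" "continuous_on S f"
    and D: "\<And>i y. i < n \<Longrightarrow> y \<in> S \<Longrightarrow> ((\<lambda>t. f (y(i := t))) has_real_derivative f' i y) (at (y i))"
    and C: "\<And>i. i < n \<Longrightarrow> Ck_on n m S (f' i)"
  shows "Ck_on n (Suc m) S f"
proof -
  have "(\<forall>y\<in>S. (\<lambda>t. f (y(i := t))) differentiable (at (y i))) \<and> Ck_on n m S (partial i f)"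
    if i: "i < n" for i
  proof -
    have "Ck_on n m S (partial i f)"
      by (rule Ck_on_cong[OF assms(1) _ C[OF i]]) (simp add: partial_def DERIV_imp_deriv[OF D[OF i]])
    then show ?thesis using D[OF i] by (auto simp: real_differentiable_def)
  qed
  then show ?thesis using assms(2) by auto
qed

lemma Ck_on_local:
  assumes "\<And>y. y \<in> S \<Longrightarrow> \<exists>T. open_Rn n T \<and> y \<in> T \<and> T \<subseteq> S \<and> Ck_on n m T f"
  shows "Ck_on n m S f"
proof -
  have S: "open_Rn n S" by (subst openin_subopen) (meson assms)
  show ?thesis using assms
  proof (induction m arbitrary: f)
    case 0
    show ?case unfolding Ck_on.simps continuous_on_open_Rn_iff[OF S]
    proof (intro ballI allI impI)
      fix y e assume y: "y \<in> S" and e: "(e::real) > 0"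
      obtain T where T: "open_Rn n T" "y \<in> T" "T \<subseteq> S" "continuous_on T f" using 0 y by force
      obtain r where r: "r > 0" "\<And>z. z\<in>box_Rn n y r \<inter> T \<Longrightarrow> \<bar>f z - f y\<bar> < e"
        using T e by (metis continuous_on_open_Rn_iff)
      obtain s where s: "s > 0" "box_Rn n y s \<subseteq> T" using T by (auto simp: open_Rn_iff)
      have "\<bar>f z - f y\<bar> < e" if "z \<in> box_Rn n y (min r s)" for z
        using that r(2)[of z] s(2) box_Rn_mono[of "min r s" r] box_Rn_mono[of "min r s" s] by fastforce
      then show "\<exists>r>0. \<forall>z\<in>box_Rn n y r \<inter> S. \<bar>f z - f y\<bar> < e"
        using r s by (intro exI[of _ "min r s"]) auto
    qed
  next
    case (Suc m)
    have "Ck_on n m S (partial i f)" if "i < n" for i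
      by (rule Suc.IH) (use Suc.prems that in fastforce)
    moreover have "Ck_on n m S f"
      by (rule Suc.IH) (use Suc.prems Ck_on_Suc_D in metis)
    then have "continuous_on S f" by (rule Ck_on_continuous)
    moreover have "(\<lambda>t. f (y(i := t))) differentiable (at (y i))" if "i < n" "y \<in> S" for i y
      using Suc.prems[OF that(2)] that by auto
    ultimately show ?case by auto
  qed
qed

lemma Ck_on_const: "open_Rn n S \<Longrightarrow> Ck_on n m S (\<lambda>y. a)"
proof (induction m arbitrary: a)
  case (Suc m)
  show ?case
    by (rule Ck_on_SucI[OF Suc.prems, where f' = "\<lambda>_ _. 0"]) (auto intro!: Suc)
qed simp

lemma Ck_on_add:
  assumes "open_Rn n S"
  shows "Ck_on n m S f \<Longrightarrow> Ck_on n m S g \<Longrightarrow> Ck_on n m S (\<lambda>y. f y + g y)"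
proof (induction m arbitrary: f g)
  case (Suc m)
  show ?case
  proof (rule Ck_on_SucI[OF assms, where f' = "\<lambda>i y. partial i f y + partial i g y"])
    show "continuous_on S (\<lambda>y. f y + g y)" using Suc.prems by (auto intro: continuous_on_add)
    show "((\<lambda>t. f (y(i := t)) + g (y(i := t))) has_real_derivative partial i f y + partial i g y) (at (y i))"
      if "i < n" "y \<in> S" for i y
      by (intro DERIV_add Ck_on_partial[OF Suc.prems(1) that(2,1)] Ck_on_partial[OF Suc.prems(2) that(2,1)])
    show "Ck_on n m S (\<lambda>y. partial i f y + partial i g y)" if "i < n" for i
      using Suc.prems that by (intro Suc.IH) auto
  qed
qed (auto intro: continuous_on_add)

lemma Ck_on_mult:
  assumes "open_Rn n S"
  shows "Ck_on n m S f \<Longrightarrow> Ck_on n m S g \<Longrightarrow> Ck_on n m S (\<lambda>y. f y * g y)"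
proof (induction m arbitrary: f g)
  case (Suc m)
  show ?case
  proof (rule Ck_on_SucI[OF assms, where f' = "\<lambda>i y. partial i f y * g y + partial i g y * f y"])
    show "continuous_on S (\<lambda>y. f y * g y)" using Suc.prems by (auto intro: continuous_on_mult)
    fix i assume i: "i < n"
    show "((\<lambda>t. f (y(i := t)) * g (y(i := t))) has_real_derivative
        (partial i f y * g y + partial i g y * f y)) (at (y i))" if "y \<in> S" for y
      using DERIV_mult[OF Ck_on_partial[OF Suc.prems(1) that i] Ck_on_partial[OF Suc.prems(2) that i]]
      by (simp only: fun_upd_triv)
    show "Ck_on n m S (\<lambda>y. partial i f y * g y + partial i g y * f y)"
      using Suc.prems i by (auto intro!: Ck_on_add[OF assms] Suc.IH intro: Ck_on_Suc_D)
  qed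
qed (auto intro: continuous_on_mult)

lemma Ck_on_coord:
  assumes S: "open_Rn n S"
  shows "Ck_on n m S (\<lambda>y. y j)"
proof (cases m)
  case 0
  then show ?thesis
    by (simp add: continuous_on_coordinatewise_then_product continuous_on_product_coordinates
        continuous_on_subset[OF continuous_on_product_coordinates])
next
  case (Suc m')
  have c: "continuous_on S (\<lambda>y. y j)"
    by (rule continuous_on_subset[OF continuous_on_product_coordinates]) simp
  have "((\<lambda>t. (y(i := t)) j) has_real_derivative (if i = j then 1 else 0)) (at (y i))"
    for i and y :: "nat \<Rightarrow> real"
    by (cases "i = j") auto
  then show ?thesis unfolding Suc
    by (intro Ck_on_SucI[OF S c, where f' = "\<lambda>i _. if i = j then 1 else 0"] Ck_on_const[OF S])
qed

text \<open>A family closed under differentiation is the induction invariant: the partial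
  derivatives of F(f(y)) are F'(f(y)) times those of f, with F' again in the family. It is used for
  multiples of real powers and for the functions \<open>flat_exp p\<close>.\<close>

lemma Ck_on_comp_real:
  assumes "open_Rn n S"
    and fam: "\<And>F. F \<in> \<F> \<Longrightarrow> \<exists>F'\<in>\<F>. \<forall>t\<in>T. (F has_real_derivative F' t) (at t)"
    and "f ` S \<subseteq> T"
  shows "F \<in> \<F> \<Longrightarrow> Ck_on n m S f \<Longrightarrow> Ck_on n m S (\<lambda>y. F (f y))"
proof (induction m arbitrary: F)
  case 0
  have "continuous_on T F" using fam[OF 0(1)]
    by (meson DERIV_isCont continuous_at_imp_continuous_on)
  then show ?case using 0 assms(3) by (auto intro: continuous_on_compose2)
next
  case (Suc m)
  obtain F' where F': "F' \<in> \<F>" "\<And>t. t \<in> T \<Longrightarrow> (F has_real_derivative F' t) (at t)"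
    using fam[OF Suc.prems(1)] by blast
  have "continuous_on T F" using F'
    by (meson DERIV_isCont continuous_at_imp_continuous_on)
  then have c: "continuous_on S (\<lambda>y. F (f y))"
    using Suc.prems assms(3) by (auto intro: continuous_on_compose2)
  have "((\<lambda>t. F (f (y(i := t)))) has_real_derivative (F' (f y) * partial i f y)) (at (y i))"
    if "y \<in> S" "i < n" for i y
    by (rule DERIV_chain2[OF _ Ck_on_partial[OF Suc.prems(2) that]])
      (use F'(2)[of "f y"] that assms(3) in auto)
  moreover have "Ck_on n m S (\<lambda>y. F' (f y) * partial i f y)" if "i < n" for i
  proof (rule Ck_on_mult[OF assms(1)])
    show "Ck_on n m S (\<lambda>y. F' (f y))" by (rule Suc.IH[OF F'(1) Ck_on_Suc_D[OF Suc.prems(2)]])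
    show "Ck_on n m S (partial i f)" using Suc.prems(2) that by simp
  qed
  ultimately show ?case
    by (intro Ck_on_SucI[OF assms(1) c, where f' = "\<lambda>i y. F' (f y) * partial i f y"])
qed

section \<open>Mean value theorem, chain rule and mixed partial derivatives\<close>

lemma partial_increment:
  assumes S: "open_Rn n S" and f: "Ck_on n (Suc 0) S f" and i: "i < n"
    and y: "y \<in> Rn n" and sub: "\<And>t. \<bar>t - a\<bar> \<le> \<bar>b - a\<bar> \<Longrightarrow> y(i := t) \<in> S"
  shows "\<exists>\<xi>. \<bar>\<xi> - a\<bar> \<le> \<bar>b - a\<bar> \<and> f (y(i := b)) - f (y(i := a)) = partial i f (y(i := \<xi>)) * (b - a)"
proof -
  have D: "((\<lambda>t. f (y(i := t))) has_real_derivative partial i f (y(i := t))) (at t)"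
    if "\<bar>t - a\<bar> \<le> \<bar>b - a\<bar>" for t
    using Ck_on_partial[OF f sub[OF that] i] by simp
  consider "a < b" | "a = b" | "b < a" by linarith
  then show ?thesis
  proof cases
    case 1
    from MVT2[OF 1 D] obtain z where "a < z" "z < b"
      "f (y(i := b)) - f (y(i := a)) = (b - a) * partial i f (y(i := z))" by auto
    then show ?thesis using 1 by (intro exI[of _ z]) auto
  next
    case 2
    then show ?thesis by (intro exI[of _ a]) auto
  next
    case 3
    from MVT2[OF 3 D] obtain z where "b < z" "z < a"
      "f (y(i := a)) - f (y(i := b)) = (a - b) * partial i f (y(i := z))" by auto
    then show ?thesis using 3 by (intro exI[of _ z]) (auto simp: algebra_simps)
  qed
qed

text \<open>Total differentiability in Caratheodory form: the increment quotients \<open>q\<close> are continuous at \<open>y\<close>.\<close>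

lemma Ck_on_caratheodory:
  assumes S: "open_Rn n S" and f: "Ck_on n (Suc 0) S f" and y: "y \<in> S"
  shows "\<exists>q r0. r0 > 0 \<and> (\<forall>z\<in>box_Rn n y r0. f z - f y = (\<Sum>i<n. q i z * (z i - y i))) \<and>
    (\<forall>i<n. \<forall>e>0. \<exists>r>0. \<forall>z\<in>box_Rn n y r. \<bar>q i z - partial i f y\<bar> < e)"
proof -
  obtain r0 where r0: "r0 > 0" "box_Rn n y r0 \<subseteq> S" using S y by (auto simp: open_Rn_iff)
  have yR: "y \<in> Rn n" using S y by (auto simp: open_Rn_iff)
  \<comment> \<open>\<open>w i z\<close> walks from y to z one coordinate at a time, with
    \<open>w 0 z = y\<close> and \<open>w n z = z\<close>, so that the increments of f
    telescope.\<close>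
  define w where "w i z = (\<lambda>j. if j < i then z j else y j)" for i :: nat and z :: "nat \<Rightarrow> real"
  have w_box: "(w i z)(i := t) \<in> box_Rn n y r" if "z \<in> box_Rn n y r" "\<bar>t - y i\<bar> \<le> \<bar>z i - y i\<bar>" "i < n"
    for i z t r
    using that yR by (fastforce simp: box_Rn_def w_def Rn_def)
  have "\<exists>\<xi>. \<bar>\<xi> - y i\<bar> \<le> \<bar>z i - y i\<bar> \<and> f ((w i z)(i := z i)) - f ((w i z)(i := y i))
      = partial i f ((w i z)(i := \<xi>)) * (z i - y i)"
    if "z \<in> box_Rn n y r0" "i < n" for z i
  proof (rule partial_increment[OF S f that(2)])
    show "w i z \<in> Rn n" using that yR by (auto simp: w_def Rn_def box_Rn_def)
  qed (use w_box that r0 in blast)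
  then obtain \<xi> where \<xi>: "\<And>z i. z \<in> box_Rn n y r0 \<Longrightarrow> i < n \<Longrightarrow> \<bar>\<xi> z i - y i\<bar> \<le> \<bar>z i - y i\<bar>"
    "\<And>z i. z \<in> box_Rn n y r0 \<Longrightarrow> i < n \<Longrightarrow> f ((w i z)(i := z i)) - f ((w i z)(i := y i))
      = partial i f ((w i z)(i := \<xi> z i)) * (z i - y i)" by metis
  define q where "q i z = partial i f ((w i z)(i := \<xi> z i))" for i z
  have "f z - f y = (\<Sum>i<n. q i z * (z i - y i))" if z: "z \<in> box_Rn n y r0" for z
  proof -
    have "(\<Sum>i<n. q i z * (z i - y i)) = (\<Sum>i<n. f (w (Suc i) z) - f (w i z))"
    proof (rule sum.cong)
      fix i assume "i \<in> {..<n}"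
      moreover have "(w i z)(i := z i) = w (Suc i) z" "(w i z)(i := y i) = w i z"
        by (auto simp: w_def less_Suc_eq)
      ultimately show "q i z * (z i - y i) = f (w (Suc i) z) - f (w i z)"
        using \<xi>(2)[OF z, of i] by (simp add: q_def)
    qed simp
    also have "\<dots> = f (w n z) - f (w 0 z)" by (rule sum_lessThan_telescope)
    also have "w n z = z" using z yR by (auto simp: w_def box_Rn_def Rn_def)
    also have "w 0 z = y" by (auto simp: w_def)
    finally show ?thesis by simp
  qed
  moreover have "\<exists>r>0. \<forall>z\<in>box_Rn n y r. \<bar>q i z - partial i f y\<bar> < e" if i: "i < n" and e: "e > 0" for i e
  proof -
    have "continuous_on S (partial i f)" using f i by auto
    then obtain r where r: "r > 0" "\<And>z. z\<in>box_Rn n y r \<inter> S \<Longrightarrow> \<bar>partial i f z - partial i f y\<bar> < e"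
      using y e by (metis continuous_on_open_Rn_iff[OF S])
    have "\<bar>q i z - partial i f y\<bar> < e" if z: "z \<in> box_Rn n y (min r r0)" for z
    proof -
      have z': "z \<in> box_Rn n y r" "z \<in> box_Rn n y r0"
        using z box_Rn_mono[of "min r r0" r] box_Rn_mono[of "min r r0" r0] by fastforce+
      then have "(w i z)(i := \<xi> z i) \<in> box_Rn n y r \<inter> S"
        using w_box[OF z'(1) \<xi>(1)[OF z'(2) i] i] w_box[OF z'(2) \<xi>(1)[OF z'(2) i] i] r0 by auto
      then show ?thesis unfolding q_def by (rule r(2))
    qed
    then show ?thesis using r r0 by (intro exI[of _ "min r r0"]) auto
  qed
  ultimately show ?thesis using r0(1) by blast
qed

text \<open>Dividing the Caratheodory expansion at \<open>\<gamma> t0\<close> by t - t0 leaves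
  products of increment quotients, each convergent along the curve. Differentiability of the curve
  at the single parameter t0 suffices for this.\<close>

lemma chain_rule_curve:
  assumes S: "open_Rn n S" and f: "Ck_on n (Suc 0) S f" and y: "\<gamma> t0 \<in> S"
    and ev: "\<forall>\<^sub>F t in at t0. \<gamma> t \<in> Rn n"
    and D: "\<And>i. i < n \<Longrightarrow> ((\<lambda>t. \<gamma> t i) has_real_derivative \<gamma>' i) (at t0)"
  shows "((\<lambda>t. f (\<gamma> t)) has_real_derivative (\<Sum>i<n. partial i f (\<gamma> t0) * \<gamma>' i)) (at t0)"
proof -
  define y where "y = \<gamma> t0"
  have "\<exists>q r0. r0 > 0 \<and> (\<forall>z\<in>box_Rn n y r0. f z - f y = (\<Sum>i<n. q i z * (z i - y i))) \<and>
    (\<forall>i<n. \<forall>e>0. \<exists>r>0. \<forall>z\<in>box_Rn n y r. \<bar>q i z - partial i f y\<bar> < e)"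
    using Ck_on_caratheodory[OF S f y] unfolding y_def .
  then obtain q r0 where r0: "r0 > 0"
    and q_eq: "\<forall>z\<in>box_Rn n y r0. f z - f y = (\<Sum>i<n. q i z * (z i - y i))"
    and q_lim: "\<forall>i<n. \<forall>e>0. \<exists>r>0. \<forall>z\<in>box_Rn n y r. \<bar>q i z - partial i f y\<bar> < e"
    by (elim exE conjE)
  have in_box: "\<forall>\<^sub>F t in at t0. \<gamma> t \<in> box_Rn n y r" if r: "r > 0" for r
  proof -
    have "\<forall>\<^sub>F t in at t0. \<bar>\<gamma> t i - y i\<bar> < r" if i: "i < n" for i
    proof -
      have "((\<lambda>t. \<gamma> t i) \<longlongrightarrow> y i) (at t0)"
        using DERIV_isCont[OF D[OF i]] by (simp add: isCont_def y_def)
      from tendstoD[OF this r] show ?thesis by (simp add: dist_real_def)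
    qed
    then have "\<forall>\<^sub>F t in at t0. \<forall>i\<in>{..<n}. \<bar>\<gamma> t i - y i\<bar> < r"
      by (intro eventually_ball_finite) auto
    with ev show ?thesis by eventually_elim (auto simp: box_Rn_def)
  qed
  have "((\<lambda>t. q i (\<gamma> t)) \<longlongrightarrow> partial i f y) (at t0)" if i: "i < n" for i
  proof (rule tendstoI)
    fix e :: real assume "e > 0"
    then obtain r where r: "r > 0" "\<forall>z\<in>box_Rn n y r. \<bar>q i z - partial i f y\<bar> < e"
      using q_lim i by blast
    show "\<forall>\<^sub>F t in at t0. dist (q i (\<gamma> t)) (partial i f y) < e"
      using in_box[OF r(1)] by eventually_elim (use r in \<open>auto simp: dist_real_def\<close>)
  qed
  moreover have "((\<lambda>t. (\<gamma> t i - y i) / (t - t0)) \<longlongrightarrow> \<gamma>' i) (at t0)" if i: "i < n" for i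
    using D[OF i] by (simp add: has_field_derivative_iff y_def)
  ultimately have "((\<lambda>t. \<Sum>i<n. q i (\<gamma> t) * ((\<gamma> t i - y i) / (t - t0))) \<longlongrightarrow>
      (\<Sum>i<n. partial i f y * \<gamma>' i)) (at t0)"
    by (intro tendsto_sum tendsto_mult) auto
  moreover have "\<forall>\<^sub>F t in at t0. (\<Sum>i<n. q i (\<gamma> t) * ((\<gamma> t i - y i) / (t - t0))) =
      (f (\<gamma> t) - f (\<gamma> t0)) / (t - t0)"
    using in_box[OF r0]
    by eventually_elim (simp add: q_eq[rule_format, unfolded y_def] y_def sum_divide_distrib)
  ultimately show ?thesis
    unfolding has_field_derivative_iff y_def using Lim_transform_eventually by fastforce
qed

text \<open>By the chain rule each partial derivative of the composite is a sum of products. One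
  factor is a partial derivative of f composed with \<Phi>, to which the induction hypothesis
  applies because f is arbitrary there.\<close>

lemma Ck_on_comp_map:
  assumes S: "open_Rn n S" and T: "open_Rn n T" and sub: "\<Phi> ` S \<subseteq> T"
  shows "(\<And>i. i < n \<Longrightarrow> Ck_on n m S (\<lambda>y. \<Phi> y i)) \<Longrightarrow> Ck_on n m T f \<Longrightarrow> Ck_on n m S (\<lambda>y. f (\<Phi> y))"
proof (induction m arbitrary: f)
  case 0
  show ?case unfolding Ck_on.simps continuous_on_open_Rn_iff[OF S]
  proof (intro ballI allI impI)
    fix y e assume y: "y \<in> S" and e: "(e::real) > 0"
    then have y': "\<Phi> y \<in> T" using sub by auto
    obtain r where r: "r > 0" "\<And>z. z\<in>box_Rn n (\<Phi> y) r \<inter> T \<Longrightarrow> \<bar>f z - f (\<Phi> y)\<bar> < e"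
      using 0(2) y' e unfolding Ck_on.simps continuous_on_open_Rn_iff[OF T] by metis
    have "\<exists>s>0. \<forall>i<n. \<forall>z\<in>box_Rn n y s \<inter> S. \<bar>\<Phi> z i - \<Phi> y i\<bar> < r"
    proof (rule ex_uniform_radius)
      show "\<exists>s>0. \<forall>z\<in>box_Rn n y s \<inter> S. \<bar>\<Phi> z i - \<Phi> y i\<bar> < r" if "i < n" for i
        using 0(1)[OF that] y r(1) unfolding Ck_on.simps continuous_on_open_Rn_iff[OF S] by blast
    qed (use box_Rn_mono in blast)
    then obtain s where s: "s > 0" "\<forall>i<n. \<forall>z\<in>box_Rn n y s \<inter> S. \<bar>\<Phi> z i - \<Phi> y i\<bar> < r" by blast
    have "\<bar>f (\<Phi> z) - f (\<Phi> y)\<bar> < e" if z: "z \<in> box_Rn n y s \<inter> S" for z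
    proof (rule r(2))
      have "\<Phi> z \<in> T" using z sub by auto
      moreover then have "\<Phi> z \<in> Rn n" using T by (auto simp: open_Rn_iff)
      ultimately show "\<Phi> z \<in> box_Rn n (\<Phi> y) r \<inter> T" using s(2) z by (auto simp: box_Rn_def)
    qed
    then show "\<exists>s>0. \<forall>z\<in>box_Rn n y s \<inter> S. \<bar>f (\<Phi> z) - f (\<Phi> y)\<bar> < e" using s(1) by blast
  qed
next
  case (Suc m)
  have low: "Ck_on n m S (\<lambda>y. g (\<Phi> y))" if "Ck_on n m T g" for g
    by (rule Suc.IH[OF Ck_on_Suc_D[OF Suc.prems(1)] that])
  have "Ck_on n m S (\<lambda>y. f (\<Phi> y))" by (rule low[OF Ck_on_Suc_D[OF Suc.prems(2)]])
  then have c: "continuous_on S (\<lambda>y. f (\<Phi> y))" by (rule Ck_on_continuous)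
  have f1: "Ck_on n (Suc 0) T f" using Suc.prems(2) by (auto intro: Ck_on_continuous)
  have "((\<lambda>t. f (\<Phi> (y(j := t)))) has_real_derivative
      (\<Sum>i<n. partial i f (\<Phi> y) * partial j (\<lambda>y. \<Phi> y i) y)) (at (y j))"
    if y: "y \<in> S" and j: "j < n" for j y
  proof -
    have "\<forall>\<^sub>F t in at (y j). y(j := t) \<in> S"
      using eventually_fun_upd_open_Rn[OF S y j] by (simp add: eventually_nhds_conv_at)
    then have "\<forall>\<^sub>F t in at (y j). \<Phi> (y(j := t)) \<in> Rn n"
      by eventually_elim (use sub T in \<open>auto simp: open_Rn_iff\<close>)
    from chain_rule_curve[OF T f1 _ this, of "\<lambda>i. partial j (\<lambda>y. \<Phi> y i) y"]
    show ?thesis using Ck_on_partial[OF Suc.prems(1) y j] sub y by auto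
  qed
  moreover have "Ck_on n m S (\<lambda>y. \<Sum>i\<in>I. partial i f (\<Phi> y) * partial j (\<lambda>y. \<Phi> y i) y)"
    if j: "j < n" and I: "finite I" "I \<subseteq> {..<n}" for j I
    using I
  proof (induction I rule: finite_induct)
    case (insert i I)
    then have i: "i < n" by auto
    have "Ck_on n m S (\<lambda>y. partial i f (\<Phi> y))" using Suc.prems(2) i by (intro low) auto
    moreover have "Ck_on n m S (partial j (\<lambda>y. \<Phi> y i))" using Suc.prems(1)[OF i] j by auto
    ultimately show ?case using insert by (auto intro!: Ck_on_add[OF S] Ck_on_mult[OF S])
  qed (auto intro: Ck_on_const[OF S])
  ultimately show ?case
    by (intro Ck_on_SucI[OF S c,
          where f' = "\<lambda>j y. \<Sum>i<n. partial i f (\<Phi> y) * partial j (\<lambda>y. \<Phi> y i) y"]) auto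
qed

text \<open>The mean value theorem in coordinate i, applied to the difference along j, and then in
  coordinate j turns the second difference over a square into a mixed derivative. The second
  difference is symmetric in i and j, which is what \<open>partial_commute\<close> exploits.\<close>

lemma partial_second_increment:
  assumes S: "open_Rn n S" and f: "Ck_on n 2 S f" and y: "y \<in> S" and ij: "i < n" "j < n" "i \<noteq> j"
    and h: "h > 0" and sub: "\<And>s t. \<bar>s\<bar> \<le> h \<Longrightarrow> \<bar>t\<bar> \<le> h \<Longrightarrow> y(i := y i + s, j := y j + t) \<in> S"
  shows "\<exists>s t. \<bar>s\<bar> \<le> h \<and> \<bar>t\<bar> \<le> h \<and>
    f (y(i := y i + h, j := y j + h)) - f (y(i := y i + h)) - f (y(j := y j + h)) + f y =
      h * h * partial j (partial i f) (y(i := y i + s, j := y j + t))"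
proof -
  have f': "Ck_on n (Suc 0) S f" "Ck_on n (Suc 0) S (partial i f)"
    using f ij by (auto simp: numeral_2_eq_2 intro: Ck_on_continuous)
  define F where "F u = f (y(i := u, j := y j + h)) - f (y(i := u))" for u
  have sub': "y(i := y i + s) \<in> S" if "\<bar>s\<bar> \<le> h" for s
    using sub[of s 0] that h ij by (simp add: fun_upd_twist[of i j] fun_upd_idem)
  have D: "(F has_real_derivative partial i f (y(i := u, j := y j + h)) - partial i f (y(i := u))) (at u)"
    if u: "y i \<le> u" "u \<le> y i + h" for u
  proof -
    have "y(i := u, j := y j + h) \<in> S" "y(i := u) \<in> S"
      using sub[of "u - y i" h] sub'[of "u - y i"] u h by auto
    from Ck_on_partial[OF f'(1) this(1) ij(1)] Ck_on_partial[OF f'(1) this(2) ij(1)]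
    have "((\<lambda>t. f (y(i := t, j := y j + h))) has_real_derivative partial i f (y(i := u, j := y j + h))) (at u)"
      "((\<lambda>t. f (y(i := t))) has_real_derivative partial i f (y(i := u))) (at u)"
      using ij(3) by (simp_all add: fun_upd_twist[of j i])
    then show ?thesis unfolding F_def by (rule DERIV_diff)
  qed
  from MVT2[of "y i" "y i + h" F, OF _ D] h obtain z where z: "y i < z" "z < y i + h"
    "F (y i + h) - F (y i) = h * (partial i f (y(i := z, j := y j + h)) - partial i f (y(i := z)))"
    by auto
  have zS: "y(i := z, j := t) \<in> S" if "\<bar>t - y j\<bar> \<le> \<bar>y j + h - y j\<bar>" for t
    using sub[of "z - y i" "t - y j"] z that h by auto
  have "y \<in> Rn n" using y S by (auto simp: open_Rn_iff)
  then have yR: "y(i := z) \<in> Rn n" using ij by (auto simp: Rn_def)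
  from partial_increment[OF S f'(2) ij(2) yR, of "y j" "y j + h"] zS
  obtain \<xi> where \<xi>: "\<bar>\<xi> - y j\<bar> \<le> h"
    "partial i f (y(i := z, j := y j + h)) - partial i f (y(i := z, j := y j))
      = partial j (partial i f) (y(i := z, j := \<xi>)) * h"
    using h by auto
  have e: "y(i := z, j := y j) = y(i := z)" using ij by (auto simp: fun_eq_iff)
  have "F (y i + h) - F (y i) = h * h * partial j (partial i f) (y(i := z, j := \<xi>))"
    using z(3) \<xi>(2) unfolding e by simp
  moreover have "F (y i + h) - F (y i) =
    f (y(i := y i + h, j := y j + h)) - f (y(i := y i + h)) - f (y(j := y j + h)) + f y"
    by (simp add: F_def)
  ultimately show ?thesis
    using z \<xi>(1) by (intro exI[of _ "z - y i"] exI[of _ "\<xi> - y j"]) auto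
qed

lemma partial_commute:
  assumes S: "open_Rn n S" and f: "Ck_on n 2 S f" and y: "y \<in> S" and ij: "i < n" "j < n"
  shows "partial i (partial j f) y = partial j (partial i f) y"
proof (cases "i = j")
  case False
  have "\<bar>partial i (partial j f) y - partial j (partial i f) y\<bar> \<le> e" if e: "e > 0" for e
  proof -
    have c: "continuous_on S (partial i (partial j f))" "continuous_on S (partial j (partial i f))"
      using f ij by (auto simp: numeral_2_eq_2)
    obtain r1 where r1: "r1 > 0" "\<And>z. z\<in>box_Rn n y r1 \<inter> S \<Longrightarrow>
        \<bar>partial i (partial j f) z - partial i (partial j f) y\<bar> < e / 2"
      using c(1) y e unfolding continuous_on_open_Rn_iff[OF S] by (meson half_gt_zero)
    obtain r2 where r2: "r2 > 0" "\<And>z. z\<in>box_Rn n y r2 \<inter> S \<Longrightarrow>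
        \<bar>partial j (partial i f) z - partial j (partial i f) y\<bar> < e / 2"
      using c(2) y e unfolding continuous_on_open_Rn_iff[OF S] by (meson half_gt_zero)
    obtain r3 where r3: "r3 > 0" "box_Rn n y r3 \<subseteq> S" using S y by (auto simp: open_Rn_iff)
    \<comment> \<open>Halving makes the closed square of half-width h fit strictly inside all three
      boxes.\<close>
    define h where "h = min r1 (min r2 r3) / 2"
    have h: "h > 0" "h < r1" "h < r2" "h < r3" using r1 r2 r3 by (auto simp: h_def)
    have yR: "y \<in> Rn n" using y S by (auto simp: open_Rn_iff)
    have box: "y(i := y i + s, j := y j + t) \<in> box_Rn n y r"
      if "\<bar>s\<bar> \<le> h" "\<bar>t\<bar> \<le> h" "h < r" for s t r
      using that yR ij h by (auto simp: box_Rn_def Rn_def)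
    have twist: "y(j := a, i := b) = y(i := b, j := a)" for a b
      using False by (rule fun_upd_twist[symmetric])
    have sub: "y(i := y i + s, j := y j + t) \<in> S" if "\<bar>s\<bar> \<le> h" "\<bar>t\<bar> \<le> h" for s t
      using box[OF that h(4)] r3 by auto
    from partial_second_increment[OF S f y ij False h(1) sub]
    obtain s t where st: "\<bar>s\<bar> \<le> h" "\<bar>t\<bar> \<le> h"
      "f (y(i := y i + h, j := y j + h)) - f (y(i := y i + h)) - f (y(j := y j + h)) + f y =
      h * h * partial j (partial i f) (y(i := y i + s, j := y j + t))" by auto
    from partial_second_increment[OF S f y ij(2,1) _ h(1)] sub False
    obtain s' t' where st': "\<bar>s'\<bar> \<le> h" "\<bar>t'\<bar> \<le> h"
      "f (y(i := y i + h, j := y j + h)) - f (y(j := y j + h)) - f (y(i := y i + h)) + f y =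
      h * h * partial i (partial j f) (y(i := y i + s', j := y j + t'))" unfolding twist by metis
    have "partial j (partial i f) (y(i := y i + s, j := y j + t)) =
      partial i (partial j f) (y(i := y i + s', j := y j + t'))"
    proof -
      have "h * h * partial j (partial i f) (y(i := y i + s, j := y j + t)) =
          h * h * partial i (partial j f) (y(i := y i + s', j := y j + t'))"
        using st(3) st'(3) by linarith
      then show ?thesis using h(1) by (simp del: fun_upd_apply)
    qed
    moreover have "\<bar>partial j (partial i f) (y(i := y i + s, j := y j + t)) - partial j (partial i f) y\<bar> < e / 2"
      using r2(2) box[OF st(1,2) h(3)] sub[OF st(1,2)] by blast
    moreover have "\<bar>partial i (partial j f) (y(i := y i + s', j := y j + t')) - partial i (partial j f) y\<bar> < e / 2"
      using r1(2) box[OF st'(1,2) h(2)] sub[OF st'(1,2)] by blast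
    ultimately show ?thesis by linarith
  qed
  then have "\<bar>partial i (partial j f) y - partial j (partial i f) y\<bar> \<le> 0"
    by (meson field_le_epsilon dual_order.refl zero_less_abs_iff linorder_not_le order.strict_iff_not dense)
  then show ?thesis by simp
qed simp

section \<open>Smooth functions and tangent vectors\<close>

lemma sum_fun_apply: "(\<Sum>i\<in>I. F i) x = (\<Sum>i\<in>I. F i x)"
  by (induction I rule: infinite_finite_induct) auto

lemma scaleR_fun_apply [simp]: "(a *\<^sub>R f) x = a *\<^sub>R f x"
  by (simp add: scaleR_fun_def)

locale manifold_ctx =
  fixes M :: "'m::{t2_space,second_countable_topology} manifold"
  assumes smooth_manifold: "smooth_manifold M"
begin

abbreviation "n \<equiv> mdim M"

lemma ex_chart: "\<exists>c\<in>atlas M. x \<in> fst c"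
  using smooth_manifold by (auto simp: smooth_manifold_def)

lemma chart_open: "c \<in> atlas M \<Longrightarrow> open (fst c)"
  using smooth_manifold by (auto simp: smooth_manifold_def)

lemma chart_homeo:
  "c \<in> atlas M \<Longrightarrow> homeomorphism (fst c) (snd c ` fst c) (snd c) (chart_inv c)"
  using smooth_manifold by (auto simp: smooth_manifold_def)

lemma chart_transition:
  "c \<in> atlas M \<Longrightarrow> d \<in> atlas M \<Longrightarrow> i < n \<Longrightarrow>
    smooth_on_Rn n (snd c ` (fst c \<inter> fst d)) (\<lambda>y. snd d (chart_inv c y) i)"
  using smooth_manifold unfolding smooth_manifold_def by blast

lemma chart_inv_left: "c \<in> atlas M \<Longrightarrow> x \<in> fst c \<Longrightarrow> chart_inv c (snd c x) = x"
  using chart_homeo by (auto simp: homeomorphism_def)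

lemma chart_image_open:
  assumes c: "c \<in> atlas M" and W: "open W"
  shows "open_Rn n (snd c ` (fst c \<inter> W))"
proof -
  have "openin (top_of_set (snd c ` fst c)) (snd c ` (fst c \<inter> W))"
    by (rule homeomorphism_imp_open_map[OF chart_homeo[OF c]]) (use W in auto)
  moreover have "open_Rn n (snd c ` fst c)"
    using smooth_manifold c by (auto simp: smooth_manifold_def)
  ultimately show ?thesis using openin_trans by blast
qed

lemma smooth_fun_on_Ck:
  "smooth_fun_on M W f \<Longrightarrow> c \<in> atlas M \<Longrightarrow> Ck_on n m (snd c ` (fst c \<inter> W)) (\<lambda>y. f (chart_inv c y))"
  by (simp add: smooth_fun_on_def smooth_on_Rn_def comp_def)

lemma smooth_fun_onI:
  "(\<And>c m. c \<in> atlas M \<Longrightarrow> Ck_on n m (snd c ` (fst c \<inter> W)) (\<lambda>y. f (chart_inv c y))) \<Longrightarrow>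
    smooth_fun_on M W f"
  by (simp add: smooth_fun_on_def smooth_on_Rn_def comp_def)

lemma smooth_fun_on_subset: "smooth_fun_on M W f \<Longrightarrow> V \<subseteq> W \<Longrightarrow> smooth_fun_on M V f"
  by (rule smooth_fun_onI, rule Ck_on_subset, rule smooth_fun_on_Ck) auto

lemma smooth_fun_on_cong:
  assumes f: "smooth_fun_on M W f" and W: "open W" and eq: "\<And>y. y \<in> W \<Longrightarrow> f y = g y"
  shows "smooth_fun_on M W g"
proof (rule smooth_fun_onI)
  fix c m assume c: "c \<in> atlas M"
  show "Ck_on n m (snd c ` (fst c \<inter> W)) (\<lambda>y. g (chart_inv c y))"
    by (rule Ck_on_cong[OF chart_image_open[OF c W] _ smooth_fun_on_Ck[OF f c]])
      (use c eq in \<open>auto simp: chart_inv_left\<close>)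
qed

text \<open>Compatibility of the atlas makes one chart enough: in any other chart the function is
  the given coordinate expression composed with a smooth transition map.\<close>

lemma smooth_fun_on_chartI:
  assumes c: "c \<in> atlas M" and W: "open W" "W \<subseteq> fst c"
    and f: "\<And>m. Ck_on n m (snd c ` W) (\<lambda>y. f (chart_inv c y))"
  shows "smooth_fun_on M W f"
proof (rule smooth_fun_onI)
  fix d m assume d: "d \<in> atlas M"
  let ?S = "snd d ` (fst d \<inter> W)"
  have "Ck_on n m ?S (\<lambda>y. f (chart_inv c (snd c (chart_inv d y))))"
  proof (rule Ck_on_comp_map[where T = "snd c ` (fst c \<inter> W)" and f = "\<lambda>y. f (chart_inv c y)"
        and \<Phi> = "\<lambda>y. snd c (chart_inv d y)"])
    show "Ck_on n m ?S (\<lambda>y. snd c (chart_inv d y) i)" if "i < n" for i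
      by (rule Ck_on_subset) (use chart_transition[OF d c that] W in \<open>auto simp: smooth_on_Rn_def\<close>)
    show "Ck_on n m (snd c ` (fst c \<inter> W)) (\<lambda>y. f (chart_inv c y))"
      using f W by (simp add: Int_absorb1)
    show "(\<lambda>y. snd c (chart_inv d y)) ` ?S \<subseteq> snd c ` (fst c \<inter> W)"
      using d W by (auto simp: chart_inv_left)
  qed (use chart_image_open c d W in auto)
  then show "Ck_on n m ?S (\<lambda>y. f (chart_inv d y))"
    by (rule Ck_on_cong[OF chart_image_open[OF d W(1)], rotated])
      (use W c d in \<open>auto simp: chart_inv_left subset_iff\<close>)
qed

lemma smooth_fun_on_local:
  assumes "\<And>y. y \<in> W \<Longrightarrow> \<exists>V. open V \<and> y \<in> V \<and> smooth_fun_on M V f"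
    and W: "open W"
  shows "smooth_fun_on M W f"
proof (rule smooth_fun_onI, rule Ck_on_local)
  fix c m y assume c: "c \<in> atlas M" and "y \<in> snd c ` (fst c \<inter> W)"
  then obtain x where x: "x \<in> fst c" "x \<in> W" "y = snd c x" by auto
  then obtain V where V: "open V" "x \<in> V" "smooth_fun_on M V f" using assms(1) by blast
  show "\<exists>T. open_Rn n T \<and> y \<in> T \<and> T \<subseteq> snd c ` (fst c \<inter> W) \<and> Ck_on n m T (\<lambda>y. f (chart_inv c y))"
  proof (intro exI conjI)
    show "open_Rn n (snd c ` (fst c \<inter> (V \<inter> W)))" using V W c by (intro chart_image_open) auto
    show "Ck_on n m (snd c ` (fst c \<inter> (V \<inter> W))) (\<lambda>y. f (chart_inv c y))"
      by (rule Ck_on_subset[OF smooth_fun_on_Ck[OF V(3) c]]) auto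
  qed (use x V in auto)
qed

lemma smooth_fun_on_const: "open W \<Longrightarrow> smooth_fun_on M W (\<lambda>y. a)"
  by (intro smooth_fun_onI Ck_on_const chart_image_open)

lemma smooth_fun_on_add:
  "open W \<Longrightarrow> smooth_fun_on M W f \<Longrightarrow> smooth_fun_on M W g \<Longrightarrow> smooth_fun_on M W (\<lambda>y. f y + g y)"
  by (rule smooth_fun_onI, rule Ck_on_add) (erule (1) chart_image_open[rotated], (erule (1) smooth_fun_on_Ck)+)

lemma smooth_fun_on_mult:
  "open W \<Longrightarrow> smooth_fun_on M W f \<Longrightarrow> smooth_fun_on M W g \<Longrightarrow> smooth_fun_on M W (\<lambda>y. f y * g y)"
  by (rule smooth_fun_onI, rule Ck_on_mult) (erule (1) chart_image_open[rotated], (erule (1) smooth_fun_on_Ck)+)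

lemma smooth_fun_on_minus:
  assumes "open W" "smooth_fun_on M W f"
  shows "smooth_fun_on M W (\<lambda>y. - f y)"
  using smooth_fun_on_mult[OF assms(1) smooth_fun_on_const[OF assms(1), of "-1"] assms(2)] by simp

lemma smooth_fun_on_diff:
  assumes "open W" "smooth_fun_on M W f" "smooth_fun_on M W g"
  shows "smooth_fun_on M W (\<lambda>y. f y - g y)"
  using smooth_fun_on_add[OF assms(1,2) smooth_fun_on_minus[OF assms(1,3)]] by simp

lemma smooth_fun_on_sum:
  "open W \<Longrightarrow> (\<And>i. i \<in> I \<Longrightarrow> smooth_fun_on M W (f i)) \<Longrightarrow> smooth_fun_on M W (\<lambda>y. \<Sum>i\<in>I. f i y)"
  by (induction I rule: infinite_finite_induct)
    (auto intro: smooth_fun_on_const smooth_fun_on_add)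

lemma smooth_fun_on_comp_real:
  assumes "open W" and fam: "\<And>F. F \<in> \<F> \<Longrightarrow> \<exists>F'\<in>\<F>. \<forall>t\<in>T. (F has_real_derivative F' t) (at t)"
    and "f ` W \<subseteq> T" "F \<in> \<F>" "smooth_fun_on M W f"
  shows "smooth_fun_on M W (\<lambda>y. F (f y))"
proof (rule smooth_fun_onI)
  fix c m assume c: "c \<in> atlas M"
  show "Ck_on n m (snd c ` (fst c \<inter> W)) (\<lambda>y. F (f (chart_inv c y)))"
  proof (rule Ck_on_comp_real[OF chart_image_open[OF c assms(1)] fam _ assms(4)])
    show "(\<lambda>y. f (chart_inv c y)) ` snd c ` (fst c \<inter> W) \<subseteq> T"
      using assms(3) c by (auto simp: chart_inv_left)
  qed (use smooth_fun_on_Ck[OF assms(5) c] in auto)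
qed

lemma smooth_fun_on_powr:
  assumes "open W" "smooth_fun_on M W f" "\<And>y. y \<in> W \<Longrightarrow> f y > 0"
  shows "smooth_fun_on M W (\<lambda>y. f y powr a)"
proof (rule smooth_fun_on_comp_real[where F = "\<lambda>t. t powr a" and T = "{0<..}"
      and \<F> = "{\<lambda>t. b * t powr e | b e. True}"])
  fix F :: "real \<Rightarrow> real" assume "F \<in> {\<lambda>t. b * t powr e |b e. True}"
  then obtain b e where F: "F = (\<lambda>t. b * t powr e)" by auto
  have "(F has_real_derivative (b * e) * t powr (e - 1)) (at t)" if "t > 0" for t
    unfolding F using that by (auto intro!: derivative_eq_intros)
  then show "\<exists>F'\<in>{\<lambda>t. b * t powr e |b e. True}. \<forall>t\<in>{0<..}. (F has_real_derivative F' t) (at t)"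
    by (intro bexI[of _ "\<lambda>t. (b * e) * t powr (e - 1)"]) auto
next
  show "(\<lambda>t. t powr a) \<in> {\<lambda>t. b * t powr e |b e. True}"
    by (rule CollectI, rule exI[of _ 1], rule exI[of _ a]) simp
qed (use assms in auto)

lemma smooth_fun_on_continuous:
  assumes W: "open W" and f: "smooth_fun_on M W f"
  shows "continuous_on W f"
proof -
  have "continuous_on (W \<inter> fst c) f" if c: "c \<in> atlas M" for c
  proof -
    have "continuous_on (snd c ` (fst c \<inter> W)) (\<lambda>y. f (chart_inv c y))"
      using smooth_fun_on_Ck[OF f c] by (rule Ck_on_continuous)
    moreover have "continuous_on (W \<inter> fst c) (snd c)"
      using chart_homeo[OF c] by (auto simp: homeomorphism_def intro: continuous_on_subset)
    ultimately have "continuous_on (W \<inter> fst c) (\<lambda>x. f (chart_inv c (snd c x)))"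
      by (rule continuous_on_compose2) auto
    then show ?thesis
      by (rule continuous_on_eq) (use c in \<open>auto simp: chart_inv_left\<close>)
  qed
  then have "continuous_on (\<Union>c\<in>atlas M. W \<inter> fst c) f"
    using W by (intro continuous_on_open_UN) (auto intro: chart_open)
  moreover have "(\<Union>c\<in>atlas M. W \<inter> fst c) = W" using ex_chart by blast
  ultimately show ?thesis by simp
qed

lemma smooth_fun_on_coord:
  assumes c: "c \<in> atlas M"
  shows "smooth_fun_on M (fst c) (\<lambda>y. snd c y i)"
proof (rule smooth_fun_on_chartI[OF c chart_open[OF c] order_refl])
  fix m
  have "open_Rn n (snd c ` fst c)" using chart_image_open[OF c, of UNIV] by simp
  then show "Ck_on n m (snd c ` fst c) (\<lambda>y. snd c (chart_inv c y) i)"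
    by (intro Ck_on_cong[OF _ _ Ck_on_coord[of _ _ _ i]]) (use c in \<open>auto simp: chart_inv_left\<close>)
qed

section \<open>Coordinate vectors and tangent vectors as derivations\<close>

lemma coord_vec_eq:
  "open W \<Longrightarrow> x \<in> W \<Longrightarrow> smooth_fun_on M W f \<Longrightarrow>
    coord_vec M c i x f = partial i (\<lambda>y. f (chart_inv c y)) (snd c x)"
  by (auto simp: coord_vec_def comp_def smooth_near_def)

lemma coord_vec_has_derivative:
  assumes c: "c \<in> atlas M" "x \<in> fst c" "i < n" and W: "open W" "x \<in> W" and f: "smooth_fun_on M W f"
  shows "((\<lambda>t. f (chart_inv c ((snd c x)(i := t)))) has_real_derivative coord_vec M c i x f)
    (at (snd c x i))"
  unfolding coord_vec_eq[OF W f]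
  by (rule Ck_on_partial[OF smooth_fun_on_Ck[OF f c(1)]]) (use c W in auto)

text \<open>The rules for sums, products, constants and coordinates are derived through uniqueness
  of the real derivative, so that \<open>deriv\<close> itself never has to be computed.\<close>

lemma coord_vec_unique:
  assumes "c \<in> atlas M" "x \<in> fst c" "i < n" "open W" "x \<in> W" "smooth_fun_on M W f"
    "((\<lambda>t. f (chart_inv c ((snd c x)(i := t)))) has_real_derivative d) (at (snd c x i))"
  shows "coord_vec M c i x f = d"
  using DERIV_unique[OF coord_vec_has_derivative[OF assms(1-6)] assms(7)] .

lemma coord_vec_add:
  assumes "c \<in> atlas M" "x \<in> fst c" "i < n" "open W" "x \<in> W" "smooth_fun_on M W f" "smooth_fun_on M W g"
  shows "coord_vec M c i x (\<lambda>y. f y + g y) = coord_vec M c i x f + coord_vec M c i x g"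
  by (rule coord_vec_unique[OF assms(1-5)])
    (intro smooth_fun_on_add DERIV_add coord_vec_has_derivative[OF assms(1-5)] assms)+

lemma coord_vec_mult:
  assumes "c \<in> atlas M" "x \<in> fst c" "i < n" "open W" "x \<in> W" "smooth_fun_on M W f" "smooth_fun_on M W g"
  shows "coord_vec M c i x (\<lambda>y. f y * g y) = coord_vec M c i x f * g x + f x * coord_vec M c i x g"
proof (rule coord_vec_unique[OF assms(1-5)])
  show "((\<lambda>t. f (chart_inv c ((snd c x)(i := t))) * g (chart_inv c ((snd c x)(i := t))))
      has_real_derivative coord_vec M c i x f * g x + f x * coord_vec M c i x g) (at (snd c x i))"
    using DERIV_mult[OF coord_vec_has_derivative[OF assms(1-5,6)]
        coord_vec_has_derivative[OF assms(1-5,7)]] assms(1,2)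
    by (simp add: chart_inv_left add.commute mult.commute del: fun_upd_apply)
qed (intro smooth_fun_on_mult assms)+

lemma coord_vec_const: "c \<in> atlas M \<Longrightarrow> x \<in> fst c \<Longrightarrow> i < n \<Longrightarrow> coord_vec M c i x (\<lambda>y. a) = 0"
  by (rule coord_vec_unique[where W = UNIV]) (auto intro: smooth_fun_on_const)

lemma coord_vec_cong:
  assumes c: "c \<in> atlas M" "x \<in> fst c" "i < n" and W: "open W" "x \<in> W" and f: "smooth_fun_on M W f"
    and eq: "\<And>y. y \<in> W \<Longrightarrow> f y = g y"
  shows "coord_vec M c i x f = coord_vec M c i x g"
proof -
  have "smooth_fun_on M W g" by (rule smooth_fun_on_cong[OF f W(1) eq])
  then show ?thesis unfolding coord_vec_eq[OF W f] coord_vec_eq[OF W \<open>smooth_fun_on M W g\<close>]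
    by (intro partial_cong[OF chart_image_open[OF c(1) W(1)]])
      (use c W eq in \<open>auto simp: chart_inv_left\<close>)
qed

lemma coord_vec_coord:
  assumes c: "c \<in> atlas M" "x \<in> fst c" "i < n"
  shows "coord_vec M c i x (\<lambda>y. snd c y j) = (if i = j then 1 else 0)"
proof (rule coord_vec_unique[OF c chart_open[OF c(1)] c(2) smooth_fun_on_coord[OF c(1)]])
  have S: "open_Rn n (snd c ` fst c)" using chart_image_open[OF c(1), of UNIV] by simp
  have "((\<lambda>t. ((snd c x)(i := t)) j) has_real_derivative (if i = j then 1 else 0)) (at (snd c x i))"
    by (cases "i = j") auto
  then show "((\<lambda>t. snd c (chart_inv c ((snd c x)(i := t))) j) has_real_derivative
      (if i = j then 1 else 0)) (at (snd c x i))"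
    by (subst has_partial_cong[OF S, of "\<lambda>y. snd c (chart_inv c y) j" "\<lambda>y. y j" "snd c x" i])
      (use c in \<open>auto simp: chart_inv_left simp del: fun_upd_apply\<close>)
qed

text \<open>The chain rule for a coordinate line of c seen in the chart d. The identity is one
  between functionals on all functions; on those that are not smooth near x both sides are 0 by the
  default value in \<open>coord_vec\<close>.\<close>

lemma coord_vec_change:
  assumes c: "c \<in> atlas M" "x \<in> fst c" "i < n" and d: "d \<in> atlas M" "x \<in> fst d"
  shows "coord_vec M c i x = (\<Sum>j<n. coord_vec M c i x (\<lambda>y. snd d y j) *\<^sub>R coord_vec M d j x)"
proof
  fix f
  show "coord_vec M c i x f = (\<Sum>j<n. coord_vec M c i x (\<lambda>y. snd d y j) *\<^sub>R coord_vec M d j x) f"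
  proof (cases "smooth_near M x f")
    case False
    then show ?thesis by (simp add: sum_fun_apply coord_vec_def)
  next
    case True
    then obtain W where W: "open W" "x \<in> W" "smooth_fun_on M W f" by (auto simp: smooth_near_def)
    let ?\<gamma> = "\<lambda>t. snd d (chart_inv c ((snd c x)(i := t)))"
    let ?S = "snd c ` (fst c \<inter> (fst d \<inter> W))"
    have S: "open_Rn n ?S" using c d W by (intro chart_image_open) (auto intro: chart_open)
    have ev: "\<forall>\<^sub>F t in nhds (snd c x i). (snd c x)(i := t) \<in> ?S"
      by (rule eventually_fun_upd_open_Rn[OF S]) (use c d W in auto)
    have T: "open_Rn n (snd d ` (fst d \<inter> W))" using d W by (intro chart_image_open)
    then have TR: "snd d ` (fst d \<inter> W) \<subseteq> Rn n" by (auto simp: open_Rn_iff)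
    have ev': "\<forall>\<^sub>F t in at (snd c x i). ?\<gamma> t \<in> Rn n"
      using ev unfolding eventually_nhds_conv_at
      by (auto elim!: eventually_mono) (use c TR in \<open>auto simp: chart_inv_left\<close>)
    have "((\<lambda>t. f (chart_inv d (?\<gamma> t))) has_real_derivative
        (\<Sum>j<n. partial j (\<lambda>y. f (chart_inv d y)) (?\<gamma> (snd c x i)) * coord_vec M c i x (\<lambda>y. snd d y j)))
        (at (snd c x i))"
    proof (rule chain_rule_curve[OF T smooth_fun_on_Ck[OF W(3) d(1)] _ ev'])
      show "?\<gamma> (snd c x i) \<in> snd d ` (fst d \<inter> W)" using c d W by (simp add: chart_inv_left)
      show "((\<lambda>t. ?\<gamma> t j) has_real_derivative coord_vec M c i x (\<lambda>y. snd d y j)) (at (snd c x i))" for j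
        by (rule coord_vec_has_derivative[OF c chart_open[OF d(1)] d(2) smooth_fun_on_coord[OF d(1)]])
    qed
    moreover have "?\<gamma> (snd c x i) = snd d x" using c by (simp add: chart_inv_left)
    moreover have "\<forall>\<^sub>F t in nhds (snd c x i). f (chart_inv d (?\<gamma> t)) = f (chart_inv c ((snd c x)(i := t)))"
      using ev by eventually_elim (use c d in \<open>auto simp: chart_inv_left\<close>)
    ultimately have "((\<lambda>t. f (chart_inv c ((snd c x)(i := t)))) has_real_derivative
        (\<Sum>j<n. coord_vec M d j x f * coord_vec M c i x (\<lambda>y. snd d y j))) (at (snd c x i))"
      using W d by (subst (asm) DERIV_cong_ev[OF refl _ refl]) (simp_all add: coord_vec_eq)
    from coord_vec_unique[OF c W this] show ?thesis
      by (simp add: sum_fun_apply mult.commute)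
  qed
qed

lemma subspace_tangent: "subspace (tangent_space M x)"
  by (simp add: tangent_space_def)

lemma coord_vec_tangent: "c \<in> atlas M \<Longrightarrow> x \<in> fst c \<Longrightarrow> i < n \<Longrightarrow> coord_vec M c i x \<in> tangent_space M x"
  unfolding tangent_space_def by (rule span_base) blast

text \<open>\<open>tangent_space\<close> is spanned by the coordinate vectors of all charts around
  x. By the change of charts those of one chart suffice, and the coefficients are read off as values
  on its coordinate functions.\<close>

lemma tangent_expand:
  assumes v: "v \<in> tangent_space M x" and d: "d \<in> atlas M" "x \<in> fst d"
  shows "v = (\<Sum>j<n. v (\<lambda>y. snd d y j) *\<^sub>R coord_vec M d j x)"
  using v unfolding tangent_space_def
proof (induction rule: span_induct_alt)
  case base
  then show ?case by (simp add: fun_eq_iff sum_fun_apply)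
next
  case (step a w v)
  then obtain c i where w: "w = coord_vec M c i x" "c \<in> atlas M" "x \<in> fst c" "i < n" by auto
  have "a *\<^sub>R w + v = a *\<^sub>R (\<Sum>j<n. w (\<lambda>y. snd d y j) *\<^sub>R coord_vec M d j x) +
     (\<Sum>j<n. v (\<lambda>y. snd d y j) *\<^sub>R coord_vec M d j x)"
    using coord_vec_change[OF w(2-4) d] step.IH unfolding w(1) by metis
  also have "\<dots> = (\<Sum>j<n. (a *\<^sub>R w + v) (\<lambda>y. snd d y j) *\<^sub>R coord_vec M d j x)"
    by (simp add: scaleR_sum_right sum.distrib scaleR_left_distrib)
  finally show ?case .
qed

lemma tangent_apply:
  assumes v: "v \<in> tangent_space M x" and d: "d \<in> atlas M" "x \<in> fst d"
  shows "v f = (\<Sum>j<n. v (\<lambda>y. snd d y j) * coord_vec M d j x f)"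
proof -
  have "v f = (\<Sum>j<n. v (\<lambda>y. snd d y j) *\<^sub>R coord_vec M d j x) f"
    using tangent_expand[OF assms] by simp
  then show ?thesis by (simp add: sum_fun_apply)
qed

lemma tangent_add:
  assumes "v \<in> tangent_space M x" "open W" "x \<in> W" "smooth_fun_on M W f" "smooth_fun_on M W g"
  shows "v (\<lambda>y. f y + g y) = v f + v g"
proof -
  obtain d where d: "d \<in> atlas M" "x \<in> fst d" using ex_chart by blast
  show ?thesis unfolding tangent_apply[OF assms(1) d, of f] tangent_apply[OF assms(1) d, of g]
      tangent_apply[OF assms(1) d, of "\<lambda>y. f y + g y"]
    using coord_vec_add[OF d _ assms(2-5)] by (simp add: distrib_left sum.distrib)
qed

lemma tangent_mult:
  assumes "v \<in> tangent_space M x" "open W" "x \<in> W" "smooth_fun_on M W f" "smooth_fun_on M W g"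
  shows "v (\<lambda>y. f y * g y) = v f * g x + f x * v g"
proof -
  obtain d where d: "d \<in> atlas M" "x \<in> fst d" using ex_chart by blast
  show ?thesis unfolding tangent_apply[OF assms(1) d, of f] tangent_apply[OF assms(1) d, of g]
      tangent_apply[OF assms(1) d, of "\<lambda>y. f y * g y"]
    using coord_vec_mult[OF d _ assms(2-5)]
    by (simp add: distrib_left sum.distrib sum_distrib_left sum_distrib_right mult_ac)
qed

lemma tangent_const: "v \<in> tangent_space M x \<Longrightarrow> v (\<lambda>y. a) = 0"
proof -
  assume v: "v \<in> tangent_space M x"
  obtain d where d: "d \<in> atlas M" "x \<in> fst d" using ex_chart by blast
  show ?thesis unfolding tangent_apply[OF v d, of "\<lambda>y. a"] using coord_vec_const[OF d] by simp
qed

lemma tangent_cong: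
  assumes "v \<in> tangent_space M x" "open W" "x \<in> W" "smooth_fun_on M W f" "\<And>y. y \<in> W \<Longrightarrow> f y = g y"
  shows "v f = v g"
proof -
  obtain d where d: "d \<in> atlas M" "x \<in> fst d" using ex_chart by blast
  show ?thesis unfolding tangent_apply[OF assms(1) d, of f] tangent_apply[OF assms(1) d, of g]
    using coord_vec_cong[OF d _ assms(2-4), of _ g] assms(5) by simp
qed

lemma tangent_sum:
  assumes "v \<in> tangent_space M x" "open W" "x \<in> W" "\<And>i. i \<in> I \<Longrightarrow> smooth_fun_on M W (f i)"
  shows "v (\<lambda>y. \<Sum>i\<in>I. f i y) = (\<Sum>i\<in>I. v (f i))"
  using assms(4)
proof (induction I rule: infinite_finite_induct)
  case (insert i I)
  have "v (\<lambda>y. f i y + (\<Sum>i\<in>I. f i y)) = v (f i) + v (\<lambda>y. \<Sum>i\<in>I. f i y)"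
    using insert.prems by (intro tangent_add[OF assms(1-3)] smooth_fun_on_sum assms(2)) auto
  then show ?case using insert by simp
qed (use tangent_const[OF assms(1)] in auto)

lemma smooth_fun_on_coord_vec:
  assumes c: "c \<in> atlas M" "i < n" and W: "open W" and f: "smooth_fun_on M W f"
  shows "smooth_fun_on M (W \<inter> fst c) (\<lambda>y. coord_vec M c i y f)"
proof (rule smooth_fun_on_chartI[OF c(1)])
  fix m
  have "Ck_on n (Suc m) (snd c ` (fst c \<inter> W)) (\<lambda>y. f (chart_inv c y))"
    by (rule smooth_fun_on_Ck[OF f c(1)])
  then have "Ck_on n m (snd c ` (fst c \<inter> W)) (partial i (\<lambda>y. f (chart_inv c y)))" using c(2) by auto
  then have "Ck_on n m (snd c ` (fst c \<inter> W)) (\<lambda>y. coord_vec M c i (chart_inv c y) f)"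
    by (rule Ck_on_cong[OF chart_image_open[OF c(1) W], rotated])
      (use c W f in \<open>auto simp: chart_inv_left coord_vec_eq\<close>)
  then show "Ck_on n m (snd c ` (W \<inter> fst c)) (\<lambda>y. coord_vec M c i (chart_inv c y) f)"
    by (simp add: Int_commute)
qed (use W chart_open[OF c(1)] in auto)

text \<open>Equality of mixed partial derivatives. Together with torsion freeness it is what allows
  the volume density to be differentiated.\<close>

lemma lie_bracket_coord_vec:
  assumes c: "c \<in> atlas M" "x \<in> fst c" and ij: "i < n" "j < n"
  shows "lie_bracket M (coord_vec M c i) (coord_vec M c j) x = 0"
proof
  fix f
  show "lie_bracket M (coord_vec M c i) (coord_vec M c j) x f = 0 f"
  proof (cases "smooth_near M x f")
    case True
    then obtain W where W: "open W" "x \<in> W" "smooth_fun_on M W f" by (auto simp: smooth_near_def)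
    let ?S = "snd c ` (fst c \<inter> W)" and ?F = "\<lambda>y. f (chart_inv c y)"
    have S: "open_Rn n ?S" using chart_image_open[OF c(1) W(1)] .
    have xS: "snd c x \<in> ?S" using c W by auto
    have o: "open (W \<inter> fst c)" "x \<in> W \<inter> fst c" using W c(2) chart_open[OF c(1)] by auto
    have *: "coord_vec M c a x (\<lambda>y. coord_vec M c b y f) = partial a (partial b ?F) (snd c x)"
      if "a < n" "b < n" for a b
      unfolding coord_vec_eq[OF o smooth_fun_on_coord_vec[OF c(1) that(2) W(1,3)]]
      by (rule partial_cong[OF S _ xS that(1)]) (use W c in \<open>auto simp: chart_inv_left coord_vec_eq\<close>)
    show ?thesis
      using True partial_commute[OF S smooth_fun_on_Ck[OF W(3) c(1)] xS ij] ij
      by (simp add: lie_bracket_def *)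
  qed (simp add: lie_bracket_def)
qed

end

section \<open>Sections of vector bundles\<close>

locale bundle_ctx = manifold_ctx M
  for M :: "'m::{t2_space,second_countable_topology} manifold" +
  fixes E :: "('m, 'e::real_vector) vbundle"
  assumes vector_bundle: "vector_bundle M E"
begin

lemma ex_frame: "\<exists>V s. (V, s) \<in> frames E \<and> x \<in> V"
  using vector_bundle unfolding vector_bundle_def by blast

lemma frame_open: "(V, s) \<in> frames E \<Longrightarrow> open V"
  using vector_bundle unfolding vector_bundle_def by blast

lemma frame_section: "(V, s) \<in> frames E \<Longrightarrow> i < brank E \<Longrightarrow> smooth_section_on M E V (s i)"
  using vector_bundle unfolding vector_bundle_def by blast

lemma subspace_fibre: "subspace (fibre E x)"
proof -
  obtain V s where Vs: "(V, s) \<in> frames E" "x \<in> V" using ex_frame by blast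
  then have "span ((\<lambda>i. s i x) ` {..<brank E}) = fibre E x"
    using vector_bundle unfolding vector_bundle_def by blast
  then show ?thesis using subspace_span by metis
qed

lemma frame_unique:
  assumes Vs: "(V, s) \<in> frames E" "x \<in> V"
    and eq: "(\<Sum>i<brank E. a i *\<^sub>R s i x) = (\<Sum>i<brank E. b i *\<^sub>R s i x)" and i: "i < brank E"
  shows "a i = b i"
proof -
  have *: "inj_on (\<lambda>i. s i x) {..<brank E}" "independent ((\<lambda>i. s i x) ` {..<brank E})"
    using vector_bundle Vs unfolding vector_bundle_def by blast+
  let ?inv = "the_inv_into {..<brank E} (\<lambda>i. s i x)"
  have "(\<Sum>v\<in>(\<lambda>i. s i x) ` {..<brank E}. (a (?inv v) - b (?inv v)) *\<^sub>R v) =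
    (\<Sum>i<brank E. (a i - b i) *\<^sub>R s i x)"
    using *(1) by (subst sum.reindex) (auto intro!: sum.cong simp: the_inv_into_f_f[OF *(1)])
  also have "\<dots> = 0" using eq by (simp add: scaleR_left_diff_distrib sum_subtractf)
  finally have "a (?inv v) - b (?inv v) = 0" if "v \<in> (\<lambda>i. s i x) ` {..<brank E}" for v
    using independentD[OF *(2) finite_imageI[OF finite_lessThan] order_refl _ that,
        where u = "\<lambda>v. a (?inv v) - b (?inv v)"] by simp
  from this[of "s i x"] show ?thesis using i by (simp add: the_inv_into_f_f[OF *(1)])
qed

lemma section_fibre: "smooth_section_on M E W \<sigma> \<Longrightarrow> x \<in> W \<Longrightarrow> \<sigma> x \<in> fibre E x"
  by (auto simp: smooth_section_on_def)

lemma section_coeffs: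
  assumes "smooth_section_on M E W \<sigma>" "(V, s) \<in> frames E"
  shows "\<exists>a. (\<forall>i<brank E. smooth_fun_on M (V \<inter> W) (a i)) \<and>
    (\<forall>x\<in>V \<inter> W. \<sigma> x = (\<Sum>i<brank E. a i x *\<^sub>R s i x))"
  using assms unfolding smooth_section_on_def by blast

lemma section_subset_cong:
  assumes "smooth_section_on M E W \<sigma>" "W' \<subseteq> W" "\<And>y. y \<in> W' \<Longrightarrow> \<sigma> y = \<tau> y"
  shows "smooth_section_on M E W' \<tau>"
  unfolding smooth_section_on_def
proof (intro conjI ballI, goal_cases)
  case (1 x)
  then have "\<tau> x = \<sigma> x" "x \<in> W" using assms(2,3) by auto
  then show ?case using section_fibre[OF assms(1)] by simp
next
  case (2 Vs)
  obtain V s where Vs: "Vs = (V, s)" by force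
  with 2 have V: "(V, s) \<in> frames E" by simp
  obtain a where a: "\<forall>i<brank E. smooth_fun_on M (V \<inter> W) (a i)" "\<forall>x\<in>V \<inter> W. \<sigma> x = (\<Sum>i<brank E. a i x *\<^sub>R s i x)"
      using section_coeffs[OF assms(1) V] by blast
  have "smooth_fun_on M (V \<inter> W') (a i)" if "i < brank E" for i
    by (rule smooth_fun_on_subset[OF a(1)[rule_format, OF that]]) (use assms(2) in auto)
  moreover have "\<tau> x = (\<Sum>i<brank E. a i x *\<^sub>R s i x)" if "x \<in> V \<inter> W'" for x
  proof -
    have "\<tau> x = \<sigma> x" using that assms(3)[of x] by simp
    also have "\<dots> = (\<Sum>i<brank E. a i x *\<^sub>R s i x)" using that assms(2) by (intro a(2)[rule_format]) auto
    finally show ?thesis .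
  qed
  ultimately show ?case unfolding Vs prod.case by (intro exI[of _ a]) simp
qed

lemma section_subset: "smooth_section_on M E W \<sigma> \<Longrightarrow> W' \<subseteq> W \<Longrightarrow> smooth_section_on M E W' \<sigma>"
  by (rule section_subset_cong) auto

lemma section_cong:
  "smooth_section_on M E W \<sigma> \<Longrightarrow> (\<And>y. y \<in> W \<Longrightarrow> \<sigma> y = \<tau> y) \<Longrightarrow> smooth_section_on M E W \<tau>"
  by (rule section_subset_cong[OF _ order_refl])

lemma section_zero:
  assumes "open W"
  shows "smooth_section_on M E W (\<lambda>y. 0)"
  unfolding smooth_section_on_def
proof (intro conjI ballI, goal_cases)
  case (1 x)
  show ?case by (rule subspace_0[OF subspace_fibre])
next
  case (2 Vs)
  obtain V s where Vs: "Vs = (V, s)" by force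
  with 2 have "open (V \<inter> W)" using frame_open[of V s] assms by (simp add: open_Int)
  from smooth_fun_on_const[OF this, of 0] show ?case unfolding Vs prod.case
    by (intro exI[of _ "\<lambda>_ _. 0"]) simp
qed

lemma section_add:
  assumes W: "open W" and s: "smooth_section_on M E W \<sigma>" and t: "smooth_section_on M E W \<tau>"
  shows "smooth_section_on M E W (\<lambda>y. \<sigma> y + \<tau> y)"
  unfolding smooth_section_on_def
proof (intro conjI ballI, goal_cases)
  case (1 x)
  then show ?case using section_fibre[OF s] section_fibre[OF t]
    by (intro subspace_add[OF subspace_fibre]) auto
next
  case (2 Vs)
  obtain V s where Vs: "Vs = (V, s)" by force
  with 2 have V: "(V, s) \<in> frames E" by simp
  obtain a where a: "\<forall>i<brank E. smooth_fun_on M (V \<inter> W) (a i)" "\<forall>x\<in>V \<inter> W. \<sigma> x = (\<Sum>i<brank E. a i x *\<^sub>R s i x)"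
      using section_coeffs[OF s V] by blast
  obtain b where b: "\<forall>i<brank E. smooth_fun_on M (V \<inter> W) (b i)" "\<forall>x\<in>V \<inter> W. \<tau> x = (\<Sum>i<brank E. b i x *\<^sub>R s i x)"
      using section_coeffs[OF t V] by blast
  have o: "open (V \<inter> W)" using frame_open[OF V] W by auto
  show ?case unfolding Vs prod.case
  proof (intro exI[of _ "\<lambda>i x. a i x + b i x"] conjI allI impI ballI)
    show "smooth_fun_on M (V \<inter> W) (\<lambda>x. a i x + b i x)" if "i < brank E" for i
      using a(1) b(1) that by (intro smooth_fun_on_add[OF o]) auto
  qed (use a(2) b(2) in \<open>simp add: scaleR_left_distrib sum.distrib\<close>)
qed

lemma section_scale:
  assumes W: "open W" and f: "smooth_fun_on M W f" and s: "smooth_section_on M E W \<sigma>"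
  shows "smooth_section_on M E W (\<lambda>y. f y *\<^sub>R \<sigma> y)"
  unfolding smooth_section_on_def
proof (intro conjI ballI, goal_cases)
  case (1 x)
  then show ?case using section_fibre[OF s] by (intro subspace_scale[OF subspace_fibre]) auto
next
  case (2 Vs)
  obtain V s where Vs: "Vs = (V, s)" by force
  with 2 have V: "(V, s) \<in> frames E" by simp
  obtain a where a: "\<forall>i<brank E. smooth_fun_on M (V \<inter> W) (a i)" "\<forall>x\<in>V \<inter> W. \<sigma> x = (\<Sum>i<brank E. a i x *\<^sub>R s i x)"
      using section_coeffs[OF s V] by blast
  have o: "open (V \<inter> W)" using frame_open[OF V] W by auto
  have f': "smooth_fun_on M (V \<inter> W) f" by (rule smooth_fun_on_subset[OF f]) auto
  show ?case unfolding Vs prod.case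
  proof (intro exI[of _ "\<lambda>i x. f x * a i x"] conjI allI impI ballI)
    show "smooth_fun_on M (V \<inter> W) (\<lambda>x. f x * a i x)" if "i < brank E" for i
      using a(1) that by (intro smooth_fun_on_mult[OF o f']) auto
  qed (use a(2) in \<open>simp add: scaleR_sum_right\<close>)
qed

lemma section_minus:
  assumes "open W" "smooth_section_on M E W \<sigma>"
  shows "smooth_section_on M E W (\<lambda>y. - \<sigma> y)"
  using section_scale[OF assms(1) smooth_fun_on_const[OF assms(1), of "-1"] assms(2)] by simp

lemma section_diff:
  assumes "open W" "smooth_section_on M E W \<sigma>" "smooth_section_on M E W \<tau>"
  shows "smooth_section_on M E W (\<lambda>y. \<sigma> y - \<tau> y)"
  using section_add[OF assms(1,2) section_minus[OF assms(1,3)]] by simp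

lemma section_sum:
  "open W \<Longrightarrow> (\<And>i. i \<in> I \<Longrightarrow> smooth_section_on M E W (\<sigma> i)) \<Longrightarrow>
    smooth_section_on M E W (\<lambda>y. \<Sum>i\<in>I. \<sigma> i y)"
  by (induction I rule: infinite_finite_induct) (auto intro: section_zero section_add)

text \<open>Local coefficient functions glue because coefficients in a frame are unique; at each
  point the coefficients chosen for that very point are taken.\<close>

lemma section_local:
  assumes W: "open W"
    and loc: "\<And>x. x \<in> W \<Longrightarrow> \<exists>U. open U \<and> x \<in> U \<and> smooth_section_on M E U \<sigma>"
  shows "smooth_section_on M E W \<sigma>"
  unfolding smooth_section_on_def
proof (intro conjI ballI, goal_cases)
  case (1 x)
  then obtain U where "x \<in> U" "smooth_section_on M E U \<sigma>" using loc[of x] by blast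
  then show ?case using section_fibre[of U \<sigma> x] by simp
next
  case (2 Vs)
  obtain V s where Vs: "Vs = (V, s)" by force
  with 2 have V: "(V, s) \<in> frames E" by simp
  have "\<exists>U a. open U \<and> x \<in> U \<and> (\<forall>i<brank E. smooth_fun_on M (V \<inter> U) (a i)) \<and>
      (\<forall>y\<in>V \<inter> U. \<sigma> y = (\<Sum>i<brank E. a i y *\<^sub>R s i y))" if "x \<in> W" for x
  proof -
    obtain U where U: "open U" "x \<in> U" "smooth_section_on M E U \<sigma>" using loc[OF \<open>x \<in> W\<close>] by blast
    obtain a where a: "\<forall>i<brank E. smooth_fun_on M (V \<inter> U) (a i)" "\<forall>x\<in>V \<inter> U. \<sigma> x = (\<Sum>i<brank E. a i x *\<^sub>R s i x)"
      using section_coeffs[OF U(3) V] by blast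
    then show ?thesis using U by blast
  qed
  then have "\<forall>x\<in>W. \<exists>U a. open U \<and> x \<in> U \<and> (\<forall>i<brank E. smooth_fun_on M (V \<inter> U) (a i)) \<and>
      (\<forall>y\<in>V \<inter> U. \<sigma> y = (\<Sum>i<brank E. a i y *\<^sub>R s i y))" by blast
  from bchoice[OF this] obtain U where "\<forall>x\<in>W. \<exists>a. open (U x) \<and> x \<in> U x \<and>
      (\<forall>i<brank E. smooth_fun_on M (V \<inter> U x) (a i)) \<and>
      (\<forall>y\<in>V \<inter> U x. \<sigma> y = (\<Sum>i<brank E. a i y *\<^sub>R s i y))" by (elim exE)
  from bchoice[OF this] obtain a where *: "\<forall>x\<in>W. open (U x) \<and> x \<in> U x \<and>
      (\<forall>i<brank E. smooth_fun_on M (V \<inter> U x) (a x i)) \<and>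
      (\<forall>y\<in>V \<inter> U x. \<sigma> y = (\<Sum>i<brank E. a x i y *\<^sub>R s i y))" by (elim exE)
  have Ua: "\<And>x. x \<in> W \<Longrightarrow> open (U x)" "\<And>x. x \<in> W \<Longrightarrow> x \<in> U x"
    "\<And>x i. x \<in> W \<Longrightarrow> i < brank E \<Longrightarrow> smooth_fun_on M (V \<inter> U x) (a x i)"
    "\<And>x y. x \<in> W \<Longrightarrow> y \<in> V \<Longrightarrow> y \<in> U x \<Longrightarrow> \<sigma> y = (\<Sum>i<brank E. a x i y *\<^sub>R s i y)"
    using * by simp_all
  define A where "A i x = a x i x" for i x
  have A: "A i y = a x i y" if "x \<in> W" "y \<in> W" "y \<in> V" "y \<in> U x" "i < brank E" for i x y
    using frame_unique[OF V that(3) _ that(5), of "\<lambda>i. a y i y" "\<lambda>i. a x i y"]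
      Ua(4)[OF that(1,3,4)] Ua(4)[OF that(2,3) Ua(2)[OF that(2)]] by (simp add: A_def)
  have "smooth_fun_on M (V \<inter> W) (A i)" if i: "i < brank E" for i
  proof (rule smooth_fun_on_local)
    fix x assume x: "x \<in> V \<inter> W"
    have "smooth_fun_on M (V \<inter> U x \<inter> W) (a x i)"
      by (rule smooth_fun_on_subset[OF Ua(3)]) (use x i in auto)
    then have "smooth_fun_on M (V \<inter> U x \<inter> W) (A i)"
      by (rule smooth_fun_on_cong) (use frame_open[OF V] W Ua(1) A x i in auto)
    then show "\<exists>T. open T \<and> x \<in> T \<and> smooth_fun_on M T (A i)"
      using frame_open[OF V] W Ua(1,2)[of x] x by (intro exI[of _ "V \<inter> U x \<inter> W"]) auto
  qed (use frame_open[OF V] W in auto)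
  moreover have "\<sigma> x = (\<Sum>i<brank E. A i x *\<^sub>R s i x)" if "x \<in> V \<inter> W" for x
    using Ua(4)[of x x] Ua(2)[of x] that by (simp add: A_def)
  ultimately show ?case unfolding Vs prod.case by (intro exI[of _ A]) simp
qed

end

section \<open>The trivial line bundle and the tangent bundle\<close>

lemma (in manifold_ctx) trivial_line_section_iff:
  assumes "open W"
  shows "smooth_section_on M trivial_line W f \<longleftrightarrow> smooth_fun_on M W f"
proof
  assume "smooth_section_on M trivial_line W f"
  then obtain a where a: "smooth_fun_on M W (a 0)" "\<forall>x\<in>W. f x = a 0 x"
    by (auto simp: smooth_section_on_def trivial_line_def)
  show "smooth_fun_on M W f" by (rule smooth_fun_on_cong[OF a(1) assms]) (use a in auto)
next
  assume "smooth_fun_on M W f"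
  then show "smooth_section_on M trivial_line W f"
    by (auto simp: smooth_section_on_def trivial_line_def intro!: exI[of _ "\<lambda>_. f"])
qed

lemma (in manifold_ctx) vector_bundle_trivial_line: "vector_bundle M trivial_line"
proof -
  have "span {1::real} = UNIV"
    using span_superset[of "{1::real}"] span_mul[of 1 "{1::real}"] by auto
  moreover have "smooth_section_on M trivial_line UNIV (\<lambda>_. 1)"
    by (simp add: trivial_line_section_iff smooth_fun_on_const)
  moreover have "inj_on (\<lambda>i::nat. 1::real) {..<Suc 0}" by (auto simp: inj_on_def)
  moreover have "(\<lambda>i::nat. 1::real) ` {..<Suc 0} = {1}" by auto
  ultimately show ?thesis unfolding vector_bundle_def by (simp add: trivial_line_def)
qed

lemma (in manifold_ctx) vector_bundle_tangent: "vector_bundle M (tangent_bundle M)"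
proof -
  have 1: "inj_on (\<lambda>i. coord_vec M c i x) {..<n}"
    and 2: "independent ((\<lambda>i. coord_vec M c i x) ` {..<n})"
    and 3: "span ((\<lambda>i. coord_vec M c i x) ` {..<n}) = tangent_space M x"
    if c: "c \<in> atlas M" "x \<in> fst c" for c x
  proof -
    show inj: "inj_on (\<lambda>i. coord_vec M c i x) {..<n}"
    proof (rule inj_onI)
      fix i j assume ij: "i \<in> {..<n}" "j \<in> {..<n}" "coord_vec M c i x = coord_vec M c j x"
      have "coord_vec M c j x (\<lambda>y. snd c y i) = 1"
        unfolding ij(3)[symmetric] using coord_vec_coord[OF c, of i i] ij(1) by simp
      then show "i = j" using coord_vec_coord[OF c, of j i] ij(2) by (auto split: if_splits)
    qed
    \<comment> \<open>Evaluating a linear relation on the j-th coordinate function isolates its j-th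
      coefficient.\<close>
    have "\<forall>f. (\<Sum>v\<in>(\<lambda>i. coord_vec M c i x) ` {..<n}. f v *\<^sub>R v) = 0 \<longrightarrow>
        (\<forall>j<n. f (coord_vec M c j x) = 0)"
    proof (intro allI impI)
      fix f j assume *: "(\<Sum>v\<in>(\<lambda>i. coord_vec M c i x) ` {..<n}. f v *\<^sub>R v) = 0" and j: "j < n"
      have "0 = (\<Sum>v\<in>(\<lambda>i. coord_vec M c i x) ` {..<n}. f v *\<^sub>R v) (\<lambda>y. snd c y j)"
        unfolding * by simp
      also have "\<dots> = (\<Sum>i<n. f (coord_vec M c i x) * coord_vec M c i x (\<lambda>y. snd c y j))"
        using inj by (subst sum.reindex) (simp_all add: sum_fun_apply)
      also have "\<dots> = (\<Sum>i<n. if i = j then f (coord_vec M c j x) else 0)"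
        by (intro sum.cong refl) (simp add: coord_vec_coord[OF c])
      also have "\<dots> = f (coord_vec M c j x)" using j by simp
      finally show "f (coord_vec M c j x) = 0" by simp
    qed
    then show "independent ((\<lambda>i. coord_vec M c i x) ` {..<n})"
      by (intro independent_if_scalars_zero[OF finite_imageI[OF finite_lessThan]]) blast
    show "span ((\<lambda>i. coord_vec M c i x) ` {..<n}) = tangent_space M x"
    proof
      show "span ((\<lambda>i. coord_vec M c i x) ` {..<n}) \<subseteq> tangent_space M x"
        using coord_vec_tangent[OF c] by (intro span_minimal subspace_tangent) auto
      show "tangent_space M x \<subseteq> span ((\<lambda>i. coord_vec M c i x) ` {..<n})"
      proof
        fix v assume "v \<in> tangent_space M x"
        then show "v \<in> span ((\<lambda>i. coord_vec M c i x) ` {..<n})"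
          by (subst tangent_expand[OF _ c]) (auto intro!: span_sum span_scale intro: span_base)
      qed
    qed
  qed
  have 4: "smooth_section_on M (tangent_bundle M) (fst c) (coord_vec M c i)" if "c \<in> atlas M" "i < n" for c i
    unfolding smooth_section_on_def
  proof (intro conjI ballI)
    fix Vs assume "Vs \<in> frames (tangent_bundle M)"
    then obtain d where d: "d \<in> atlas M" "Vs = (fst d, coord_vec M d)" by (auto simp: tangent_bundle_def)
    show "case Vs of (V, s) \<Rightarrow> \<exists>a. (\<forall>j<brank (tangent_bundle M). smooth_fun_on M (V \<inter> fst c) (a j)) \<and>
        (\<forall>x\<in>V \<inter> fst c. coord_vec M c i x = (\<Sum>j<brank (tangent_bundle M). a j x *\<^sub>R s j x))"
      unfolding d(2) prod.case
      using smooth_fun_on_coord_vec[OF that chart_open[OF d(1)] smooth_fun_on_coord[OF d(1)]]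
        coord_vec_change[OF that(1) _ that(2) d(1)]
      by (intro exI[of _ "\<lambda>j x. coord_vec M c i x (\<lambda>y. snd d y j)"]) (auto simp: tangent_bundle_def)
  qed (use that coord_vec_tangent in \<open>auto simp: tangent_bundle_def\<close>)
  show ?thesis
    unfolding vector_bundle_def using 1 2 3 4 chart_open ex_chart
    by (auto simp: tangent_bundle_def)
qed

sublocale manifold_ctx \<subseteq> tan: bundle_ctx M "tangent_bundle M"
  by unfold_locales (rule vector_bundle_tangent)

sublocale manifold_ctx \<subseteq> line: bundle_ctx M "trivial_line"
  by unfold_locales (rule vector_bundle_trivial_line)

context manifold_ctx
begin

lemma fibre_tangent [simp]: "fibre (tangent_bundle M) = tangent_space M"
  by (simp add: tangent_bundle_def)

lemma field_tangent: "vector_field_on M W X \<Longrightarrow> x \<in> W \<Longrightarrow> X x \<in> tangent_space M x"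
  using tan.section_fibre by simp

lemma coord_vec_field: "c \<in> atlas M \<Longrightarrow> i < n \<Longrightarrow> vector_field_on M (fst c) (coord_vec M c i)"
  using tan.frame_section[of "fst c" "coord_vec M c" i] by (simp add: tangent_bundle_def)

lemma smooth_fun_on_field:
  assumes W: "open W" and X: "vector_field_on M W X" and f: "smooth_fun_on M W f"
  shows "smooth_fun_on M W (\<lambda>y. X y f)"
proof (rule smooth_fun_on_local[OF _ W])
  fix x assume x: "x \<in> W"
  obtain c where c: "c \<in> atlas M" "x \<in> fst c" using ex_chart by blast
  have "(fst c, coord_vec M c) \<in> frames (tangent_bundle M)" using c by (simp add: tangent_bundle_def)
  from tan.section_coeffs[OF X this] obtain a where a:
    "\<forall>i<n. smooth_fun_on M (fst c \<inter> W) (a i)"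
    "\<forall>x\<in>fst c \<inter> W. X x = (\<Sum>i<n. a i x *\<^sub>R coord_vec M c i x)"
    unfolding tangent_bundle_def by auto
  have o: "open (fst c \<inter> W)" using W chart_open[OF c(1)] by auto
  have "smooth_fun_on M (fst c \<inter> W) (\<lambda>y. \<Sum>i<n. a i y * coord_vec M c i y f)"
    using smooth_fun_on_coord_vec[OF c(1) _ W f]
    by (intro smooth_fun_on_sum smooth_fun_on_mult o a(1)[rule_format]) (auto simp: Int_commute)
  then have "smooth_fun_on M (fst c \<inter> W) (\<lambda>y. X y f)"
    by (rule smooth_fun_on_cong[OF _ o]) (simp add: a(2) sum_fun_apply)
  then show "\<exists>V. open V \<and> x \<in> V \<and> smooth_fun_on M V (\<lambda>y. X y f)" using o c x by blast
qed

end

section \<open>Connections\<close>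

locale conn_ctx = bundle_ctx M E
  for M :: "'m::{t2_space,second_countable_topology} manifold"
    and E :: "('m, 'e::real_vector) vbundle" +
  fixes nab :: "('m, 'e) conn"
  assumes connection: "connection M E nab"
begin

context
  fixes W \<sigma> x
  assumes W: "open W" "x \<in> W" and \<sigma>: "smooth_section_on M E W \<sigma>"
begin

lemma conn_all:
  "\<forall>x\<in>W. \<forall>v\<in>tangent_space M x.
          nab x v \<sigma> \<in> fibre E x \<and>
          (\<forall>w\<in>tangent_space M x. \<forall>a b.
             nab x (a *\<^sub>R v + b *\<^sub>R w) \<sigma> = a *\<^sub>R nab x v \<sigma> + b *\<^sub>R nab x w \<sigma>) \<and>
          (\<forall>\<tau>. smooth_section_on M E W \<tau> \<longrightarrow>
             nab x v (\<lambda>y. \<sigma> y + \<tau> y) = nab x v \<sigma> + nab x v \<tau>) \<and>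
          (\<forall>f. smooth_fun_on M W f \<longrightarrow>
             nab x v (\<lambda>y. f y *\<^sub>R \<sigma> y) = v f *\<^sub>R \<sigma> x + f x *\<^sub>R nab x v \<sigma>) \<and>
          (\<forall>\<tau>. (\<forall>y\<in>W. \<tau> y = \<sigma> y) \<longrightarrow> nab x v \<tau> = nab x v \<sigma>)"
  using connection[unfolded connection_def, rule_format, OF conjI[OF W(1) \<sigma>]] by (rule conjunct1)

lemmas conn_at = conn_all[THEN bspec, OF W(2), THEN bspec]

lemma conn_fibre: "v \<in> tangent_space M x \<Longrightarrow> nab x v \<sigma> \<in> fibre E x"
  by (rule conn_at[THEN conjunct1])

lemma conn_lin:
  "v \<in> tangent_space M x \<Longrightarrow> w \<in> tangent_space M x \<Longrightarrow>
    nab x (a *\<^sub>R v + b *\<^sub>R w) \<sigma> = a *\<^sub>R nab x v \<sigma> + b *\<^sub>R nab x w \<sigma>"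
  by (rule conn_at[THEN conjunct2, THEN conjunct1, rule_format])

lemma conn_add:
  "v \<in> tangent_space M x \<Longrightarrow> smooth_section_on M E W \<tau> \<Longrightarrow>
    nab x v (\<lambda>y. \<sigma> y + \<tau> y) = nab x v \<sigma> + nab x v \<tau>"
  by (rule conn_at[THEN conjunct2, THEN conjunct2, THEN conjunct1, rule_format])

lemma conn_scale:
  "v \<in> tangent_space M x \<Longrightarrow> smooth_fun_on M W f \<Longrightarrow>
    nab x v (\<lambda>y. f y *\<^sub>R \<sigma> y) = v f *\<^sub>R \<sigma> x + f x *\<^sub>R nab x v \<sigma>"
  by (rule conn_at[THEN conjunct2, THEN conjunct2, THEN conjunct2, THEN conjunct1, rule_format])

lemma conn_cong:
  "v \<in> tangent_space M x \<Longrightarrow> (\<And>y. y \<in> W \<Longrightarrow> \<tau> y = \<sigma> y) \<Longrightarrow> nab x v \<tau> = nab x v \<sigma>"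
  by (rule conn_at[THEN conjunct2, THEN conjunct2, THEN conjunct2, THEN conjunct2, rule_format])

lemma conn_zero:
  assumes "v \<in> tangent_space M x"
  shows "nab x v (\<lambda>y. 0) = 0"
  using conn_scale[OF assms smooth_fun_on_const[OF W(1), of 0]] tangent_const[OF assms, of 0] by simp

lemma conn_scale_const:
  assumes "v \<in> tangent_space M x"
  shows "nab x v (\<lambda>y. a *\<^sub>R \<sigma> y) = a *\<^sub>R nab x v \<sigma>"
  using conn_scale[OF assms smooth_fun_on_const[OF W(1), of a]] tangent_const[OF assms, of a] by simp

lemma conn_dir_zero: "nab x 0 \<sigma> = 0"
  using conn_lin[OF subspace_0[OF subspace_tangent] subspace_0[OF subspace_tangent], of 0 0] by simp

lemma conn_dir_sum:
  assumes "\<And>i. i \<in> I \<Longrightarrow> v i \<in> tangent_space M x"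
  shows "nab x (\<Sum>i\<in>I. a i *\<^sub>R v i) \<sigma> = (\<Sum>i\<in>I. a i *\<^sub>R nab x (v i) \<sigma>)"
  using assms
proof (induction I rule: infinite_finite_induct)
  case (insert i I)
  have "(\<Sum>i\<in>I. a i *\<^sub>R v i) \<in> tangent_space M x"
    using insert.prems by (intro subspace_sum subspace_scale subspace_tangent) auto
  from conn_lin[OF insert.prems[of i] this, of "a i" 1]
  have "nab x (a i *\<^sub>R v i + (\<Sum>i\<in>I. a i *\<^sub>R v i)) \<sigma> = a i *\<^sub>R nab x (v i) \<sigma> + nab x (\<Sum>i\<in>I. a i *\<^sub>R v i) \<sigma>"
    by simp
  also have "nab x (\<Sum>i\<in>I. a i *\<^sub>R v i) \<sigma> = (\<Sum>i\<in>I. a i *\<^sub>R nab x (v i) \<sigma>)"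
    by (rule insert.IH) (rule insert.prems, simp)
  finally show ?case unfolding sum.insert[OF insert.hyps] .
qed (simp_all add: conn_dir_zero)

end

lemma conn_sum:
  assumes "open W" "x \<in> W" "v \<in> tangent_space M x" "\<And>i. i \<in> I \<Longrightarrow> smooth_section_on M E W (\<sigma> i)"
  shows "nab x v (\<lambda>y. \<Sum>i\<in>I. \<sigma> i y) = (\<Sum>i\<in>I. nab x v (\<sigma> i))"
  using assms(4)
proof (induction I rule: infinite_finite_induct)
  case (insert i I)
  have "nab x v (\<lambda>y. \<sigma> i y + (\<Sum>i\<in>I. \<sigma> i y)) = nab x v (\<sigma> i) + nab x v (\<lambda>y. \<Sum>i\<in>I. \<sigma> i y)"
    using insert.prems by (intro conn_add[OF assms(1,2)] section_sum assms(1,3)) auto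
  then show ?case using insert by simp
qed (use conn_zero[OF assms(1,2) section_zero[OF assms(1)] assms(3)] in auto)

end

section \<open>Alternating forms\<close>

text \<open>Stated for arguments from an arbitrary set S, so that it covers forms on tangent vectors
  as well as their components on index lists.\<close>

definition swap_odd :: "'a set \<Rightarrow> nat \<Rightarrow> ('a list \<Rightarrow> 'b::real_vector) \<Rightarrow> bool"
  where "swap_odd S k f \<longleftrightarrow> (\<forall>xs. length xs = k \<longrightarrow> set xs \<subseteq> S \<longrightarrow>
    (\<forall>i j. i < j \<longrightarrow> j < k \<longrightarrow> f (xs[i := xs ! j, j := xs ! i]) = - f xs))"

lemma length_omit: "p < length xs \<Longrightarrow> length (omit p xs) = length xs - 1"
  by (auto simp: omit_def)

lemma set_omit: "set (omit p xs) \<subseteq> set xs"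
  by (auto simp: omit_def dest: in_set_takeD in_set_dropD)

lemma map_omit: "map f (omit p xs) = omit p (map f xs)"
  by (simp add: omit_def take_map drop_map)

lemma nth_omit:
  "p < length xs \<Longrightarrow> i < length xs - 1 \<Longrightarrow> omit p xs ! i = (if i < p then xs ! i else xs ! Suc i)"
  by (auto simp: omit_def nth_append min_def)

text \<open>The entry at position p travels to the front by p swaps of neighbours, each costing a
  sign.\<close>

lemma swap_odd_move_front:
  assumes f: "swap_odd S k f"
  shows "length xs = k \<Longrightarrow> set xs \<subseteq> S \<Longrightarrow> p < k \<Longrightarrow> f xs = (- 1) ^ p *\<^sub>R f (xs ! p # omit p xs)"
proof (induction p arbitrary: xs)
  case 0
  then show ?case by (cases xs) (auto simp: omit_def)
next
  case (Suc p)
  let ?ys = "xs[p := xs ! Suc p, Suc p := xs ! p]"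
  have len: "length ?ys = k" using Suc.prems by simp
  have S: "set ?ys \<subseteq> S" using Suc.prems by (intro set_update_subsetI) (auto simp: subset_iff)
  have "f ?ys = (- 1) ^ p *\<^sub>R f (?ys ! p # omit p ?ys)"
    using Suc.IH[OF len S] Suc.prems by simp
  moreover have "?ys ! p = xs ! Suc p" using Suc.prems by simp
  moreover have "omit p ?ys = omit (Suc p) xs"
    using Suc.prems by (intro nth_equalityI) (auto simp: length_omit nth_omit nth_list_update less_Suc_eq)
  moreover have "f ?ys = - f xs" using f Suc.prems by (auto simp: swap_odd_def)
  then have "f xs = - f ?ys" by simp
  ultimately show ?case by (simp only: power_Suc mult_minus1 scaleR_minus_left)
qed

lemma swap_odd_map:
  assumes "swap_odd S k f" "e ` T \<subseteq> S"
  shows "swap_odd T k (\<lambda>I. f (map e I))"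
  unfolding swap_odd_def
proof (intro allI impI)
  fix xs i j assume xs: "length xs = k" "set xs \<subseteq> T" "i < j" "j < k"
  have "set (map e xs) \<subseteq> S" using assms(2) xs(2) by auto
  then have "f ((map e xs)[i := map e xs ! j, j := map e xs ! i]) = - f (map e xs)"
    using assms(1)[unfolded swap_odd_def, rule_format, of "map e xs" i j] xs by simp
  then show "f (map e (xs[i := xs ! j, j := xs ! i])) = - f (map e xs)"
    using xs by (simp add: map_update)
qed

lemma swap_odd_Cons:
  assumes "swap_odd S (Suc k) f" "a \<in> S"
  shows "swap_odd S k (\<lambda>xs. f (a # xs))"
  unfolding swap_odd_def
proof (intro allI impI)
  fix xs :: "'a list" and i j assume xs: "length xs = k" "set xs \<subseteq> S" "i < j" "j < k"
  then show "f (a # xs[i := xs ! j, j := xs ! i]) = - f (a # xs)"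
    using assms(1)[unfolded swap_odd_def, rule_format, of "a # xs" "Suc i" "Suc j"] assms(2) by simp
qed

section \<open>Lists of tangent vectors and their extensions to vector fields\<close>

context manifold_ctx
begin

lemma tlists_update: "vs \<in> tlists M k x \<Longrightarrow> v \<in> tangent_space M x \<Longrightarrow> vs[i := v] \<in> tlists M k x"
  using set_update_subset_insert[of vs i v] by (auto simp: tlists_def)

lemma tlists_nth: "vs \<in> tlists M k x \<Longrightarrow> i < k \<Longrightarrow> vs ! i \<in> tangent_space M x"
  by (auto simp: tlists_def)

lemma tlists_omit: "vs \<in> tlists M (Suc k) x \<Longrightarrow> p \<le> k \<Longrightarrow> omit p vs \<in> tlists M k x"
  using set_omit[of p vs] by (auto simp: tlists_def length_omit)

lemma tlists_Cons: "v \<in> tangent_space M x \<Longrightarrow> vs \<in> tlists M k x \<Longrightarrow> v # vs \<in> tlists M (Suc k) x"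
  by (auto simp: tlists_def)

abbreviation fields_on :: "'m set \<Rightarrow> ('m \<Rightarrow> 'm tvec) list \<Rightarrow> bool"
  where "fields_on W Ys \<equiv> \<forall>Y\<in>set Ys. vector_field_on M W Y"

abbreviation at_point :: "'m \<Rightarrow> ('m \<Rightarrow> 'm tvec) list \<Rightarrow> 'm tvec list"
  where "at_point y Ys \<equiv> map (\<lambda>Y. Y y) Ys"

lemma fields_on_tlists: "fields_on W Ys \<Longrightarrow> y \<in> W \<Longrightarrow> at_point y Ys \<in> tlists M (length Ys) y"
  using field_tangent by (fastforce simp: tlists_def)

lemma fields_on_update: "fields_on W Ys \<Longrightarrow> vector_field_on M W Y \<Longrightarrow> fields_on W (Ys[i := Y])"
  using set_update_subset_insert[of Ys i Y] by auto

lemma fields_on_subset: "fields_on W Ys \<Longrightarrow> V \<subseteq> W \<Longrightarrow> fields_on V Ys"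
  using tan.section_subset by blast

text \<open>Extends a tangent vector over a chart by keeping its chart coordinates constant. It
  serves as the witness for \<open>extend\<close> and, later, as the field that normalizes the Gram
  matrix at a point.\<close>

definition const_field :: "'m chart \<Rightarrow> 'm tvec \<Rightarrow> 'm \<Rightarrow> 'm tvec"
  where "const_field c v = (\<lambda>y. \<Sum>j<n. v (\<lambda>y. snd c y j) *\<^sub>R coord_vec M c j y)"

lemma const_field_at: "c \<in> atlas M \<Longrightarrow> x \<in> fst c \<Longrightarrow> v \<in> tangent_space M x \<Longrightarrow> const_field c v x = v"
  using tangent_expand[of v x c] by (simp add: const_field_def)

lemma vector_field_const_field:
  assumes c: "c \<in> atlas M"
  shows "vector_field_on M (fst c) (const_field c v)"
  unfolding const_field_def
  by (intro tan.section_sum tan.section_scale smooth_fun_on_const coord_vec_field chart_open c) auto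

lemma at_point_const_field:
  "c \<in> atlas M \<Longrightarrow> x \<in> fst c \<Longrightarrow> vs \<in> tlists M k x \<Longrightarrow> at_point x (map (const_field c) vs) = vs"
  by (auto simp: tlists_def const_field_at subset_iff intro!: map_idI)

lemma fields_on_const_field: "c \<in> atlas M \<Longrightarrow> fields_on (fst c) (map (const_field c) vs)"
  using vector_field_const_field by auto

lemma extend_works:
  assumes "vs \<in> tlists M k x"
  shows "at_point x (extend M x vs) = vs"
    "\<exists>W. open W \<and> x \<in> W \<and> fields_on W (extend M x vs)"
proof -
  obtain c where c: "c \<in> atlas M" "x \<in> fst c" using ex_chart by blast
  have "\<exists>Ys. map (\<lambda>Y. Y x) Ys = vs \<and> (\<exists>W. open W \<and> x \<in> W \<and> (\<forall>Y\<in>set Ys. vector_field_on M W Y))"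
    using at_point_const_field[OF c assms] fields_on_const_field[OF c(1), of vs] chart_open[OF c(1)] c(2)
    by (intro exI[of _ "map (const_field c) vs"] conjI exI[of _ "fst c"])
  from someI_ex[OF this] show "at_point x (extend M x vs) = vs"
    "\<exists>W. open W \<and> x \<in> W \<and> fields_on W (extend M x vs)"
    unfolding extend_def by (rule conjunct1, rule conjunct2)
qed

end

context bundle_ctx
begin

lemma alt_fibre: "\<alpha> \<in> alt_forms M E k x \<Longrightarrow> vs \<in> tlists M k x \<Longrightarrow> \<alpha> vs \<in> fibre E x"
  by (simp add: alt_forms_def)

lemma alt_outside: "\<alpha> \<in> alt_forms M E k x \<Longrightarrow> vs \<notin> tlists M k x \<Longrightarrow> \<alpha> vs = 0"
  by (simp add: alt_forms_def)

lemma alt_lin: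
  "\<alpha> \<in> alt_forms M E k x \<Longrightarrow> vs \<in> tlists M k x \<Longrightarrow> i < k \<Longrightarrow> v \<in> tangent_space M x \<Longrightarrow>
    w \<in> tangent_space M x \<Longrightarrow>
    \<alpha> (vs[i := a *\<^sub>R v + b *\<^sub>R w]) = a *\<^sub>R \<alpha> (vs[i := v]) + b *\<^sub>R \<alpha> (vs[i := w])"
  by (simp add: alt_forms_def)

lemma alt_repeat:
  "\<alpha> \<in> alt_forms M E k x \<Longrightarrow> vs \<in> tlists M k x \<Longrightarrow> i < j \<Longrightarrow> j < k \<Longrightarrow> vs ! i = vs ! j \<Longrightarrow> \<alpha> vs = 0"
  unfolding alt_forms_def by blast

lemma alt_add:
  "\<alpha> \<in> alt_forms M E k x \<Longrightarrow> vs \<in> tlists M k x \<Longrightarrow> i < k \<Longrightarrow> v \<in> tangent_space M x \<Longrightarrow>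
    w \<in> tangent_space M x \<Longrightarrow> \<alpha> (vs[i := v + w]) = \<alpha> (vs[i := v]) + \<alpha> (vs[i := w])"
  using alt_lin[of \<alpha> k x vs i v w 1 1] by simp

lemma alt_slot_zero:
  assumes "\<alpha> \<in> alt_forms M E k x" "vs \<in> tlists M k x" "i < k"
  shows "\<alpha> (vs[i := 0]) = 0"
  using alt_lin[OF assms subspace_0[OF subspace_tangent] subspace_0[OF subspace_tangent], of 0 0] by simp

lemma alt_sum:
  assumes \<alpha>: "\<alpha> \<in> alt_forms M E k x" "vs \<in> tlists M k x" "i < k"
    and v: "\<And>j. j \<in> I \<Longrightarrow> v j \<in> tangent_space M x"
  shows "\<alpha> (vs[i := (\<Sum>j\<in>I. a j *\<^sub>R v j)]) = (\<Sum>j\<in>I. a j *\<^sub>R \<alpha> (vs[i := v j]))"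
  using v
proof (induction I rule: infinite_finite_induct)
  case (insert j I)
  have "(\<Sum>j\<in>I. a j *\<^sub>R v j) \<in> tangent_space M x"
    using insert.prems by (intro subspace_sum subspace_scale subspace_tangent) auto
  from alt_lin[OF \<alpha> insert.prems[of j] this, of "a j" 1]
  have "\<alpha> (vs[i := a j *\<^sub>R v j + (\<Sum>j\<in>I. a j *\<^sub>R v j)]) =
      a j *\<^sub>R \<alpha> (vs[i := v j]) + \<alpha> (vs[i := (\<Sum>j\<in>I. a j *\<^sub>R v j)])" by simp
  also have "\<alpha> (vs[i := (\<Sum>j\<in>I. a j *\<^sub>R v j)]) = (\<Sum>j\<in>I. a j *\<^sub>R \<alpha> (vs[i := v j]))"
    by (rule insert.IH) (rule insert.prems, simp)
  finally show ?case unfolding sum.insert[OF insert.hyps] .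
qed (simp_all add: alt_slot_zero[OF \<alpha>])

text \<open>Polarization: \<open>alt_forms\<close> asks for vanishing on repeated arguments, and
  expanding the value with v + w in both slots yields the sign.\<close>

lemma alt_swap:
  assumes \<alpha>: "\<alpha> \<in> alt_forms M E k x" and vs: "vs \<in> tlists M k x" and ij: "i < j" "j < k"
    and T: "v \<in> tangent_space M x" "w \<in> tangent_space M x"
  shows "\<alpha> (vs[i := v, j := w]) = - \<alpha> (vs[i := w, j := v])"
proof -
  have len: "length vs = k" using vs by (simp add: tlists_def)
  have i: "i < k" and ne: "i \<noteq> j" using ij by auto
  note up = tlists_update[OF vs]
  have vw: "v + w \<in> tangent_space M x" using T by (intro subspace_add subspace_tangent)
  have rep: "\<alpha> (vs[i := u, j := u]) = 0" if "u \<in> tangent_space M x" for u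
  proof (rule alt_repeat[OF \<alpha> _ ij])
    show "vs[i := u, j := u] \<in> tlists M k x" by (intro tlists_update vs that)
  qed (use ij len in simp)
  have "0 = \<alpha> (vs[i := v + w, j := v + w])" using rep[OF vw] by simp
  also have "\<dots> = \<alpha> (vs[i := v + w, j := v]) + \<alpha> (vs[i := v + w, j := w])"
    by (rule alt_add[OF \<alpha> up[OF vw] ij(2) T])
  also have "\<dots> = (\<alpha> (vs[i := v, j := v]) + \<alpha> (vs[i := w, j := v])) +
      (\<alpha> (vs[i := v, j := w]) + \<alpha> (vs[i := w, j := w]))"
    unfolding list_update_swap[OF ne]
    by (simp only: alt_add[OF \<alpha> up[OF T(1)] i T] alt_add[OF \<alpha> up[OF T(2)] i T])
  finally show ?thesis using rep[OF T(1)] rep[OF T(2)] by (simp add: eq_neg_iff_add_eq_0 add.commute)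
qed

lemma alt_swap_odd:
  assumes "\<alpha> \<in> alt_forms M E k x"
  shows "swap_odd (tangent_space M x) k \<alpha>"
  unfolding swap_odd_def
proof (intro allI impI)
  fix xs i j assume xs: "length xs = k" "set xs \<subseteq> tangent_space M x" "i < j" "j < k"
  then have t: "xs \<in> tlists M k x" by (simp add: tlists_def)
  from alt_swap[OF assms t xs(3,4), of "xs ! j" "xs ! i"] xs tlists_nth[OF t]
  show "\<alpha> (xs[i := xs ! j, j := xs ! i]) = - \<alpha> xs" by simp
qed

lemma alt_zero: "(\<lambda>vs. 0) \<in> alt_forms M E k x"
  by (auto simp: alt_forms_def subspace_0[OF subspace_fibre])

lemma alt_formsI:
  assumes "\<And>vs. vs \<notin> tlists M k x \<Longrightarrow> \<alpha> vs = 0"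
    and "\<And>vs. vs \<in> tlists M k x \<Longrightarrow> \<alpha> vs \<in> fibre E x"
    and "\<And>vs i v w a b. vs \<in> tlists M k x \<Longrightarrow> i < k \<Longrightarrow> v \<in> tangent_space M x \<Longrightarrow>
      w \<in> tangent_space M x \<Longrightarrow>
      \<alpha> (vs[i := a *\<^sub>R v + b *\<^sub>R w]) = a *\<^sub>R \<alpha> (vs[i := v]) + b *\<^sub>R \<alpha> (vs[i := w])"
    and "\<And>vs i j. vs \<in> tlists M k x \<Longrightarrow> i < j \<Longrightarrow> j < k \<Longrightarrow> vs ! i = vs ! j \<Longrightarrow> \<alpha> vs = 0"
  shows "\<alpha> \<in> alt_forms M E k x"
  unfolding alt_forms_def mem_Collect_eq
proof (intro conjI allI impI ballI)
  fix vs assume vs: "vs \<in> tlists M k x"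
  show "\<alpha> vs = 0" if "i < j \<and> j < k \<and> vs ! i = vs ! j" for i j
    using assms(4)[OF vs] that by blast
qed (use assms in auto)

lemma alt_lincomb:
  assumes a: "\<alpha> \<in> alt_forms M E k x" and b: "\<beta> \<in> alt_forms M E k x"
  shows "(\<lambda>vs. s *\<^sub>R \<alpha> vs + t *\<^sub>R \<beta> vs) \<in> alt_forms M E k x"
proof (rule alt_formsI)
  show "s *\<^sub>R \<alpha> vs + t *\<^sub>R \<beta> vs \<in> fibre E x" if "vs \<in> tlists M k x" for vs
    using alt_fibre[OF a that] alt_fibre[OF b that]
    by (intro subspace_add subspace_scale subspace_fibre)
  show "s *\<^sub>R \<alpha> vs + t *\<^sub>R \<beta> vs = 0" if "vs \<in> tlists M k x" "i < j" "j < k" "vs ! i = vs ! j" for vs i j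
    using alt_repeat[OF a that] alt_repeat[OF b that] by simp
qed (simp_all add: alt_outside[OF a] alt_outside[OF b] alt_lin[OF a] alt_lin[OF b] algebra_simps)

text \<open>The interior product with u; the guard supplies the value 0 that
  \<open>alt_forms\<close> requires outside \<open>tlists\<close>.\<close>

lemma alt_Cons:
  assumes a: "\<alpha> \<in> alt_forms M E (Suc k) x" and u: "u \<in> tangent_space M x"
  shows "(\<lambda>vs. if vs \<in> tlists M k x then \<alpha> (u # vs) else 0) \<in> alt_forms M E k x"
proof (rule alt_formsI)
  fix vs i v w r s assume vs: "vs \<in> tlists M k x" "i < k" "v \<in> tangent_space M x" "w \<in> tangent_space M x"
  have "r *\<^sub>R v + s *\<^sub>R w \<in> tangent_space M x"
    using vs by (intro subspace_add subspace_scale subspace_tangent)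
  then show "(if vs[i := r *\<^sub>R v + s *\<^sub>R w] \<in> tlists M k x then \<alpha> (u # vs[i := r *\<^sub>R v + s *\<^sub>R w]) else 0) =
    r *\<^sub>R (if vs[i := v] \<in> tlists M k x then \<alpha> (u # vs[i := v]) else 0) +
    s *\<^sub>R (if vs[i := w] \<in> tlists M k x then \<alpha> (u # vs[i := w]) else 0)"
    using alt_lin[OF a tlists_Cons[OF u vs(1)], of "Suc i" v w r s] vs tlists_update[OF vs(1)] by simp
next
  fix vs i j assume vs: "vs \<in> tlists M k x" "i < j" "j < k" "vs ! i = vs ! j"
  then show "(if vs \<in> tlists M k x then \<alpha> (u # vs) else 0) = 0"
    using alt_repeat[OF a tlists_Cons[OF u vs(1)], of "Suc i" "Suc j"] by simp
qed (use alt_fibre[OF a tlists_Cons[OF u]] in auto)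

section \<open>Smooth bundle-valued forms\<close>

lemma form_alt: "smooth_form_on M E k W \<phi> \<Longrightarrow> x \<in> W \<Longrightarrow> \<phi> x \<in> alt_forms M E k x"
  by (simp add: smooth_form_on_def)

lemma form_section:
  assumes "smooth_form_on M E k W \<phi>" "open V" "V \<subseteq> W" "length Ys = k" "fields_on V Ys"
  shows "smooth_section_on M E V (eval_form \<phi> Ys)"
  using assms unfolding smooth_form_on_def by blast

lemma form_subset:
  assumes "smooth_form_on M E k W \<phi>" "V \<subseteq> W"
  shows "smooth_form_on M E k V \<phi>"
  unfolding smooth_form_on_def
proof (intro conjI ballI allI impI)
  fix U Ys assume *: "open U \<and> U \<subseteq> V \<and> length Ys = k \<and> fields_on U Ys"
  then show "smooth_section_on M E U (eval_form \<phi> Ys)"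
    using assms(2) by (intro form_section[OF assms(1)]) auto
qed (use form_alt[OF assms(1)] assms(2) in blast)

lemma form_cong:
  assumes "smooth_form_on M E k W \<phi>" "\<And>y. y \<in> W \<Longrightarrow> \<phi> y = \<psi> y"
  shows "smooth_form_on M E k W \<psi>"
  unfolding smooth_form_on_def
proof (intro conjI ballI allI impI)
  fix V Ys assume *: "open V \<and> V \<subseteq> W \<and> length Ys = k \<and> fields_on V Ys"
  then have "smooth_section_on M E V (eval_form \<phi> Ys)" by (intro form_section[OF assms(1)]) auto
  then show "smooth_section_on M E V (eval_form \<psi> Ys)"
  proof (rule section_cong)
    fix y assume "y \<in> V"
    then have "\<phi> y = \<psi> y" using * by (intro assms(2)) blast
    then show "eval_form \<phi> Ys y = eval_form \<psi> Ys y" by (simp only: eval_form_def)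
  qed
qed (use form_alt[OF assms(1)] assms(2) in simp)

lemma form_local:
  assumes "\<And>x. x \<in> W \<Longrightarrow> \<exists>U. open U \<and> x \<in> U \<and> smooth_form_on M E k U \<phi>"
  shows "smooth_form_on M E k W \<phi>"
  unfolding smooth_form_on_def
proof (intro conjI ballI allI impI)
  show "\<phi> x \<in> alt_forms M E k x" if "x \<in> W" for x
    using assms[OF that] form_alt by blast
next
  fix V Ys assume *: "open V \<and> V \<subseteq> W \<and> length Ys = k \<and> fields_on V Ys"
  show "smooth_section_on M E V (eval_form \<phi> Ys)"
  proof (rule section_local)
    fix x assume x: "x \<in> V"
    then obtain U where U: "open U" "x \<in> U" "smooth_form_on M E k U \<phi>" using assms * by blast
    have "smooth_section_on M E (U \<inter> V) (eval_form \<phi> Ys)"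
      by (rule form_section[OF U(3)]) (use U * fields_on_subset[of Ys V "U \<inter> V"] in auto)
    then show "\<exists>U. open U \<and> x \<in> U \<and> smooth_section_on M E U (eval_form \<phi> Ys)"
      using U x * by (intro exI[of _ "U \<inter> V"]) auto
  qed (use * in simp)
qed

lemma form_zero: "smooth_form_on M E k W (\<lambda>y vs. 0)"
  unfolding smooth_form_on_def eval_form_def using alt_zero section_zero by simp

lemma form_add:
  assumes "smooth_form_on M E k W \<phi>" "smooth_form_on M E k W \<psi>"
  shows "smooth_form_on M E k W (\<lambda>y vs. \<phi> y vs + \<psi> y vs)"
  unfolding smooth_form_on_def
proof (intro conjI ballI allI impI)
  fix V Ys assume *: "open V \<and> V \<subseteq> W \<and> length Ys = k \<and> fields_on V Ys"
  show "smooth_section_on M E V (eval_form (\<lambda>y vs. \<phi> y vs + \<psi> y vs) Ys)"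
    using section_add[OF _ form_section[OF assms(1), of V Ys] form_section[OF assms(2), of V Ys]] *
    by (simp add: eval_form_def[abs_def])
qed (use alt_lincomb[OF form_alt[OF assms(1)] form_alt[OF assms(2)], of _ 1 1] in simp)

lemma form_scale:
  assumes "smooth_form_on M E k W \<phi>" "open W" "smooth_fun_on M W f"
  shows "smooth_form_on M E k W (\<lambda>y vs. f y *\<^sub>R \<phi> y vs)"
  unfolding smooth_form_on_def
proof (intro conjI ballI allI impI)
  fix V Ys assume *: "open V \<and> V \<subseteq> W \<and> length Ys = k \<and> fields_on V Ys"
  then have "smooth_fun_on M V f" using smooth_fun_on_subset[OF assms(3)] by blast
  from section_scale[OF _ this form_section[OF assms(1), of V Ys]] *
  show "smooth_section_on M E V (eval_form (\<lambda>y vs. f y *\<^sub>R \<phi> y vs) Ys)"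
    by (simp add: eval_form_def[abs_def])
qed (use alt_lincomb[OF form_alt[OF assms(1)] form_alt[OF assms(1)], of _ _ 0] in simp)

lemma form_Cons:
  assumes "smooth_form_on M E (Suc k) W \<phi>" "vector_field_on M W X"
  shows "smooth_form_on M E k W (\<lambda>y vs. if vs \<in> tlists M k y then \<phi> y (X y # vs) else 0)"
  unfolding smooth_form_on_def
proof (intro conjI ballI allI impI)
  fix V Ys assume *: "open V \<and> V \<subseteq> W \<and> length Ys = k \<and> fields_on V Ys"
  then have "fields_on V (X # Ys)" using tan.section_subset[OF assms(2)] by auto
  then have "smooth_section_on M E V (eval_form \<phi> (X # Ys))" using * by (intro form_section[OF assms(1)]) auto
  then show "smooth_section_on M E V (eval_form (\<lambda>y vs. if vs \<in> tlists M k y then \<phi> y (X y # vs) else 0) Ys)"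
    by (rule section_cong) (use * fields_on_tlists in \<open>auto simp: eval_form_def\<close>)
qed (rule alt_Cons[OF form_alt[OF assms(1)] field_tangent[OF assms(2)]])

end

section \<open>The tensor product connection\<close>

locale lc_ctx = manifold_ctx M
  for M :: "'m::{t2_space,second_countable_topology} manifold" +
  fixes g :: "'m \<Rightarrow> 'm tvec \<Rightarrow> 'm tvec \<Rightarrow> real" and D :: "('m, 'm tvec) conn"
  assumes metric: "riemannian_metric M g" and levi_civita: "levi_civita M g D"

sublocale lc_ctx \<subseteq> tan: conn_ctx M "tangent_bundle M" D
  by unfold_locales (use levi_civita in \<open>simp add: levi_civita_def metric_connection_def\<close>)

lemma (in lc_ctx) torsion_free:
  "open W \<Longrightarrow> x \<in> W \<Longrightarrow> vector_field_on M W X \<Longrightarrow> vector_field_on M W Y \<Longrightarrow>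
    lie_bracket M X Y x = D x (X x) Y - D x (Y x) X"
  using levi_civita unfolding levi_civita_def by metis

locale form_ctx = lc_ctx M g D + conn_ctx M E nab
  for M :: "'m::{t2_space,second_countable_topology} manifold"
    and g :: "'m \<Rightarrow> 'm tvec \<Rightarrow> 'm tvec \<Rightarrow> real" and D :: "('m, 'm tvec) conn"
    and E :: "('m, 'e::real_vector) vbundle" and nab :: "('m, 'e) conn"
begin

abbreviation "nabla \<equiv> form_nabla M D nab"

lemma at_fields: "length Ys = k \<Longrightarrow> fields_on W Ys \<Longrightarrow> y \<in> W \<Longrightarrow> at_point y Ys \<in> tlists M k y"
  using fields_on_tlists by blast

lemma D_fields:
  "open W \<Longrightarrow> x \<in> W \<Longrightarrow> v \<in> tangent_space M x \<Longrightarrow> length Ys = k \<Longrightarrow> fields_on W Ys \<Longrightarrow> i < k \<Longrightarrow>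
    D x v (Ys ! i) \<in> tangent_space M x"
  using tan.conn_fibre[of W x "Ys ! i" v] by simp

text \<open>The formula behind \<open>form_nabla\<close> with an arbitrary list of fields in place
  of the chosen extension. Showing that it depends only on the values of the fields at x frees
  \<open>form_nabla\<close> from that choice.\<close>

definition cov :: "nat \<Rightarrow> ('m \<Rightarrow> 'm tvec list \<Rightarrow> 'e) \<Rightarrow> 'm \<Rightarrow> 'm tvec \<Rightarrow> ('m \<Rightarrow> 'm tvec) list \<Rightarrow> 'e"
  where "cov k \<phi> x v Ys = nab x v (eval_form \<phi> Ys) - (\<Sum>i<k. \<phi> x ((at_point x Ys)[i := D x v (Ys ! i)]))"

context
  fixes k W0 \<phi> x v
  assumes \<phi>: "smooth_form_on M E k W0 \<phi>" and W0: "open W0" "x \<in> W0" and v: "v \<in> tangent_space M x"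
begin

text \<open>Separates the correction term of slot j from the others, in which the field in slot j
  enters only through its values; linearity in one slot is then visible term by term.\<close>

lemma cov_update:
  assumes Ys: "length Ys = k" and j: "j < k"
  shows "cov k \<phi> x v (Ys[j := Y]) = nab x v (\<lambda>y. \<phi> y ((at_point y Ys)[j := Y y])) -
    (\<phi> x ((at_point x Ys)[j := D x v Y]) +
     (\<Sum>i\<in>{..<k}-{j}. \<phi> x ((at_point x Ys)[i := D x v (Ys ! i), j := Y x])))"
proof -
  have "(\<Sum>i<k. \<phi> x ((at_point x (Ys[j := Y]))[i := D x v (Ys[j := Y] ! i)])) =
    \<phi> x ((at_point x (Ys[j := Y]))[j := D x v (Ys[j := Y] ! j)]) +
    (\<Sum>i\<in>{..<k}-{j}. \<phi> x ((at_point x (Ys[j := Y]))[i := D x v (Ys[j := Y] ! i)]))"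
    using j by (intro sum.remove) auto
  also have "(\<Sum>i\<in>{..<k}-{j}. \<phi> x ((at_point x (Ys[j := Y]))[i := D x v (Ys[j := Y] ! i)])) =
    (\<Sum>i\<in>{..<k}-{j}. \<phi> x ((at_point x Ys)[i := D x v (Ys ! i), j := Y x]))"
    by (intro sum.cong refl) (auto simp: map_update list_update_swap)
  finally show ?thesis
    using Ys j by (simp add: cov_def eval_form_def[abs_def] map_update)
qed

context
  fixes W Ys j
  assumes W: "open W" "x \<in> W" "W \<subseteq> W0" and Ys: "length Ys = k" "fields_on W Ys" and j: "j < k"
begin

lemma eval_update_section:
  assumes "vector_field_on M W Y"
  shows "smooth_section_on M E W (\<lambda>y. \<phi> y ((at_point y Ys)[j := Y y]))"
proof -
  have "smooth_section_on M E W (eval_form \<phi> (Ys[j := Y]))"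
    using Ys W fields_on_update[OF Ys(2) assms, of j] by (intro form_section[OF \<phi>]) auto
  then show ?thesis by (simp add: eval_form_def[abs_def] map_update)
qed

lemma cov_add:
  assumes Y: "vector_field_on M W Y" and Z: "vector_field_on M W Z"
  shows "cov k \<phi> x v (Ys[j := \<lambda>y. Y y + Z y]) = cov k \<phi> x v (Ys[j := Y]) + cov k \<phi> x v (Ys[j := Z])"
proof -
  note alt = form_alt[OF \<phi>]
  have "nab x v (\<lambda>y. \<phi> y ((at_point y Ys)[j := Y y + Z y])) =
    nab x v (\<lambda>y. \<phi> y ((at_point y Ys)[j := Y y]) + \<phi> y ((at_point y Ys)[j := Z y]))"
  proof (rule conn_cong[OF W(1,2) _ v])
    show "smooth_section_on M E W (\<lambda>y. \<phi> y ((at_point y Ys)[j := Y y]) + \<phi> y ((at_point y Ys)[j := Z y]))"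
      using Y Z by (intro section_add W eval_update_section)
    show "\<phi> y ((at_point y Ys)[j := Y y + Z y]) =
        \<phi> y ((at_point y Ys)[j := Y y]) + \<phi> y ((at_point y Ys)[j := Z y])" if "y \<in> W" for y
      using that W by (intro alt_add[OF alt at_fields[OF Ys] j] field_tangent[OF Y] field_tangent[OF Z]) auto
  qed
  also have "\<dots> = nab x v (\<lambda>y. \<phi> y ((at_point y Ys)[j := Y y])) + nab x v (\<lambda>y. \<phi> y ((at_point y Ys)[j := Z y]))"
    using Y Z by (intro conn_add[OF W(1,2) _ v] eval_update_section)
  finally have 1: "nab x v (\<lambda>y. \<phi> y ((at_point y Ys)[j := Y y + Z y])) = \<dots>" .
  have 2: "D x v (\<lambda>y. Y y + Z y) = D x v Y + D x v Z"
    by (rule tan.conn_add[OF W(1,2) Y v Z])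
  have 3: "\<phi> x ((at_point x Ys)[j := D x v Y + D x v Z]) =
     \<phi> x ((at_point x Ys)[j := D x v Y]) + \<phi> x ((at_point x Ys)[j := D x v Z])"
    using tan.conn_fibre[OF W(1,2) Y v] tan.conn_fibre[OF W(1,2) Z v]
    by (intro alt_add[OF alt[OF W0(2)] at_fields[OF Ys W(2)] j]) auto
  have 4: "\<phi> x ((at_point x Ys)[i := D x v (Ys ! i), j := Y x + Z x]) =
     \<phi> x ((at_point x Ys)[i := D x v (Ys ! i), j := Y x]) + \<phi> x ((at_point x Ys)[i := D x v (Ys ! i), j := Z x])"
    if "i < k" for i
    by (intro alt_add[OF alt[OF W0(2)] tlists_update[OF at_fields[OF Ys W(2)] D_fields[OF W(1,2) v Ys that]] j]
        field_tangent[OF Y] field_tangent[OF Z] W(2))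
  show ?thesis
    unfolding cov_update[OF Ys(1) j] 1 2 3 by (simp add: 4 sum.distrib)
qed

text \<open>Tensoriality: the Leibniz term with \<open>v f\<close> produced by \<open>nab\<close>
  cancels the one that \<open>D\<close> produces in slot j.\<close>

lemma cov_scale:
  assumes Y: "vector_field_on M W Y" and f: "smooth_fun_on M W f"
  shows "cov k \<phi> x v (Ys[j := \<lambda>y. f y *\<^sub>R Y y]) = f x *\<^sub>R cov k \<phi> x v (Ys[j := Y])"
proof -
  note alt = form_alt[OF \<phi>]
  have sc: "\<phi> y (us[j := a *\<^sub>R u]) = a *\<^sub>R \<phi> y (us[j := u])"
    if "y \<in> W0" "us \<in> tlists M k y" "u \<in> tangent_space M y" for y us u a
    using alt_lin[OF alt[OF that(1)] that(2) j that(3,3), of a 0] by simp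
  have "nab x v (\<lambda>y. \<phi> y ((at_point y Ys)[j := f y *\<^sub>R Y y])) =
    nab x v (\<lambda>y. f y *\<^sub>R \<phi> y ((at_point y Ys)[j := Y y]))"
  proof (rule conn_cong[OF W(1,2) _ v])
    show "smooth_section_on M E W (\<lambda>y. f y *\<^sub>R \<phi> y ((at_point y Ys)[j := Y y]))"
      using Y f by (intro section_scale W eval_update_section)
    show "\<phi> y ((at_point y Ys)[j := f y *\<^sub>R Y y]) = f y *\<^sub>R \<phi> y ((at_point y Ys)[j := Y y])" if "y \<in> W" for y
      using that W by (intro sc at_fields[OF Ys] field_tangent[OF Y]) auto
  qed
  also have "\<dots> = v f *\<^sub>R \<phi> x ((at_point x Ys)[j := Y x]) + f x *\<^sub>R nab x v (\<lambda>y. \<phi> y ((at_point y Ys)[j := Y y]))"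
    using Y f by (intro conn_scale[OF W(1,2) _ v] eval_update_section)
  finally have 1: "nab x v (\<lambda>y. \<phi> y ((at_point y Ys)[j := f y *\<^sub>R Y y])) = \<dots>" .
  have 2: "D x v (\<lambda>y. f y *\<^sub>R Y y) = v f *\<^sub>R Y x + f x *\<^sub>R D x v Y"
    by (rule tan.conn_scale[OF W(1,2) Y v f])
  have 3: "\<phi> x ((at_point x Ys)[j := v f *\<^sub>R Y x + f x *\<^sub>R D x v Y]) =
     v f *\<^sub>R \<phi> x ((at_point x Ys)[j := Y x]) + f x *\<^sub>R \<phi> x ((at_point x Ys)[j := D x v Y])"
    using tan.conn_fibre[OF W(1,2) Y v] field_tangent[OF Y W(2)]
    by (intro alt_lin[OF alt[OF W0(2)] at_fields[OF Ys W(2)] j]) auto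
  have 4: "\<phi> x ((at_point x Ys)[i := D x v (Ys ! i), j := f x *\<^sub>R Y x]) =
     f x *\<^sub>R \<phi> x ((at_point x Ys)[i := D x v (Ys ! i), j := Y x])"
    if "i < k" for i
    by (intro sc[OF W0(2) tlists_update[OF at_fields[OF Ys W(2)] D_fields[OF W(1,2) v Ys that]]] field_tangent[OF Y] W(2))
  show ?thesis
    unfolding cov_update[OF Ys(1) j] 1 2 3 by (simp add: 4 scaleR_sum_right[symmetric] algebra_simps)
qed

lemma cov_sum:
  assumes "\<And>l. l \<in> I \<Longrightarrow> vector_field_on M W (Z l)" "\<And>l. l \<in> I \<Longrightarrow> smooth_fun_on M W (a l)"
  shows "cov k \<phi> x v (Ys[j := \<lambda>y. \<Sum>l\<in>I. a l y *\<^sub>R Z l y]) = (\<Sum>l\<in>I. a l x *\<^sub>R cov k \<phi> x v (Ys[j := Z l]))"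
proof -
  have 0: "cov k \<phi> x v (Ys[j := \<lambda>y. 0]) = 0"
    using cov_scale[OF tan.section_zero[OF W(1)] smooth_fun_on_const[OF W(1), of 0]] by simp
  show ?thesis using assms
  proof (induction I rule: infinite_finite_induct)
    case (insert l I)
    have "cov k \<phi> x v (Ys[j := \<lambda>y. \<Sum>l\<in>insert l I. a l y *\<^sub>R Z l y]) =
      cov k \<phi> x v (Ys[j := \<lambda>y. a l y *\<^sub>R Z l y + (\<Sum>l\<in>I. a l y *\<^sub>R Z l y)])"
      using insert.hyps by simp
    also have "\<dots> = cov k \<phi> x v (Ys[j := \<lambda>y. a l y *\<^sub>R Z l y]) + cov k \<phi> x v (Ys[j := \<lambda>y. \<Sum>l\<in>I. a l y *\<^sub>R Z l y])"
      using insert.prems by (intro cov_add tan.section_scale tan.section_sum W) auto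
    also have "cov k \<phi> x v (Ys[j := \<lambda>y. a l y *\<^sub>R Z l y]) = a l x *\<^sub>R cov k \<phi> x v (Ys[j := Z l])"
      using insert.prems by (intro cov_scale) auto
    finally show ?case using insert by simp
  qed (simp_all add: 0)
qed

end

lemma cov_cong:
  assumes W: "open W" "x \<in> W" "W \<subseteq> W0" and Ys: "length Ys = k" "fields_on W Ys"
    and Zs: "length Zs = k" "\<And>i y. i < k \<Longrightarrow> y \<in> W \<Longrightarrow> (Zs ! i) y = (Ys ! i) y"
  shows "cov k \<phi> x v Zs = cov k \<phi> x v Ys"
proof -
  have eq: "at_point y Zs = at_point y Ys" if "y \<in> W" for y
    using Ys(1) Zs(1) Zs(2)[OF _ that] by (intro nth_equalityI) auto
  have "nab x v (eval_form \<phi> Zs) = nab x v (eval_form \<phi> Ys)"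
    by (rule conn_cong[OF W(1,2) form_section[OF \<phi> W(1,3) Ys] v]) (simp add: eval_form_def eq)
  moreover have "D x v (Zs ! i) = D x v (Ys ! i)" if "i < k" for i
    by (rule tan.conn_cong[OF W(1,2) _ v Zs(2)[OF that]]) (use Ys that in auto)
  ultimately show ?thesis unfolding cov_def by (simp add: eq[OF W(2)])
qed

text \<open>Linearity over functions allows the field in slot j to be expanded in coordinate fields
  near x; the resulting formula involves only its value at x.\<close>

lemma cov_slot_tensor:
  assumes W: "open W" "x \<in> W" "W \<subseteq> W0" and Ys: "length Ys = k" "fields_on W Ys" and j: "j < k"
    and YZ: "vector_field_on M W Y" "vector_field_on M W Z" "Y x = Z x"
  shows "cov k \<phi> x v (Ys[j := Y]) = cov k \<phi> x v (Ys[j := Z])"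
proof -
  obtain c where c: "c \<in> atlas M" "x \<in> fst c" using ex_chart by blast
  let ?W = "W \<inter> fst c"
  have W': "open ?W" "x \<in> ?W" "?W \<subseteq> W0" using W c chart_open[OF c(1)] by auto
  have Ys': "fields_on ?W Ys" using fields_on_subset[OF Ys(2)] by blast
  have "cov k \<phi> x v (Ys[j := Y]) = (\<Sum>l<n. Y x (\<lambda>y. snd c y l) *\<^sub>R cov k \<phi> x v (Ys[j := coord_vec M c l]))"
    if Y: "vector_field_on M W Y" for Y
  proof -
    have Y': "vector_field_on M ?W Y" using tan.section_subset[OF Y] by blast
    have co: "smooth_fun_on M ?W (\<lambda>y. Y y (\<lambda>y. snd c y l))" for l
      by (rule smooth_fun_on_field[OF W'(1) Y']) (rule smooth_fun_on_subset[OF smooth_fun_on_coord[OF c(1)]], simp)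
    have cf: "vector_field_on M ?W (coord_vec M c l)" if "l < n" for l
      by (rule tan.section_subset[OF coord_vec_field[OF c(1) that]]) simp
    have "cov k \<phi> x v (Ys[j := Y]) =
        cov k \<phi> x v (Ys[j := \<lambda>y. \<Sum>l<n. Y y (\<lambda>y. snd c y l) *\<^sub>R coord_vec M c l y])"
    proof (rule cov_cong[OF W'])
      show "fields_on ?W (Ys[j := \<lambda>y. \<Sum>l<n. Y y (\<lambda>y. snd c y l) *\<^sub>R coord_vec M c l y])"
        using co cf by (intro fields_on_update[OF Ys'] tan.section_sum tan.section_scale W') auto
      show "(Ys[j := Y] ! i) y = (Ys[j := \<lambda>y. \<Sum>l<n. Y y (\<lambda>y. snd c y l) *\<^sub>R coord_vec M c l y] ! i) y"
        if "i < k" "y \<in> ?W" for i y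
        using tangent_expand[OF field_tangent[OF Y'] c(1), of y] that Ys(1) by (cases "i = j") auto
    qed (use Ys in auto)
    also have "\<dots> = (\<Sum>l<n. Y x (\<lambda>y. snd c y l) *\<^sub>R cov k \<phi> x v (Ys[j := coord_vec M c l]))"
      using co cf by (intro cov_sum[OF W' Ys(1) Ys' j]) auto
    finally show ?thesis .
  qed
  from this[OF YZ(1)] this[OF YZ(2)] YZ(3) show ?thesis by simp
qed

text \<open>The fields are exchanged one at a time; \<open>take m Zs @ drop m Ys\<close> is the
  stage after m exchanges.\<close>

lemma cov_tensor:
  assumes W: "open W" "x \<in> W" "W \<subseteq> W0" and Ys: "length Ys = k" "fields_on W Ys"
    and Zs: "length Zs = k" "fields_on W Zs" and eq: "at_point x Ys = at_point x Zs"
  shows "cov k \<phi> x v Ys = cov k \<phi> x v Zs"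
proof -
  have "cov k \<phi> x v Ys = cov k \<phi> x v (take m Zs @ drop m Ys)" if "m \<le> k" for m
    using that
  proof (induction m)
    case (Suc m)
    let ?Xs = "take m Zs @ drop m Ys"
    have Xs: "length ?Xs = k" "fields_on W ?Xs"
      using Ys Zs Suc.prems by (auto dest: in_set_takeD in_set_dropD)
    have m: "m < k" using Suc.prems by simp
    have "?Xs = ?Xs[m := Ys ! m]" using m Ys Zs by (intro nth_equalityI) (auto simp: nth_append nth_list_update)
    moreover have "take (Suc m) Zs @ drop (Suc m) Ys = ?Xs[m := Zs ! m]"
      using m Ys Zs by (intro nth_equalityI) (auto simp: nth_append nth_list_update min_def less_Suc_eq)
    moreover have "(Ys ! m) x = (Zs ! m) x"
      using arg_cong[OF eq, of "\<lambda>l. l ! m"] m Ys(1) Zs(1) by simp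
    then have "cov k \<phi> x v (?Xs[m := Ys ! m]) = cov k \<phi> x v (?Xs[m := Zs ! m])"
      using m Ys Zs by (intro cov_slot_tensor[OF W Xs m]) auto
    ultimately show ?case using Suc by simp
  qed simp
  from this[of k] Ys Zs show ?thesis by simp
qed

lemma nabla_at:
  assumes W: "open W" "x \<in> W" and Ys: "length Ys = k" "fields_on W Ys"
  shows "nabla k \<phi> x v (at_point x Ys) = cov k \<phi> x v Ys"
proof -
  have t: "at_point x Ys \<in> tlists M k x" using fields_on_tlists[OF Ys(2) W(2)] Ys(1) by simp
  obtain W' where W': "open W'" "x \<in> W'" "fields_on W' (extend M x (at_point x Ys))"
    using extend_works(2)[OF t] by blast
  let ?Zs = "extend M x (at_point x Ys)"
  have at: "at_point x ?Zs = at_point x Ys" by (rule extend_works(1)[OF t])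
  then have len: "length ?Zs = k" using Ys(1) by (metis length_map)
  have "nabla k \<phi> x v (at_point x Ys) = cov k \<phi> x v ?Zs"
    using t at by (simp add: form_nabla_def cov_def Let_def)
  also have "\<dots> = cov k \<phi> x v Ys"
  proof (rule cov_tensor[of "W \<inter> W' \<inter> W0"])
    show "fields_on (W \<inter> W' \<inter> W0) ?Zs" by (rule fields_on_subset[OF W'(3)]) auto
    show "fields_on (W \<inter> W' \<inter> W0) Ys" by (rule fields_on_subset[OF Ys(2)]) auto
  qed (use W W' W0 len Ys at in auto)
  finally show ?thesis .
qed

lemma nabla_outside: "vs \<notin> tlists M k x \<Longrightarrow> nabla k \<phi> x v vs = 0"
  by (simp add: form_nabla_def)

lemma nabla_alt: "nabla k \<phi> x v \<in> alt_forms M E k x"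
proof (rule alt_formsI)
  obtain c where c: "c \<in> atlas M" "x \<in> fst c" using ex_chart by blast
  let ?Y = "\<lambda>vs. map (const_field c) vs" and ?W = "fst c \<inter> W0"
  have W: "open ?W" "x \<in> ?W" "?W \<subseteq> W0" using c chart_open[OF c(1)] W0 by auto
  have Y: "fields_on ?W (?Y vs)" for vs
    by (rule fields_on_subset[OF fields_on_const_field[OF c(1)]]) simp
  have F: "vector_field_on M ?W (const_field c u)" for u
    by (rule tan.section_subset[OF vector_field_const_field[OF c(1)]]) simp
  have len: "length (?Y vs) = k" if "vs \<in> tlists M k x" for vs using that by (simp add: tlists_def)
  have N: "nabla k \<phi> x v (at_point x Ys) = cov k \<phi> x v Ys" if "length Ys = k" "fields_on ?W Ys" for Ys
    by (rule nabla_at[OF W(1,2) that])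
  have N': "nabla k \<phi> x v vs = cov k \<phi> x v (?Y vs)" if "vs \<in> tlists M k x" for vs
    using N[OF len[OF that] Y] at_point_const_field[OF c that] by simp
  note alt = form_alt[OF \<phi> W0(2)]
  show "nabla k \<phi> x v vs \<in> fibre E x" if vs: "vs \<in> tlists M k x" for vs
    unfolding N'[OF vs] cov_def
    using D_fields[OF W(1,2) v len[OF vs] Y] vs at_fields[OF len[OF vs] Y W(2)]
    by (intro subspace_diff subspace_sum subspace_fibre conn_fibre[OF W(1,2) form_section[OF \<phi> W(1,3) len[OF vs] Y] v]
        alt_fibre[OF alt] tlists_update) auto
  show "nabla k \<phi> x v (vs[i := a *\<^sub>R u + b *\<^sub>R w]) = a *\<^sub>R nabla k \<phi> x v (vs[i := u]) + b *\<^sub>R nabla k \<phi> x v (vs[i := w])"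
    if vs: "vs \<in> tlists M k x" and i: "i < k" and u: "u \<in> tangent_space M x" and w: "w \<in> tangent_space M x"
    for vs i u w a b
  proof -
    let ?U = "const_field c u" and ?V = "const_field c w"
    have at: "at_point x ((?Y vs)[i := Z]) = vs[i := Z x]" for Z
      using at_point_const_field[OF c vs] by (simp add: map_update)
    have "nabla k \<phi> x v (vs[i := a *\<^sub>R u + b *\<^sub>R w]) =
        nabla k \<phi> x v (at_point x ((?Y vs)[i := \<lambda>y. a *\<^sub>R ?U y + b *\<^sub>R ?V y]))"
      unfolding at const_field_at[OF c u] const_field_at[OF c w] ..
    also have "\<dots> = cov k \<phi> x v ((?Y vs)[i := \<lambda>y. a *\<^sub>R ?U y + b *\<^sub>R ?V y])"
      using len[OF vs] by (intro N fields_on_update Y tan.section_add tan.section_scale F smooth_fun_on_const W) simp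
    also have "\<dots> = cov k \<phi> x v ((?Y vs)[i := \<lambda>y. a *\<^sub>R ?U y]) + cov k \<phi> x v ((?Y vs)[i := \<lambda>y. b *\<^sub>R ?V y])"
      by (intro cov_add[OF W len[OF vs] Y i] tan.section_scale F smooth_fun_on_const W)
    also have "cov k \<phi> x v ((?Y vs)[i := \<lambda>y. a *\<^sub>R ?U y]) = a *\<^sub>R cov k \<phi> x v ((?Y vs)[i := ?U])"
      by (intro cov_scale[OF W len[OF vs] Y i] F smooth_fun_on_const W)
    also have "cov k \<phi> x v ((?Y vs)[i := \<lambda>y. b *\<^sub>R ?V y]) = b *\<^sub>R cov k \<phi> x v ((?Y vs)[i := ?V])"
      by (intro cov_scale[OF W len[OF vs] Y i] F smooth_fun_on_const W)
    also have "cov k \<phi> x v ((?Y vs)[i := ?U]) = nabla k \<phi> x v (vs[i := u])"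
      using N[of "(?Y vs)[i := ?U]"] len[OF vs] fields_on_update[OF Y F] unfolding at const_field_at[OF c u] by simp
    also have "cov k \<phi> x v ((?Y vs)[i := ?V]) = nabla k \<phi> x v (vs[i := w])"
      using N[of "(?Y vs)[i := ?V]"] len[OF vs] fields_on_update[OF Y F] unfolding at const_field_at[OF c w] by simp
    finally show ?thesis .
  qed
  show "nabla k \<phi> x v vs = 0" if vs: "vs \<in> tlists M k x" and ij: "i < j" "j < k" "vs ! i = vs ! j" for vs i j
  proof -
    have lvs: "length vs = k" using vs by (simp add: tlists_def)
    have i: "i < k" using ij by simp
    have Yij: "?Y vs ! i = ?Y vs ! j" using lvs ij by simp
    have "nab x v (eval_form \<phi> (?Y vs)) = nab x v (\<lambda>y. 0)"
    proof (rule conn_cong[OF W(1,2) section_zero[OF W(1)] v])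
      fix y assume y: "y \<in> ?W"
      show "eval_form \<phi> (?Y vs) y = 0" unfolding eval_form_def
        by (rule alt_repeat[OF form_alt[OF \<phi>] at_fields[OF len[OF vs] Y y] ij(1,2)]) (use y Yij lvs ij in auto)
    qed
    then have 1: "nab x v (eval_form \<phi> (?Y vs)) = 0"
      using conn_zero[OF W(1,2) section_zero[OF W(1)] v] by simp
    let ?t = "\<lambda>l. \<phi> x (vs[l := D x v (?Y vs ! l)])"
    have DT: "D x v (?Y vs ! l) \<in> tangent_space M x" if "l < k" for l
      by (rule D_fields[OF W(1,2) v len[OF vs] Y that])
    have z: "?t l = 0" if "l < k" "l \<noteq> i" "l \<noteq> j" for l
      by (rule alt_repeat[OF alt tlists_update[OF vs DT] ij(1,2)]) (use that ij in auto)
    \<comment> \<open>With equal arguments in slots i and j, every other correction term still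
      repeats an argument, and these two differ by a transposition.\<close>
    have "?t i + ?t j = 0"
    proof -
      have "?t i = \<phi> x (vs[i := D x v (?Y vs ! i), j := vs ! i])" using ij lvs
        by (metis list_update_id list_update_swap less_irrefl)
      also have "\<dots> = - \<phi> x (vs[i := vs ! i, j := D x v (?Y vs ! i)])"
        by (rule alt_swap[OF alt vs ij(1,2) DT[OF i] tlists_nth[OF vs i]])
      also have "vs[i := vs ! i, j := D x v (?Y vs ! i)] = vs[j := D x v (?Y vs ! j)]"
        by (simp only: list_update_id Yij)
      finally show ?thesis by simp
    qed
    moreover have "(\<Sum>l<k. ?t l) = ?t i + (?t j + (\<Sum>l\<in>{..<k} - {i} - {j}. ?t l))"
      using i ij by (subst sum.remove[of _ i], simp, simp, subst sum.remove[of _ j], simp, simp) simp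
    moreover have "(\<Sum>l\<in>{..<k} - {i} - {j}. ?t l) = 0"
      by (rule sum.neutral) (use z in auto)
    ultimately have "(\<Sum>l<k. ?t l) = 0" by (simp add: add.assoc[symmetric])
    then show ?thesis unfolding N'[OF vs] cov_def 1 using at_point_const_field[OF c vs] by simp
  qed
qed (simp add: nabla_outside)

end

lemma nabla_dir_sum:
  assumes \<phi>: "smooth_form_on M E k W0 \<phi>" and W0: "open W0" "x \<in> W0"
    and v: "\<And>i. i \<in> I \<Longrightarrow> v i \<in> tangent_space M x"
  shows "nabla k \<phi> x (\<Sum>i\<in>I. a i *\<^sub>R v i) vs = (\<Sum>i\<in>I. a i *\<^sub>R nabla k \<phi> x (v i) vs)"
proof (cases "vs \<in> tlists M k x")
  case vs: True
  obtain c where c: "c \<in> atlas M" "x \<in> fst c" using ex_chart by blast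
  let ?Y = "map (const_field c) vs" and ?W = "fst c \<inter> W0"
  have W: "open ?W" "x \<in> ?W" "?W \<subseteq> W0" using c chart_open[OF c(1)] W0 by auto
  have Y: "fields_on ?W ?Y"
    by (rule fields_on_subset[OF fields_on_const_field[OF c(1)]]) simp
  have len: "length ?Y = k" using vs by (simp add: tlists_def)
  have at: "at_point x ?Y = vs" by (rule at_point_const_field[OF c vs])
  have vT: "(\<Sum>i\<in>I. a i *\<^sub>R v i) \<in> tangent_space M x"
    using v by (intro subspace_sum subspace_scale subspace_tangent)
  have N: "nabla k \<phi> x u vs = cov k \<phi> x u ?Y" if "u \<in> tangent_space M x" for u
    using nabla_at[OF \<phi> W0 that W(1,2) len Y] at by simp
  have "\<phi> x (vs[l := D x (\<Sum>i\<in>I. a i *\<^sub>R v i) (?Y ! l)]) = (\<Sum>i\<in>I. a i *\<^sub>R \<phi> x (vs[l := D x (v i) (?Y ! l)]))"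
    if l: "l < k" for l
  proof -
    have f: "vector_field_on M ?W (?Y ! l)" using Y l len by (metis nth_mem)
    have "D x (\<Sum>i\<in>I. a i *\<^sub>R v i) (?Y ! l) = (\<Sum>i\<in>I. a i *\<^sub>R D x (v i) (?Y ! l))"
      by (rule tan.conn_dir_sum[OF W(1,2) f v])
    then show ?thesis using tan.conn_fibre[OF W(1,2) f v]
      by (simp add: alt_sum[OF form_alt[OF \<phi> W0(2)] vs l])
  qed
  moreover have "nab x (\<Sum>i\<in>I. a i *\<^sub>R v i) (eval_form \<phi> ?Y) = (\<Sum>i\<in>I. a i *\<^sub>R nab x (v i) (eval_form \<phi> ?Y))"
    by (rule conn_dir_sum[OF W(1,2) form_section[OF \<phi> W(1,3) len Y] v])
  moreover have "(\<Sum>i\<in>I. a i *\<^sub>R nabla k \<phi> x (v i) vs) = (\<Sum>i\<in>I. a i *\<^sub>R cov k \<phi> x (v i) ?Y)"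
    using N[OF v] by simp
  ultimately show ?thesis unfolding N[OF vT]
    unfolding cov_def at by (simp add: scaleR_diff_right sum_subtractf scaleR_sum_right sum.swap[of _ I])
qed (simp add: form_nabla_def)

lemma nabla_cong:
  assumes \<phi>: "smooth_form_on M E k W \<phi>" and W: "open W" "x \<in> W" and v: "v \<in> tangent_space M x"
    and eq: "\<And>y. y \<in> W \<Longrightarrow> \<psi> y = \<phi> y"
  shows "nabla k \<psi> x v = nabla k \<phi> x v"
proof
  fix vs
  have \<psi>: "smooth_form_on M E k W \<psi>" by (rule form_cong[OF \<phi>]) (simp add: eq)
  show "nabla k \<psi> x v vs = nabla k \<phi> x v vs"
  proof (cases "vs \<in> tlists M k x")
    case vs: True
    let ?Ys = "extend M x vs"
    obtain W' where W': "open W'" "x \<in> W'" "fields_on W' ?Ys"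
      using extend_works(2)[OF vs] by blast
    have len: "length ?Ys = k" using extend_works(1)[OF vs] vs by (metis (mono_tags, lifting) length_map mem_Collect_eq tlists_def)
    have o: "open (W \<inter> W')" "x \<in> W \<inter> W'" using W W' by auto
    have "nab x v (eval_form \<psi> ?Ys) = nab x v (eval_form \<phi> ?Ys)"
      by (rule conn_cong[OF o form_section[OF \<phi> o(1) _ len] v])
        (use fields_on_subset[OF W'(3)] eq in \<open>auto simp: eval_form_def\<close>)
    then show ?thesis by (simp add: form_nabla_def Let_def eq[OF W(2)])
  qed (simp add: form_nabla_def)
qed

lemma nabla_scale:
  assumes \<phi>: "smooth_form_on M E k W \<phi>" and W: "open W" "x \<in> W" and v: "v \<in> tangent_space M x"
    and f: "smooth_fun_on M W f" and vs: "vs \<in> tlists M k x"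
  shows "nabla k (\<lambda>y vs. f y *\<^sub>R \<phi> y vs) x v vs = v f *\<^sub>R \<phi> x vs + f x *\<^sub>R nabla k \<phi> x v vs"
proof -
  let ?Ys = "extend M x vs"
  obtain W' where W': "open W'" "x \<in> W'" "fields_on W' ?Ys"
    using extend_works(2)[OF vs] by blast
  have len: "length ?Ys = k" using extend_works(1)[OF vs] vs by (metis (mono_tags, lifting) length_map mem_Collect_eq tlists_def)
  have o: "open (W \<inter> W')" "x \<in> W \<inter> W'" using W W' by auto
  have "nab x v (\<lambda>y. f y *\<^sub>R eval_form \<phi> ?Ys y) = v f *\<^sub>R eval_form \<phi> ?Ys x + f x *\<^sub>R nab x v (eval_form \<phi> ?Ys)"
    by (rule conn_scale[OF o form_section[OF \<phi> o(1) _ len] v])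
      (use fields_on_subset[OF W'(3)] smooth_fun_on_subset[OF f] in auto)
  moreover have "eval_form (\<lambda>y vs. f y *\<^sub>R \<phi> y vs) ?Ys = (\<lambda>y. f y *\<^sub>R eval_form \<phi> ?Ys y)"
    by (simp add: eval_form_def[abs_def])
  moreover have "eval_form \<phi> ?Ys x = \<phi> x vs" using extend_works(1)[OF vs] by (simp add: eval_form_def)
  ultimately show ?thesis using vs
    by (simp add: form_nabla_def Let_def scaleR_sum_right scaleR_diff_right)
qed

text \<open>Leibniz rule for the interior product: slot 0 of the correction sum for degree
  \<open>Suc k\<close> accounts for the term with \<open>D x v X\<close>, and the remaining slots
  are those of the contracted form.\<close>

lemma nabla_Cons:
  assumes \<phi>: "smooth_form_on M E (Suc k) W \<phi>" and W: "open W" "x \<in> W" and v: "v \<in> tangent_space M x"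
    and X: "vector_field_on M W X" and vs: "vs \<in> tlists M k x"
  shows "nabla k (\<lambda>y vs. if vs \<in> tlists M k y then \<phi> y (X y # vs) else 0) x v vs =
    \<phi> x (D x v X # vs) + nabla (Suc k) \<phi> x v (X x # vs)"
proof -
  let ?\<psi> = "\<lambda>y vs. if vs \<in> tlists M k y then \<phi> y (X y # vs) else 0" and ?Ys = "extend M x vs"
  obtain W' where W': "open W'" "x \<in> W'" "fields_on W' ?Ys"
    using extend_works(2)[OF vs] by blast
  have at: "at_point x ?Ys = vs" by (rule extend_works(1)[OF vs])
  then have len: "length ?Ys = k" using vs by (metis (mono_tags, lifting) length_map mem_Collect_eq tlists_def)
  let ?W = "W \<inter> W'"
  have o: "open ?W" "x \<in> ?W" "?W \<subseteq> W" using W W' by auto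
  have Ys: "fields_on ?W ?Ys" using fields_on_subset[OF W'(3)] by simp
  have XYs: "fields_on ?W (X # ?Ys)" "length (X # ?Ys) = Suc k"
    using Ys tan.section_subset[OF X] len by auto
  have "nab x v (eval_form ?\<psi> ?Ys) = nab x v (eval_form \<phi> (X # ?Ys))"
    by (rule conn_cong[OF o(1,2) form_section[OF \<phi> o(1,3) XYs(2,1)] v])
      (use fields_on_tlists[OF Ys] len in \<open>auto simp: eval_form_def\<close>)
  moreover have "vs[i := D x v (?Ys ! i)] \<in> tlists M k x" if "i < k" for i
    by (intro tlists_update[OF vs] tan.conn_fibre[OF o(1,2) _ v, simplified]) (use Ys that len in auto)
  ultimately have "nabla k ?\<psi> x v vs = nab x v (eval_form \<phi> (X # ?Ys)) - (\<Sum>i<k. \<phi> x (X x # vs[i := D x v (?Ys ! i)]))"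
    using vs by (simp add: form_nabla_def Let_def)
  moreover have "nabla (Suc k) \<phi> x v (X x # vs) = cov (Suc k) \<phi> x v (X # ?Ys)"
    using nabla_at[OF \<phi> W v o(1,2) XYs(2,1)] at by simp
  ultimately show ?thesis unfolding cov_def by (simp add: at sum.lessThan_Suc_shift del: sum.lessThan_Suc)
qed

end

section \<open>The covariant exterior derivative\<close>

lemma omit_update: "omit i (xs[i := z]) = omit i xs"
  by (simp add: omit_def)

lemma omit_omit:
  assumes "p \<le> i" "Suc i < length xs"
  shows "omit i (omit p xs) = omit p (omit (Suc i) xs)"
  using assms by (intro nth_equalityI) (auto simp: length_omit nth_omit)

text \<open>With q = i + 1 the pairs p \<le> i < k become p < q \<le> k; this undoes the shift of
  positions behind an omitted entry.\<close>

lemma sum_triangle_shift: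
  "(\<Sum>p\<le>k. \<Sum>i\<in>{p..<k}. f p (Suc i)) = (\<Sum>q\<le>k. \<Sum>p<q. f p q)" for f :: "nat \<Rightarrow> nat \<Rightarrow> 'a::comm_monoid_add"
proof (induction k)
  case (Suc k)
  have "(\<Sum>p\<le>Suc k. \<Sum>i\<in>{p..<Suc k}. f p (Suc i)) = (\<Sum>p\<le>k. \<Sum>i\<in>{p..<Suc k}. f p (Suc i))"
    by simp
  also have "\<dots> = (\<Sum>p\<le>k. (\<Sum>i\<in>{p..<k}. f p (Suc i)) + f p (Suc k))"
    by (intro sum.cong refl) simp
  finally show ?case using Suc by (simp add: sum.distrib lessThan_Suc_atMost)
qed simp

context manifold_ctx
begin

text \<open>Directional derivatives of functions are a connection on the trivial line, so that
  real-valued forms inherit the theory of bundle-valued ones.\<close>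

lemma connection_flat: "connection M trivial_line (\<lambda>x v f. v f)"
  unfolding connection_def
proof (intro allI impI conjI ballI)
  fix W \<sigma> x v assume W: "open W \<and> smooth_section_on M trivial_line W \<sigma>" and x: "x \<in> W"
    and v: "v \<in> tangent_space M x"
  then have o: "open W" by simp
  then have s: "smooth_fun_on M W \<sigma>"
    using conjunct2[OF W] by (rule trivial_line_section_iff[THEN iffD1])
  show "v \<sigma> \<in> fibre trivial_line x" by (simp add: trivial_line_def)
  show "(a *\<^sub>R v + b *\<^sub>R w) \<sigma> = a *\<^sub>R v \<sigma> + b *\<^sub>R w \<sigma>" for w a b by simp
  show "v (\<lambda>y. \<sigma> y + \<tau> y) = v \<sigma> + v \<tau>" if "smooth_section_on M trivial_line W \<tau>" for \<tau>
    using that by (intro tangent_add[OF v o x s]) (simp add: trivial_line_section_iff[OF o])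
  show "v (\<lambda>y. f y *\<^sub>R \<sigma> y) = v f *\<^sub>R \<sigma> x + f x *\<^sub>R v \<sigma>" if "smooth_fun_on M W f" for f
    using tangent_mult[OF v o x that s] by simp
  show "v \<tau> = v \<sigma>" if "\<forall>y\<in>W. \<tau> y = \<sigma> y" for \<tau>
    by (rule tangent_cong[OF v o x s, symmetric]) (simp add: that)
next
  fix W \<sigma> X assume W: "open W \<and> smooth_section_on M trivial_line W \<sigma>" and X: "vector_field_on M W X"
  note iff = trivial_line_section_iff[OF conjunct1[OF W]]
  show "smooth_section_on M trivial_line W (\<lambda>x. X x \<sigma>)"
    unfolding iff by (rule smooth_fun_on_field[OF conjunct1[OF W] X iff[THEN iffD1, OF conjunct2[OF W]]])
qed

end

sublocale lc_ctx \<subseteq> real: form_ctx M g D trivial_line "\<lambda>x v f. v f"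
  by unfold_locales (rule connection_flat)

context lc_ctx
begin

text \<open>Torsion freeness writes each bracket of the Cartan formula as a difference of two
  covariant derivatives, and these are exactly the correction terms of the antisymmetrized covariant
  derivative.\<close>

lemma ext_deriv_eq:
  assumes \<omega>: "smooth_form_on M trivial_line k W \<omega>" and W: "open W" "x \<in> W"
    and vs: "vs \<in> tlists M (Suc k) x"
  shows "ext_deriv M k \<omega> x vs = (\<Sum>p\<le>k. (- 1) ^ p * real.nabla k \<omega> x (vs ! p) (omit p vs))"
proof -
  define Ys where "Ys = extend M x vs"
  obtain W' where W': "open W'" "x \<in> W'" "fields_on W' Ys"
    unfolding Ys_def using extend_works(2)[OF vs] by blast
  have at: "at_point x Ys = vs" unfolding Ys_def by (rule extend_works(1)[OF vs])
  have lvs: "length vs = Suc k" using vs by (simp add: tlists_def)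
  then have len: "length Ys = Suc k" using at by (metis length_map)
  define U where "U = W \<inter> W'"
  have U: "open U" "x \<in> U" "U \<subseteq> W" using W W' by (auto simp: U_def)
  have Ys: "fields_on U Ys" using fields_on_subset[OF W'(3)] by (simp add: U_def)
  have fld: "vector_field_on M U (Ys ! i)" if "i \<le> k" for i using Ys len that by simp
  have vT: "vs ! p \<in> tangent_space M x" if "p \<le> k" for p using tlists_nth[OF vs, of p] that by simp
  have DT: "D x (vs ! p) (Ys ! r) \<in> tangent_space M x" if "p \<le> k" "r \<le> k" for p r
    using tan.conn_fibre[OF U(1,2) fld vT] that by simp
  note alt = line.form_alt[OF \<omega> W(2)]
  \<comment> \<open>The covariant derivative of field r along vector p stands in front, and both
    positions are removed. The larger one goes first, so that the smaller one does not shift; min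
    and max give one formula for both orders.\<close>
  define A where "A p r = \<omega> x (D x (vs ! p) (Ys ! r) # omit (min p r) (omit (max p r) vs))" for p r
  have slot: "\<omega> x ((omit p vs)[i := D x (vs ! p) (omit p Ys ! i)]) =
      (- 1) ^ i * (if i < p then A p i else A p (Suc i))" if p: "p \<le> k" and i: "i < k" for p i
  proof -
    let ?Z = "D x (vs ! p) (omit p Ys ! i)"
    have nth: "omit p Ys ! i = Ys ! (if i < p then i else Suc i)" using nth_omit[of p Ys i] p i len by simp
    have Z: "?Z \<in> tangent_space M x" unfolding nth using DT[OF p] i p by simp
    have t: "(omit p vs)[i := ?Z] \<in> tlists M k x" by (intro tlists_update tlists_omit[OF vs p] Z)
    have "\<omega> x ((omit p vs)[i := ?Z]) =
      (- 1) ^ i *\<^sub>R \<omega> x ((omit p vs)[i := ?Z] ! i # omit i ((omit p vs)[i := ?Z]))"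
      using t i by (intro swap_odd_move_front[OF line.alt_swap_odd[OF alt]]) (simp_all add: tlists_def)
    also have "(omit p vs)[i := ?Z] ! i = ?Z" using i p lvs by (simp add: length_omit)
    also have "omit i ((omit p vs)[i := ?Z]) = omit i (omit p vs)" by (rule omit_update)
    finally show ?thesis
      using omit_omit[of p i vs] i p lvs unfolding A_def nth by (auto simp: min_def max_def)
  qed
  have nab: "real.nabla k \<omega> x (vs ! p) (omit p vs) =
      (vs ! p) (eval_form \<omega> (omit p Ys)) - (\<Sum>i<k. (- 1) ^ i * (if i < p then A p i else A p (Suc i)))"
    if p: "p \<le> k" for p
  proof -
    have "length (omit p Ys) = k" "fields_on U (omit p Ys)"
      using p len Ys set_omit[of p Ys] by (auto simp: length_omit)
    from real.nabla_at[OF \<omega> W vT[OF p] U(1,2) this]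
    show ?thesis unfolding real.cov_def map_omit at using slot[OF p] by simp
  qed
  have lie: "\<omega> x (lie_bracket M (Ys ! p) (Ys ! q) x # omit p (omit q vs)) = A p q - A q p"
    if pq: "p < q" "q \<le> k" for p q
  proof -
    let ?r = "omit p (omit q vs)"
    obtain k' where k': "k = Suc k'" using pq by (cases k) auto
    have r: "?r \<in> tlists M k' x"
      using tlists_omit[OF tlists_omit[OF vs pq(2), unfolded k']] pq k' by simp
    have at': "(Ys ! p) x = vs ! p" "(Ys ! q) x = vs ! q" using at pq len by (metis less_Suc_eq_le less_trans nth_map le_less_trans less_imp_le_nat)+
    have "lie_bracket M (Ys ! p) (Ys ! q) x = 1 *\<^sub>R D x (vs ! p) (Ys ! q) + (- 1) *\<^sub>R D x (vs ! q) (Ys ! p)"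
      using torsion_free[OF U(1,2) fld[of p] fld[of q]] pq at' by simp
    moreover have "\<omega> x ((0 # ?r)[0 := 1 *\<^sub>R D x (vs ! p) (Ys ! q) + (- 1) *\<^sub>R D x (vs ! q) (Ys ! p)]) =
      1 *\<^sub>R \<omega> x ((0 # ?r)[0 := D x (vs ! p) (Ys ! q)]) + (- 1) *\<^sub>R \<omega> x ((0 # ?r)[0 := D x (vs ! q) (Ys ! p)])"
      using tlists_Cons[OF subspace_0[OF subspace_tangent] r] pq k'
      by (intro line.alt_lin[OF alt] DT) auto
    ultimately show ?thesis using pq by (simp add: A_def min_def max_def)
  qed
  have inner: "(\<Sum>i<k. (- 1) ^ i * (if i < p then A p i else A p (Suc i))) =
      (\<Sum>i<p. (- 1) ^ i * A p i) + (\<Sum>i\<in>{p..<k}. (- 1) ^ i * A p (Suc i))" if "p \<le> k" for p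
  proof -
    have "(\<Sum>i<k. (- 1) ^ i * (if i < p then A p i else A p (Suc i))) =
      (\<Sum>i<p. (- 1) ^ i * (if i < p then A p i else A p (Suc i))) +
      (\<Sum>i\<in>{p..<k}. (- 1) ^ i * (if i < p then A p i else A p (Suc i)))"
      unfolding lessThan_atLeast0 by (rule sum.atLeastLessThan_concat[symmetric]) (use that in simp_all)
    then show ?thesis by simp
  qed
  have "(\<Sum>p\<le>k. (- 1) ^ p * (\<Sum>i<k. (- 1) ^ i * (if i < p then A p i else A p (Suc i)))) =
      (\<Sum>p\<le>k. (\<Sum>i<p. (- 1) ^ (p + i) * A p i)) + (\<Sum>p\<le>k. \<Sum>i\<in>{p..<k}. (- 1) ^ (p + i) * A p (Suc i))"
    by (simp add: inner distrib_left sum.distrib sum_distrib_left power_add mult.assoc)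
  \<comment> \<open>The shift from i to i + 1 costs a sign; because of it the two halves of the sum
    combine into the differences \<open>A p q - A q p\<close>.\<close>
  also have "(\<Sum>p\<le>k. \<Sum>i\<in>{p..<k}. (- 1) ^ (p + i) * A p (Suc i)) =
      (\<Sum>p\<le>k. \<Sum>i\<in>{p..<k}. - ((- 1) ^ (p + Suc i)) * A p (Suc i))" by simp
  also have "\<dots> = (\<Sum>q\<le>k. \<Sum>p<q. - ((- 1) ^ (p + q)) * A p q)"
    by (rule sum_triangle_shift[of "\<lambda>p q. - ((- 1) ^ (p + q)) * A p q"])
  finally have S: "(\<Sum>p\<le>k. (- 1) ^ p * (\<Sum>i<k. (- 1) ^ i * (if i < p then A p i else A p (Suc i)))) =
      - (\<Sum>q\<le>k. \<Sum>p<q. (- 1) ^ (p + q) * (A p q - A q p))"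
    by (simp add: sum.distrib[symmetric] sum_negf[symmetric] right_diff_distrib add.commute)
  have "ext_deriv M k \<omega> x vs = (\<Sum>p\<le>k. (- 1) ^ p * (vs ! p) (eval_form \<omega> (omit p Ys))) +
      (\<Sum>q\<le>k. \<Sum>p<q. (- 1) ^ (p + q) * (A p q - A q p))"
    using vs lie by (simp add: ext_deriv_def Let_def Ys_def[symmetric])
  also have "\<dots> = (\<Sum>p\<le>k. (- 1) ^ p * real.nabla k \<omega> x (vs ! p) (omit p vs))"
    using S by (simp add: nab right_diff_distrib sum_subtractf)
  finally show ?thesis .
qed

end

context form_ctx
begin

text \<open>The antisymmetrized covariant derivative. Unlike \<open>d_nabla\<close> it refers to no
  decomposition, and the two agree on smooth forms.\<close>

definition dN :: "nat \<Rightarrow> ('m \<Rightarrow> 'm tvec list \<Rightarrow> 'e) \<Rightarrow> 'm \<Rightarrow> 'm tvec list \<Rightarrow> 'e"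
  where "dN k \<phi> x vs = (if vs \<in> tlists M (Suc k) x
    then (\<Sum>p\<le>k. (- 1) ^ p *\<^sub>R nabla k \<phi> x (vs ! p) (omit p vs)) else 0)"

lemma nabla_decomposition:
  assumes W: "open W" "x \<in> W" and \<omega>: "\<And>j. j < N \<Longrightarrow> smooth_form_on M trivial_line k W (\<omega> j)"
    and s: "\<And>j. j < N \<Longrightarrow> smooth_section_on M E W (s j)"
    and eq: "\<And>y. y \<in> W \<Longrightarrow> \<phi> y = (\<lambda>vs. \<Sum>j<N. \<omega> j y vs *\<^sub>R s j y)"
    and v: "v \<in> tangent_space M x" and us: "us \<in> tlists M k x"
  shows "nabla k \<phi> x v us = (\<Sum>j<(N::nat). real.nabla k (\<omega> j) x v us *\<^sub>R s j x + \<omega> j x us *\<^sub>R nab x v (s j))"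
proof -
  define Ys where "Ys = extend M x us"
  obtain W' where W': "open W'" "x \<in> W'" "fields_on W' Ys"
    unfolding Ys_def using extend_works(2)[OF us] by blast
  have at: "at_point x Ys = us" unfolding Ys_def by (rule extend_works(1)[OF us])
  have "length us = k" using us by (simp add: tlists_def)
  then have len: "length Ys = k" using at by (metis length_map)
  define U where "U = W \<inter> W'"
  have U: "open U" "x \<in> U" "U \<subseteq> W" using W W' by (auto simp: U_def)
  have Ys: "fields_on U Ys" using fields_on_subset[OF W'(3)] by (simp add: U_def)
  have co: "smooth_fun_on M U (eval_form (\<omega> j) Ys)" if "j < N" for j
    using line.form_section[OF \<omega>[OF that] U(1,3) len Ys] by (simp add: trivial_line_section_iff[OF U(1)])
  have sU: "smooth_section_on M E U (s j)" if "j < N" for j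
    by (rule section_subset[OF s[OF that] U(3)])
  have sm: "smooth_section_on M E U (\<lambda>y. eval_form (\<omega> j) Ys y *\<^sub>R s j y)" if "j < N" for j
    by (rule section_scale[OF U(1) co[OF that] sU[OF that]])
  have "nab x v (eval_form \<phi> Ys) = nab x v (\<lambda>y. \<Sum>j<N. eval_form (\<omega> j) Ys y *\<^sub>R s j y)"
  proof (rule conn_cong[OF U(1,2) _ v])
    show "smooth_section_on M E U (\<lambda>y. \<Sum>j<N. eval_form (\<omega> j) Ys y *\<^sub>R s j y)"
      using sm by (intro section_sum U) auto
    fix y assume "y \<in> U"
    then have "\<phi> y = (\<lambda>vs. \<Sum>j<N. \<omega> j y vs *\<^sub>R s j y)" using U(3) by (intro eq) auto
    then show "eval_form \<phi> Ys y = (\<Sum>j<N. eval_form (\<omega> j) Ys y *\<^sub>R s j y)" by (simp add: eval_form_def)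
  qed
  also have "\<dots> = (\<Sum>j<N. nab x v (\<lambda>y. eval_form (\<omega> j) Ys y *\<^sub>R s j y))"
    by (rule conn_sum[OF U(1,2) v]) (simp add: sm)
  also have "\<dots> = (\<Sum>j<N. v (eval_form (\<omega> j) Ys) *\<^sub>R s j x + \<omega> j x us *\<^sub>R nab x v (s j))"
  proof (intro sum.cong refl)
    fix j assume "j \<in> {..<N}"
    then have j: "j < N" by simp
    show "nab x v (\<lambda>y. eval_form (\<omega> j) Ys y *\<^sub>R s j y) = v (eval_form (\<omega> j) Ys) *\<^sub>R s j x + \<omega> j x us *\<^sub>R nab x v (s j)"
      using conn_scale[OF U(1,2) sU[OF j] v co[OF j]] by (simp add: eval_form_def at)
  qed
  finally have 1: "nab x v (eval_form \<phi> Ys) = \<dots>" .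
  have 2: "\<phi> x = (\<lambda>vs. \<Sum>j<N. \<omega> j x vs *\<^sub>R s j x)" by (rule eq[OF W(2)])
  have "nabla k \<phi> x v us = nab x v (eval_form \<phi> Ys) - (\<Sum>i<k. \<phi> x (us[i := D x v (Ys ! i)]))"
    using us by (simp add: form_nabla_def Let_def Ys_def)
  also have "(\<Sum>i<k. \<phi> x (us[i := D x v (Ys ! i)])) = (\<Sum>j<N. (\<Sum>i<k. \<omega> j x (us[i := D x v (Ys ! i)])) *\<^sub>R s j x)"
    unfolding 2 by (simp add: scaleR_sum_left) (rule sum.swap)
  finally show ?thesis unfolding 1
    using us by (simp add: form_nabla_def Let_def Ys_def[symmetric] sum_subtractf[symmetric] algebra_simps)
qed

lemma dN_decomposition:
  assumes W: "open W" "x \<in> W" and \<omega>: "\<And>j. j < N \<Longrightarrow> smooth_form_on M trivial_line k W (\<omega> j)"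
    and s: "\<And>j. j < N \<Longrightarrow> smooth_section_on M E W (s j)"
    and eq: "\<And>y. y \<in> W \<Longrightarrow> \<phi> y = (\<lambda>vs. \<Sum>j<(N::nat). \<omega> j y vs *\<^sub>R s j y)"
  shows "(\<lambda>vs. \<Sum>j<N. ext_deriv M k (\<omega> j) x vs *\<^sub>R s j x +
            (- 1) ^ k *\<^sub>R wedge1 M k x (\<omega> j x) (\<lambda>v. nab x v (s j)) vs) = dN k \<phi> x"
proof
  fix vs
  show "(\<Sum>j<N. ext_deriv M k (\<omega> j) x vs *\<^sub>R s j x +
            (- 1) ^ k *\<^sub>R wedge1 M k x (\<omega> j x) (\<lambda>v. nab x v (s j)) vs) = dN k \<phi> x vs"
  proof (cases "vs \<in> tlists M (Suc k) x")
    case vs: True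
    have "ext_deriv M k (\<omega> j) x vs *\<^sub>R s j x + (- 1) ^ k *\<^sub>R wedge1 M k x (\<omega> j x) (\<lambda>v. nab x v (s j)) vs =
      (\<Sum>p\<le>k. (- 1) ^ p *\<^sub>R (real.nabla k (\<omega> j) x (vs ! p) (omit p vs) *\<^sub>R s j x +
         \<omega> j x (omit p vs) *\<^sub>R nab x (vs ! p) (s j)))" if j: "j < N" for j
    proof -
      \<comment> \<open>Converts the sign of \<open>wedge1\<close>, where the covector comes last,
        into the sign of \<open>dN\<close>, where it comes first.\<close>
      have "(- 1) ^ k * (- 1) ^ (k - p) = (- 1 :: real) ^ p" if "p \<le> k" for p
      proof -
        have "(- 1) ^ k * (- 1) ^ (k - p) = (- 1 :: real) ^ (k + (k - p))" by (simp add: power_add)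
        also have "k + (k - p) = p + 2 * (k - p)" using that by simp
        finally show ?thesis by (simp add: power_add)
      qed
      then have "(- 1) ^ k *\<^sub>R wedge1 M k x (\<omega> j x) (\<lambda>v. nab x v (s j)) vs =
          (\<Sum>p\<le>k. (- 1) ^ p *\<^sub>R (\<omega> j x (omit p vs) *\<^sub>R nab x (vs ! p) (s j)))"
        using vs by (simp add: wedge1_def scaleR_sum_right mult.assoc[symmetric])
      then show ?thesis unfolding ext_deriv_eq[OF \<omega>[OF j] W vs]
        by (simp add: scaleR_sum_left sum.distrib scaleR_right_distrib)
    qed
    then have "(\<Sum>j<N. ext_deriv M k (\<omega> j) x vs *\<^sub>R s j x +
            (- 1) ^ k *\<^sub>R wedge1 M k x (\<omega> j x) (\<lambda>v. nab x v (s j)) vs) =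
        (\<Sum>j<N. \<Sum>p\<le>k. (- 1) ^ p *\<^sub>R (real.nabla k (\<omega> j) x (vs ! p) (omit p vs) *\<^sub>R s j x +
         \<omega> j x (omit p vs) *\<^sub>R nab x (vs ! p) (s j)))" by simp
    also have "\<dots> = (\<Sum>p\<le>k. (- 1) ^ p *\<^sub>R (\<Sum>j<N. real.nabla k (\<omega> j) x (vs ! p) (omit p vs) *\<^sub>R s j x +
         \<omega> j x (omit p vs) *\<^sub>R nab x (vs ! p) (s j)))"
      by (subst sum.swap) (simp add: scaleR_sum_right)
    also have "\<dots> = (\<Sum>p\<le>k. (- 1) ^ p *\<^sub>R nabla k \<phi> x (vs ! p) (omit p vs))"
    proof (intro sum.cong refl)
      fix p assume "p \<in> {..k}"
      then have p: "p \<le> k" by simp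
      then have "vs ! p \<in> tangent_space M x" using tlists_nth[OF vs, of p] by simp
      from nabla_decomposition[where \<phi> = \<phi> and N = N and \<omega> = \<omega> and s = s, OF W \<omega> s eq this tlists_omit[OF vs p]]
      show "(- 1) ^ p *\<^sub>R (\<Sum>j<N. real.nabla k (\<omega> j) x (vs ! p) (omit p vs) *\<^sub>R s j x +
         \<omega> j x (omit p vs) *\<^sub>R nab x (vs ! p) (s j)) = (- 1) ^ p *\<^sub>R nabla k \<phi> x (vs ! p) (omit p vs)"
        by simp
    qed
    finally show ?thesis using vs by (simp add: dN_def)
  qed (simp add: dN_def ext_deriv_def wedge1_def)
qed

end

context bundle_ctx
begin

lemma frame_span:
  assumes Vs: "(V, s) \<in> frames E" "x \<in> V" and e: "e \<in> fibre E x"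
  shows "\<exists>a. e = (\<Sum>i<brank E. a i *\<^sub>R s i x)"
proof -
  have *: "inj_on (\<lambda>i. s i x) {..<brank E}" "span ((\<lambda>i. s i x) ` {..<brank E}) = fibre E x"
    using vector_bundle Vs unfolding vector_bundle_def by blast+
  have "e \<in> range (\<lambda>u. \<Sum>v\<in>(\<lambda>i. s i x) ` {..<brank E}. u v *\<^sub>R v)"
    using e *(2) span_finite[of "(\<lambda>i. s i x) ` {..<brank E}"] by simp
  then obtain u where "e = (\<Sum>v\<in>(\<lambda>i. s i x) ` {..<brank E}. u v *\<^sub>R v)" by blast
  then have "e = (\<Sum>i<brank E. u (s i x) *\<^sub>R s i x)" by (simp add: sum.reindex[OF *(1)])
  then show ?thesis by (rule exI[of _ "\<lambda>i. u (s i x)"])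
qed

text \<open>Components in a local frame give a decomposition, so the choice in
  \<open>d_nabla\<close> is made from a nonempty set.\<close>

lemma form_decomposition:
  assumes \<phi>: "smooth_form_on M E k W0 \<phi>" and W0: "open W0" "x \<in> W0"
  shows "\<exists>W (N::nat) \<omega> s. open W \<and> x \<in> W \<and>
    (\<forall>j<N. smooth_form_on M trivial_line k W (\<omega> j) \<and> smooth_section_on M E W (s j)) \<and>
    (\<forall>y\<in>W. \<phi> y = (\<lambda>vs. \<Sum>j<N. \<omega> j y vs *\<^sub>R s j y))"
proof -
  obtain V s where V: "(V, s) \<in> frames E" "x \<in> V" using ex_frame by blast
  \<comment> \<open>Frame coefficients chosen separately at each point; uniqueness in the frame
    makes them linear and identifies them with the smooth coefficients of a section.\<close>
  define co where "co y e = (SOME a. e = (\<Sum>i<brank E. a i *\<^sub>R s i y))" for y e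
  have co: "e = (\<Sum>i<brank E. co y e i *\<^sub>R s i y)" if "y \<in> V" "e \<in> fibre E y" for y e
    unfolding co_def by (rule someI_ex[OF frame_span[OF V(1) that]])
  have co_unique: "co y e i = a i" if "y \<in> V" "e = (\<Sum>i<brank E. a i *\<^sub>R s i y)" "i < brank E" for y e i a
  proof (rule frame_unique[OF V(1) that(1) _ that(3)])
    have "\<exists>a. e = (\<Sum>i<brank E. a i *\<^sub>R s i y)" using that(2) by blast
    from someI_ex[OF this] have "e = (\<Sum>i<brank E. co y e i *\<^sub>R s i y)" unfolding co_def .
    then show "(\<Sum>i<brank E. co y e i *\<^sub>R s i y) = (\<Sum>i<brank E. a i *\<^sub>R s i y)" using that(2) by simp
  qed
  have co_lin: "co y (a *\<^sub>R e + b *\<^sub>R e') i = a * co y e i + b * co y e' i"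
    if y: "y \<in> V" and e: "e \<in> fibre E y" "e' \<in> fibre E y" and i: "i < brank E" for y e e' a b i
  proof (rule co_unique[OF y _ i])
    have "a *\<^sub>R e + b *\<^sub>R e' = a *\<^sub>R (\<Sum>i<brank E. co y e i *\<^sub>R s i y) + b *\<^sub>R (\<Sum>i<brank E. co y e' i *\<^sub>R s i y)"
      using co[OF y e(1)] co[OF y e(2)] by simp
    then show "a *\<^sub>R e + b *\<^sub>R e' = (\<Sum>i<brank E. (a * co y e i + b * co y e' i) *\<^sub>R s i y)"
      by (simp add: scaleR_sum_right scaleR_left_distrib sum.distrib)
  qed
  define \<omega> where "\<omega> j y vs = (if vs \<in> tlists M k y then co y (\<phi> y vs) j else 0)" for j y vs
  let ?W = "V \<inter> W0"
  have "smooth_form_on M trivial_line k ?W (\<omega> j)" if j: "j < brank E" for j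
    unfolding smooth_form_on_def
  proof (intro conjI ballI allI impI)
    fix y assume y: "y \<in> ?W"
    then have yV: "y \<in> V" by simp
    from y have alt: "\<phi> y \<in> alt_forms M E k y" using form_alt[OF \<phi>] by simp
    show "\<omega> j y \<in> alt_forms M trivial_line k y"
    proof (rule line.alt_formsI)
      fix vs i v w a b
      assume vs: "vs \<in> tlists M k y" "i < k" "v \<in> tangent_space M y" "w \<in> tangent_space M y"
      have "a *\<^sub>R v + b *\<^sub>R w \<in> tangent_space M y"
        using vs by (intro subspace_add subspace_scale subspace_tangent)
      then show "\<omega> j y (vs[i := a *\<^sub>R v + b *\<^sub>R w]) = a *\<^sub>R \<omega> j y (vs[i := v]) + b *\<^sub>R \<omega> j y (vs[i := w])"
        using vs tlists_update[OF vs(1)] co_lin[OF yV alt_fibre[OF alt] alt_fibre[OF alt] j]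
        by (simp add: \<omega>_def alt_lin[OF alt])
    next
      fix vs i i' assume vs: "vs \<in> tlists M k y" "i < i'" "i' < k" "vs ! i = vs ! i'"
      have "co y 0 j = 0" by (rule co_unique[OF yV _ j, of _ "\<lambda>_. 0"]) simp
      then show "\<omega> j y vs = 0" using alt_repeat[OF alt vs] by (simp add: \<omega>_def)
    qed (simp_all add: \<omega>_def trivial_line_def)
  next
    fix U Ys assume *: "open U \<and> U \<subseteq> ?W \<and> length Ys = k \<and> fields_on U Ys"
    then have "smooth_section_on M E U (eval_form \<phi> Ys)" by (intro form_section[OF \<phi>]) auto
    from section_coeffs[OF this V(1)] obtain a where
      a: "\<forall>i<brank E. smooth_fun_on M (V \<inter> U) (a i)"
        "\<forall>y\<in>V \<inter> U. eval_form \<phi> Ys y = (\<Sum>i<brank E. a i y *\<^sub>R s i y)" by blast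
    have VU: "V \<inter> U = U" using * by auto
    have "smooth_fun_on M U (a j)" using a(1) j VU by auto
    then have "smooth_fun_on M U (eval_form (\<omega> j) Ys)"
    proof (rule smooth_fun_on_cong)
      show "open U" using * by simp
      fix y assume y: "y \<in> U"
      have t: "at_point y Ys \<in> tlists M k y" using fields_on_tlists[of Ys U y] * y by auto
      have "co y (eval_form \<phi> Ys y) j = a j y"
        by (rule co_unique[OF _ _ j, of y _ "\<lambda>i. a i y"]) (use y a(2) VU in auto)
      then show "a j y = eval_form (\<omega> j) Ys y" using t by (simp add: eval_form_def \<omega>_def)
    qed
    then show "smooth_section_on M trivial_line U (eval_form (\<omega> j) Ys)"
      using * by (simp add: trivial_line_section_iff)
  qed
  moreover have "smooth_section_on M E ?W (s j)" if "j < brank E" for j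
    by (rule section_subset[OF frame_section[OF V(1) that]]) simp
  moreover have "\<phi> y = (\<lambda>vs. \<Sum>j<brank E. \<omega> j y vs *\<^sub>R s j y)" if y: "y \<in> ?W" for y
  proof
    fix vs
    have alt: "\<phi> y \<in> alt_forms M E k y" using form_alt[OF \<phi>] y by simp
    show "\<phi> y vs = (\<Sum>j<brank E. \<omega> j y vs *\<^sub>R s j y)"
    proof (cases "vs \<in> tlists M k y")
      case True
      then show ?thesis using co[of y "\<phi> y vs"] alt_fibre[OF alt True] y by (simp add: \<omega>_def)
    qed (simp add: alt_outside[OF alt] \<omega>_def)
  qed
  moreover have "open ?W" "x \<in> ?W" using frame_open[OF V(1)] W0 V(2) by auto
  ultimately show ?thesis by (intro exI[of _ ?W] exI[of _ "brank E"] exI[of _ \<omega>] exI[of _ s]) simp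
qed

end

context form_ctx
begin

lemma d_nabla_eq_dN:
  assumes \<phi>: "smooth_form_on M E k W0 \<phi>" and W0: "open W0" "x \<in> W0"
  shows "d_nabla M E nab k \<phi> x = dN k \<phi> x"
  unfolding d_nabla_def
proof (rule some_equality)
  from form_decomposition[OF assms] obtain W N \<omega> s where *: "open W" "x \<in> W"
    "\<forall>j<N. smooth_form_on M trivial_line k W (\<omega> j) \<and> smooth_section_on M E W (s j)"
    "\<forall>y\<in>W. \<phi> y = (\<lambda>vs. \<Sum>j<(N::nat). \<omega> j y vs *\<^sub>R s j y)" by blast
  have eq: "dN k \<phi> x = (\<lambda>vs. \<Sum>j<N. ext_deriv M k (\<omega> j) x vs *\<^sub>R s j x +
            (- 1) ^ k *\<^sub>R wedge1 M k x (\<omega> j x) (\<lambda>v. nab x v (s j)) vs)"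
    by (rule dN_decomposition[OF *(1,2), symmetric]) (use * in simp_all)
  show "\<exists>W (N::nat) \<omega> s. open W \<and> x \<in> W \<and>
    (\<forall>j<N. smooth_form_on M trivial_line k W (\<omega> j) \<and> smooth_section_on M E W (s j)) \<and>
    (\<forall>y\<in>W. \<phi> y = (\<lambda>vs. \<Sum>j<N. \<omega> j y vs *\<^sub>R s j y)) \<and>
    dN k \<phi> x = (\<lambda>vs. \<Sum>j<N. ext_deriv M k (\<omega> j) x vs *\<^sub>R s j x +
            (- 1) ^ k *\<^sub>R wedge1 M k x (\<omega> j x) (\<lambda>v. nab x v (s j)) vs)"
    by (intro exI[of _ W] exI[of _ N] exI[of _ \<omega>] exI[of _ s] conjI * eq)
next
  fix \<alpha>
  assume "\<exists>W (N::nat) \<omega> s. open W \<and> x \<in> W \<and>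
    (\<forall>j<N. smooth_form_on M trivial_line k W (\<omega> j) \<and> smooth_section_on M E W (s j)) \<and>
    (\<forall>y\<in>W. \<phi> y = (\<lambda>vs. \<Sum>j<N. \<omega> j y vs *\<^sub>R s j y)) \<and>
    \<alpha> = (\<lambda>vs. \<Sum>j<N. ext_deriv M k (\<omega> j) x vs *\<^sub>R s j x +
            (- 1) ^ k *\<^sub>R wedge1 M k x (\<omega> j x) (\<lambda>v. nab x v (s j)) vs)"
  then obtain W N \<omega> s where *: "open W" "x \<in> W"
    "\<forall>j<N. smooth_form_on M trivial_line k W (\<omega> j) \<and> smooth_section_on M E W (s j)"
    "\<forall>y\<in>W. \<phi> y = (\<lambda>vs. \<Sum>j<(N::nat). \<omega> j y vs *\<^sub>R s j y)"
    "\<alpha> = (\<lambda>vs. \<Sum>j<N. ext_deriv M k (\<omega> j) x vs *\<^sub>R s j x +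
            (- 1) ^ k *\<^sub>R wedge1 M k x (\<omega> j x) (\<lambda>v. nab x v (s j)) vs)"
    by (elim exE conjE)
  show "\<alpha> = dN k \<phi> x" unfolding *(5)
    by (rule dN_decomposition[OF *(1,2)]) (use * in simp_all)
qed

end

section \<open>Bilinear forms and sums over multi-indices\<close>

text \<open>Bilinear on the whole type, so that the algebra carries no membership conditions. Only
  semidefinite, because a fibre metric is extended through a projection that may have a
  kernel.\<close>

locale psd_form =
  fixes H :: "'e::real_vector \<Rightarrow> 'e \<Rightarrow> real"
  assumes H_lin: "H (a *\<^sub>R u + b *\<^sub>R v) w = a * H u w + b * H v w"
    and H_sym: "H u v = H v u"
    and H_nonneg: "H u u \<ge> 0"
begin

lemma H_add: "H (u + v) w = H u w + H v w"
  using H_lin[of 1 u 1 v w] by simp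

lemma H_scale: "H (a *\<^sub>R u) w = a * H u w"
  using H_lin[of a u 0 u w] by simp

lemma H_zero [simp]: "H 0 w = 0" "H w 0 = 0"
  using H_scale[of 0 0 w] H_sym[of w 0] by simp_all

lemma H_minus: "H (- u) w = - H u w"
  using H_scale[of "-1" u w] by simp

lemma H_diff: "H (u - v) w = H u w - H v w"
  using H_lin[of 1 u "-1" v w] by simp

lemma H_sum: "H (\<Sum>i\<in>I. u i) w = (\<Sum>i\<in>I. H (u i) w)"
  by (induction I rule: infinite_finite_induct) (auto simp: H_add)

lemma H_add_right: "H w (u + v) = H w u + H w v"
  and H_scale_right: "H w (a *\<^sub>R u) = a * H w u"
  and H_minus_right: "H w (- u) = - H w u"
  and H_diff_right: "H w (u - v) = H w u - H w v"
  by (simp_all add: H_sym[of w] H_add H_scale H_minus H_diff)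

lemma H_sum_right: "H w (\<Sum>i\<in>I. u i) = (\<Sum>i\<in>I. H w (u i))"
  unfolding H_sym[of w] by (rule H_sum)

lemmas H_simps = H_add H_scale H_minus H_diff H_sum H_add_right H_scale_right H_minus_right H_diff_right H_sum_right

end

text \<open>All index lists, not just the increasing ones: sums then split off one index at a time,
  which suits induction on the degree. The price is a factor 1/k! in the inner product.\<close>

definition idx :: "nat \<Rightarrow> nat \<Rightarrow> nat list set"
  where "idx n k = {I. length I = k \<and> set I \<subseteq> {..<n}}"

lemma finite_idx: "finite (idx n k)"
  unfolding idx_def using finite_lists_length_eq[of "{..<n}" k] by (simp add: conj_commute)

lemma idx_0 [simp]: "idx n 0 = {[]}"
  by (auto simp: idx_def)

lemma sum_idx_Suc: "(\<Sum>I\<in>idx n (Suc k). F I) = (\<Sum>i<n. \<Sum>J\<in>idx n k. F (i # J))"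
proof -
  have "(\<Sum>I\<in>idx n (Suc k). F I) = (\<Sum>(i, J)\<in>{..<n} \<times> idx n k. F (i # J))"
    by (rule sum.reindex_bij_witness[of _ "\<lambda>(i, J). i # J" "\<lambda>I. (hd I, tl I)"])
      (auto simp: idx_def length_Suc_conv)
  then show ?thesis by (simp add: sum.cartesian_product)
qed

lemma idx_update: "I \<in> idx n k \<Longrightarrow> m < n \<Longrightarrow> I[p := m] \<in> idx n k"
  using set_update_subset_insert[of I p m] by (auto simp: idx_def)

lemma idx_nth: "I \<in> idx n k \<Longrightarrow> p < k \<Longrightarrow> I ! p < n"
  by (auto simp: idx_def subset_iff)

lemma idx_update_nth: "I \<in> idx n k \<Longrightarrow> p < k \<Longrightarrow> I[p := m] ! p = m"
  by (simp add: idx_def)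

lemma mset_omit: "p < length ys \<Longrightarrow> mset (omit p ys) = mset ys - {#ys ! p#}"
proof -
  assume p: "p < length ys"
  have "mset ys = mset (take p ys @ ys ! p # drop (Suc p) ys)" using id_take_nth_drop[OF p] by simp
  then show ?thesis by (simp add: omit_def)
qed

context psd_form
begin

text \<open>Moving the matching entry of ys to the front costs the same sign in a and in b, and the
  product of the two signs is 1. The tails are then compared by induction with that entry held
  fixed.\<close>

lemma swap_odd_perm:
  "swap_odd S k a \<Longrightarrow> swap_odd S k b \<Longrightarrow> mset xs = mset ys \<Longrightarrow> set xs \<subseteq> S \<Longrightarrow> length xs = k \<Longrightarrow>
    H (a xs) (b xs) = H (a ys) (b ys)"
proof (induction xs arbitrary: ys k a b)
  case (Cons x xs)
  have len: "length ys = k" using Cons.prems(3,5) by (metis size_mset)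
  have S: "set ys \<subseteq> S" using Cons.prems(3,4) by (metis set_mset_mset)
  have "x \<in> set ys" using Cons.prems(3) by (metis list.set_intros(1) set_mset_mset)
  then obtain p where p: "p < k" "ys ! p = x" using len by (auto simp: in_set_conv_nth)
  obtain k' where k': "k = Suc k'" "length xs = k'" using Cons.prems(5) by auto
  have x: "x \<in> S" using Cons.prems(4) by simp
  have "H (a ys) (b ys) = (- 1) ^ p * ((- 1) ^ p * H (a (x # omit p ys)) (b (x # omit p ys)))"
    using swap_odd_move_front[OF Cons.prems(1) len S p(1)] swap_odd_move_front[OF Cons.prems(2) len S p(1)] p(2)
    by (simp add: H_scale H_scale_right)
  also have "\<dots> = H (a (x # omit p ys)) (b (x # omit p ys))"
    by (simp add: mult.assoc[symmetric] power_add[symmetric])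
  also have "\<dots> = H (a (x # xs)) (b (x # xs))"
  proof (rule Cons.IH[of k' "\<lambda>zs. a (x # zs)" "\<lambda>zs. b (x # zs)", symmetric])
    show "mset xs = mset (omit p ys)" using mset_omit[of p ys] p len Cons.prems(3)[symmetric] by simp
  qed (use Cons.prems k' x swap_odd_Cons in auto)
  finally show ?case by simp
qed simp

text \<open>Lists with a repeated index contribute nothing, and the k! orderings of a k-element set
  contribute equally.\<close>

lemma sum_idx_sorted:
  assumes ab: "swap_odd {..<n} k a" "swap_odd {..<n} k b"
    and rep: "\<And>I. I \<in> idx n k \<Longrightarrow> \<not> distinct I \<Longrightarrow> a I = 0"
  shows "(\<Sum>I\<in>idx n k. H (a I) (b I)) =
    fact k * (\<Sum>I | length I = k \<and> sorted_wrt (<) I \<and> set I \<subseteq> {..<n}. H (a I) (b I))"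
proof -
  let ?F = "\<lambda>I. H (a I) (b I)"
  let ?\<A> = "{A. A \<subseteq> {..<n} \<and> card A = k}"
  have fin: "finite A" if "A \<in> ?\<A>" for A using that finite_subset by blast
  have "(\<Sum>I\<in>idx n k. ?F I) = (\<Sum>I\<in>(\<Union>A\<in>?\<A>. permutations_of_set A). ?F I)"
  proof (rule sum.mono_neutral_right[OF finite_idx])
    show "(\<Union>A\<in>?\<A>. permutations_of_set A) \<subseteq> idx n k"
      by (auto simp: permutations_of_set_def idx_def distinct_card)
    show "\<forall>I\<in>idx n k - (\<Union>A\<in>?\<A>. permutations_of_set A). ?F I = 0"
    proof
      fix I assume "I \<in> idx n k - (\<Union>A\<in>?\<A>. permutations_of_set A)"
      moreover then have "\<not> distinct I" by (auto simp: permutations_of_set_def idx_def distinct_card)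
      ultimately show "?F I = 0" using rep[of I] by simp
    qed
  qed
  also have "\<dots> = (\<Sum>A\<in>?\<A>. \<Sum>I\<in>permutations_of_set A. ?F I)"
  proof (rule sum.UNION_disjoint)
    show "\<forall>A\<in>?\<A>. \<forall>B\<in>?\<A>. A \<noteq> B \<longrightarrow> permutations_of_set A \<inter> permutations_of_set B = {}"
      by (auto simp: permutations_of_set_def)
  qed auto
  also have "\<dots> = (\<Sum>A\<in>?\<A>. fact k * ?F (sorted_list_of_set A))"
  proof (intro sum.cong refl)
    fix A assume A: "A \<in> ?\<A>"
    have "?F I = ?F (sorted_list_of_set A)" if I: "I \<in> permutations_of_set A" for I
    proof (rule swap_odd_perm[OF ab])
      show "mset I = mset (sorted_list_of_set A)"
        using I fin[OF A] by (intro set_eq_iff_mset_eq_distinct[THEN iffD1]) (auto simp: permutations_of_set_def)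
    qed (use I A in \<open>auto simp: permutations_of_set_def distinct_card\<close>)
    then have "(\<Sum>I\<in>permutations_of_set A. ?F I) = (\<Sum>I\<in>permutations_of_set A. ?F (sorted_list_of_set A))"
      by (intro sum.cong refl)
    then show "(\<Sum>I\<in>permutations_of_set A. ?F I) = fact k * ?F (sorted_list_of_set A)"
      using A fin[OF A] by simp
  qed
  also have "\<dots> = fact k * (\<Sum>A\<in>?\<A>. ?F (sorted_list_of_set A))" by (simp add: sum_distrib_left)
  also have "(\<Sum>A\<in>?\<A>. ?F (sorted_list_of_set A)) =
      (\<Sum>I | length I = k \<and> sorted_wrt (<) I \<and> set I \<subseteq> {..<n}. ?F I)"
  proof (rule sum.reindex_bij_witness[of _ set sorted_list_of_set])
    fix A assume A: "A \<in> ?\<A>"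
    have l: "set (sorted_list_of_set A) = A" using fin[OF A] by simp
    show "set (sorted_list_of_set A) = A" by (rule l)
    show "sorted_list_of_set A \<in> {I. length I = k \<and> sorted_wrt (<) I \<and> set I \<subseteq> {..<n}}"
      using A l by simp
  next
    fix I assume "I \<in> {I. length I = k \<and> sorted_wrt (<) I \<and> set I \<subseteq> {..<n}}"
    then have I: "length I = k" "sorted I" "distinct I" "set I \<subseteq> {..<n}" by (auto simp: strict_sorted_iff)
    show "sorted_list_of_set (set I) = I"
      by (rule sorted_list_of_set.idem_if_sorted_distinct[OF I(2,3)])
    show "set I \<in> ?\<A>" using I by (simp add: distinct_card)
  qed simp
  finally show ?thesis .
qed

text \<open>Infinitesimal orthogonal invariance: a skew matrix acting on the indices as a derivation
  preserves the inner product. In \<open>finner_metric\<close> this removes the connection matrix of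
  an orthonormal frame.\<close>

lemma sum_idx_antisym_cancel:
  assumes \<omega>: "\<And>i j. i < n \<Longrightarrow> j < n \<Longrightarrow> \<omega> i j = - \<omega> j i"
  shows "(\<Sum>I\<in>idx n k. (\<Sum>p<k. \<Sum>m<n. \<omega> (I ! p) m * H (a (I[p := m])) (b I)) +
     (\<Sum>p<k. \<Sum>m<n. \<omega> (I ! p) m * H (a I) (b (I[p := m])))) = (0::real)"
proof -
  have "(\<Sum>I\<in>idx n k. \<Sum>m<n. \<omega> (I ! p) m * H (a I) (b (I[p := m]))) =
      - (\<Sum>I\<in>idx n k. \<Sum>m<n. \<omega> (I ! p) m * H (a (I[p := m])) (b I))" if p: "p < k" for p
  proof -
    \<comment> \<open>The involution that exchanges m with the p-th entry of I turns one sum into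
      the other with \<omega> transposed.\<close>
    have "(\<Sum>(I, m)\<in>idx n k \<times> {..<n}. \<omega> (I ! p) m * H (a I) (b (I[p := m]))) =
        (\<Sum>(I, m)\<in>idx n k \<times> {..<n}. \<omega> m (I ! p) * H (a (I[p := m])) (b I))"
      by (rule sum.reindex_bij_witness[of _ "\<lambda>(I, m). (I[p := m], I ! p)" "\<lambda>(I, m). (I[p := m], I ! p)"])
        (use p in \<open>auto simp: idx_nth idx_update idx_update_nth\<close>)
    also have "\<dots> = (\<Sum>(I, m)\<in>idx n k \<times> {..<n}. - (\<omega> (I ! p) m * H (a (I[p := m])) (b I)))"
    proof (intro sum.cong refl)
      fix Im assume "Im \<in> idx n k \<times> {..<n}"
      then obtain I m where Im: "Im = (I, m)" "I \<in> idx n k" "m < n" by auto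
      have "\<omega> m (I ! p) = - \<omega> (I ! p) m" by (rule \<omega>[OF Im(3) idx_nth[OF Im(2) p]])
      then show "(case Im of (I, m) \<Rightarrow> \<omega> m (I ! p) * H (a (I[p := m])) (b I)) =
          (case Im of (I, m) \<Rightarrow> - (\<omega> (I ! p) m * H (a (I[p := m])) (b I)))" by (simp add: Im(1))
    qed
    finally show ?thesis by (simp add: sum.cartesian_product sum_negf split_beta)
  qed
  then have "(\<Sum>p<k. \<Sum>I\<in>idx n k. \<Sum>m<n. \<omega> (I ! p) m * H (a I) (b (I[p := m]))) =
      - (\<Sum>p<k. \<Sum>I\<in>idx n k. \<Sum>m<n. \<omega> (I ! p) m * H (a (I[p := m])) (b I))"
    by (simp add: sum_negf)
  then show ?thesis
    by (simp add: sum.distrib sum.swap[of _ _ "idx n k"])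
qed

end

section \<open>Metrics and orthonormal frames\<close>

locale metric_bundle_ctx = bundle_ctx M E
  for M :: "'m::{t2_space,second_countable_topology} manifold"
    and E :: "('m, 'e::real_vector) vbundle" +
  fixes h :: "'m \<Rightarrow> 'e \<Rightarrow> 'e \<Rightarrow> real"
  assumes fibre_metric: "fibre_metric M E h"
begin

lemma h_lin:
  "u \<in> fibre E x \<Longrightarrow> v \<in> fibre E x \<Longrightarrow> w \<in> fibre E x \<Longrightarrow>
    h x (a *\<^sub>R u + b *\<^sub>R v) w = a * h x u w + b * h x v w"
  using fibre_metric unfolding fibre_metric_def by blast

lemma h_sym: "u \<in> fibre E x \<Longrightarrow> v \<in> fibre E x \<Longrightarrow> h x u v = h x v u"
  using fibre_metric unfolding fibre_metric_def by blast

lemma h_pos: "u \<in> fibre E x \<Longrightarrow> u \<noteq> 0 \<Longrightarrow> h x u u > 0"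
  using fibre_metric unfolding fibre_metric_def by blast

lemma h_smooth:
  "open W \<Longrightarrow> smooth_section_on M E W \<sigma> \<Longrightarrow> smooth_section_on M E W \<tau> \<Longrightarrow>
    smooth_fun_on M W (\<lambda>x. h x (\<sigma> x) (\<tau> x))"
  using fibre_metric unfolding fibre_metric_def by blast

text \<open>The metric on a fibre is only bilinear there; composing with a linear projection onto the
  fibre extends it to the whole type.\<close>

definition htot :: "'m \<Rightarrow> 'e \<Rightarrow> 'e \<Rightarrow> real"
  where "htot x = (SOME H. psd_form H \<and> (\<forall>u\<in>fibre E x. \<forall>v\<in>fibre E x. H u v = h x u v))"

lemma htot: "psd_form (htot x)" "u \<in> fibre E x \<Longrightarrow> v \<in> fibre E x \<Longrightarrow> htot x u v = h x u v"
proof -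
  obtain \<pi> where \<pi>: "range \<pi> \<subseteq> fibre E x" "linear \<pi>" "\<forall>v\<in>fibre E x. \<pi> v = v"
    using linear_exists_left_inverse_on[OF linear_id subspace_fibre[of x]] by auto
  have r: "\<pi> u \<in> fibre E x" for u using \<pi>(1) by auto
  have "psd_form (\<lambda>u v. h x (\<pi> u) (\<pi> v))"
  proof
    show "h x (\<pi> (a *\<^sub>R u + b *\<^sub>R v)) (\<pi> w) = a * h x (\<pi> u) (\<pi> w) + b * h x (\<pi> v) (\<pi> w)" for a u b v w
      by (simp add: linear_add[OF \<pi>(2)] linear_scale[OF \<pi>(2)] h_lin[OF r r r])
    show "h x (\<pi> u) (\<pi> u) \<ge> 0" for u
      using h_pos[OF r[of u]] h_lin[OF r[of u] r[of u] r[of u], of 0 0] by (cases "\<pi> u = 0") (auto intro: less_imp_le)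
  qed (rule h_sym[OF r r])
  then have "\<exists>H. psd_form H \<and> (\<forall>u\<in>fibre E x. \<forall>v\<in>fibre E x. H u v = h x u v)"
    using \<pi>(3) by (intro exI[of _ "\<lambda>u v. h x (\<pi> u) (\<pi> v)"]) simp
  from someI_ex[OF this] show "psd_form (htot x)"
    "u \<in> fibre E x \<Longrightarrow> v \<in> fibre E x \<Longrightarrow> htot x u v = h x u v"
    unfolding htot_def[symmetric] by blast+
qed

end

locale metric_conn_ctx = metric_bundle_ctx M E h + conn_ctx M E nab
  for M :: "'m::{t2_space,second_countable_topology} manifold"
    and E :: "('m, 'e::real_vector) vbundle" and h :: "'m \<Rightarrow> 'e \<Rightarrow> 'e \<Rightarrow> real"
    and nab :: "('m, 'e) conn" +
  assumes metric_connection: "metric_connection M E h nab"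
begin

lemma conn_metric:
  "open W \<Longrightarrow> x \<in> W \<Longrightarrow> smooth_section_on M E W \<sigma> \<Longrightarrow> smooth_section_on M E W \<tau> \<Longrightarrow>
    v \<in> tangent_space M x \<Longrightarrow>
    v (\<lambda>y. h y (\<sigma> y) (\<tau> y)) = h x (nab x v \<sigma>) (\<tau> x) + h x (\<sigma> x) (nab x v \<tau>)"
  using metric_connection unfolding metric_connection_def by blast

end

sublocale lc_ctx \<subseteq> tan: metric_conn_ctx M "tangent_bundle M" g D
  by unfold_locales
    (use metric levi_civita in \<open>simp_all add: riemannian_metric_def levi_civita_def\<close>)

context lc_ctx
begin

lemma g_lin:
  "u \<in> tangent_space M x \<Longrightarrow> v \<in> tangent_space M x \<Longrightarrow> w \<in> tangent_space M x \<Longrightarrow>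
    g x (a *\<^sub>R u + b *\<^sub>R v) w = a * g x u w + b * g x v w"
  by (rule tan.h_lin) simp_all

lemma g_sym: "u \<in> tangent_space M x \<Longrightarrow> v \<in> tangent_space M x \<Longrightarrow> g x u v = g x v u"
  by (rule tan.h_sym) simp_all

lemma g_scale:
  "u \<in> tangent_space M x \<Longrightarrow> w \<in> tangent_space M x \<Longrightarrow> g x (a *\<^sub>R u) w = a * g x u w"
  using g_lin[of u x u w a 0] by simp

lemma g_diff:
  "u \<in> tangent_space M x \<Longrightarrow> v \<in> tangent_space M x \<Longrightarrow> w \<in> tangent_space M x \<Longrightarrow>
    g x (u - v) w = g x u w - g x v w"
  using g_lin[of u x v w 1 "-1"] by simp

lemma g_sum:
  assumes "\<And>i. i \<in> I \<Longrightarrow> u i \<in> tangent_space M x" and w: "w \<in> tangent_space M x"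
  shows "g x (\<Sum>i\<in>I. a i *\<^sub>R u i) w = (\<Sum>i\<in>I. a i * g x (u i) w)"
proof -
  interpret psd_form "tan.htot x" by (rule tan.htot(1))
  have "(\<Sum>i\<in>I. a i *\<^sub>R u i) \<in> tangent_space M x"
    using assms by (intro subspace_sum subspace_scale subspace_tangent)
  then have "g x (\<Sum>i\<in>I. a i *\<^sub>R u i) w = tan.htot x (\<Sum>i\<in>I. a i *\<^sub>R u i) w"
    using w by (intro tan.htot(2)[symmetric]) simp_all
  also have "\<dots> = (\<Sum>i\<in>I. a i * tan.htot x (u i) w)" by (simp only: H_sum H_scale)
  also have "\<dots> = (\<Sum>i\<in>I. a i * g x (u i) w)"
    using assms by (intro sum.cong refl) (simp add: tan.htot(2))
  finally show ?thesis .
qed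

definition onbasis :: "'m \<Rightarrow> (nat \<Rightarrow> 'm tvec) \<Rightarrow> bool"
  where "onbasis x e \<longleftrightarrow> (\<forall>i<n. e i \<in> tangent_space M x) \<and>
    (\<forall>i<n. \<forall>j<n. g x (e i) (e j) = (if i = j then 1 else 0))"

definition onframe :: "'m set \<Rightarrow> (nat \<Rightarrow> 'm \<Rightarrow> 'm tvec) \<Rightarrow> bool"
  where "onframe W e \<longleftrightarrow> open W \<and> (\<forall>i<n. vector_field_on M W (e i)) \<and> (\<forall>y\<in>W. onbasis y (\<lambda>i. e i y))"

text \<open>Gram--Schmidt; the triangularity of the frame shows that no step produces a zero vector.\<close>

lemma gram_schmidt:
  assumes c: "c \<in> atlas M"
  shows "m \<le> n \<Longrightarrow> \<exists>e. (\<forall>i<m. vector_field_on M (fst c) (e i)) \<and>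
    (\<forall>y\<in>fst c. \<forall>i<m. \<forall>j<m. g y (e i y) (e j y) = (if i = j then 1 else 0)) \<and>
    (\<forall>y\<in>fst c. \<forall>i<m. \<forall>l<n. i < l \<longrightarrow> e i y (\<lambda>z. snd c z l) = 0)"
proof (induction m)
  case (Suc m)
  then have m: "m < n" by simp
  from Suc.IH[OF less_imp_le[OF m]] obtain e where e: "\<forall>i<m. vector_field_on M (fst c) (e i)"
    "\<forall>y\<in>fst c. \<forall>i<m. \<forall>j<m. g y (e i y) (e j y) = (if i = j then 1 else 0)"
    "\<forall>y\<in>fst c. \<forall>i<m. \<forall>l<n. i < l \<longrightarrow> e i y (\<lambda>z. snd c z l) = 0" by (elim exE conjE)
  note U = chart_open[OF c]
  let ?p = "coord_vec M c m"
  define S where "S y = (\<Sum>i<m. g y (?p y) (e i y) *\<^sub>R e i y)" for y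
  define R where "R y = ?p y - S y" for y
  note pf = coord_vec_field[OF c m]
  have Sf: "vector_field_on M (fst c) S"
    unfolding S_def using e(1) by (intro tan.section_sum tan.section_scale tan.h_smooth U pf) auto
  have Rf: "vector_field_on M (fst c) R"
    unfolding R_def by (intro tan.section_diff U pf Sf)
  have eT: "e i y \<in> tangent_space M y" if "i < m" "y \<in> fst c" for i y
    using field_tangent[of "fst c" "e i" y] e(1) that by simp
  have RT: "R y \<in> tangent_space M y" if "y \<in> fst c" for y by (rule field_tangent[OF Rf that])
  have ST: "S y \<in> tangent_space M y" if "y \<in> fst c" for y by (rule field_tangent[OF Sf that])
  have pT: "?p y \<in> tangent_space M y" if "y \<in> fst c" for y by (rule field_tangent[OF pf that])
  have Rl: "R y (\<lambda>z. snd c z l) = (if l = m then 1 else 0)" if y: "y \<in> fst c" and l: "m \<le> l" "l < n" for y l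
    using coord_vec_coord[OF c y m, of l] e(3) y l by (auto simp: R_def S_def sum_fun_apply)
  have R0: "R y \<noteq> 0" if y: "y \<in> fst c" for y
    using Rl[OF y order_refl m] by auto
  have pos: "g y (R y) (R y) > 0" if y: "y \<in> fst c" for y
    using tan.h_pos[of "R y" y] RT[OF y] R0[OF y] by simp
  have orth: "g y (R y) (e j y) = 0" if y: "y \<in> fst c" and j: "j < m" for y j
  proof -
    have "g y (S y) (e j y) = (\<Sum>i<m. g y (?p y) (e i y) * g y (e i y) (e j y))"
      unfolding S_def using eT y j by (intro g_sum) auto
    also have "\<dots> = (\<Sum>i<m. if i = j then g y (?p y) (e j y) else 0)"
      using e(2) y j by (intro sum.cong refl) auto
    also have "\<dots> = g y (?p y) (e j y)" using j by simp
    finally show ?thesis unfolding R_def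
      using g_diff[OF pT[OF y] ST[OF y] eT[OF j y]] by simp
  qed
  \<comment> \<open>The reciprocal norm is written as a power, because smoothness is available in
    that form.\<close>
  define N where "N y = g y (R y) (R y) powr (- 1 / 2)" for y
  have Ns: "smooth_fun_on M (fst c) N"
    unfolding N_def by (intro smooth_fun_on_powr U tan.h_smooth Rf pos)
  define F where "F y = N y *\<^sub>R R y" for y
  have Ff: "vector_field_on M (fst c) F"
    unfolding F_def by (intro tan.section_scale U Ns Rf)
  have FT: "F y \<in> tangent_space M y" if "y \<in> fst c" for y by (rule field_tangent[OF Ff that])
  have FF: "g y (F y) (F y) = 1" if y: "y \<in> fst c" for y
  proof -
    have "g y (F y) (F y) = N y * g y (R y) (F y)"
      unfolding F_def using RT[OF y] FT[OF y] by (intro g_scale) (simp_all add: F_def)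
    also have "g y (R y) (F y) = N y * g y (R y) (R y)"
      using g_sym[OF RT[OF y] FT[OF y]] g_scale[OF RT[OF y] RT[OF y], of "N y"] by (simp add: F_def)
    finally have "g y (F y) (F y) = (N y * N y) * g y (R y) (R y)" by simp
    also have "N y * N y = g y (R y) (R y) powr (- 1)"
      unfolding N_def by (simp add: powr_add[symmetric])
    finally show ?thesis using pos[OF y] by (simp add: powr_minus)
  qed
  have Fe: "g y (F y) (e j y) = 0" "g y (e j y) (F y) = 0" if y: "y \<in> fst c" and j: "j < m" for y j
  proof -
    show "g y (F y) (e j y) = 0"
      using g_scale[OF RT[OF y] eT[OF j y], of "N y"] orth[OF y j] by (simp add: F_def)
    then show "g y (e j y) (F y) = 0" using g_sym[OF FT[OF y] eT[OF j y]] by simp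
  qed
  show ?case
  proof (intro exI[of _ "e(m := F)"] conjI allI impI ballI)
    show "vector_field_on M (fst c) ((e(m := F)) i)" if "i < Suc m" for i
      using e(1) Ff that by (auto simp: less_Suc_eq)
    show "g y ((e(m := F)) i y) ((e(m := F)) j y) = (if i = j then 1 else 0)"
      if "y \<in> fst c" "i < Suc m" "j < Suc m" for y i j
      using e(2) FF[OF that(1)] Fe[OF that(1)] that by (auto simp: less_Suc_eq)
    show "(e(m := F)) i y (\<lambda>z. snd c z l) = 0" if "y \<in> fst c" "i < Suc m" "l < n" "i < l" for y i l
      using e(3) Rl[OF that(1), of l] that by (auto simp: less_Suc_eq F_def)
  qed
qed simp

lemma ex_onframe: "c \<in> atlas M \<Longrightarrow> \<exists>e. onframe (fst c) e"
proof -
  assume c: "c \<in> atlas M"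
  obtain e where e: "\<forall>i<n. vector_field_on M (fst c) (e i)"
    "\<forall>y\<in>fst c. \<forall>i<n. \<forall>j<n. g y (e i y) (e j y) = (if i = j then 1 else 0)"
    using gram_schmidt[OF c order_refl] by (elim exE conjE)
  then have "onframe (fst c) e"
    unfolding onframe_def onbasis_def using chart_open[OF c] field_tangent[of "fst c"] by simp
  then show ?thesis by (rule exI[of _ e])
qed

lemma onbasis_onb: "onbasis x (onb M g x)"
proof -
  obtain c where c: "c \<in> atlas M" "x \<in> fst c" using ex_chart by blast
  obtain e where "onframe (fst c) e" using ex_onframe[OF c(1)] by blast
  then have "onbasis x (\<lambda>i. e i x)" using c(2) by (simp add: onframe_def)
  then have "\<exists>e. onbasis x e" by blast
  from someI_ex[OF this] show ?thesis unfolding onbasis_def onb_def .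
qed

lemma onbasis_tangent: "onbasis x e \<Longrightarrow> i < n \<Longrightarrow> e i \<in> tangent_space M x"
  by (simp add: onbasis_def)

lemma onbasis_coeff:
  assumes e: "onbasis x e" and j: "j < n"
  shows "g x (\<Sum>i<n. a i *\<^sub>R e i) (e j) = a j"
proof -
  have "g x (\<Sum>i<n. a i *\<^sub>R e i) (e j) = (\<Sum>i<n. a i * g x (e i) (e j))"
    using e j by (intro g_sum) (auto simp: onbasis_def)
  also have "\<dots> = (\<Sum>i<n. if i = j then a j else 0)"
    using e j by (intro sum.cong refl) (auto simp: onbasis_def)
  finally show ?thesis using j by simp
qed

text \<open>Dimension count: orthonormal vectors are independent, and a vector outside their span
  would make n + 1 independent vectors inside the span of n coordinate vectors.\<close>

lemma onbasis_expand:
  assumes e: "onbasis x e" and v: "v \<in> tangent_space M x"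
  shows "v = (\<Sum>i<n. g x v (e i) *\<^sub>R e i)"
proof -
  obtain c where c: "c \<in> atlas M" "x \<in> fst c" using ex_chart by blast
  have inj: "inj_on e {..<n}"
  proof (rule inj_onI)
    fix i j assume ij: "i \<in> {..<n}" "j \<in> {..<n}" "e i = e j"
    have "g x (e i) (e j) = 1" unfolding ij(3) using e ij by (simp add: onbasis_def)
    then show "i = j" using e ij(1,2) by (auto simp: onbasis_def split: if_splits)
  qed
  have zero: "\<forall>f. (\<Sum>v\<in>e ` {..<n}. f v *\<^sub>R v) = 0 \<longrightarrow> (\<forall>j<n. f (e j) = 0)"
  proof (intro allI impI)
    fix f j assume *: "(\<Sum>v\<in>e ` {..<n}. f v *\<^sub>R v) = 0" and j: "j < n"
    have "(\<Sum>i<n. f (e i) *\<^sub>R e i) = 0" using * by (simp add: sum.reindex[OF inj])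
    then have "f (e j) = g x 0 (e j)" using onbasis_coeff[OF e j, of "\<lambda>i. f (e i)"] by simp
    also have "\<dots> = 0" using g_scale[OF subspace_0[OF subspace_tangent] onbasis_tangent[OF e j], of 0] by simp
    finally show "f (e j) = 0" .
  qed
  have ind: "independent (e ` {..<n})"
    by (rule independent_if_scalars_zero[OF finite_imageI[OF finite_lessThan]]) (use zero in blast)
  have "v \<in> span (e ` {..<n})"
  proof (rule ccontr)
    assume nv: "v \<notin> span (e ` {..<n})"
    then have "independent (insert v (e ` {..<n}))" using ind by (simp add: independent_insert)
    moreover have "insert v (e ` {..<n}) \<subseteq> span ((\<lambda>i. coord_vec M c i x) ` {..<n})"
    proof -
      have "(fst c, coord_vec M c) \<in> frames (tangent_bundle M)" using c by (simp add: tangent_bundle_def)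
      then have "span ((\<lambda>i. coord_vec M c i x) ` {..<brank (tangent_bundle M)}) = fibre (tangent_bundle M) x"
        using vector_bundle_tangent c(2) unfolding vector_bundle_def by blast
      then have "span ((\<lambda>i. coord_vec M c i x) ` {..<n}) = tangent_space M x"
        by (simp add: tangent_bundle_def)
      then show ?thesis using v e by (auto simp: onbasis_def)
    qed
    ultimately have "card (insert v (e ` {..<n})) \<le> card ((\<lambda>i. coord_vec M c i x) ` {..<n})"
      using independent_span_bound[OF finite_imageI[OF finite_lessThan]] by blast
    also have "\<dots> \<le> n" using card_image_le[of "{..<n}" "\<lambda>i. coord_vec M c i x"] by simp
    finally have "card (insert v (e ` {..<n})) \<le> n" .
    moreover have "v \<notin> e ` {..<n}" using nv span_base[of v "e ` {..<n}"] by auto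
    ultimately show False by (simp add: card_image[OF inj])
  qed
  then have "v \<in> range (\<lambda>u. \<Sum>v\<in>e ` {..<n}. u v *\<^sub>R v)"
    using span_finite[of "e ` {..<n}"] by simp
  then obtain u where "v = (\<Sum>v\<in>e ` {..<n}. u v *\<^sub>R v)" by blast
  then have u: "v = (\<Sum>i<n. u (e i) *\<^sub>R e i)" by (simp add: sum.reindex[OF inj])
  have "g x v (e j) = u (e j)" if "j < n" for j
    by (subst u) (rule onbasis_coeff[OF e that])
  then have "(\<Sum>i<n. g x v (e i) *\<^sub>R e i) = (\<Sum>i<n. u (e i) *\<^sub>R e i)" by simp
  with u show ?thesis by simp
qed

lemma onbasis_parseval:
  assumes e: "onbasis x e" and u: "u \<in> tangent_space M x" and w: "w \<in> tangent_space M x"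
  shows "(\<Sum>i<n. g x (e i) u * g x (e i) w) = g x u w"
proof -
  have "g x u w = g x (\<Sum>i<n. g x u (e i) *\<^sub>R e i) w" using onbasis_expand[OF e u] by simp
  also have "\<dots> = (\<Sum>i<n. g x u (e i) * g x (e i) w)"
    using e w by (intro g_sum) (auto simp: onbasis_def)
  also have "\<dots> = (\<Sum>i<n. g x (e i) u * g x (e i) w)"
    using g_sym[OF u onbasis_tangent[OF e]] by simp
  finally show ?thesis by simp
qed

lemma map_onbasis_tlists: "onbasis x e \<Longrightarrow> I \<in> idx n k \<Longrightarrow> map e I \<in> tlists M k x"
  by (auto simp: idx_def tlists_def onbasis_def subset_iff)

end

section \<open>The inner product of forms in orthonormal bases and its derivative\<close>

locale geo_ctx = form_ctx M g D E nab + metric_conn_ctx M E h nab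
  for M :: "'m::{t2_space,second_countable_topology} manifold"
    and g :: "'m \<Rightarrow> 'm tvec \<Rightarrow> 'm tvec \<Rightarrow> real" and D :: "('m, 'm tvec) conn"
    and E :: "('m, 'e::real_vector) vbundle" and h :: "'m \<Rightarrow> 'e \<Rightarrow> 'e \<Rightarrow> real"
    and nab :: "('m, 'e) conn"
begin

abbreviation "finner \<equiv> form_inner M g h"

lemma htot_alt:
  assumes "\<alpha> \<in> alt_forms M E k x" "\<beta> \<in> alt_forms M E k x" "vs \<in> tlists M k x"
  shows "htot x (\<alpha> vs) (\<beta> vs) = h x (\<alpha> vs) (\<beta> vs)"
  by (rule htot(2)) (use assms alt_fibre in auto)

text \<open>The change-of-basis matrix is orthogonal by Parseval, so the double expansion collapses
  to the diagonal. Linearity is asked only on combinations of f, since forms are linear on tangent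
  vectors only.\<close>

lemma trace_onbasis:
  assumes e: "onbasis x e" and f: "onbasis x f"
    and A: "\<And>a :: nat \<Rightarrow> real. A (\<Sum>j<n. a j *\<^sub>R f j) = (\<Sum>j<n. a j *\<^sub>R A (f j))"
    and B: "\<And>a :: nat \<Rightarrow> real. B (\<Sum>j<n. a j *\<^sub>R f j) = (\<Sum>j<n. a j *\<^sub>R B (f j))"
  shows "(\<Sum>i<n. htot x (A (e i)) (B (e i))) = (\<Sum>j<n. htot x (A (f j)) (B (f j)))"
proof -
  interpret psd_form "htot x" by (rule htot)
  have "(\<Sum>i<n. htot x (A (e i)) (B (e i))) =
      (\<Sum>i<n. htot x (\<Sum>j<n. g x (e i) (f j) *\<^sub>R A (f j)) (\<Sum>l<n. g x (e i) (f l) *\<^sub>R B (f l)))"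
  proof (intro sum.cong refl)
    fix i assume "i \<in> {..<n}"
    then have ei: "e i = (\<Sum>j<n. g x (e i) (f j) *\<^sub>R f j)"
      by (intro onbasis_expand[OF f onbasis_tangent[OF e]]) simp
    show "htot x (A (e i)) (B (e i)) =
        htot x (\<Sum>j<n. g x (e i) (f j) *\<^sub>R A (f j)) (\<Sum>l<n. g x (e i) (f l) *\<^sub>R B (f l))"
      unfolding A[symmetric] B[symmetric] ei[symmetric] ..
  qed
  also have "\<dots> = (\<Sum>i<n. \<Sum>j<n. \<Sum>l<n. (g x (e i) (f j) * g x (e i) (f l)) * htot x (A (f j)) (B (f l)))"
    by (simp only: H_sum H_scale) (simp add: H_sum_right H_scale_right sum_distrib_left mult.assoc)
  also have "\<dots> = (\<Sum>j<n. \<Sum>i<n. \<Sum>l<n. (g x (e i) (f j) * g x (e i) (f l)) * htot x (A (f j)) (B (f l)))"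
    by (rule sum.swap)
  also have "\<dots> = (\<Sum>j<n. \<Sum>l<n. \<Sum>i<n. (g x (e i) (f j) * g x (e i) (f l)) * htot x (A (f j)) (B (f l)))"
    by (intro sum.cong refl sum.swap)
  also have "\<dots> = (\<Sum>j<n. \<Sum>l<n. (if l = j then htot x (A (f j)) (B (f j)) else 0))"
  proof (intro sum.cong refl)
    fix j l assume "j \<in> {..<n}" "l \<in> {..<n}"
    then have "(\<Sum>i<n. g x (e i) (f j) * g x (e i) (f l)) = (if j = l then 1 else 0)"
      using onbasis_parseval[OF e onbasis_tangent[OF f] onbasis_tangent[OF f]] f by (auto simp: onbasis_def)
    then show "(\<Sum>i<n. (g x (e i) (f j) * g x (e i) (f l)) * htot x (A (f j)) (B (f l))) =
        (if l = j then htot x (A (f j)) (B (f j)) else 0)"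
      by (simp add: sum_distrib_right[symmetric])
  qed
  finally show ?thesis by simp
qed

lemma alt_sum_Cons:
  assumes "\<alpha> \<in> alt_forms M E (Suc k) x" "vs \<in> tlists M k x" "\<And>j. j \<in> J \<Longrightarrow> v j \<in> tangent_space M x"
  shows "\<alpha> ((\<Sum>j\<in>J. a j *\<^sub>R v j) # vs) = (\<Sum>j\<in>J. a j *\<^sub>R \<alpha> (v j # vs))"
  using alt_sum[OF assms(1) tlists_Cons[OF subspace_0[OF subspace_tangent] assms(2)], of 0 J v a] assms(3)
  by simp

text \<open>The basis is changed slot by slot: with the first slot fixed the induction hypothesis
  treats the contracted forms, and \<open>trace_onbasis\<close> then changes the first slot.\<close>

lemma sum_idx_onbasis:
  assumes e: "onbasis x e" and f: "onbasis x f"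
  shows "\<alpha> \<in> alt_forms M E k x \<Longrightarrow> \<beta> \<in> alt_forms M E k x \<Longrightarrow>
    (\<Sum>I\<in>idx n k. htot x (\<alpha> (map e I)) (\<beta> (map e I))) =
    (\<Sum>I\<in>idx n k. htot x (\<alpha> (map f I)) (\<beta> (map f I)))"
proof (induction k arbitrary: \<alpha> \<beta>)
  case (Suc k)
  let ?c = "\<lambda>\<gamma> u vs. if vs \<in> tlists M k x then \<gamma> (u # vs) else 0"
  have "(\<Sum>I\<in>idx n (Suc k). htot x (\<alpha> (map e I)) (\<beta> (map e I))) =
      (\<Sum>i<n. \<Sum>J\<in>idx n k. htot x (?c \<alpha> (e i) (map e J)) (?c \<beta> (e i) (map e J)))"
    using map_onbasis_tlists[OF e] by (simp add: sum_idx_Suc)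
  also have "\<dots> = (\<Sum>i<n. \<Sum>J\<in>idx n k. htot x (?c \<alpha> (e i) (map f J)) (?c \<beta> (e i) (map f J)))"
  proof (rule sum.cong[OF refl])
    fix i assume "i \<in> {..<n}"
    then have ei: "e i \<in> tangent_space M x" using onbasis_tangent[OF e] by simp
    show "(\<Sum>J\<in>idx n k. htot x (?c \<alpha> (e i) (map e J)) (?c \<beta> (e i) (map e J))) =
        (\<Sum>J\<in>idx n k. htot x (?c \<alpha> (e i) (map f J)) (?c \<beta> (e i) (map f J)))"
      by (rule Suc.IH[OF alt_Cons[OF Suc.prems(1) ei] alt_Cons[OF Suc.prems(2) ei]])
  qed
  also have "\<dots> = (\<Sum>J\<in>idx n k. \<Sum>i<n. htot x (\<alpha> (e i # map f J)) (\<beta> (e i # map f J)))"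
    using map_onbasis_tlists[OF f] by (subst sum.swap) simp
  also have "\<dots> = (\<Sum>J\<in>idx n k. \<Sum>i<n. htot x (\<alpha> (f i # map f J)) (\<beta> (f i # map f J)))"
  proof (rule sum.cong[OF refl])
    fix J assume "J \<in> idx n k"
    then have J: "map f J \<in> tlists M k x" by (rule map_onbasis_tlists[OF f])
    show "(\<Sum>i<n. htot x (\<alpha> (e i # map f J)) (\<beta> (e i # map f J))) =
        (\<Sum>i<n. htot x (\<alpha> (f i # map f J)) (\<beta> (f i # map f J)))"
      using onbasis_tangent[OF f]
      by (intro trace_onbasis[OF e f, of "\<lambda>u. \<alpha> (u # map f J)" "\<lambda>u. \<beta> (u # map f J)"]
          alt_sum_Cons[OF Suc.prems(1) J] alt_sum_Cons[OF Suc.prems(2) J]) auto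
  qed
  also have "\<dots> = (\<Sum>I\<in>idx n (Suc k). htot x (\<alpha> (map f I)) (\<beta> (map f I)))"
    by (simp add: sum_idx_Suc) (rule sum.swap)
  finally show ?case .
qed simp

text \<open>Replaces increasing multi-indices in the one basis \<open>onb\<close> by all index lists
  in any orthonormal basis. From here on the values of a smooth frame can be used at every
  point.\<close>

lemma finner_onbasis:
  assumes e: "onbasis x e" and \<alpha>: "\<alpha> \<in> alt_forms M E k x" and \<beta>: "\<beta> \<in> alt_forms M E k x"
  shows "finner k x \<alpha> \<beta> = (\<Sum>I\<in>idx n k. htot x (\<alpha> (map e I)) (\<beta> (map e I))) / fact k"
proof -
  let ?f = "onb M g x"
  interpret psd_form "htot x" by (rule htot)
  note f = onbasis_onb[of x]
  have fT: "?f ` {..<n} \<subseteq> tangent_space M x" using onbasis_tangent[OF f] by auto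
  have "(\<Sum>I\<in>idx n k. htot x (\<alpha> (map ?f I)) (\<beta> (map ?f I))) =
    fact k * (\<Sum>I | length I = k \<and> sorted_wrt (<) I \<and> set I \<subseteq> {..<n}. htot x (\<alpha> (map ?f I)) (\<beta> (map ?f I)))"
  proof (rule sum_idx_sorted[where a = "\<lambda>I. \<alpha> (map ?f I)" and b = "\<lambda>I. \<beta> (map ?f I)"])
    show "swap_odd {..<n} k (\<lambda>I. \<alpha> (map ?f I))" "swap_odd {..<n} k (\<lambda>I. \<beta> (map ?f I))"
      using swap_odd_map[OF alt_swap_odd[OF \<alpha>] fT] swap_odd_map[OF alt_swap_odd[OF \<beta>] fT] .
    fix I assume I: "I \<in> idx n k" "\<not> distinct I"
    then obtain i j where ij: "i < j" "j < k" "I ! i = I ! j"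
      by (auto simp: distinct_conv_nth idx_def) (metis nat_neq_iff)
    show "\<alpha> (map ?f I) = 0"
      by (rule alt_repeat[OF \<alpha> map_onbasis_tlists[OF f I(1)] ij(1,2)]) (use ij I in \<open>auto simp: idx_def\<close>)
  qed
  also have "(\<Sum>I | length I = k \<and> sorted_wrt (<) I \<and> set I \<subseteq> {..<n}. htot x (\<alpha> (map ?f I)) (\<beta> (map ?f I))) =
      finner k x \<alpha> \<beta>"
    unfolding form_inner_def
    by (intro sum.cong refl htot_alt[OF \<alpha> \<beta>] map_onbasis_tlists[OF f]) (auto simp: idx_def)
  finally show ?thesis using sum_idx_onbasis[OF f e \<alpha> \<beta>] by simp
qed

lemma form_norm_sq: "\<alpha> \<in> alt_forms M E k x \<Longrightarrow> (form_norm M g h k x \<alpha>)\<^sup>2 = finner k x \<alpha> \<alpha>"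
proof -
  assume \<alpha>: "\<alpha> \<in> alt_forms M E k x"
  interpret psd_form "htot x" by (rule htot)
  have "finner k x \<alpha> \<alpha> \<ge> 0"
    unfolding finner_onbasis[OF onbasis_onb \<alpha> \<alpha>] by (intro divide_nonneg_nonneg sum_nonneg H_nonneg) simp
  then show ?thesis by (simp add: form_norm_def)
qed

lemma onframe_fields: "onframe W e \<Longrightarrow> I \<in> idx n k \<Longrightarrow> fields_on W (map e I) \<and> length (map e I) = k"
  by (auto simp: onframe_def idx_def subset_iff)

lemma onframe_onbasis: "onframe W e \<Longrightarrow> y \<in> W \<Longrightarrow> onbasis y (\<lambda>i. e i y)"
  by (simp add: onframe_def)

context
  fixes W e k \<phi> \<psi>
  assumes e: "onframe W e" and \<phi>: "smooth_form_on M E k W \<phi>" and \<psi>: "smooth_form_on M E k W \<psi>"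
begin

lemma finner_frame:
  assumes y: "y \<in> W"
  shows "finner k y (\<phi> y) (\<psi> y) =
    (\<Sum>I\<in>idx n k. h y (eval_form \<phi> (map e I) y) (eval_form \<psi> (map e I) y)) / fact k"
proof -
  have "finner k y (\<phi> y) (\<psi> y) =
      (\<Sum>I\<in>idx n k. htot y (\<phi> y (map (\<lambda>i. e i y) I)) (\<psi> y (map (\<lambda>i. e i y) I))) / fact k"
    by (rule finner_onbasis[OF onframe_onbasis[OF e y] form_alt[OF \<phi> y] form_alt[OF \<psi> y]])
  also have "(\<Sum>I\<in>idx n k. htot y (\<phi> y (map (\<lambda>i. e i y) I)) (\<psi> y (map (\<lambda>i. e i y) I))) =
      (\<Sum>I\<in>idx n k. h y (eval_form \<phi> (map e I) y) (eval_form \<psi> (map e I) y))"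
    using htot_alt[OF form_alt[OF \<phi> y] form_alt[OF \<psi> y] map_onbasis_tlists[OF onframe_onbasis[OF e y]]]
    by (intro sum.cong refl) (simp add: eval_form_def comp_def)
  finally show ?thesis .
qed

lemma finner_smooth: "smooth_fun_on M W (\<lambda>y. finner k y (\<phi> y) (\<psi> y))"
proof -
  have W: "open W" using e by (simp add: onframe_def)
  have *: "smooth_fun_on M W (\<lambda>y. (\<Sum>I\<in>idx n k. h y (eval_form \<phi> (map e I) y) (eval_form \<psi> (map e I) y)) * (1 / fact k))"
    using onframe_fields[OF e]
    by (intro smooth_fun_on_mult smooth_fun_on_sum smooth_fun_on_const h_smooth
        form_section[OF \<phi> W order_refl] form_section[OF \<psi> W order_refl] W) auto
  show ?thesis by (rule smooth_fun_on_cong[OF * W]) (simp add: finner_frame)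
qed

text \<open>In an orthonormal frame, covariant and componentwise differentiation differ by the
  connection matrix \<omega>. It is skew because \<open>D\<close> is metric, so its contributions
  cancel and the metric property of \<open>nab\<close> remains.\<close>

lemma finner_metric:
  assumes x: "x \<in> W" and v: "v \<in> tangent_space M x"
  shows "v (\<lambda>y. finner k y (\<phi> y) (\<psi> y)) = finner k x (nabla k \<phi> x v) (\<psi> x) + finner k x (\<phi> x) (nabla k \<psi> x v)"
proof -
  interpret psd_form "htot x" by (rule htot)
  have W: "open W" using e by (simp add: onframe_def)
  note ox = onframe_onbasis[OF e x]
  let ?e = "\<lambda>i. e i x"
  have ef: "vector_field_on M W (e i)" if "i < n" for i using e that by (simp add: onframe_def)
  have De: "D x v (e i) \<in> tangent_space M x" if "i < n" for i
    using tan.conn_fibre[OF W x ef[OF that] v] by simp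
  define \<omega> where "\<omega> i j = g x (D x v (e i)) (e j x)" for i j
  have anti: "\<omega> i j = - \<omega> j i" if ij: "i < n" "j < n" for i j
  proof -
    have "v (\<lambda>y. g y (e i y) (e j y)) = g x (D x v (e i)) (e j x) + g x (e i x) (D x v (e j))"
      by (rule tan.conn_metric[OF W x ef[OF ij(1)] ef[OF ij(2)] v])
    moreover have "v (\<lambda>y. g y (e i y) (e j y)) = v (\<lambda>y. if i = j then 1 else 0)"
      by (rule tangent_cong[OF v W x]) (use ij e ef in \<open>auto simp: onframe_def onbasis_def intro!: tan.h_smooth\<close>)
    moreover have "v (\<lambda>y. if i = j then 1 else 0) = 0" by (rule tangent_const[OF v])
    moreover have "g x (e i x) (D x v (e j)) = \<omega> j i"
      unfolding \<omega>_def by (rule g_sym[OF onbasis_tangent[OF ox ij(1)] De[OF ij(2)]])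
    ultimately show ?thesis by (simp add: \<omega>_def)
  qed
  have nab_comp: "nab x v (eval_form \<theta> (map e I)) = nabla k \<theta> x v (map ?e I) +
      (\<Sum>p<k. \<Sum>m<n. \<omega> (I ! p) m *\<^sub>R \<theta> x (map ?e (I[p := m])))"
    if \<theta>: "smooth_form_on M E k W \<theta>" and I: "I \<in> idx n k" for \<theta> I
  proof -
    have Ys: "length (map e I) = k" "fields_on W (map e I)" using onframe_fields[OF e I] by auto
    have at: "at_point x (map e I) = map ?e I" by (simp add: comp_def)
    have "\<theta> x ((map ?e I)[p := D x v (map e I ! p)]) = (\<Sum>m<n. \<omega> (I ! p) m *\<^sub>R \<theta> x (map ?e (I[p := m])))"
      if p: "p < k" for p
    proof -
      have Ip: "I ! p < n" "length I = k" using I p idx_nth by (auto simp: idx_def)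
      have "D x v (map e I ! p) = (\<Sum>m<n. \<omega> (I ! p) m *\<^sub>R ?e m)"
        using onbasis_expand[OF ox De[OF Ip(1)]] p Ip(2) by (simp add: \<omega>_def)
      then have "\<theta> x ((map ?e I)[p := D x v (map e I ! p)]) =
          (\<Sum>m<n. \<omega> (I ! p) m *\<^sub>R \<theta> x ((map ?e I)[p := ?e m]))"
        using alt_sum[OF form_alt[OF \<theta> x] map_onbasis_tlists[OF ox I] p, of "{..<n}" ?e]
          onbasis_tangent[OF ox] by simp
      then show ?thesis by (simp add: map_update)
    qed
    then show ?thesis
      using nabla_at[OF \<theta> W x v W x Ys] unfolding at cov_def by simp
  qed
  have fs: "smooth_section_on M E W (eval_form \<phi> (map e I))" "smooth_section_on M E W (eval_form \<psi> (map e I))"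
    if "I \<in> idx n k" for I
    using form_section[OF \<phi> W order_refl] form_section[OF \<psi> W order_refl] onframe_fields[OF e that] by auto
  have evx: "eval_form \<theta> (map e I) x = \<theta> x (map ?e I)" for \<theta> I by (simp add: eval_form_def comp_def)
  have hder: "v (\<lambda>y. h y (eval_form \<phi> (map e I) y) (eval_form \<psi> (map e I) y)) =
      htot x (nab x v (eval_form \<phi> (map e I))) (\<psi> x (map ?e I)) +
      htot x (\<phi> x (map ?e I)) (nab x v (eval_form \<psi> (map e I)))" if I: "I \<in> idx n k" for I
    using conn_metric[OF W x fs(1)[OF I] fs(2)[OF I] v]
      conn_fibre[OF W x fs(1)[OF I] v] conn_fibre[OF W x fs(2)[OF I] v]
      alt_fibre[OF form_alt[OF \<phi> x] map_onbasis_tlists[OF ox I]]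
      alt_fibre[OF form_alt[OF \<psi> x] map_onbasis_tlists[OF ox I]]
    by (simp add: htot(2) evx)
  have "v (\<lambda>y. finner k y (\<phi> y) (\<psi> y)) =
      v (\<lambda>y. (1 / fact k) * (\<Sum>I\<in>idx n k. h y (eval_form \<phi> (map e I) y) (eval_form \<psi> (map e I) y)))"
    by (rule tangent_cong[OF v W x finner_smooth]) (simp add: finner_frame)
  also have "\<dots> = (1 / fact k) * v (\<lambda>y. \<Sum>I\<in>idx n k. h y (eval_form \<phi> (map e I) y) (eval_form \<psi> (map e I) y))"
    using tangent_mult[OF v W x smooth_fun_on_const[OF W, of "1 / fact k"]
        smooth_fun_on_sum[OF W h_smooth[OF W fs]], of "idx n k" "\<lambda>I. I"] tangent_const[OF v] by simp
  also have "v (\<lambda>y. \<Sum>I\<in>idx n k. h y (eval_form \<phi> (map e I) y) (eval_form \<psi> (map e I) y)) =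
      (\<Sum>I\<in>idx n k. v (\<lambda>y. h y (eval_form \<phi> (map e I) y) (eval_form \<psi> (map e I) y)))"
    by (rule tangent_sum[OF v W x]) (intro h_smooth W fs)
  also have "\<dots> = (\<Sum>I\<in>idx n k. htot x (nabla k \<phi> x v (map ?e I)) (\<psi> x (map ?e I)) +
        htot x (\<phi> x (map ?e I)) (nabla k \<psi> x v (map ?e I))) +
      (\<Sum>I\<in>idx n k. (\<Sum>p<k. \<Sum>m<n. \<omega> (I ! p) m * htot x (\<phi> x (map ?e (I[p := m]))) (\<psi> x (map ?e I))) +
        (\<Sum>p<k. \<Sum>m<n. \<omega> (I ! p) m * htot x (\<phi> x (map ?e I)) (\<psi> x (map ?e (I[p := m])))))"
    unfolding sum.distrib[symmetric]
    by (intro sum.cong refl) (simp add: hder nab_comp[OF \<phi>] nab_comp[OF \<psi>] H_simps sum.distrib)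
  also have "(\<Sum>I\<in>idx n k. (\<Sum>p<k. \<Sum>m<n. \<omega> (I ! p) m * htot x (\<phi> x (map ?e (I[p := m]))) (\<psi> x (map ?e I))) +
        (\<Sum>p<k. \<Sum>m<n. \<omega> (I ! p) m * htot x (\<phi> x (map ?e I)) (\<psi> x (map ?e (I[p := m]))))) = 0"
    by (rule sum_idx_antisym_cancel[OF anti, where a = "\<lambda>I. \<phi> x (map ?e I)" and b = "\<lambda>I. \<psi> x (map ?e I)"])
  finally show ?thesis
    unfolding finner_onbasis[OF ox nabla_alt[OF \<phi> W x v] form_alt[OF \<psi> x]]
      finner_onbasis[OF ox form_alt[OF \<phi> x] nabla_alt[OF \<psi> W x v]]
    by (simp add: sum.distrib add_divide_distrib)
qed

end

end

section \<open>The algebraic inequality\<close>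

text \<open>Just the sign rule for moving one entry to the front, the form of antisymmetry on which
  the adjointness of wedge and contraction rests.\<close>

definition move_odd :: "nat \<Rightarrow> nat \<Rightarrow> (nat list \<Rightarrow> 'b::real_vector) \<Rightarrow> bool"
  where "move_odd n k f \<longleftrightarrow> (\<forall>J\<in>idx n k. \<forall>p<k. f J = (- 1) ^ p *\<^sub>R f (J ! p # omit p J))"

lemma swap_odd_move_odd: "swap_odd {..<n} k f \<Longrightarrow> move_odd n k f"
  unfolding move_odd_def idx_def using swap_odd_move_front by blast

lemma move_oddD: "move_odd n k f \<Longrightarrow> J \<in> idx n k \<Longrightarrow> p < k \<Longrightarrow> f J = (- 1) ^ p *\<^sub>R f (J ! p # omit p J)"
  by (simp add: move_odd_def)

lemma omit_Cons_0 [simp]: "omit 0 (i # I) = I"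
  and omit_Cons_Suc [simp]: "omit (Suc p) (i # I) = i # omit p I"
  by (simp_all add: omit_def)

lemma idx_length: "J \<in> idx n k \<Longrightarrow> length J = k"
  by (simp add: idx_def)

lemma idx_omit: "J \<in> idx n (Suc k) \<Longrightarrow> p \<le> k \<Longrightarrow> omit p J \<in> idx n k"
  using set_omit[of p J] by (auto simp: idx_def length_omit)

lemma idx_Cons: "i < n \<Longrightarrow> I \<in> idx n k \<Longrightarrow> i # I \<in> idx n (Suc k)"
  by (auto simp: idx_def)

lemma move_odd_Cons_Cons:
  assumes "move_odd n (Suc (Suc k)) f" "i < n" "j < n" "I \<in> idx n k"
  shows "f (i # j # I) = - f (j # i # I)"
  using move_oddD[OF assms(1) idx_Cons[OF assms(2) idx_Cons[OF assms(3,4)]], of 1] by simp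

lemma move_odd_sum:
  assumes "\<And>i. i \<in> I \<Longrightarrow> move_odd n k (f i)"
  shows "move_odd n k (\<lambda>J. \<Sum>i\<in>I. a i *\<^sub>R f i J)"
  unfolding move_odd_def
proof (intro ballI allI impI)
  fix J p assume J: "J \<in> idx n k" "p < k"
  show "(\<Sum>i\<in>I. a i *\<^sub>R f i J) = (- 1) ^ p *\<^sub>R (\<Sum>i\<in>I. a i *\<^sub>R f i (J ! p # omit p J))"
    unfolding scaleR_sum_right
  proof (intro sum.cong refl)
    fix i assume "i \<in> I"
    from move_oddD[OF assms[OF this] J]
    have "a i *\<^sub>R f i J = a i *\<^sub>R ((- 1) ^ p *\<^sub>R f i (J ! p # omit p J))" by (rule arg_cong)
    then show "a i *\<^sub>R f i J = (- 1) ^ p *\<^sub>R a i *\<^sub>R f i (J ! p # omit p J)" by (simp add: mult.commute)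
  qed
qed

text \<open>The components of \<open>\<Sum>\<^sub>i e\<^sub>i \<and> T\<^sub>i\<close>; with
  \<open>T i\<close> the components of the covariant derivative along the i-th basis vector this is
  the exterior derivative.\<close>

definition alt_sum_omit :: "(nat \<Rightarrow> nat list \<Rightarrow> 'b::real_vector) \<Rightarrow> nat list \<Rightarrow> 'b"
  where "alt_sum_omit T J = (\<Sum>p<length J. (- 1) ^ p *\<^sub>R T (J ! p) (omit p J))"

definition wdg :: "(nat \<Rightarrow> real) \<Rightarrow> (nat list \<Rightarrow> 'b::real_vector) \<Rightarrow> nat list \<Rightarrow> 'b"
  where "wdg w \<beta> = alt_sum_omit (\<lambda>i J. w i *\<^sub>R \<beta> J)"

lemma wdg_Nil [simp]: "wdg w \<beta> [] = 0"
  by (simp add: wdg_def alt_sum_omit_def)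

text \<open>The anticommutation rule \<open>\<iota>\<^sub>i (w \<and> \<beta>) = w\<^sub>i \<beta> -
  w \<and> \<iota>\<^sub>i \<beta>\<close>, from which the norm identities of the algebraic part
  follow.\<close>

lemma wdg_Cons: "wdg w \<beta> (i # I) = w i *\<^sub>R \<beta> I - wdg w (\<lambda>L. \<beta> (i # L)) I"
  by (simp add: wdg_def alt_sum_omit_def sum.lessThan_Suc_shift sum_negf[symmetric] del: sum.lessThan_Suc)

lemma wdg_cong:
  assumes "I \<in> idx n (Suc k)" "\<And>L. L \<in> idx n k \<Longrightarrow> \<beta> L = \<gamma> L"
  shows "wdg w \<beta> I = wdg w \<gamma> I"
  unfolding wdg_def alt_sum_omit_def
  by (intro sum.cong refl) (use assms(1) in \<open>simp add: assms(2) idx_omit idx_length\<close>)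

lemma wdg_sum: "wdg w (\<lambda>L. \<Sum>j\<in>A. a j *\<^sub>R f j L) I = (\<Sum>j\<in>A. a j *\<^sub>R wdg w (f j) I)"
  unfolding wdg_def alt_sum_omit_def
  by (simp add: scaleR_sum_right sum.swap[of _ A] mult_ac)

lemma wdg_minus: "wdg w (\<lambda>L. - f L) I = - wdg w f I"
  unfolding wdg_def alt_sum_omit_def by (simp add: sum_negf)

lemma wdg_zero: "wdg w (\<lambda>L. 0) I = 0"
  unfolding wdg_def alt_sum_omit_def by simp

text \<open>The omitted position r is below, at, or above p. For r = p one gets the leading term of
  \<open>wdg_Cons\<close>; otherwise entry p, now at position p - 1 or p, is moved to the front of
  the shortened list. Here t collects the terms for J and s those for J with entry p
  removed.\<close>

lemma move_odd_wdg:
  assumes \<beta>: "move_odd n k \<beta>"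
  shows "move_odd n (Suc k) (wdg w \<beta>)"
  unfolding move_odd_def
proof (intro ballI allI impI)
  fix J p assume J: "J \<in> idx n (Suc k)" and p: "p < Suc k"
  have len: "length J = Suc k" using J by (simp add: idx_def)
  have lo: "length (omit p J) = k" using len p by (simp add: length_omit)
  define t where "t r = (- 1) ^ r *\<^sub>R w (J ! r) *\<^sub>R \<beta> (omit r J)" for r
  define s where "s q = (- 1) ^ q *\<^sub>R w (omit p J ! q) *\<^sub>R \<beta> (J ! p # omit q (omit p J))" for q
  have low: "t r = - ((- 1) ^ p *\<^sub>R s r)" if r: "r < p" for r
  proof -
    obtain p' where p': "p = Suc p'" using r by (cases p) auto
    have "\<beta> (omit r J) = (- 1) ^ p' *\<^sub>R \<beta> (omit r J ! p' # omit p' (omit r J))"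
      using r p p' by (intro move_oddD[OF \<beta>] idx_omit[OF J]) auto
    moreover have "omit r J ! p' = J ! p" using r p p' len by (simp add: nth_omit)
    moreover have "omit p' (omit r J) = omit r (omit p J)" using omit_omit[of r p' J] r p p' len by simp
    moreover have "omit p J ! r = J ! r" using r p len by (simp add: nth_omit)
    ultimately show ?thesis by (simp add: t_def s_def p' mult_ac)
  qed
  have high: "t (Suc q) = - ((- 1) ^ p *\<^sub>R s q)" if q: "p \<le> q" "q < k" for q
  proof -
    have "\<beta> (omit (Suc q) J) = (- 1) ^ p *\<^sub>R \<beta> (omit (Suc q) J ! p # omit p (omit (Suc q) J))"
      using q by (intro move_oddD[OF \<beta>] idx_omit[OF J]) auto
    moreover have "omit (Suc q) J ! p = J ! p" using q len by (simp add: nth_omit)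
    moreover have "omit p (omit (Suc q) J) = omit q (omit p J)" using omit_omit[of p q J] q len by simp
    moreover have "omit p J ! q = J ! Suc q" using q len by (simp add: nth_omit)
    ultimately show ?thesis by (simp add: t_def s_def mult_ac)
  qed
  have "{..<Suc k} = {..<p} \<union> insert p (Suc ` {p..<k})"
    using p by (auto simp: image_Suc_atLeastLessThan)
  then have "wdg w \<beta> J = sum t ({..<p} \<union> insert p (Suc ` {p..<k}))"
    using len by (simp add: wdg_def alt_sum_omit_def t_def)
  also have "\<dots> = sum t {..<p} + (t p + sum t (Suc ` {p..<k}))"
    by (subst sum.union_disjoint) auto
  also have "sum t (Suc ` {p..<k}) = (\<Sum>q\<in>{p..<k}. - ((- 1) ^ p *\<^sub>R s q))"
    by (simp add: sum.reindex high del: image_Suc_atLeastLessThan)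
  also have "sum t {..<p} = (\<Sum>q\<in>{0..<p}. - ((- 1) ^ p *\<^sub>R s q))"
    by (simp add: low lessThan_atLeast0)
  finally have "wdg w \<beta> J = t p + ((\<Sum>q\<in>{0..<p}. - ((- 1) ^ p *\<^sub>R s q)) + (\<Sum>q\<in>{p..<k}. - ((- 1) ^ p *\<^sub>R s q)))"
    by simp
  also have "(\<Sum>q\<in>{0..<p}. - ((- 1) ^ p *\<^sub>R s q)) + (\<Sum>q\<in>{p..<k}. - ((- 1) ^ p *\<^sub>R s q)) =
      (\<Sum>q<k. - ((- 1) ^ p *\<^sub>R s q))"
    unfolding lessThan_atLeast0 by (rule sum.atLeastLessThan_concat) (use p in auto)
  also have "t p + (\<Sum>q<k. - ((- 1) ^ p *\<^sub>R s q)) = (- 1) ^ p *\<^sub>R (w (J ! p) *\<^sub>R \<beta> (omit p J) - (\<Sum>q<k. s q))"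
    by (simp add: t_def scaleR_diff_right scaleR_sum_right sum_negf)
  also have "w (J ! p) *\<^sub>R \<beta> (omit p J) - (\<Sum>q<k. s q) = wdg w \<beta> (J ! p # omit p J)"
    unfolding wdg_Cons by (simp add: s_def wdg_def alt_sum_omit_def lo)
  finally show "wdg w \<beta> J = (- 1) ^ p *\<^sub>R wdg w \<beta> (J ! p # omit p J)" .
qed

lemma sum_idx_omit:
  assumes p: "p \<le> k"
  shows "(\<Sum>J\<in>idx n (Suc k). F (J ! p) (omit p J)) = (\<Sum>i<n. \<Sum>I\<in>idx n k. F i I)"
proof -
  have "(\<Sum>J\<in>idx n (Suc k). F (J ! p) (omit p J)) = (\<Sum>(i, I)\<in>{..<n} \<times> idx n k. F i I)"
  proof (rule sum.reindex_bij_witness[of _ "\<lambda>(i, I). take p I @ i # drop p I" "\<lambda>J. (J ! p, omit p J)"])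
    fix J assume J: "J \<in> idx n (Suc k)"
    then have l: "length J = Suc k" by (simp add: idx_def)
    show "(case (J ! p, omit p J) of (i, I) \<Rightarrow> take p I @ i # drop p I) = J"
      using l p id_take_nth_drop[of p J] by (simp add: omit_def)
    show "(J ! p, omit p J) \<in> {..<n} \<times> idx n k" using idx_omit[OF J p] idx_nth[OF J] p by simp
  next
    fix iI assume "iI \<in> {..<n} \<times> idx n k"
    then obtain i I where iI: "iI = (i, I)" "i < n" "length I = k" "set I \<subseteq> {..<n}" by (auto simp: idx_def)
    show "((case iI of (i, I) \<Rightarrow> take p I @ i # drop p I) ! p, omit p (case iI of (i, I) \<Rightarrow> take p I @ i # drop p I)) = iI"
      using iI p by (simp add: omit_def nth_append)
    show "(case iI of (i, I) \<Rightarrow> take p I @ i # drop p I) \<in> idx n (Suc k)"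
      using iI p set_take_subset[of p I] set_drop_subset[of p I] by (auto simp: idx_def)
  qed simp
  then show ?thesis by (simp add: sum.cartesian_product)
qed

section \<open>The inner product on families indexed by lists\<close>

context psd_form
begin

definition ip :: "nat \<Rightarrow> nat \<Rightarrow> (nat list \<Rightarrow> 'e) \<Rightarrow> (nat list \<Rightarrow> 'e) \<Rightarrow> real"
  where "ip n k a b = (\<Sum>I\<in>idx n k. H (a I) (b I)) / fact k"

lemma ip_sym: "ip n k a b = ip n k b a"
  by (simp add: ip_def H_sym[of "a _"])

lemma ip_nonneg: "ip n k a a \<ge> 0"
  unfolding ip_def by (intro divide_nonneg_nonneg sum_nonneg H_nonneg) simp

lemma ip_cong: "(\<And>I. I \<in> idx n k \<Longrightarrow> a I = a' I) \<Longrightarrow> (\<And>I. I \<in> idx n k \<Longrightarrow> b I = b' I) \<Longrightarrow>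
    ip n k a b = ip n k a' b'"
  unfolding ip_def by simp

lemma ip_add: "ip n k (\<lambda>I. a I + b I) c = ip n k a c + ip n k b c"
  by (simp add: ip_def H_add sum.distrib add_divide_distrib)

lemma ip_diff: "ip n k (\<lambda>I. a I - b I) c = ip n k a c - ip n k b c"
  by (simp add: ip_def H_diff sum_subtractf diff_divide_distrib)

lemma ip_scale: "ip n k (\<lambda>I. r *\<^sub>R a I) c = r * ip n k a c"
  by (simp add: ip_def H_scale sum_distrib_left[symmetric])

lemma ip_add_right: "ip n k c (\<lambda>I. a I + b I) = ip n k c a + ip n k c b"
  and ip_diff_right: "ip n k c (\<lambda>I. a I - b I) = ip n k c a - ip n k c b"
  and ip_scale_right: "ip n k c (\<lambda>I. r *\<^sub>R a I) = r * ip n k c a"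
  by (simp_all add: ip_sym[of n k c] ip_add ip_diff ip_scale)

lemma ip_zero: "ip n k (\<lambda>I. 0) c = 0" "ip n k c (\<lambda>I. 0) = 0"
  by (simp_all add: ip_def)

lemma ip_sum: "ip n k (\<lambda>I. \<Sum>j\<in>A. f j I) c = (\<Sum>j\<in>A. ip n k (f j) c)"
  by (induction A rule: infinite_finite_induct) (auto simp: ip_zero ip_add)

lemma ip_sum_right: "ip n k c (\<lambda>I. \<Sum>j\<in>A. f j I) = (\<Sum>j\<in>A. ip n k c (f j))"
  unfolding ip_sym[of n k c] by (rule ip_sum)

lemma ip_Suc: "(\<Sum>i<n. ip n k (\<lambda>I. a (i # I)) (\<lambda>I. b (i # I))) = real (Suc k) * ip n (Suc k) a b"
  by (simp add: ip_def sum_idx_Suc sum_divide_distrib[symmetric] field_simps del: of_nat_Suc)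

text \<open>Exterior multiplication is adjoint to contraction: as \<psi> is alternating, each of the
  k + 1 positions contributes the same sum, and the factor k + 1 is absorbed by the
  factorials.\<close>

lemma ip_alt_sum_omit:
  assumes \<psi>: "move_odd n (Suc k) \<psi>"
  shows "ip n (Suc k) (alt_sum_omit T) \<psi> = (\<Sum>i<n. ip n k (T i) (\<lambda>I. \<psi> (i # I)))"
proof -
  have "(\<Sum>J\<in>idx n (Suc k). H (alt_sum_omit T J) (\<psi> J)) =
      (\<Sum>J\<in>idx n (Suc k). \<Sum>p<Suc k. H (T (J ! p) (omit p J)) (\<psi> (J ! p # omit p J)))"
  proof (rule sum.cong[OF refl])
    fix J assume J: "J \<in> idx n (Suc k)"
    have "H (alt_sum_omit T J) (\<psi> J) = (\<Sum>p<Suc k. (- 1) ^ p * H (T (J ! p) (omit p J)) (\<psi> J))"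
      using idx_length[OF J] by (simp add: alt_sum_omit_def H_add H_sum H_scale)
    also have "\<dots> = (\<Sum>p<Suc k. H (T (J ! p) (omit p J)) (\<psi> (J ! p # omit p J)))"
    proof (rule sum.cong[OF refl])
      fix p assume "p \<in> {..<Suc k}"
      then have p: "p < Suc k" by simp
      have "(- 1) ^ p * H (T (J ! p) (omit p J)) (\<psi> J) =
        (- 1) ^ p * ((- 1) ^ p * H (T (J ! p) (omit p J)) (\<psi> (J ! p # omit p J)))"
        by (subst move_oddD[OF \<psi> J p]) (simp add: H_scale_right)
      also have "\<dots> = H (T (J ! p) (omit p J)) (\<psi> (J ! p # omit p J))"
        by (simp add: mult.assoc[symmetric] power_add[symmetric])
      finally show "(- 1) ^ p * H (T (J ! p) (omit p J)) (\<psi> J) = H (T (J ! p) (omit p J)) (\<psi> (J ! p # omit p J))" .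
    qed
    finally show "H (alt_sum_omit T J) (\<psi> J) = (\<Sum>p<Suc k. H (T (J ! p) (omit p J)) (\<psi> (J ! p # omit p J)))" .
  qed
  also have "\<dots> = (\<Sum>p<Suc k. \<Sum>J\<in>idx n (Suc k). H (T (J ! p) (omit p J)) (\<psi> (J ! p # omit p J)))"
    by (rule sum.swap)
  also have "\<dots> = (\<Sum>p<Suc k. \<Sum>i<n. \<Sum>I\<in>idx n k. H (T i I) (\<psi> (i # I)))"
    by (intro sum.cong refl sum_idx_omit[of _ k "\<lambda>i I. H (T i I) (\<psi> (i # I))"]) simp
  also have "\<dots> = real (Suc k) * (\<Sum>i<n. \<Sum>I\<in>idx n k. H (T i I) (\<psi> (i # I)))"
    by (simp add: algebra_simps)
  finally have "(\<Sum>J\<in>idx n (Suc k). H (alt_sum_omit T J) (\<psi> J)) =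
      real (Suc k) * (\<Sum>i<n. \<Sum>I\<in>idx n k. H (T i I) (\<psi> (i # I)))" .
  then show ?thesis by (simp add: ip_def sum_divide_distrib[symmetric] del: of_nat_Suc)
qed

lemma ip_wdg:
  assumes "move_odd n (Suc k) \<psi>"
  shows "ip n (Suc k) (wdg w \<beta>) \<psi> = ip n k \<beta> (\<lambda>I. \<Sum>i<n. w i *\<^sub>R \<psi> (i # I))"
  unfolding wdg_def ip_alt_sum_omit[OF assms] by (simp add: ip_scale ip_sum_right ip_scale_right)

text \<open>The Cauchy-Schwarz inequality kept as a nonnegative square, so that no norm or
  coefficient has to be nonzero.\<close>

lemma ip_square: "0 \<le> r\<^sup>2 * ip n k a a - 2 * r * s * ip n k a b + s\<^sup>2 * ip n k b b"
proof -
  have "0 \<le> ip n k (\<lambda>I. r *\<^sub>R a I - s *\<^sub>R b I) (\<lambda>I. r *\<^sub>R a I - s *\<^sub>R b I)" by (rule ip_nonneg)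
  also have "\<dots> = r\<^sup>2 * ip n k a a - 2 * r * s * ip n k a b + s\<^sup>2 * ip n k b b"
    using ip_sym[of n k b a]
    by (simp add: ip_diff ip_diff_right ip_scale ip_scale_right power2_eq_square algebra_simps)
  finally show ?thesis .
qed

end

text \<open>One half of the estimate, used with \<kappa> = k for the exterior derivative and
  \<kappa> = n - k for the contraction. For c > 0 the square bounds 2 m s by c P + m^2 a / c, and
  what remains is m (\<kappa> + 1/c) \<le> 1, that is m \<le> c / (1 + \<kappa> c). If P and s
  vanish, the summand 1/c disappears and m \<kappa> \<le> 1 is enough.\<close>

lemma scalar_step:
  fixes c m \<kappa> a s P :: real
  assumes "c \<ge> 0" "m \<ge> 0" "a \<ge> 0" "P \<ge> 0" and sq: "0 \<le> c\<^sup>2 * P - 2 * c * m * s + m\<^sup>2 * a"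
    and cases: "(P = 0 \<and> s = 0 \<and> m * \<kappa> \<le> 1) \<or> m * (1 + \<kappa> * c) \<le> c" and "\<kappa> \<ge> 0"
  shows "m * a \<le> c * P + 2 * m * (a - s) - m\<^sup>2 * (\<kappa> * a)"
  using cases
proof
  assume *: "P = 0 \<and> s = 0 \<and> m * \<kappa> \<le> 1"
  then have "(m * a) * (m * \<kappa>) \<le> (m * a) * 1" using assms by (intro mult_left_mono) auto
  then show ?thesis using * by (simp add: power2_eq_square algebra_simps)
next
  assume *: "m * (1 + \<kappa> * c) \<le> c"
  show ?thesis
  proof (cases "c = 0")
    case True
    then have "m = 0" using * assms(2) by simp
    then show ?thesis using True by simp
  next
    case False
    then have c: "c > 0" using assms(1) by simp
    have "(m * a) * (m * (1 + \<kappa> * c)) \<le> (m * a) * c" using * assms by (intro mult_left_mono) auto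
    then have "0 \<le> c * (c * P + 2 * m * (a - s) - m\<^sup>2 * (\<kappa> * a) - m * a)"
      using sq by (simp add: power2_eq_square algebra_simps)
    then show ?thesis using c by (simp add: zero_le_mult_iff)
  qed
qed

text \<open>With \<open>T = v \<otimes> f + R\<close>, \<open>A = v \<and> f\<close> and \<open>B = \<iota>\<^sub>v f\<close>, the remainder \<open>R\<close> is tested against
  \<open>Z\<^sub>i = v \<and> \<iota>\<^sub>i f - e\<^sub>i \<and> \<iota>\<^sub>v f\<close>, which is orthogonal to \<open>v \<otimes> f\<close> and satisfies
  \<open>\<langle>T, Z\<rangle> = |v|\<^sup>2 - \<langle>\<epsilon>T, A\<rangle> - \<langle>\<iota>T, B\<rangle>\<close> and \<open>|Z|\<^sup>2 = k |A|\<^sup>2 + (n - k) |B|\<^sup>2\<close>.\<close>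

lemma (in psd_form) refined_kato_algebraic:
  fixes T :: "nat \<Rightarrow> nat list \<Rightarrow> 'e" and f :: "nat list \<Rightarrow> 'e" and c cs m :: real
  assumes T: "\<And>i. i < n \<Longrightarrow> swap_odd {..<n} k (T i)" and f: "swap_odd {..<n} k f"
    and f1: "ip n k f f = 1" and kn: "k \<le> n" and c: "c \<ge> 0" "cs \<ge> 0" "m \<ge> 0"
    and P: "((\<forall>J\<in>idx n (Suc k). alt_sum_omit T J = 0) \<and> m * real k \<le> 1) \<or> m * (1 + real k * c) \<le> c"
    and Q: "((k = 0 \<or> (\<forall>I\<in>idx n (k - 1). (\<Sum>i<n. T i (i # I)) = 0)) \<and> m * real (n - k) \<le> 1) \<or>
      m * (1 + real (n - k) * cs) \<le> cs"
  shows "(1 + m) * (\<Sum>i<n. (ip n k (T i) f)\<^sup>2) \<le> (\<Sum>i<n. ip n k (T i) (T i)) +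
    c * ip n (Suc k) (alt_sum_omit T) (alt_sum_omit T) +
    (if k = 0 then 0 else cs * ip n (k - 1) (\<lambda>I. \<Sum>i<n. T i (i # I)) (\<lambda>I. \<Sum>i<n. T i (i # I)))"
proof -
  define v where "v i = ip n k (T i) f" for i
  define N where "N = (\<Sum>i<n. (v i)\<^sup>2)"
  define A where "A = wdg v f"
  define B where "B I = (\<Sum>i<n. v i *\<^sub>R f (i # I))" for I
  define qT where "qT I = (\<Sum>i<n. T i (i # I))" for I
  define Qf where "Qf i I = wdg v (\<lambda>L. f (i # L)) I" for i I
  define Pf where "Pf i I = (if k = 0 then 0 else wdg (\<lambda>j. if j = i then 1 else 0) B I)" for i I
  define Z where "Z i I = Qf i I - Pf i I" for i I
  define a where "a = ip n (Suc k) A A"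
  \<comment> \<open>For k = 0 the truncated difference \<open>k - 1\<close> is 0. Without the case
    distinction b, sq and qq would pair spurious forms of degree 0 where there are none of degree
    -1.\<close>
  define b where "b = (if k = 0 then 0 else ip n (k - 1) B B)"
  define sq where "sq = (if k = 0 then 0 else ip n (k - 1) qT B)"
  define qq where "qq = (if k = 0 then 0 else ip n (k - 1) qT qT)"
  note f_odd = swap_odd_move_odd[OF f]
  have A_odd: "move_odd n (Suc k) A" unfolding A_def by (rule move_odd_wdg[OF f_odd])
  have iA: "A (i # I) = v i *\<^sub>R f I - Qf i I" for i I
    unfolding A_def Qf_def by (rule wdg_Cons)
  have eA: "ip n (Suc k) (alt_sum_omit U) A = (\<Sum>i<n. v i * ip n k (U i) f) - (\<Sum>i<n. ip n k (U i) (Qf i))" for U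
    unfolding ip_alt_sum_omit[OF A_odd] iA by (simp add: ip_diff_right ip_scale_right sum_subtractf)
  have k0: "k = 0 \<or> (\<exists>k'. k = Suc k')" by (cases k) auto
  have Q0: "Qf i I = 0" if "k = 0" "I \<in> idx n k" for i I using that by (simp add: Qf_def)
  have B_odd: "move_odd n k' B" if k': "k = Suc k'" for k'
    unfolding B_def using swap_odd_Cons[OF f[unfolded k']]
    by (intro move_odd_sum swap_odd_move_odd) auto
  have fi_odd: "move_odd n k' (\<lambda>L. f (i # L))" if "k = Suc k'" "i < n" for i k'
    using swap_odd_Cons[OF f[unfolded that(1)], of i] that(2) by (intro swap_odd_move_odd) auto
  have Q_odd: "move_odd n k (Qf i)" if "i < n" for i
  proof (cases k)
    case 0
    then show ?thesis by (simp add: move_odd_def)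
  next
    case (Suc k')
    have "Qf i = wdg v (\<lambda>L. f (i # L))" by (rule ext) (simp add: Qf_def)
    then show ?thesis using move_odd_wdg[OF fi_odd[OF Suc that]] Suc by simp
  qed
  have P_eq: "Pf i = wdg (\<lambda>j. if j = i then 1 else 0) B" if "k = Suc k'" for i k'
    using that by (intro ext) (simp add: Pf_def)
  have P_odd: "move_odd n k (Pf i)" if "k = Suc k'" for i k'
    unfolding P_eq[OF that] that by (rule move_odd_wdg[OF B_odd[OF that]])
  \<comment> \<open>Adjointness turns the pairing of U with the terms
    \<open>e\<^sub>i \<and> B\<close> into the pairing of the contraction of U with B.\<close>
  have iP: "(\<Sum>i<n. ip n k (U i) (Pf i)) = (if k = 0 then 0 else ip n (k - 1) (\<lambda>I. \<Sum>i<n. U i (i # I)) B)"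
    if U: "\<And>i. i < n \<Longrightarrow> move_odd n k (U i)" for U
  proof (cases k)
    case (Suc k')
    have "ip n k (U i) (Pf i) = ip n k' (\<lambda>I. U i (i # I)) B" if i: "i < n" for i
    proof -
      have "ip n k (U i) (Pf i) = ip n (Suc k') (wdg (\<lambda>j. if j = i then 1 else 0) B) (U i)"
        unfolding P_eq[OF Suc] Suc by (rule ip_sym)
      also have "\<dots> = ip n k' B (\<lambda>I. \<Sum>j<n. (if j = i then 1 else 0) *\<^sub>R U i (j # I))"
        using U[OF i] Suc by (intro ip_wdg) simp
      also have "(\<lambda>I. \<Sum>j<n. (if j = i then 1 else 0) *\<^sub>R U i (j # I)) = (\<lambda>I. U i (i # I))"
      proof
        fix I
        have "(\<Sum>j<n. (if j = i then 1 else 0) *\<^sub>R U i (j # I)) = (\<Sum>j<n. if j = i then U i (i # I) else 0)"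
          by (intro sum.cong refl) auto
        then show "(\<Sum>j<n. (if j = i then 1 else 0) *\<^sub>R U i (j # I)) = U i (i # I)" using i by simp
      qed
      finally show ?thesis by (simp add: ip_sym)
    qed
    then show ?thesis using Suc by (simp add: ip_sum)
  qed (simp add: Pf_def[abs_def] ip_zero)
  have TZ: "(\<Sum>i<n. ip n k (U i) (Z i)) = (\<Sum>i<n. v i * ip n k (U i) f) - ip n (Suc k) (alt_sum_omit U) A -
      (if k = 0 then 0 else ip n (k - 1) (\<lambda>I. \<Sum>i<n. U i (i # I)) B)"
    if U: "\<And>i. i < n \<Longrightarrow> move_odd n k (U i)" for U
    unfolding Z_def using iP[OF U] by (simp add: eA ip_diff_right sum_subtractf)
  have f_Q: "(\<Sum>i<n. v i * ip n k f (Qf i)) = b"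
  proof (cases k)
    case 0
    then have "ip n k f (Qf i) = 0" for i using ip_cong[of n k f f "Qf i" "\<lambda>_. 0"] Q0 by (simp add: ip_zero)
    then show ?thesis using 0 by (simp add: b_def)
  next
    case (Suc k')
    have "ip n k f (Qf i) = ip n k' (\<lambda>L. f (i # L)) B" for i
    proof -
      have "ip n k f (Qf i) = ip n (Suc k') (wdg v (\<lambda>L. f (i # L))) f"
        unfolding Suc ip_sym[of n "Suc k'" f] by (simp add: Qf_def[abs_def])
      also have "\<dots> = ip n k' (\<lambda>L. f (i # L)) B"
        unfolding B_def using f_odd Suc by (intro ip_wdg) simp
      finally show ?thesis .
    qed
    then have "(\<Sum>i<n. v i * ip n k f (Qf i)) = ip n k' (\<lambda>I. \<Sum>i<n. v i *\<^sub>R f (i # I)) B"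
      by (simp add: ip_sum ip_scale)
    then show ?thesis using Suc by (simp add: b_def B_def[abs_def])
  qed
  have vf: "alt_sum_omit (\<lambda>i I. v i *\<^sub>R f I) = A" by (simp add: A_def wdg_def)
  have vv: "(\<Sum>i<n. v i * v i) = N" by (simp add: N_def power2_eq_square)
  \<comment> \<open>Take U = v \<otimes> f in \<open>eA\<close>: since f is a unit vector the first
    sum is N, and by \<open>f_Q\<close> the second is b.\<close>
  have ab: "a + b = N"
  proof -
    have "a = (\<Sum>i<n. v i * ip n k (\<lambda>I. v i *\<^sub>R f I) f) - (\<Sum>i<n. ip n k (\<lambda>I. v i *\<^sub>R f I) (Qf i))"
      using eA[of "\<lambda>i I. v i *\<^sub>R f I"] unfolding vf a_def .
    then show ?thesis by (simp add: ip_scale f1 vv f_Q)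
  qed
  \<comment> \<open>By \<open>TZ\<close> this pairing is N - a - b, so the orthogonality of Z to v
    \<otimes> f is the identity just shown.\<close>
  have vfZ: "(\<Sum>i<n. v i * ip n k f (Z i)) = 0"
  proof -
    have "(\<Sum>i<n. ip n k (\<lambda>I. v i *\<^sub>R f I) (Z i)) = (\<Sum>i<n. v i * ip n k (\<lambda>I. v i *\<^sub>R f I) f) - a - b"
    proof -
      have "move_odd n k (\<lambda>I. v i *\<^sub>R f I)" for i
        using move_odd_sum[of "{()}" n k "\<lambda>_. f" "\<lambda>_. v i"] f_odd by simp
      from TZ[of "\<lambda>i I. v i *\<^sub>R f I", OF this] show ?thesis unfolding vf a_def[symmetric] by (simp add: b_def B_def[abs_def])
    qed
    then show ?thesis using ab by (simp add: ip_scale f1 vv)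
  qed
  \<comment> \<open>For k > 0 expand \<open>|Q - P|\<^sup>2\<close> with
    \<open>|Q|\<^sup>2 = k N - (k - 1) b\<close>, \<open>\<langle>Q, P\<rangle> = b\<close> and
    \<open>|P|\<^sup>2 = (n - k + 1) b\<close>, then substitute N = a + b.\<close>
  have ZZ: "(\<Sum>i<n. ip n k (Z i) (Z i)) = real k * a + real (n - k) * b"
  proof (cases k)
    case 0
    have "Z i I = 0" if "I \<in> idx n k" for i I using 0 that Q0 by (simp add: Z_def Pf_def)
    then have "ip n k (Z i) (Z i) = 0" for i
      using ip_cong[of n k "Z i" "\<lambda>_. 0" "Z i" "\<lambda>_. 0"] by (simp add: ip_zero)
    then show ?thesis using 0 by (simp add: b_def)
  next
    case (Suc k')
    have rep: "f (i # i # L) = 0" if "i < n" "L \<in> idx n k''" "k' = Suc k''" for i L k''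
    proof -
      have "f (i # i # L) = - f (i # i # L)"
        using move_odd_Cons_Cons[of n k'' f i i L] f_odd that Suc by simp
      then have "2 *\<^sub>R f (i # i # L) = 0" by (metis add_eq_0_iff scaleR_2)
      then show ?thesis by simp
    qed
    have QP: "(\<Sum>i<n. ip n k (Qf i) (Pf i)) = b"
    proof -
      have "(\<Sum>i<n. Qf i (i # I)) = B I" if I: "I \<in> idx n k'" for I
      proof -
        have "wdg v (\<lambda>L. f (i # i # L)) I = 0" if i: "i < n" for i
        proof (cases k')
          case 0
          then show ?thesis using I by simp
        next
          case (Suc k'')
          have "wdg v (\<lambda>L. f (i # i # L)) I = wdg v (\<lambda>L. 0) I"
            by (rule wdg_cong[of _ n k'']) (use I Suc rep[OF i _ Suc] in auto)
          then show ?thesis by (simp add: wdg_zero)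
        qed
        then show ?thesis by (simp add: Qf_def wdg_Cons B_def)
      qed
      then have "ip n k' (\<lambda>I. \<Sum>i<n. Qf i (i # I)) B = ip n k' B B" by (intro ip_cong) auto
      then show ?thesis using iP[of Qf, OF Q_odd] Suc by (simp add: b_def)
    qed
    \<comment> \<open>Contracting \<open>e\<^sub>i \<and> B\<close> with i and summing gives n B
      from the leading terms, and each of the k - 1 entries of the index list takes one B
      away.\<close>
    have PP: "(\<Sum>i<n. ip n k (Pf i) (Pf i)) = (real n - real k') * b"
    proof -
      have "(\<Sum>i<n. Pf i (i # I)) = (real n - real k') *\<^sub>R B I" if I: "I \<in> idx n k'" for I
      proof -
        have "(\<Sum>i<n. wdg (\<lambda>j. if j = i then 1 else 0) (\<lambda>L. B (i # L)) I) =
            (\<Sum>p<k'. \<Sum>i<n. (- 1) ^ p *\<^sub>R (if I ! p = i then 1 else 0) *\<^sub>R B (i # omit p I))"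
          unfolding wdg_def alt_sum_omit_def idx_length[OF I] by (rule sum.swap)
        also have "\<dots> = (\<Sum>p<k'. B I)"
        proof (rule sum.cong[OF refl])
          fix p assume "p \<in> {..<k'}"
          then have p: "p < k'" by simp
          have "(\<Sum>i<n. (- 1) ^ p *\<^sub>R (if I ! p = i then 1 else 0) *\<^sub>R B (i # omit p I)) =
              (\<Sum>i<n. if i = I ! p then (- 1) ^ p *\<^sub>R B (I ! p # omit p I) else 0)"
            by (intro sum.cong refl) auto
          also have "\<dots> = (- 1) ^ p *\<^sub>R B (I ! p # omit p I)" using idx_nth[OF I p] by simp
          also have "\<dots> = B I" by (rule move_oddD[OF B_odd[OF Suc] I p, symmetric])
          finally show "(\<Sum>i<n. (- 1) ^ p *\<^sub>R (if I ! p = i then 1 else 0) *\<^sub>R B (i # omit p I)) = B I" .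
        qed
        finally have "(\<Sum>i<n. wdg (\<lambda>j. if j = i then 1 else 0) (\<lambda>L. B (i # L)) I) = real k' *\<^sub>R B I"
          by (simp add: sum_constant_scaleR)
        then show ?thesis
          unfolding P_eq[OF Suc] wdg_Cons by (simp add: sum_subtractf sum_constant_scaleR scaleR_left_diff_distrib)
      qed
      then have "ip n k' (\<lambda>I. \<Sum>i<n. Pf i (i # I)) B = ip n k' (\<lambda>I. (real n - real k') *\<^sub>R B I) B"
        by (intro ip_cong) auto
      then show ?thesis using iP[of Pf, OF P_odd[OF Suc]] Suc by (simp add: b_def ip_scale)
    qed
    \<comment> \<open>By adjointness \<open>|v \<and> \<iota>\<^sub>i f|\<^sup>2\<close> is the
      pairing of \<open>\<iota>\<^sub>i f\<close> with \<open>\<iota>\<^sub>v (v \<and>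
      \<iota>\<^sub>i f) = N \<iota>\<^sub>i f + v \<and> \<iota>\<^sub>i B\<close>. Summed over i,
      the first part gives k N. The second gives -(k - 1) b, because
      \<open>\<iota>\<^sub>v \<iota>\<^sub>i f = - \<iota>\<^sub>i B\<close>.\<close>
    have QQ: "(\<Sum>i<n. ip n k (Qf i) (Qf i)) = real k * N - real k' * b"
    proof -
      have *: "ip n k (Qf i) (Qf i) = N * ip n k' (\<lambda>L. f (i # L)) (\<lambda>L. f (i # L)) +
          ip n k' (\<lambda>L. f (i # L)) (wdg v (\<lambda>L. B (i # L)))" if i: "i < n" for i
      proof -
        have "ip n k (Qf i) (Qf i) = ip n (Suc k') (wdg v (\<lambda>L. f (i # L))) (Qf i)"
          using Suc by (simp add: Qf_def[abs_def])
        also have "\<dots> = ip n k' (\<lambda>L. f (i # L)) (\<lambda>I. \<Sum>j<n. v j *\<^sub>R Qf i (j # I))"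
          using Q_odd[OF i] Suc by (intro ip_wdg) simp
        also have "\<dots> = ip n k' (\<lambda>L. f (i # L)) (\<lambda>I. N *\<^sub>R f (i # I) + wdg v (\<lambda>L. B (i # L)) I)"
        proof (rule ip_cong[OF refl])
          fix I assume I: "I \<in> idx n k'"
          have "(\<Sum>j<n. v j *\<^sub>R Qf i (j # I)) =
              (\<Sum>j<n. (v j * v j) *\<^sub>R f (i # I)) - (\<Sum>j<n. v j *\<^sub>R wdg v (\<lambda>L. f (i # j # L)) I)"
            unfolding Qf_def wdg_Cons by (simp add: scaleR_diff_right sum_subtractf)
          also have "(\<Sum>j<n. (v j * v j) *\<^sub>R f (i # I)) = N *\<^sub>R f (i # I)"
            by (simp only: scaleR_sum_left[symmetric] vv)
          also have "(\<Sum>j<n. v j *\<^sub>R wdg v (\<lambda>L. f (i # j # L)) I) = wdg v (\<lambda>L. \<Sum>j<n. v j *\<^sub>R f (i # j # L)) I"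
            by (simp only: wdg_sum)
          also have "\<dots> = - wdg v (\<lambda>L. B (i # L)) I"
          proof (cases k')
            case 0
            then show ?thesis using I by simp
          next
            case (Suc k'')
            have "wdg v (\<lambda>L. \<Sum>j<n. v j *\<^sub>R f (i # j # L)) I = wdg v (\<lambda>L. - B (i # L)) I"
            proof (rule wdg_cong[of _ n k''])
              fix L assume L: "L \<in> idx n k''"
              have "f (i # j # L) = - f (j # i # L)" if "j < n" for j
                using move_odd_Cons_Cons[of n k'' f i j L] f_odd \<open>k = Suc k'\<close> Suc i that L by simp
              then show "(\<Sum>j<n. v j *\<^sub>R f (i # j # L)) = - B (i # L)"
                by (simp add: B_def sum_negf)
            qed (use I Suc in simp)
            then show ?thesis by (simp add: wdg_minus)
          qed
          finally show "(\<Sum>j<n. v j *\<^sub>R Qf i (j # I)) = N *\<^sub>R f (i # I) + wdg v (\<lambda>L. B (i # L)) I" by simp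
        qed
        finally show ?thesis by (simp add: ip_add_right ip_scale_right)
      qed
      have "(\<Sum>i<n. ip n k' (\<lambda>L. f (i # L)) (wdg v (\<lambda>L. B (i # L)))) = - (real k' * b)"
      proof (cases k')
        case 0
        have "ip n k' (\<lambda>L. f (i # L)) (wdg v (\<lambda>L. B (i # L))) = 0" for i
          using ip_cong[of n k' "\<lambda>L. f (i # L)" "\<lambda>L. f (i # L)" "wdg v (\<lambda>L. B (i # L))" "\<lambda>_. 0"] 0
          by (simp add: ip_zero)
        then show ?thesis using 0 by simp
      next
        case (Suc k'')
        have "ip n k' (\<lambda>L. f (i # L)) (wdg v (\<lambda>L. B (i # L))) = - ip n k'' (\<lambda>L. B (i # L)) (\<lambda>L. B (i # L))"
          if i: "i < n" for i
        proof -
          have "ip n k' (\<lambda>L. f (i # L)) (wdg v (\<lambda>L. B (i # L))) =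
              ip n (Suc k'') (wdg v (\<lambda>L. B (i # L))) (\<lambda>L. f (i # L))" using Suc by (simp add: ip_sym)
          also have "\<dots> = ip n k'' (\<lambda>L. B (i # L)) (\<lambda>L. \<Sum>j<n. v j *\<^sub>R f (i # j # L))"
            using fi_odd[OF \<open>k = Suc k'\<close> i] Suc by (intro ip_wdg) simp
          also have "\<dots> = ip n k'' (\<lambda>L. B (i # L)) (\<lambda>L. (- 1) *\<^sub>R B (i # L))"
          proof (rule ip_cong[OF refl])
            fix L assume L: "L \<in> idx n k''"
            have "f (i # j # L) = - f (j # i # L)" if "j < n" for j
              using move_odd_Cons_Cons[of n k'' f i j L] f_odd \<open>k = Suc k'\<close> Suc i that L by simp
            then show "(\<Sum>j<n. v j *\<^sub>R f (i # j # L)) = (- 1) *\<^sub>R B (i # L)"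
              by (simp add: B_def sum_negf)
          qed
          finally show ?thesis by (simp only: ip_scale_right)
        qed
        then have "(\<Sum>i<n. ip n k' (\<lambda>L. f (i # L)) (wdg v (\<lambda>L. B (i # L)))) =
            - (\<Sum>i<n. ip n k'' (\<lambda>L. B (i # L)) (\<lambda>L. B (i # L)))" by (simp add: sum_negf)
        then show ?thesis using ip_Suc[of n k'' B B] Suc \<open>k = Suc k'\<close> by (simp add: b_def)
      qed
      moreover have "(\<Sum>i<n. N * ip n k' (\<lambda>L. f (i # L)) (\<lambda>L. f (i # L))) = real k * N"
        using ip_Suc[of n k' f f] f1 Suc by (simp add: sum_distrib_left[symmetric])
      ultimately show ?thesis by (simp add: * sum.distrib)
    qed
    have "(\<Sum>i<n. ip n k (Z i) (Z i)) = (\<Sum>i<n. ip n k (Qf i) (Qf i)) - 2 * (\<Sum>i<n. ip n k (Qf i) (Pf i)) +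
        (\<Sum>i<n. ip n k (Pf i) (Pf i))"
      unfolding Z_def using ip_sym[of n k "Pf _" "Qf _"]
      by (simp add: ip_diff ip_diff_right sum.distrib[symmetric] sum_distrib_left sum_subtractf[symmetric] algebra_simps)
    then show ?thesis unfolding QQ QP PP ab[symmetric] using kn Suc by (simp add: of_nat_diff algebra_simps)
  qed
  have TZ': "(\<Sum>i<n. ip n k (T i) (Z i)) = N - ip n (Suc k) (alt_sum_omit T) A - sq"
    using TZ[of T, OF swap_odd_move_odd[OF T]] vv by (simp add: sq_def qT_def[abs_def] v_def)
  define X where "X = (\<Sum>i<n. ip n k (T i) (T i))"
  define s where "s = ip n (Suc k) (alt_sum_omit T) A"
  define pp where "pp = ip n (Suc k) (alt_sum_omit T) (alt_sum_omit T)"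
  \<comment> \<open>The square norm of \<open>T - v \<otimes> f - m Z\<close>. The coefficient m of
    the test family is the gain that is to be proved.\<close>
  have main: "0 \<le> X - N - 2 * m * (N - s - sq) + m\<^sup>2 * (real k * a + real (n - k) * b)"
  proof -
    let ?R = "\<lambda>i I. T i I - v i *\<^sub>R f I - m *\<^sub>R Z i I"
    have "ip n k (?R i) (?R i) = ip n k (T i) (T i) - (v i)\<^sup>2 - 2 * m * ip n k (T i) (Z i) +
        2 * m * (v i * ip n k f (Z i)) + m\<^sup>2 * ip n k (Z i) (Z i)" for i
      using ip_sym[of n k f "T i"] ip_sym[of n k "Z i" "T i"] ip_sym[of n k "Z i" f] f1
      by (simp add: ip_add ip_add_right ip_diff ip_diff_right ip_scale ip_scale_right v_def[symmetric]
          power2_eq_square algebra_simps)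
    then have "(\<Sum>i<n. ip n k (?R i) (?R i)) = X - N - 2 * m * (\<Sum>i<n. ip n k (T i) (Z i)) +
        2 * m * (\<Sum>i<n. v i * ip n k f (Z i)) + m\<^sup>2 * (\<Sum>i<n. ip n k (Z i) (Z i))"
      by (simp add: sum.distrib sum_subtractf sum_distrib_left X_def N_def)
    moreover have "0 \<le> (\<Sum>i<n. ip n k (?R i) (?R i))" by (intro sum_nonneg ip_nonneg)
    ultimately show ?thesis unfolding TZ' vfZ ZZ s_def by simp
  qed
  have nonneg: "a \<ge> 0" "b \<ge> 0" "pp \<ge> 0" "qq \<ge> 0"
    by (simp_all add: a_def b_def pp_def qq_def ip_nonneg)
  have step1: "m * a \<le> c * pp + 2 * m * (a - s) - m\<^sup>2 * (real k * a)"
  proof (rule scalar_step[OF c(1,3) nonneg(1,3)])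
    show "0 \<le> c\<^sup>2 * pp - 2 * c * m * s + m\<^sup>2 * a" unfolding pp_def s_def a_def by (rule ip_square)
    have "pp = 0 \<and> s = 0" if "\<forall>J\<in>idx n (Suc k). alt_sum_omit T J = 0"
      using that by (simp add: pp_def s_def ip_def)
    then show "(pp = 0 \<and> s = 0 \<and> m * real k \<le> 1) \<or> m * (1 + real k * c) \<le> c" using P by blast
  qed simp
  have step2: "m * b \<le> cs * qq + 2 * m * (b - sq) - m\<^sup>2 * (real (n - k) * b)"
  proof (rule scalar_step[OF c(2,3) nonneg(2,4)])
    show "0 \<le> cs\<^sup>2 * qq - 2 * cs * m * sq + m\<^sup>2 * b"
      unfolding qq_def sq_def b_def using ip_square[of cs n "k - 1" qT m B] by simp
    have "qq = 0 \<and> sq = 0" if "k = 0 \<or> (\<forall>I\<in>idx n (k - 1). (\<Sum>i<n. T i (i # I)) = 0)"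
      using that by (auto simp: qq_def sq_def ip_def qT_def)
    then show "(qq = 0 \<and> sq = 0 \<and> m * real (n - k) \<le> 1) \<or> m * (1 + real (n - k) * cs) \<le> cs" using Q by blast
  qed simp
  \<comment> \<open>N = a + b distributes the gain m N over the two halves, each covered by one of
    the preceding steps.\<close>
  have "N + m * N = N + m * a + m * b" using ab by (simp add: distrib_left[symmetric])
  also have "\<dots> \<le> X + c * pp + cs * qq"
    using main step1 step2 unfolding ab[symmetric] by (simp add: algebra_simps)
  finally have "(1 + m) * N \<le> X + c * pp + cs * qq" by (simp add: distrib_right)
  moreover have "qT = (\<lambda>I. \<Sum>i<n. T i (i # I))" by (rule ext) (simp add: qT_def)
  ultimately show ?thesis
    by (cases "k = 0") (simp_all add: N_def v_def X_def pp_def qq_def)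
qed

section \<open>The codifferential and the divergence\<close>

context bundle_ctx
begin

lemma alt_form_sum:
  assumes "\<And>i. i \<in> I \<Longrightarrow> \<alpha> i \<in> alt_forms M E k x"
  shows "(\<lambda>vs. \<Sum>i\<in>I. \<alpha> i vs) \<in> alt_forms M E k x"
  using assms
proof (induction I rule: infinite_finite_induct)
  case (insert i I)
  then show ?case using alt_lincomb[of "\<alpha> i" k x "\<lambda>vs. \<Sum>i\<in>I. \<alpha> i vs" 1 1] by simp
qed (simp_all add: alt_zero)

end

lemma (in conn_ctx) conn_section:
  assumes "open W" "smooth_section_on M E W \<sigma>" "vector_field_on M W X"
  shows "smooth_section_on M E W (\<lambda>x. nab x (X x) \<sigma>)"
  by (rule connection[unfolded connection_def, THEN spec, THEN spec, THEN mp, OF conjI[OF assms(1,2)],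
        THEN conjunct2, THEN spec, THEN mp, OF assms(3)])

context geo_ctx
begin

text \<open>The index is the degree of the result: \<phi> has degree \<open>Suc k\<close>.\<close>

definition codiff :: "nat \<Rightarrow> ('m \<Rightarrow> 'm tvec list \<Rightarrow> 'e) \<Rightarrow> 'm \<Rightarrow> 'm tvec list \<Rightarrow> 'e"
  where "codiff k \<phi> y vs = (if vs \<in> tlists M k y
    then - (\<Sum>i<n. nabla (Suc k) \<phi> y (onb M g y i) (onb M g y i # vs)) else 0)"

text \<open>The argument of \<open>trace_onbasis\<close> for a vector-valued bilinear B. Linearity
  in the second argument is asked only when the first is a basis vector, where the covariant
  derivative is known to be a form.\<close>

lemma vector_trace_onbasis:
  assumes e: "onbasis x e" and f: "onbasis x f"
    and B1: "\<And>a w. B (\<Sum>j<n. a j *\<^sub>R f j) w = (\<Sum>j<n. a j *\<^sub>R B (f j) w :: 'c::real_vector)"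
    and B2: "\<And>a j. j < n \<Longrightarrow> B (f j) (\<Sum>l<n. a l *\<^sub>R f l) = (\<Sum>l<n. a l *\<^sub>R B (f j) (f l))"
  shows "(\<Sum>i<n. B (e i) (e i)) = (\<Sum>j<n. B (f j) (f j))"
proof -
  have "(\<Sum>i<n. B (e i) (e i)) = (\<Sum>i<n. \<Sum>j<n. \<Sum>l<n. (g x (e i) (f j) * g x (e i) (f l)) *\<^sub>R B (f j) (f l))"
  proof (intro sum.cong[OF refl])
    fix i assume "i \<in> {..<n}"
    then have ei: "(\<Sum>j<n. g x (e i) (f j) *\<^sub>R f j) = e i"
      by (intro onbasis_expand[OF f onbasis_tangent[OF e], symmetric]) simp
    have "B (e i) (e i) = (\<Sum>j<n. g x (e i) (f j) *\<^sub>R B (f j) (e i))"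
      using B1[of "\<lambda>j. g x (e i) (f j)" "e i"] unfolding ei .
    also have "\<dots> = (\<Sum>j<n. g x (e i) (f j) *\<^sub>R (\<Sum>l<n. g x (e i) (f l) *\<^sub>R B (f j) (f l)))"
    proof (rule sum.cong[OF refl])
      fix j assume "j \<in> {..<n}"
      then have "B (f j) (e i) = (\<Sum>l<n. g x (e i) (f l) *\<^sub>R B (f j) (f l))"
        using B2[of j "\<lambda>l. g x (e i) (f l)"] unfolding ei by simp
      then show "g x (e i) (f j) *\<^sub>R B (f j) (e i) =
          g x (e i) (f j) *\<^sub>R (\<Sum>l<n. g x (e i) (f l) *\<^sub>R B (f j) (f l))" by simp
    qed
    finally show "B (e i) (e i) = (\<Sum>j<n. \<Sum>l<n. (g x (e i) (f j) * g x (e i) (f l)) *\<^sub>R B (f j) (f l))"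
      by (simp add: scaleR_sum_right)
  qed
  also have "\<dots> = (\<Sum>j<n. \<Sum>i<n. \<Sum>l<n. (g x (e i) (f j) * g x (e i) (f l)) *\<^sub>R B (f j) (f l))"
    by (rule sum.swap)
  also have "\<dots> = (\<Sum>j<n. \<Sum>l<n. \<Sum>i<n. (g x (e i) (f j) * g x (e i) (f l)) *\<^sub>R B (f j) (f l))"
    by (intro sum.cong refl sum.swap)
  also have "\<dots> = (\<Sum>j<n. \<Sum>l<n. (if l = j then B (f j) (f j) else 0))"
  proof (intro sum.cong refl)
    fix j l assume "j \<in> {..<n}" "l \<in> {..<n}"
    then have "(\<Sum>i<n. g x (e i) (f j) * g x (e i) (f l)) = (if j = l then 1 else 0)"
      using onbasis_parseval[OF e onbasis_tangent[OF f] onbasis_tangent[OF f]] f by (auto simp: onbasis_def)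
    then show "(\<Sum>i<n. (g x (e i) (f j) * g x (e i) (f l)) *\<^sub>R B (f j) (f l)) =
        (if l = j then B (f j) (f j) else 0)"
      by (simp add: scaleR_sum_left[symmetric])
  qed
  finally show ?thesis by simp
qed

text \<open>The basis \<open>onb\<close> is chosen point by point, so smoothness of
  \<open>codiff\<close> cannot be seen from its definition; as the trace is the same in every
  orthonormal basis, a smooth frame may replace it.\<close>

lemma codiff_onbasis:
  assumes \<phi>: "smooth_form_on M E (Suc k) W \<phi>" and W: "open W" "x \<in> W" and e: "onbasis x e"
    and vs: "vs \<in> tlists M k x"
  shows "codiff k \<phi> x vs = - (\<Sum>i<n. nabla (Suc k) \<phi> x (e i) (e i # vs))"
proof -
  note f = onbasis_onb[of x]
  have "(\<Sum>i<n. nabla (Suc k) \<phi> x (e i) (e i # vs)) =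
      (\<Sum>j<n. nabla (Suc k) \<phi> x (onb M g x j) (onb M g x j # vs))"
  proof (rule vector_trace_onbasis[OF e f, of "\<lambda>u w. nabla (Suc k) \<phi> x u (w # vs)"])
    show "nabla (Suc k) \<phi> x (\<Sum>j<n. a j *\<^sub>R onb M g x j) (w # vs) =
        (\<Sum>j<n. a j *\<^sub>R nabla (Suc k) \<phi> x (onb M g x j) (w # vs))" for a w
      using onbasis_tangent[OF f] by (intro nabla_dir_sum[OF \<phi> W]) auto
    show "nabla (Suc k) \<phi> x (onb M g x j) ((\<Sum>l<n. a l *\<^sub>R onb M g x l) # vs) =
        (\<Sum>l<n. a l *\<^sub>R nabla (Suc k) \<phi> x (onb M g x j) (onb M g x l # vs))" if "j < n" for a j
      using onbasis_tangent[OF f] that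
      by (intro alt_sum_Cons[OF nabla_alt[OF \<phi> W] vs]) auto
  qed
  then show ?thesis using vs by (simp add: codiff_def)
qed

lemma codiff_smooth:
  assumes e: "onframe W e" and \<phi>: "smooth_form_on M E (Suc k) W \<phi>"
  shows "smooth_form_on M E k W (codiff k \<phi>)"
  unfolding smooth_form_on_def
proof (intro conjI ballI allI impI)
  have W: "open W" using e by (simp add: onframe_def)
  fix x assume x: "x \<in> W"
  let ?f = "onb M g x"
  have "(\<lambda>vs. (- 1) *\<^sub>R (\<Sum>i<n. if vs \<in> tlists M k x then nabla (Suc k) \<phi> x (?f i) (?f i # vs) else 0) +
      0 *\<^sub>R (0::'e)) \<in> alt_forms M E k x"
    using onbasis_tangent[OF onbasis_onb]
    by (intro alt_lincomb alt_zero alt_form_sum alt_Cons nabla_alt[OF \<phi> W x]) auto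
  moreover have "codiff k \<phi> x = (\<lambda>vs. (- 1) *\<^sub>R (\<Sum>i<n. if vs \<in> tlists M k x then
      nabla (Suc k) \<phi> x (?f i) (?f i # vs) else 0) + 0 *\<^sub>R (0::'e))"
    by (rule ext) (simp add: codiff_def)
  ultimately show "codiff k \<phi> x \<in> alt_forms M E k x" by simp
next
  have W: "open W" using e by (simp add: onframe_def)
  fix V Ys assume *: "open V \<and> V \<subseteq> W \<and> length Ys = k \<and> fields_on V Ys"
  then have V: "open V" "V \<subseteq> W" and Ys: "length Ys = k" "fields_on V Ys" by auto
  have ef: "vector_field_on M V (e i)" if "i < n" for i
    using e that V(2) tan.section_subset[of W "e i" V] by (simp add: onframe_def)
  let ?Z = "\<lambda>i. e i # Ys"
  have Z: "length (?Z i) = Suc k" "fields_on V (?Z i)" if "i < n" for i using Ys ef[OF that] by auto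
  have "smooth_section_on M E V (\<lambda>y. - (\<Sum>i<n. nab y (e i y) (eval_form \<phi> (?Z i)) -
      (\<Sum>p<Suc k. eval_form \<phi> ((?Z i)[p := \<lambda>y. D y (e i y) (?Z i ! p)]) y)))"
  proof (intro section_minus section_sum section_diff V)
    fix i assume "i \<in> {..<n}"
    then have i: "i < n" by simp
    show "smooth_section_on M E V (\<lambda>y. nab y (e i y) (eval_form \<phi> (?Z i)))"
      by (rule conn_section[OF V(1) form_section[OF \<phi> V Z[OF i]] ef[OF i]])
    fix p assume "p \<in> {..<Suc k}"
    then have "vector_field_on M V (?Z i ! p)" using Z[OF i] by (metis lessThan_iff nth_mem)
    then have "vector_field_on M V (\<lambda>y. D y (e i y) (?Z i ! p))"
      by (rule tan.conn_section[OF V(1) _ ef[OF i]])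
    from fields_on_update[OF Z(2)[OF i] this]
    show "smooth_section_on M E V (eval_form \<phi> ((?Z i)[p := \<lambda>y. D y (e i y) (?Z i ! p)]))"
      by (rule form_section[OF \<phi> V, rotated]) (simp only: length_list_update Z(1)[OF i])
  qed
  then show "smooth_section_on M E V (eval_form (codiff k \<phi>) Ys)"
  proof (rule section_cong)
    fix y assume y: "y \<in> V"
    then have yW: "y \<in> W" using V by auto
    have vs: "at_point y Ys \<in> tlists M k y" by (rule at_fields[OF Ys y])
    have ob: "onbasis y (\<lambda>i. e i y)" by (rule onframe_onbasis[OF e yW])
    have "nabla (Suc k) \<phi> y (e i y) (e i y # at_point y Ys) = nab y (e i y) (eval_form \<phi> (?Z i)) -
      (\<Sum>p<Suc k. eval_form \<phi> ((?Z i)[p := \<lambda>y. D y (e i y) (?Z i ! p)]) y)" if i: "i < n" for i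
      using nabla_at[OF \<phi> W yW onbasis_tangent[OF ob i] V(1) y Z[OF i]]
      unfolding cov_def by (simp only: eval_form_def map_update list.map)
    then show "- (\<Sum>i<n. nab y (e i y) (eval_form \<phi> (?Z i)) -
      (\<Sum>p<Suc k. eval_form \<phi> ((?Z i)[p := \<lambda>y. D y (e i y) (?Z i ! p)]) y)) = eval_form (codiff k \<phi>) Ys y"
      unfolding eval_form_def[of "codiff k \<phi>"] codiff_onbasis[OF \<phi> W yW ob vs]
      by (simp del: sum.lessThan_Suc)
  qed
qed

lemma ip_eq_finner:
  assumes "onbasis x e" "\<alpha> \<in> alt_forms M E k x" "\<beta> \<in> alt_forms M E k x"
  shows "finner k x \<alpha> \<beta> = psd_form.ip (htot x) n k (\<lambda>I. \<alpha> (map e I)) (\<lambda>I. \<beta> (map e I))"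
  unfolding finner_onbasis[OF assms] psd_form.ip_def[OF htot(1)] ..

lemma alt_move_odd:
  assumes e: "onbasis x e" and \<alpha>: "\<alpha> \<in> alt_forms M E k x"
  shows "swap_odd {..<n} k (\<lambda>I. \<alpha> (map e I))"
  by (rule swap_odd_map[OF alt_swap_odd[OF \<alpha>]]) (use onbasis_tangent[OF e] in auto)

lemma dN_map:
  assumes e: "onbasis x e" and J: "J \<in> idx n (Suc k)"
  shows "dN k \<phi> x (map e J) = alt_sum_omit (\<lambda>i I. nabla k \<phi> x (e i) (map e I)) J"
  using map_onbasis_tlists[OF e J] idx_length[OF J]
  by (simp add: dN_def alt_sum_omit_def map_omit lessThan_Suc_atMost del: sum.lessThan_Suc)

lemma dN_alt:
  assumes \<phi>: "smooth_form_on M E k W \<phi>" and W: "open W" "x \<in> W"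
  shows "dN k \<phi> x \<in> alt_forms M E (Suc k) x"
proof (rule alt_formsI)
  fix vs assume vs: "vs \<in> tlists M (Suc k) x"
  have n: "nabla k \<phi> x (vs ! p) \<in> alt_forms M E k x" if "p \<le> k" for p
    using nabla_alt[OF \<phi> W tlists_nth[OF vs, of p]] that by simp
  show "dN k \<phi> x vs \<in> fibre E x"
    using vs alt_fibre[OF n tlists_omit[OF vs]]
    by (auto simp: dN_def intro!: subspace_sum subspace_scale subspace_fibre)
next
  fix vs i v w a b
  assume vs: "vs \<in> tlists M (Suc k) x" and i: "i < Suc k"
    and v: "v \<in> tangent_space M x" and w: "w \<in> tangent_space M x"
  have len: "length vs = Suc k" using vs by (simp add: tlists_def)
  have avw: "a *\<^sub>R v + b *\<^sub>R w \<in> tangent_space M x"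
    using v w by (intro subspace_add subspace_scale subspace_tangent)
  have n: "nabla k \<phi> x (vs ! p) \<in> alt_forms M E k x" if "p \<le> k" for p
    using nabla_alt[OF \<phi> W tlists_nth[OF vs, of p]] that by simp
  have ndir: "nabla k \<phi> x (a *\<^sub>R v + b *\<^sub>R w) us = a *\<^sub>R nabla k \<phi> x v us + b *\<^sub>R nabla k \<phi> x w us" for us
    using nabla_dir_sum[OF \<phi> W, of "{0, 1::nat}" "\<lambda>i. if i = 0 then v else w" "\<lambda>i. if i = 0 then a else b" us] v w
    by simp
  let ?t = "\<lambda>us p. (- 1) ^ p *\<^sub>R nabla k \<phi> x (us ! p) (omit p us)"
  have "?t (vs[i := a *\<^sub>R v + b *\<^sub>R w]) p = a *\<^sub>R ?t (vs[i := v]) p + b *\<^sub>R ?t (vs[i := w]) p" if p: "p \<le> k" for p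
  proof (cases "p = i")
    case True
    then show ?thesis using i len ndir by (simp add: omit_update scaleR_right_distrib mult.commute)
  next
    case False
    \<comment> \<open>Where slot i ends up after position p is omitted: at i if i < p, at i - 1 if i
      > p.\<close>
    obtain q where q: "q < k" "\<And>u. omit p (vs[i := u]) = (omit p vs)[q := u]"
    proof (cases "i < p")
      case True
      have "omit p (vs[i := u]) = (omit p vs)[i := u]" for u
        using True p len by (simp add: omit_def take_update_swap list_update_append)
      then show ?thesis using that[of i] True p by simp
    next
      case False
      then have "p < i" using \<open>p \<noteq> i\<close> by simp
      then have "omit p (vs[i := u]) = (omit p vs)[i - 1 := u]" for u
        using i len by (intro nth_equalityI) (auto simp: length_omit nth_omit nth_list_update)
      then show ?thesis using that[of "i - 1"] \<open>p < i\<close> i by simp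
    qed
    have "nabla k \<phi> x (vs ! p) ((omit p vs)[q := a *\<^sub>R v + b *\<^sub>R w]) =
      a *\<^sub>R nabla k \<phi> x (vs ! p) ((omit p vs)[q := v]) + b *\<^sub>R nabla k \<phi> x (vs ! p) ((omit p vs)[q := w])"
      by (rule alt_lin[OF n[OF p] tlists_omit[OF vs p] q(1) v w])
    then show ?thesis using False q(2) by (simp add: scaleR_right_distrib mult.commute)
  qed
  then show "dN k \<phi> x (vs[i := a *\<^sub>R v + b *\<^sub>R w]) = a *\<^sub>R dN k \<phi> x (vs[i := v]) + b *\<^sub>R dN k \<phi> x (vs[i := w])"
    using tlists_update[OF vs avw, of i] tlists_update[OF vs v, of i] tlists_update[OF vs w, of i]
    by (simp add: dN_def scaleR_sum_right sum.distrib)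
next
  fix vs i j assume vs: "vs \<in> tlists M (Suc k) x" and ij: "i < j" "j < Suc k" "vs ! i = vs ! j"
  have len: "length vs = Suc k" using vs by (simp add: tlists_def)
  have n: "nabla k \<phi> x (vs ! p) \<in> alt_forms M E k x" if "p \<le> k" for p
    using nabla_alt[OF \<phi> W tlists_nth[OF vs, of p]] that by simp
  let ?t = "\<lambda>p. (- 1) ^ p *\<^sub>R nabla k \<phi> x (vs ! p) (omit p vs)"
  have z: "?t p = 0" if p: "p \<le> k" "p \<noteq> i" "p \<noteq> j" for p
  proof -
    let ?i = "if i < p then i else i - 1" and ?j = "if j < p then j else j - 1"
    have "nabla k \<phi> x (vs ! p) (omit p vs) = 0"
    proof (rule alt_repeat[OF n[OF p(1)] tlists_omit[OF vs p(1)]])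
      show "?i < ?j" "?j < k" using p ij by auto
      show "omit p vs ! ?i = omit p vs ! ?j" using p ij len by (auto simp: nth_omit)
    qed
    then show ?thesis by simp
  qed
  \<comment> \<open>In each of the two terms the surviving copy of the repeated vector is moved to
    the front. The rests agree, and the total signs are \<open>(- 1) ^ (i + j - 1)\<close> and
    \<open>(- 1) ^ (i + j)\<close>.\<close>
  have "?t i + ?t j = 0"
  proof -
    have i: "i \<le> k" and j: "j \<le> k" using ij by auto
    obtain j' where j': "j = Suc j'" using ij by (cases j) auto
    note no = swap_odd_move_front[OF alt_swap_odd[OF n]]
    have "nabla k \<phi> x (vs ! i) (omit i vs) =
        (- 1) ^ j' *\<^sub>R nabla k \<phi> x (vs ! i) (omit i vs ! j' # omit j' (omit i vs))"
      using tlists_omit[OF vs i] ij j' by (intro no[OF i]) (auto simp: tlists_def)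
    moreover have "nabla k \<phi> x (vs ! j) (omit j vs) =
        (- 1) ^ i *\<^sub>R nabla k \<phi> x (vs ! j) (omit j vs ! i # omit i (omit j vs))"
      using tlists_omit[OF vs j] ij by (intro no[OF j]) (auto simp: tlists_def)
    moreover have "omit i vs ! j' = vs ! j" "omit j vs ! i = vs ! i" using ij len j' by (simp_all add: nth_omit)
    moreover have "omit j' (omit i vs) = omit i (omit j vs)" using omit_omit[of i j' vs] ij len j' by simp
    ultimately show ?thesis by (simp add: ij(3) j' mult.commute)
  qed
  moreover have "(\<Sum>p\<le>k. ?t p) = ?t i + (?t j + (\<Sum>p\<in>{..k} - {i} - {j}. ?t p))"
    using ij by (subst sum.remove[of _ i], simp, simp, subst sum.remove[of _ j], simp, simp) simp
  moreover have "(\<Sum>p\<in>{..k} - {i} - {j}. ?t p) = 0" by (rule sum.neutral) (use z in auto)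
  ultimately show "dN k \<phi> x vs = 0" using vs by (simp add: dN_def add.assoc[symmetric])
qed (simp add: dN_def)

abbreviation contract :: "nat \<Rightarrow> ('m \<Rightarrow> 'm tvec) \<Rightarrow> ('m \<Rightarrow> 'm tvec list \<Rightarrow> 'e) \<Rightarrow> 'm \<Rightarrow> 'm tvec list \<Rightarrow> 'e"
  where "contract k X \<phi> \<equiv> (\<lambda>y vs. if vs \<in> tlists M k y then \<phi> y (X y # vs) else 0)"

text \<open>Pointwise integration by parts. Adjointness expresses the first pairing by contractions
  of \<phi>, the metric property moves the derivative off \<eta>, and \<open>nabla_Cons\<close>
  splits the derivative of a contraction into the codifferential part and a term with
  \<open>D x (e i x) (e i)\<close>. The right side is the form in which \<open>dvg_frame\<close>
  computes a divergence.\<close>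

lemma divergence_identity:
  assumes e: "onframe W e" and x: "x \<in> W"
    and \<phi>: "smooth_form_on M E (Suc k) W \<phi>" and \<eta>: "smooth_form_on M E k W \<eta>"
  shows "finner (Suc k) x (d_nabla M E nab k \<eta> x) (\<phi> x) - finner k x (\<eta> x) (codiff k \<phi> x) =
    (\<Sum>i<n. e i x (\<lambda>y. finner k y (\<eta> y) (contract k (e i) \<phi> y))) -
    (\<Sum>i<n. \<Sum>j<n. g x (D x (e i x) (e i)) (e j x) * finner k x (\<eta> x) (contract k (e j) \<phi> x))"
proof -
  interpret psd_form "htot x" by (rule htot)
  have W: "open W" using e by (simp add: onframe_def)
  note ob = onframe_onbasis[OF e x]
  let ?e = "\<lambda>i. e i x"
  have eT: "e i x \<in> tangent_space M x" if "i < n" for i using onbasis_tangent[OF ob that] .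
  have ef: "vector_field_on M W (e i)" if "i < n" for i using e that by (simp add: onframe_def)
  have cs: "smooth_form_on M E k W (contract k (e i) \<phi>)" if "i < n" for i
    by (rule form_Cons[OF \<phi> ef[OF that]])
  have ca: "contract k (e i) \<phi> x \<in> alt_forms M E k x" if "i < n" for i
    by (rule form_alt[OF cs[OF that] x])
  note \<eta>a = form_alt[OF \<eta> x] and \<phi>a = form_alt[OF \<phi> x]
  have na: "nabla k \<eta> x (e i x) \<in> alt_forms M E k x" if "i < n" for i
    by (rule nabla_alt[OF \<eta> W x eT[OF that]])
  have De: "D x (e i x) (e i) \<in> tangent_space M x" if "i < n" for i
    using tan.conn_fibre[OF W x ef[OF that] eT[OF that]] by simp
  note ipf = ip_eq_finner[OF ob]
  have cm: "contract k (e i) \<phi> x (map ?e I) = \<phi> x (map ?e (i # I))" if "I \<in> idx n k" for i I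
    using map_onbasis_tlists[OF ob that] by simp
  have "finner (Suc k) x (d_nabla M E nab k \<eta> x) (\<phi> x) =
      ip n (Suc k) (\<lambda>J. dN k \<eta> x (map ?e J)) (\<lambda>J. \<phi> x (map ?e J))"
    unfolding d_nabla_eq_dN[OF \<eta> W x] by (rule ipf[OF dN_alt[OF \<eta> W x] \<phi>a])
  also have "\<dots> = ip n (Suc k) (alt_sum_omit (\<lambda>i I. nabla k \<eta> x (e i x) (map ?e I))) (\<lambda>J. \<phi> x (map ?e J))"
    by (rule ip_cong[OF dN_map[OF ob] refl])
  also have "\<dots> = (\<Sum>i<n. ip n k (\<lambda>I. nabla k \<eta> x (e i x) (map ?e I)) (\<lambda>I. \<phi> x (map ?e (i # I))))"
    by (rule ip_alt_sum_omit[OF swap_odd_move_odd[OF alt_move_odd[OF ob \<phi>a]]])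
  also have "\<dots> = (\<Sum>i<n. finner k x (nabla k \<eta> x (e i x)) (contract k (e i) \<phi> x))"
  proof (rule sum.cong[OF refl])
    fix i assume "i \<in> {..<n}"
    then have i: "i < n" by simp
    show "ip n k (\<lambda>I. nabla k \<eta> x (e i x) (map ?e I)) (\<lambda>I. \<phi> x (map ?e (i # I))) =
        finner k x (nabla k \<eta> x (e i x)) (contract k (e i) \<phi> x)"
      unfolding ipf[OF na[OF i] ca[OF i]] by (rule ip_cong[OF refl cm[symmetric]])
  qed
  also have "\<dots> = (\<Sum>i<n. e i x (\<lambda>y. finner k y (\<eta> y) (contract k (e i) \<phi> y)) -
      finner k x (\<eta> x) (nabla k (contract k (e i) \<phi>) x (e i x)))"
  proof (rule sum.cong[OF refl])
    fix i assume "i \<in> {..<n}"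
    then have i: "i < n" by simp
    show "finner k x (nabla k \<eta> x (e i x)) (contract k (e i) \<phi> x) =
      e i x (\<lambda>y. finner k y (\<eta> y) (contract k (e i) \<phi> y)) -
      finner k x (\<eta> x) (nabla k (contract k (e i) \<phi>) x (e i x))"
      using finner_metric[OF e \<eta> cs[OF i] x eT[OF i]] by simp
  qed
  finally have 1: "finner (Suc k) x (d_nabla M E nab k \<eta> x) (\<phi> x) = \<dots>" .
  have 2: "finner k x (\<eta> x) (nabla k (contract k (e i) \<phi>) x (e i x)) =
      (\<Sum>j<n. g x (D x (e i x) (e i)) (e j x) * finner k x (\<eta> x) (contract k (e j) \<phi> x)) +
      ip n k (\<lambda>I. \<eta> x (map ?e I)) (\<lambda>I. nabla (Suc k) \<phi> x (e i x) (e i x # map ?e I))" if i: "i < n" for i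
  proof -
    have "nabla k (contract k (e i) \<phi>) x (e i x) (map ?e I) =
        (\<Sum>j<n. g x (D x (e i x) (e i)) (e j x) *\<^sub>R contract k (e j) \<phi> x (map ?e I)) +
        nabla (Suc k) \<phi> x (e i x) (e i x # map ?e I)" if I: "I \<in> idx n k" for I
    proof -
      note t = map_onbasis_tlists[OF ob I]
      have "\<phi> x (D x (e i x) (e i) # map ?e I) = \<phi> x ((\<Sum>j<n. g x (D x (e i x) (e i)) (e j x) *\<^sub>R e j x) # map ?e I)"
        using onbasis_expand[OF ob De[OF i]] by simp
      also have "\<dots> = (\<Sum>j<n. g x (D x (e i x) (e i)) (e j x) *\<^sub>R \<phi> x (e j x # map ?e I))"
        by (rule alt_sum_Cons[OF \<phi>a t]) (simp add: eT)
      finally show ?thesis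
        using nabla_Cons[OF \<phi> W x eT[OF i] ef[OF i] t] t by simp
    qed
    then have "finner k x (\<eta> x) (nabla k (contract k (e i) \<phi>) x (e i x)) =
        ip n k (\<lambda>I. \<eta> x (map ?e I)) (\<lambda>I. (\<Sum>j<n. g x (D x (e i x) (e i)) (e j x) *\<^sub>R contract k (e j) \<phi> x (map ?e I)) +
        nabla (Suc k) \<phi> x (e i x) (e i x # map ?e I))"
      unfolding ipf[OF \<eta>a nabla_alt[OF cs[OF i] W x eT[OF i]]] by (intro ip_cong) auto
    also have "\<dots> = (\<Sum>j<n. g x (D x (e i x) (e i)) (e j x) *
        ip n k (\<lambda>I. \<eta> x (map ?e I)) (\<lambda>I. contract k (e j) \<phi> x (map ?e I))) +
        ip n k (\<lambda>I. \<eta> x (map ?e I)) (\<lambda>I. nabla (Suc k) \<phi> x (e i x) (e i x # map ?e I))"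
      by (simp only: ip_add_right ip_sum_right ip_scale_right)
    finally show ?thesis using ipf[OF \<eta>a ca] by simp
  qed
  have 3: "finner k x (\<eta> x) (codiff k \<phi> x) =
      - (\<Sum>i<n. ip n k (\<lambda>I. \<eta> x (map ?e I)) (\<lambda>I. nabla (Suc k) \<phi> x (e i x) (e i x # map ?e I)))"
  proof -
    have "finner k x (\<eta> x) (codiff k \<phi> x) = ip n k (\<lambda>I. \<eta> x (map ?e I)) (\<lambda>I. codiff k \<phi> x (map ?e I))"
      by (rule ipf[OF \<eta>a form_alt[OF codiff_smooth[OF e \<phi>] x]])
    also have "\<dots> = ip n k (\<lambda>I. \<eta> x (map ?e I))
        (\<lambda>I. (- 1) *\<^sub>R (\<Sum>i<n. nabla (Suc k) \<phi> x (e i x) (e i x # map ?e I)))"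
      by (intro ip_cong refl) (simp add: codiff_onbasis[OF \<phi> W x ob map_onbasis_tlists[OF ob]])
    finally show ?thesis by (simp only: ip_scale_right ip_sum_right)
  qed
  show ?thesis unfolding 1 3 using 2 by (simp add: sum_subtractf sum.distrib)
qed

end

section \<open>The divergence of a vector field in an orthonormal frame\<close>

context lc_ctx
begin

text \<open>The divergence as trace of the covariant derivative. The orthonormal basis at x is an
  argument, so that the frame formula and the coordinate formula can be used with the same
  one.\<close>

definition dvg :: "(nat \<Rightarrow> 'm tvec) \<Rightarrow> ('m \<Rightarrow> 'm tvec) \<Rightarrow> 'm \<Rightarrow> real"
  where "dvg e X x = (\<Sum>i<n. g x (D x (e i) X) (e i))"

text \<open>Leibniz rule for \<open>D\<close>. Since the frame is orthonormal and \<open>D\<close>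
  metric, the coefficients \<open>g(D\<^sub>i e\<^sub>j, e\<^sub>i)\<close> equal
  \<open>- g(D\<^sub>i e\<^sub>i, e\<^sub>j)\<close>, the form that occurs in
  \<open>divergence_identity\<close>.\<close>

lemma dvg_frame:
  assumes e: "onframe W e" and x: "x \<in> W" and X: "\<And>i. i < n \<Longrightarrow> smooth_fun_on M W (X i)"
  shows "dvg (\<lambda>i. e i x) (\<lambda>y. \<Sum>j<n. X j y *\<^sub>R e j y) x =
    (\<Sum>i<n. e i x (X i)) - (\<Sum>i<n. \<Sum>j<n. g x (D x (e i x) (e i)) (e j x) * X j x)"
proof -
  have W: "open W" using e by (simp add: onframe_def)
  have ob: "onbasis x (\<lambda>i. e i x)" using e x by (simp add: onframe_def)
  have eT: "e i x \<in> tangent_space M x" if "i < n" for i using onbasis_tangent[OF ob that] .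
  have ef: "vector_field_on M W (e i)" if "i < n" for i using e that by (simp add: onframe_def)
  have DT: "D x (e i x) (e j) \<in> tangent_space M x" if "i < n" "j < n" for i j
    using tan.conn_fibre[OF W x ef[OF that(2)] eT[OF that(1)]] by simp
  have anti: "g x (D x (e i x) (e j)) (e i x) = - g x (D x (e i x) (e i)) (e j x)" if ij: "i < n" "j < n" for i j
  proof -
    have "e i x (\<lambda>y. g y (e j y) (e i y)) = g x (D x (e i x) (e j)) (e i x) + g x (e j x) (D x (e i x) (e i))"
      by (rule tan.conn_metric[OF W x ef[OF ij(2)] ef[OF ij(1)] eT[OF ij(1)]])
    moreover have "e i x (\<lambda>y. g y (e j y) (e i y)) = e i x (\<lambda>y. if j = i then 1 else 0)"
      by (rule tangent_cong[OF eT[OF ij(1)] W x])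
        (use ij e ef in \<open>auto simp: onframe_def onbasis_def intro!: tan.h_smooth\<close>)
    moreover have "e i x (\<lambda>y. if j = i then 1 else 0) = 0" by (rule tangent_const[OF eT[OF ij(1)]])
    moreover have "g x (e j x) (D x (e i x) (e i)) = g x (D x (e i x) (e i)) (e j x)"
      by (rule g_sym[OF eT[OF ij(2)] DT[OF ij(1) ij(1)]])
    ultimately show ?thesis by simp
  qed
  have main: "g x (D x (e i x) (\<lambda>y. \<Sum>j<n. X j y *\<^sub>R e j y)) (e i x) =
      e i x (X i) - (\<Sum>j<n. g x (D x (e i x) (e i)) (e j x) * X j x)" if i: "i < n" for i
  proof -
    have "D x (e i x) (\<lambda>y. \<Sum>j<n. X j y *\<^sub>R e j y) = (\<Sum>j<n. D x (e i x) (\<lambda>y. X j y *\<^sub>R e j y))"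
      using X ef by (intro tan.conn_sum[OF W x eT[OF i]] tan.section_scale W) auto
    also have "\<dots> = (\<Sum>j<n. e i x (X j) *\<^sub>R e j x + X j x *\<^sub>R D x (e i x) (e j))"
      using X ef by (intro sum.cong refl tan.conn_scale[OF W x _ eT[OF i]]) auto
    also have "\<dots> = (\<Sum>j<n. e i x (X j) *\<^sub>R e j x) + (\<Sum>j<n. X j x *\<^sub>R D x (e i x) (e j))"
      by (rule sum.distrib)
    finally have eq: "D x (e i x) (\<lambda>y. \<Sum>j<n. X j y *\<^sub>R e j y) = \<dots>" .
    have T1: "(\<Sum>j<n. e i x (X j) *\<^sub>R e j x) \<in> tangent_space M x"
      using eT by (intro subspace_sum subspace_scale subspace_tangent) auto
    have T2: "(\<Sum>j<n. X j x *\<^sub>R D x (e i x) (e j)) \<in> tangent_space M x"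
      using DT i by (intro subspace_sum subspace_scale subspace_tangent) auto
    have "g x (D x (e i x) (\<lambda>y. \<Sum>j<n. X j y *\<^sub>R e j y)) (e i x) =
      g x (\<Sum>j<n. e i x (X j) *\<^sub>R e j x) (e i x) + g x (\<Sum>j<n. X j x *\<^sub>R D x (e i x) (e j)) (e i x)"
      unfolding eq using g_lin[OF T1 T2 eT[OF i], of 1 1] by simp
    also have "g x (\<Sum>j<n. e i x (X j) *\<^sub>R e j x) (e i x) = e i x (X i)" by (rule onbasis_coeff[OF ob i])
    also have "g x (\<Sum>j<n. X j x *\<^sub>R D x (e i x) (e j)) (e i x) = (\<Sum>j<n. X j x * g x (D x (e i x) (e j)) (e i x))"
      using DT i eT by (intro g_sum) auto
    also have "\<dots> = - (\<Sum>j<n. g x (D x (e i x) (e i)) (e j x) * X j x)"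
      unfolding sum_negf[symmetric] using anti[OF i] by (intro sum.cong refl) simp
    finally show ?thesis by (simp only: add_uminus_conv_diff)
  qed
  show ?thesis unfolding dvg_def sum_subtractf[symmetric] by (rule sum.cong[OF refl], rule main) simp
qed

end

section \<open>The divergence in coordinates\<close>

context manifold_ctx
begin

lemma smooth_fun_on_prod:
  "open W \<Longrightarrow> (\<And>i. i \<in> I \<Longrightarrow> smooth_fun_on M W (f i)) \<Longrightarrow> smooth_fun_on M W (\<lambda>y. \<Prod>i\<in>I. f i y)"
  by (induction I rule: infinite_finite_induct)
    (auto intro: smooth_fun_on_const smooth_fun_on_mult)

lemma tangent_prod:
  assumes v: "v \<in> tangent_space M x" and W: "open W" "x \<in> W" and "finite I"
    and f: "\<And>i. i \<in> I \<Longrightarrow> smooth_fun_on M W (f i)"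
  shows "v (\<lambda>y. \<Prod>i\<in>I. f i y) = (\<Sum>i\<in>I. v (f i) * (\<Prod>j\<in>I - {i}. f j x))"
  using assms(4) f
proof (induction I rule: finite_induct)
  case (insert a I)
  have "v (\<lambda>y. f a y * (\<Prod>i\<in>I. f i y)) = v (f a) * (\<Prod>i\<in>I. f i x) + f a x * v (\<lambda>y. \<Prod>i\<in>I. f i y)"
    using insert.prems by (intro tangent_mult[OF v W] smooth_fun_on_prod W) auto
  also have "v (\<lambda>y. \<Prod>i\<in>I. f i y) = (\<Sum>i\<in>I. v (f i) * (\<Prod>j\<in>I - {i}. f j x))"
    using insert by auto
  also have "f a x * \<dots> = (\<Sum>i\<in>I. v (f i) * (\<Prod>j\<in>insert a I - {i}. f j x))"
    unfolding sum_distrib_left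
  proof (rule sum.cong[OF refl])
    fix i assume i: "i \<in> I"
    then have "insert a I - {i} = insert a (I - {i})" using insert.hyps by auto
    then show "f a x * (v (f i) * (\<Prod>j\<in>I - {i}. f j x)) = v (f i) * (\<Prod>j\<in>insert a I - {i}. f j x)"
      using insert.hyps by simp
  qed
  also have "(\<Prod>i\<in>I. f i x) = (\<Prod>j\<in>insert a I - {a}. f j x)" using insert.hyps by simp
  finally show ?case using insert.hyps by simp
qed (use tangent_const[OF v] in simp)

lemma det_mat:
  "Determinant.det (Matrix.mat m m (\<lambda>(i, j). B i j)) =
    (\<Sum>p | p permutes {0..<m}. signof p * (\<Prod>i = 0..<m. B i (p i)))" for B :: "nat \<Rightarrow> nat \<Rightarrow> real"
  by (subst det_def'[of _ m]) (auto intro!: sum.cong prod.cong simp: permutes_in_image)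

lemma smooth_fun_on_det:
  assumes "open W" "\<And>i j. i < m \<Longrightarrow> j < m \<Longrightarrow> smooth_fun_on M W (\<lambda>y. B y i j)"
  shows "smooth_fun_on M W (\<lambda>y. Determinant.det (Matrix.mat m m (\<lambda>(i, j). B y i j)))"
  unfolding det_mat
  by (intro smooth_fun_on_sum smooth_fun_on_mult smooth_fun_on_prod smooth_fun_on_const assms)
    (auto simp: permutes_in_image)

text \<open>At the identity matrix the derivative of the determinant is the trace: every permutation but
  the identity moves two indices.\<close>

lemma tangent_det:
  assumes v: "v \<in> tangent_space M x" and W: "open W" "x \<in> W"
    and B: "\<And>i j. i < m \<Longrightarrow> j < m \<Longrightarrow> smooth_fun_on M W (\<lambda>y. B y i j)"
    and id: "\<And>i j. i < m \<Longrightarrow> j < m \<Longrightarrow> B x i j = (if i = j then 1 else 0)"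
  shows "v (\<lambda>y. Determinant.det (Matrix.mat m m (\<lambda>(i, j). B y i j))) = (\<Sum>i<m. v (\<lambda>y. B y i i))"
proof -
  let ?P = "{p. p permutes {0..<m}}"
  let ?s = "\<lambda>p. \<Sum>i = 0..<m. v (\<lambda>y. B y i (p i)) * (\<Prod>j\<in>{0..<m} - {i}. B x j (p j))"
  have Bp: "smooth_fun_on M W (\<lambda>y. B y i (p i))" if "p \<in> ?P" "i \<in> {0..<m}" for p i
    using B[of i "p i"] that permutes_in_image[of p "{0..<m}" i] by simp
  have "v (\<lambda>y. Determinant.det (Matrix.mat m m (\<lambda>(i, j). B y i j))) =
      (\<Sum>p\<in>?P. v (\<lambda>y. signof p * (\<Prod>i = 0..<m. B y i (p i))))"
    unfolding det_mat
    by (rule tangent_sum[OF v W]) (intro smooth_fun_on_mult smooth_fun_on_prod smooth_fun_on_const W Bp, auto)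
  also have "\<dots> = (\<Sum>p\<in>?P. signof p * ?s p)"
  proof (rule sum.cong[OF refl])
    fix p assume p: "p \<in> ?P"
    have "smooth_fun_on M W (\<lambda>y. \<Prod>i = 0..<m. B y i (p i))"
      by (intro smooth_fun_on_prod W Bp[OF p])
    from tangent_mult[OF v W smooth_fun_on_const[OF W(1), of "signof p"] this]
    have "v (\<lambda>y. signof p * (\<Prod>i = 0..<m. B y i (p i))) = signof p * v (\<lambda>y. \<Prod>i = 0..<m. B y i (p i))"
      using tangent_const[OF v] by simp
    also have "v (\<lambda>y. \<Prod>i = 0..<m. B y i (p i)) = ?s p"
      by (rule tangent_prod[OF v W finite_atLeastLessThan Bp[OF p]])
    finally show "v (\<lambda>y. signof p * (\<Prod>i = 0..<m. B y i (p i))) = signof p * ?s p" .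
  qed
  also have "\<dots> = (\<Sum>p\<in>{id}. signof p * ?s p)"
  proof (rule sum.mono_neutral_right)
    show "finite ?P" by (rule finite_permutations) simp
    show "{id} \<subseteq> ?P" by (simp add: permutes_id)
    show "\<forall>p\<in>?P - {id}. signof p * ?s p = 0"
    proof
      fix p assume "p \<in> ?P - {id}"
      then have p: "p permutes {0..<m}" "p \<noteq> id" by auto
      then obtain a where a: "p a \<noteq> a" by (metis eq_id_iff)
      have aS: "a \<in> {0..<m}" using a p(1) by (meson permutes_not_in)
      have paS: "p a \<in> {0..<m}" using permutes_in_image[OF p(1)] aS by simp
      have ppa: "p (p a) \<noteq> p a" using a permutes_inj[OF p(1)] by (meson injD)
      have "(\<Prod>j\<in>{0..<m} - {i}. B x j (p j)) = 0" for i
      proof (rule prod_zero)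
        have pS: "p j \<in> {0..<m}" if "j \<in> {0..<m}" for j using permutes_in_image[OF p(1)] that by simp
        show "\<exists>j\<in>{0..<m} - {i}. B x j (p j) = 0"
        proof (cases "i = a")
          case True
          then show ?thesis using id[of "p a" "p (p a)"] pS[OF paS] paS ppa a by (intro bexI[of _ "p a"]) auto
        next
          case False
          then show ?thesis using id[of a "p a"] paS aS a by (intro bexI[of _ a]) auto
        qed
      qed simp
      then show "signof p * ?s p = 0" by (simp only: mult_zero_right sum.neutral_const)
    qed
  qed
  also have "\<dots> = (\<Sum>i<m. v (\<lambda>y. B y i i))"
    by (simp add: id lessThan_atLeast0)
  finally show ?thesis .
qed

lemma det_gram_change:
  fixes A G :: "nat \<Rightarrow> nat \<Rightarrow> real"
  shows "Determinant.det (Matrix.mat m m (\<lambda>(i, j). \<Sum>p<m. \<Sum>q<m. A i p * A j q * G p q)) =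
    (Determinant.det (Matrix.mat m m (\<lambda>(i, j). A i j)))\<^sup>2 * Determinant.det (Matrix.mat m m (\<lambda>(i, j). G i j))"
proof -
  let ?A = "Matrix.mat m m (\<lambda>(i, j). A i j)" and ?G = "Matrix.mat m m (\<lambda>(i, j). G i j)"
  have "Matrix.mat m m (\<lambda>(i, j). \<Sum>p<m. \<Sum>q<m. A i p * A j q * G p q) = ?A * (?G * transpose_mat ?A)"
    by (rule eq_matI)
      (auto simp: scalar_prod_def lessThan_atLeast0 sum_distrib_left mult_ac intro!: sum.cong)
  moreover have A: "?A \<in> carrier_mat m m" and G: "?G \<in> carrier_mat m m"
    and At: "transpose_mat ?A \<in> carrier_mat m m" by auto
  moreover have "Determinant.det (?A * (?G * transpose_mat ?A)) =
      Determinant.det ?A * (Determinant.det ?G * Determinant.det ?A)"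
    unfolding det_mult[OF A mult_carrier_mat[OF G At]] det_mult[OF G At] det_transpose[OF A] ..
  ultimately show ?thesis by (simp only: power2_eq_square mult_ac)
qed

end

section \<open>The Riemannian density and its derivative\<close>

context lc_ctx
begin

lemma gram_change:
  assumes e: "onbasis x e" and c: "c \<in> atlas M" "x \<in> fst c" and y: "y \<in> fst c"
  shows "g y (const_field c (e i) y) (const_field c (e j) y) =
    (\<Sum>p<n. \<Sum>q<n. e i (\<lambda>z. snd c z p) * e j (\<lambda>z. snd c z q) * g y (coord_vec M c p y) (coord_vec M c q y))"
proof -
  have T: "coord_vec M c p y \<in> tangent_space M y" if "p < n" for p by (rule coord_vec_tangent[OF c(1) y that])
  have CT: "const_field c u y \<in> tangent_space M y" for u
    by (rule field_tangent[OF vector_field_const_field[OF c(1)] y])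
  have 1: "g y (const_field c (e i) y) w = (\<Sum>p<n. e i (\<lambda>z. snd c z p) * g y (coord_vec M c p y) w)"
    if "w \<in> tangent_space M y" for w i
    unfolding const_field_def using T that by (intro g_sum) auto
  have "g y (const_field c (e i) y) (const_field c (e j) y) =
      (\<Sum>p<n. e i (\<lambda>z. snd c z p) * g y (const_field c (e j) y) (coord_vec M c p y))"
    unfolding 1[OF CT] using g_sym[OF T CT] by (intro sum.cong refl) simp
  also have "\<dots> = (\<Sum>p<n. e i (\<lambda>z. snd c z p) * (\<Sum>q<n. e j (\<lambda>z. snd c z q) * g y (coord_vec M c q y) (coord_vec M c p y)))"
    using 1[OF T] by (intro sum.cong refl) simp
  also have "\<dots> = (\<Sum>p<n. \<Sum>q<n. e i (\<lambda>z. snd c z p) * e j (\<lambda>z. snd c z q) * g y (coord_vec M c p y) (coord_vec M c q y))"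
    unfolding sum_distrib_left using g_sym[OF T T] by (intro sum.cong refl) (simp add: mult_ac)
  finally show ?thesis .
qed

text \<open>Replacing the coordinate fields by the constant-coordinate extensions of e multiplies
  the Gram determinant by a factor independent of y and makes the Gram matrix the identity at x. The
  determinant then has to be differentiated only at the identity.\<close>

lemma gram_det_change:
  assumes e: "onbasis x e" and c: "c \<in> atlas M" "x \<in> fst c" and y: "y \<in> fst c"
  shows "Determinant.det (Matrix.mat n n (\<lambda>(i, j). g y (const_field c (e i) y) (const_field c (e j) y))) =
    (Determinant.det (Matrix.mat n n (\<lambda>(i, j). e i (\<lambda>z. snd c z j))))\<^sup>2 * gram_det M g c y"
  unfolding gram_change[OF assms] gram_det_def by (rule det_gram_change)

lemma gram_det_at:
  assumes e: "onbasis x e" and c: "c \<in> atlas M" "x \<in> fst c"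
  shows "(Determinant.det (Matrix.mat n n (\<lambda>(i, j). e i (\<lambda>z. snd c z j))))\<^sup>2 * gram_det M g c x = 1"
proof -
  have "Matrix.mat n n (\<lambda>(i, j). g x (const_field c (e i) x) (const_field c (e j) x)) = 1\<^sub>m n"
    using e const_field_at[OF c] by (intro eq_matI) (auto simp: onbasis_def)
  then show ?thesis unfolding gram_det_change[OF e c c(2), symmetric] by simp
qed

lemma gram_det_pos:
  assumes c: "c \<in> atlas M" "x \<in> fst c"
  shows "gram_det M g c x > 0"
  using gram_det_at[OF onbasis_onb c]
  by (metis mult_nonneg_nonpos not_le not_one_le_zero zero_le_power2)

lemma gram_det_smooth:
  assumes c: "c \<in> atlas M"
  shows "smooth_fun_on M (fst c) (gram_det M g c)"
  unfolding gram_det_def[abs_def]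
  by (intro smooth_fun_on_det tan.h_smooth chart_open coord_vec_field c)

lemma sqrt_gram_det_smooth:
  assumes c: "c \<in> atlas M"
  shows "smooth_fun_on M (fst c) (\<lambda>y. sqrt (gram_det M g c y))"
proof -
  have "smooth_fun_on M (fst c) (\<lambda>y. gram_det M g c y powr (1 / 2))"
    by (intro smooth_fun_on_powr gram_det_smooth chart_open c gram_det_pos)
  then show ?thesis
    by (rule smooth_fun_on_cong) (use chart_open c gram_det_pos[OF c] in \<open>auto simp: powr_half_sqrt less_imp_le\<close>)
qed

text \<open>Jacobi's formula. After normalization at x, the derivative of the determinant is the sum
  of the derivatives of the diagonal entries \<open>g(C\<^sub>i, C\<^sub>i)\<close>, each twice
  \<open>g(D\<^sub>l C\<^sub>i, e\<^sub>i)\<close>. Exchanging direction and field turns the sum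
  into twice the divergence of the l-th coordinate field.\<close>

lemma coord_vec_gram_det:
  assumes e: "onbasis x e" and c: "c \<in> atlas M" "x \<in> fst c" and l: "l < n"
  shows "coord_vec M c l x (gram_det M g c) = 2 * gram_det M g c x * dvg e (coord_vec M c l) x"
proof -
  note U = chart_open[OF c(1)]
  let ?v = "coord_vec M c l x"
  let ?C = "\<lambda>i. const_field c (e i)"
  let ?B = "\<lambda>y i j. g y (?C i y) (?C j y)"
  define a where "a = (Determinant.det (Matrix.mat n n (\<lambda>(i, j). e i (\<lambda>z. snd c z j))))\<^sup>2"
  have v: "?v \<in> tangent_space M x" by (rule coord_vec_tangent[OF c l])
  have Cf: "vector_field_on M (fst c) (?C i)" for i by (rule vector_field_const_field[OF c(1)])
  have Cx: "?C i x = e i" if "i < n" for i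
    by (rule const_field_at[OF c onbasis_tangent[OF e that]])
  have DT: "D x ?v (?C i) \<in> tangent_space M x" for i
    using tan.conn_fibre[OF U c(2) Cf v] by simp
  \<comment> \<open>The field \<open>?C i\<close> has constant coefficients in coordinate fields,
    and these commute; torsion freeness then exchanges the direction with the differentiated
    field.\<close>
  have torsion: "D x ?v (?C i) = D x (e i) (coord_vec M c l)" if i: "i < n" for i
  proof -
    have "D x ?v (?C i) = (\<Sum>j<n. D x ?v (\<lambda>y. e i (\<lambda>z. snd c z j) *\<^sub>R coord_vec M c j y))"
      unfolding const_field_def
      by (intro tan.conn_sum[OF U c(2) v] tan.section_scale smooth_fun_on_const coord_vec_field c U) simp
    also have "\<dots> = (\<Sum>j<n. e i (\<lambda>z. snd c z j) *\<^sub>R D x ?v (coord_vec M c j))"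
      by (intro sum.cong refl tan.conn_scale_const[OF U c(2) _ v] coord_vec_field c) simp
    also have "\<dots> = (\<Sum>j<n. e i (\<lambda>z. snd c z j) *\<^sub>R D x (coord_vec M c j x) (coord_vec M c l))"
    proof (rule sum.cong[OF refl])
      fix j assume "j \<in> {..<n}"
      then have j: "j < n" by simp
      have "D x ?v (coord_vec M c j) - D x (coord_vec M c j x) (coord_vec M c l) = 0"
        unfolding torsion_free[OF U c(2) coord_vec_field[OF c(1) l] coord_vec_field[OF c(1) j], symmetric]
        by (rule lie_bracket_coord_vec[OF c l j])
      then show "e i (\<lambda>z. snd c z j) *\<^sub>R D x ?v (coord_vec M c j) =
          e i (\<lambda>z. snd c z j) *\<^sub>R D x (coord_vec M c j x) (coord_vec M c l)" by (simp only: right_minus_eq)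
    qed
    also have "\<dots> = D x (\<Sum>j<n. e i (\<lambda>z. snd c z j) *\<^sub>R coord_vec M c j x) (coord_vec M c l)"
      by (rule tan.conn_dir_sum[OF U c(2) coord_vec_field[OF c(1) l], symmetric])
        (use coord_vec_tangent[OF c] in simp)
    also have "(\<Sum>j<n. e i (\<lambda>z. snd c z j) *\<^sub>R coord_vec M c j x) = e i"
      by (rule tangent_expand[OF onbasis_tangent[OF e i] c, symmetric])
    finally show ?thesis .
  qed
  have "?v (\<lambda>y. Determinant.det (Matrix.mat n n (\<lambda>(i, j). ?B y i j))) = (\<Sum>i<n. ?v (\<lambda>y. ?B y i i))"
    by (rule tangent_det[OF v U c(2)]) (use e Cx in \<open>auto intro: tan.h_smooth[OF U Cf Cf] simp: onbasis_def\<close>)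
  also have "\<dots> = (\<Sum>i<n. 2 * g x (D x (e i) (coord_vec M c l)) (e i))"
  proof (rule sum.cong[OF refl])
    fix i assume "i \<in> {..<n}"
    then have i: "i < n" by simp
    have "?v (\<lambda>y. ?B y i i) = g x (D x ?v (?C i)) (e i) + g x (e i) (D x ?v (?C i))"
      using tan.conn_metric[OF U c(2) Cf Cf v, of i i] Cx[OF i] by simp
    also have "g x (e i) (D x ?v (?C i)) = g x (D x ?v (?C i)) (e i)"
      by (rule g_sym[OF onbasis_tangent[OF e i] DT])
    finally show "?v (\<lambda>y. ?B y i i) = 2 * g x (D x (e i) (coord_vec M c l)) (e i)"
      unfolding torsion[OF i] by simp
  qed
  also have "\<dots> = 2 * dvg e (coord_vec M c l) x" by (simp add: dvg_def sum_distrib_left)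
  finally have 1: "?v (\<lambda>y. Determinant.det (Matrix.mat n n (\<lambda>(i, j). ?B y i j))) = \<dots>" .
  have sm: "smooth_fun_on M (fst c) (\<lambda>y. a * gram_det M g c y)"
    by (intro smooth_fun_on_mult smooth_fun_on_const gram_det_smooth U c)
  have "?v (\<lambda>y. a * gram_det M g c y) = ?v (\<lambda>y. Determinant.det (Matrix.mat n n (\<lambda>(i, j). ?B y i j)))"
    by (rule tangent_cong[OF v U c(2) sm]) (simp only: gram_det_change[OF e c] a_def)
  moreover have "?v (\<lambda>y. a * gram_det M g c y) = a * ?v (gram_det M g c)"
    using tangent_mult[OF v U c(2) smooth_fun_on_const[OF U, of a] gram_det_smooth[OF c(1)]]
      tangent_const[OF v] by simp
  ultimately have "a * ?v (gram_det M g c) = 2 * dvg e (coord_vec M c l) x" using 1 by simp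
  moreover have "a * gram_det M g c x = 1" unfolding a_def by (rule gram_det_at[OF e c])
  ultimately show ?thesis
    by (metis mult.assoc mult.commute mult.right_neutral)
qed

lemma coord_vec_sqrt_gram_det:
  assumes e: "onbasis x e" and c: "c \<in> atlas M" "x \<in> fst c" and l: "l < n"
  shows "coord_vec M c l x (\<lambda>y. sqrt (gram_det M g c y)) = sqrt (gram_det M g c x) * dvg e (coord_vec M c l) x"
proof -
  note U = chart_open[OF c(1)]
  let ?v = "coord_vec M c l x" and ?r = "\<lambda>y. sqrt (gram_det M g c y)"
  have v: "?v \<in> tangent_space M x" by (rule coord_vec_tangent[OF c l])
  have pos: "?r x > 0" using gram_det_pos[OF c] by simp
  have "2 * gram_det M g c x * dvg e (coord_vec M c l) x = ?v (gram_det M g c)"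
    by (rule coord_vec_gram_det[OF assms, symmetric])
  also have "\<dots> = ?v (\<lambda>y. ?r y * ?r y)"
    by (rule tangent_cong[OF v U c(2) gram_det_smooth[OF c(1)]])
      (use gram_det_pos[OF c(1)] in \<open>simp add: less_imp_le\<close>)
  also have "\<dots> = ?v ?r * ?r x + ?r x * ?v ?r"
    by (intro tangent_mult[OF v U c(2)] sqrt_gram_det_smooth c)
  also have "\<dots> = 2 * ?r x * ?v ?r" by simp
  finally have eq: "2 * gram_det M g c x * dvg e (coord_vec M c l) x = 2 * ?r x * ?v ?r" .
  define r where "r = ?r x"
  have rr: "gram_det M g c x = r * r" and r: "r \<noteq> 0"
    unfolding r_def using gram_det_pos[OF c] by auto
  have "(2 * r) * (r * dvg e (coord_vec M c l) x) = (2 * r) * ?v ?r"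
    using eq[folded r_def] unfolding rr by simp
  then have "r * dvg e (coord_vec M c l) x = ?v ?r"
    by (rule mult_left_cancel[THEN iffD1, rotated]) (use r in simp)
  then show ?thesis unfolding r_def by (rule sym)
qed

text \<open>The Leibniz rule for \<open>D\<close> gives the derivatives of the components of X plus
  the components times the divergences of the coordinate fields; by
  \<open>coord_vec_sqrt_gram_det\<close> the latter are logarithmic derivatives of the
  density.\<close>

lemma dvg_coord:
  assumes e: "onbasis x e" and c: "c \<in> atlas M" "x \<in> fst c" and W: "open W" "x \<in> W" "W \<subseteq> fst c"
    and X: "vector_field_on M W X"
  shows "sqrt (gram_det M g c x) * dvg e X x =
    (\<Sum>l<n. coord_vec M c l x (\<lambda>y. sqrt (gram_det M g c y) * X y (\<lambda>z. snd c z l)))"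
proof -
  let ?X = "\<lambda>l y. X y (\<lambda>z. snd c z l)" and ?d = "\<lambda>l. coord_vec M c l"
  have Xs: "smooth_fun_on M W (?X l)" for l
    by (rule smooth_fun_on_field[OF W(1) X smooth_fun_on_subset[OF smooth_fun_on_coord[OF c(1)] W(3)]])
  have df: "vector_field_on M W (?d l)" if "l < n" for l
    by (rule tan.section_subset[OF coord_vec_field[OF c(1) that] W(3)])
  have eT: "e i \<in> tangent_space M x" if "i < n" for i by (rule onbasis_tangent[OF e that])
  have dT: "?d l x \<in> tangent_space M x" if "l < n" for l by (rule coord_vec_tangent[OF c that])
  have DT: "D x (e i) (?d l) \<in> tangent_space M x" if "i < n" "l < n" for i l
    using tan.conn_fibre[OF W(1,2) df[OF that(2)] eT[OF that(1)]] by simp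
  have DX: "g x (D x (e i) X) (e i) = (\<Sum>l<n. e i (?X l) * g x (?d l x) (e i)) +
      (\<Sum>l<n. ?X l x * g x (D x (e i) (?d l)) (e i))" if i: "i < n" for i
  proof -
    have "D x (e i) X = D x (e i) (\<lambda>y. \<Sum>l<n. ?X l y *\<^sub>R ?d l y)"
    proof (rule tan.conn_cong[OF W(1,2) _ eT[OF i]])
      show "vector_field_on M W (\<lambda>y. \<Sum>l<n. ?X l y *\<^sub>R ?d l y)"
        using Xs df by (intro tan.section_sum tan.section_scale W) auto
      fix y assume "y \<in> W"
      then show "X y = (\<Sum>l<n. ?X l y *\<^sub>R ?d l y)"
        using tangent_expand[OF field_tangent[OF X] c(1)] W(3) by blast
    qed
    also have "\<dots> = (\<Sum>l<n. D x (e i) (\<lambda>y. ?X l y *\<^sub>R ?d l y))"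
      using Xs df by (intro tan.conn_sum[OF W(1,2) eT[OF i]] tan.section_scale W) auto
    also have "\<dots> = (\<Sum>l<n. e i (?X l) *\<^sub>R ?d l x + ?X l x *\<^sub>R D x (e i) (?d l))"
      using Xs df by (intro sum.cong refl tan.conn_scale[OF W(1,2) _ eT[OF i]]) auto
    also have "\<dots> = (\<Sum>l<n. e i (?X l) *\<^sub>R ?d l x) + (\<Sum>l<n. ?X l x *\<^sub>R D x (e i) (?d l))"
      by (rule sum.distrib)
    finally have eq: "D x (e i) X = \<dots>" .
    have T1: "(\<Sum>l<n. e i (?X l) *\<^sub>R ?d l x) \<in> tangent_space M x"
      using dT by (intro subspace_sum subspace_scale subspace_tangent) auto
    have T2: "(\<Sum>l<n. ?X l x *\<^sub>R D x (e i) (?d l)) \<in> tangent_space M x"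
      using DT i by (intro subspace_sum subspace_scale subspace_tangent) auto
    have "g x (D x (e i) X) (e i) = g x (\<Sum>l<n. e i (?X l) *\<^sub>R ?d l x) (e i) +
        g x (\<Sum>l<n. ?X l x *\<^sub>R D x (e i) (?d l)) (e i)"
      unfolding eq using g_lin[OF T1 T2 eT[OF i], of 1 1] by simp
    also have "g x (\<Sum>l<n. e i (?X l) *\<^sub>R ?d l x) (e i) = (\<Sum>l<n. e i (?X l) * g x (?d l x) (e i))"
      using dT eT[OF i] by (intro g_sum) auto
    also have "g x (\<Sum>l<n. ?X l x *\<^sub>R D x (e i) (?d l)) (e i) = (\<Sum>l<n. ?X l x * g x (D x (e i) (?d l)) (e i))"
      using DT i eT[OF i] by (intro g_sum) auto
    finally show ?thesis .
  qed
  have dX: "?d l x (?X l) = (\<Sum>i<n. e i (?X l) * g x (?d l x) (e i))" if l: "l < n" for l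
  proof -
    have "?d l x (?X l) = (\<Sum>i<n. g x (?d l x) (e i) *\<^sub>R e i) (?X l)"
      by (rule fun_cong[OF onbasis_expand[OF e dT[OF l]]])
    then show ?thesis by (simp add: sum_fun_apply mult.commute)
  qed
  have "dvg e X x = (\<Sum>i<n. (\<Sum>l<n. e i (?X l) * g x (?d l x) (e i)) + (\<Sum>l<n. ?X l x * g x (D x (e i) (?d l)) (e i)))"
    unfolding dvg_def by (intro sum.cong refl) (simp only: DX lessThan_iff)
  also have "\<dots> = (\<Sum>l<n. \<Sum>i<n. e i (?X l) * g x (?d l x) (e i)) +
      (\<Sum>l<n. \<Sum>i<n. ?X l x * g x (D x (e i) (?d l)) (e i))"
    unfolding sum.distrib by (intro arg_cong2[of _ _ _ _ plus] sum.swap)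
  also have "(\<Sum>l<n. \<Sum>i<n. e i (?X l) * g x (?d l x) (e i)) = (\<Sum>l<n. ?d l x (?X l))"
    by (intro sum.cong refl) (simp only: dX lessThan_iff)
  also have "(\<Sum>l<n. \<Sum>i<n. ?X l x * g x (D x (e i) (?d l)) (e i)) = (\<Sum>l<n. ?X l x * dvg e (?d l) x)"
    unfolding dvg_def by (simp only: sum_distrib_left)
  finally have "sqrt (gram_det M g c x) * dvg e X x =
      (\<Sum>l<n. sqrt (gram_det M g c x) * ?d l x (?X l) + sqrt (gram_det M g c x) * dvg e (?d l) x * ?X l x)"
    by (simp add: distrib_left sum_distrib_left sum.distrib mult_ac)
  also have "\<dots> = (\<Sum>l<n. ?d l x (\<lambda>y. sqrt (gram_det M g c y) * ?X l y))"
  proof (rule sum.cong[OF refl])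
    fix l assume "l \<in> {..<n}"
    then have l: "l < n" by simp
    have "?d l x (\<lambda>y. sqrt (gram_det M g c y) * ?X l y) =
        ?d l x (\<lambda>y. sqrt (gram_det M g c y)) * ?X l x + sqrt (gram_det M g c x) * ?d l x (?X l)"
      by (intro tangent_mult[OF dT[OF l] W(1,2)] Xs smooth_fun_on_subset[OF sqrt_gram_det_smooth[OF c(1)] W(3)])
    then show "sqrt (gram_det M g c x) * ?d l x (?X l) + sqrt (gram_det M g c x) * dvg e (?d l) x * ?X l x =
        ?d l x (\<lambda>y. sqrt (gram_det M g c y) * ?X l y)"
      unfolding coord_vec_sqrt_gram_det[OF e c l] by simp
  qed
  finally show ?thesis .
qed

end

section \<open>Integration in charts\<close>

abbreviation lborel_Rn :: "nat \<Rightarrow> (nat \<Rightarrow> real) measure"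
  where "lborel_Rn n \<equiv> (\<Pi>\<^sub>M i\<in>{..<n}. lborel)"

lemma zero_ext_Rn: "zero_ext n z \<in> Rn n"
  by (simp add: zero_ext_def Rn_def)

lemma zero_ext_measurable [measurable]: "zero_ext n \<in> borel_measurable (lborel_Rn n)"
proof (rule measurable_coordinatewise_then_product)
  fix i show "(\<lambda>z. zero_ext n z i) \<in> borel_measurable (lborel_Rn n)"
  proof (cases "i < n")
    case True
    then have "(\<lambda>z. z i) \<in> measurable (lborel_Rn n) lborel"
      by (intro measurable_component_singleton) simp
    then show ?thesis using True by (simp add: zero_ext_def)
  qed (simp add: zero_ext_def)
qed

lemma closed_Rn: "closed (Rn n)"
proof -
  have "Rn n = (\<Inter>i\<in>{n..}. {y. y i = 0})" by (auto simp: Rn_def)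
  moreover have "closed {y::nat \<Rightarrow> real. y i = 0}" for i
    by (intro closed_Collect_eq continuous_on_product_coordinates continuous_on_const)
  ultimately show ?thesis by (simp add: closed_INT)
qed

lemma open_Rn_Rn: "open_Rn n (Rn n)"
  by simp

lemma borel_open_Rn: "open_Rn n S \<Longrightarrow> S \<in> sets borel"
  using closed_Rn by (auto simp: openin_open intro!: sets.Int)

lemma compact_coord_bound:
  assumes "compact (K :: (nat \<Rightarrow> real) set)"
  shows "\<exists>r>0. \<forall>y\<in>K. \<forall>i<n. \<bar>y i\<bar> \<le> r"
proof -
  have "\<exists>b. \<forall>y\<in>K. \<bar>y i\<bar> \<le> b" for i
  proof -
    have "compact ((\<lambda>y. y i) ` K)"
      by (intro compact_continuous_image assms continuous_on_subset[OF continuous_on_product_coordinates]) simp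
    then show ?thesis using compact_imp_bounded[of "(\<lambda>y. y i) ` K"] by (auto simp: bounded_iff)
  qed
  then obtain b where b: "\<forall>i. \<forall>y\<in>K. \<bar>y i\<bar> \<le> b i" by metis
  define r where "r = 1 + (\<Sum>i<n. \<bar>b i\<bar>)"
  have "\<bar>b i\<bar> \<le> (\<Sum>i<n. \<bar>b i\<bar>)" if "i < n" for i
    using that by (intro member_le_sum) auto
  then have "\<bar>y i\<bar> \<le> r" if "y \<in> K" "i < n" for y i using b that unfolding r_def by (smt (verit))
  moreover have "r > 0" unfolding r_def by (simp add: add_pos_nonneg sum_nonneg)
  ultimately show ?thesis by blast
qed

lemma emeasure_box_lborel_Rn:
  "a \<le> b \<Longrightarrow> emeasure (lborel_Rn n) (\<Pi>\<^sub>E i\<in>{..<n}. {y i + a..y i + b}) = ennreal ((b - a) ^ n)"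
  for a b :: real
proof -
  assume ab: "a \<le> b"
  interpret product_sigma_finite "\<lambda>_::nat. lborel :: real measure" by standard
  have "emeasure (lborel_Rn n) (\<Pi>\<^sub>E i\<in>{..<n}. {y i + a..y i + b}) = (\<Prod>i<n. emeasure lborel {y i + a..y i + b})"
    by (rule emeasure_PiM) auto
  also have "\<dots> = (\<Prod>i<n. ennreal (b - a))" using ab by (intro prod.cong refl) simp
  also have "\<dots> = ennreal ((b - a) ^ n)" using ab by (simp add: ennreal_power)
  finally show ?thesis .
qed

context
  fixes n :: nat and f :: "(nat \<Rightarrow> real) \<Rightarrow> real" and K :: "(nat \<Rightarrow> real) set"
  assumes f: "continuous_on (Rn n) f" and K: "compact K" "K \<subseteq> Rn n"
    and supp: "\<And>z. z \<in> Rn n \<Longrightarrow> z \<notin> K \<Longrightarrow> f z = 0"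
begin

lemma integrable_lborel_Rn: "integrable (lborel_Rn n) (\<lambda>z. f (zero_ext n z))"
proof -
  obtain r where r: "r > 0" "\<forall>y\<in>K. \<forall>i<n. \<bar>y i\<bar> \<le> r" using compact_coord_bound[OF K(1)] by blast
  have "compact (f ` K)" by (intro compact_continuous_image K continuous_on_subset[OF f])
  then obtain B where B: "\<forall>y\<in>K. \<bar>f y\<bar> \<le> B" using compact_imp_bounded[of "f ` K"] by (auto simp: bounded_iff)
  let ?A = "\<Pi>\<^sub>E i\<in>{..<n}. {0 + - r..0 + r}"
  show ?thesis
  proof (rule integrableI_bounded_set[of ?A _ _ "\<bar>B\<bar>"])
    show "?A \<in> sets (lborel_Rn n)" by (intro sets_PiM_I_finite) auto
    \<comment> \<open>Continuity is known on the closed set \<open>Rn n\<close> only; extension by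
      zero makes f Borel on the whole sequence space, where \<open>zero_ext\<close> takes its
      values.\<close>
    have "(\<lambda>y. indicator (Rn n) y *\<^sub>R f y) \<in> borel_measurable borel"
      by (intro borel_measurable_continuous_on_indicator f borel_closed closed_Rn)
    from measurable_compose[OF zero_ext_measurable[of n] this]
    show "(\<lambda>z. f (zero_ext n z)) \<in> borel_measurable (lborel_Rn n)" by (simp add: zero_ext_Rn)
    have "emeasure (lborel_Rn n) ?A = ennreal ((r - - r) ^ n)"
      by (rule emeasure_box_lborel_Rn[where y = "\<lambda>_. 0"]) (use r in simp)
    then show "emeasure (lborel_Rn n) ?A < \<infinity>" by simp
    have nz: "z \<in> ?A" if "z \<in> space (lborel_Rn n)" "zero_ext n z \<in> K" for z
    proof -
      have "z i \<in> {0 + - r..0 + r}" if "i < n" for i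
        using bspec[OF r(2) \<open>zero_ext n z \<in> K\<close>] that by (force simp: zero_ext_def abs_le_iff)
      then show ?thesis using that(1) by (simp add: space_PiM PiE_iff)
    qed
    show "AE z in lborel_Rn n. z \<in> ?A \<longrightarrow> norm (f (zero_ext n z)) \<le> \<bar>B\<bar>"
    proof (rule AE_I2, rule impI)
      fix z :: "nat \<Rightarrow> real"
      show "norm (f (zero_ext n z)) \<le> \<bar>B\<bar>"
        using B supp[OF zero_ext_Rn, of z] by (cases "zero_ext n z \<in> K") fastforce+
    qed
    show "AE z in lborel_Rn n. z \<notin> ?A \<longrightarrow> f (zero_ext n z) = 0"
      by (rule AE_I2) (use nz supp zero_ext_Rn in blast)
  qed
qed

text \<open>A positive value persists on a closed box of side r, whose measure \<open>r ^ n\<close>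
  is positive, also for n = 0.\<close>

lemma continuous_nonneg_integral_eq_0:
  assumes "\<And>z. z \<in> Rn n \<Longrightarrow> f z \<ge> 0" and int: "(\<integral>z. f (zero_ext n z) \<partial>lborel_Rn n) = 0"
    and y: "y \<in> Rn n"
  shows "f y = 0"
proof (rule ccontr)
  assume "f y \<noteq> 0"
  then have pos: "f y > 0" using assms(1)[OF y] by simp
  obtain r where r: "r > 0" "\<forall>z\<in>box_Rn n y r \<inter> Rn n. \<bar>f z - f y\<bar> < f y"
    using f[unfolded continuous_on_open_Rn_iff[OF open_Rn_Rn]] y pos by blast
  let ?A = "\<Pi>\<^sub>E i\<in>{..<n}. {y i + - (r / 2)..y i + r / 2}"
  have AE0: "AE z in lborel_Rn n. f (zero_ext n z) = 0"
    using int integral_nonneg_eq_0_iff_AE[OF integrable_lborel_Rn] assms(1) zero_ext_Rn by auto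
  have A: "f (zero_ext n z) > 0" if "z \<in> ?A" for z
  proof -
    have "\<bar>z i - y i\<bar> < r" if "i < n" for i
    proof -
      have "z i \<in> {y i + - (r / 2)..y i + r / 2}" using that \<open>z \<in> ?A\<close> by (simp add: PiE_iff)
      then show ?thesis using r(1) by (simp add: abs_le_iff abs_less_iff)
    qed
    then have "zero_ext n z \<in> box_Rn n y r \<inter> Rn n" by (simp add: box_Rn_def zero_ext_def Rn_def)
    then have "\<bar>f (zero_ext n z) - f y\<bar> < f y" using r(2) by blast
    then show ?thesis by linarith
  qed
  have AE: "AE z in lborel_Rn n. z \<notin> ?A"
    using AE0
  proof (rule eventually_mono)
    fix z assume "f (zero_ext n z) = 0" then show "z \<notin> ?A" using A[of z] by (intro notI) simp
  qed
  have "{z \<in> space (lborel_Rn n). \<not> z \<notin> ?A} = ?A"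
    unfolding space_PiM by (simp only: not_not) (simp add: set_eq_iff PiE_iff, blast)
  moreover have "?A \<in> sets (lborel_Rn n)" by (intro sets_PiM_I_finite) auto
  ultimately have "emeasure (lborel_Rn n) ?A = 0" using AE_iff_measurable[of ?A "lborel_Rn n" "\<lambda>z. z \<notin> ?A"] AE by simp
  moreover have "emeasure (lborel_Rn n) ?A = ennreal ((r / 2 - - (r / 2)) ^ n)"
    by (rule emeasure_box_lborel_Rn) (use r in simp)
  ultimately show False using zero_less_power[OF r(1), of n] by (simp add: ennreal_eq_0_iff)
qed

end

text \<open>Fubini with coordinate i innermost: by the fundamental theorem of calculus the inner
  integral is a difference of two values of G outside its support.\<close>

lemma
  assumes G: "Ck_on n (Suc 0) (Rn n) G" and K: "compact K" "K \<subseteq> Rn n" and i: "i < n"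
    and supp: "\<And>z. z \<in> Rn n \<Longrightarrow> z \<notin> K \<Longrightarrow> G z = 0"
  shows integrable_partial: "integrable (lborel_Rn n) (\<lambda>z. partial i G (zero_ext n z))"
    and integral_partial: "(\<integral>z. partial i G (zero_ext n z) \<partial>lborel_Rn n) = 0"
proof -
  have cont: "continuous_on (Rn n) (partial i G)" using G i by auto
  have o: "open_Rn n (Rn n - K)"
    using compact_imp_closed[OF K(1)] by (auto simp: openin_open intro!: exI[of _ "- K"])
  have z: "partial i G z = 0" if "z \<in> Rn n" "z \<notin> K" for z
  proof -
    have "partial i G z = partial i (\<lambda>_. 0) z"
      by (rule partial_cong[OF o _ _ i]) (use supp that in auto)
    then show ?thesis by (simp add: partial_def)
  qed
  show int: "integrable (lborel_Rn n) (\<lambda>z. partial i G (zero_ext n z))"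
    by (rule integrable_lborel_Rn[OF cont K z])
  obtain r where r: "r > 0" "\<forall>y\<in>K. \<forall>i<n. \<bar>y i\<bar> \<le> r" using compact_coord_bound[OF K(1)] by blast
  interpret product_sigma_finite "\<lambda>_::nat. lborel :: real measure" by standard
  let ?I = "{..<n} - {i}"
  have I: "insert i ?I = {..<n}" using i by auto
  have upd: "zero_ext n (x(i := t)) = (zero_ext n x)(i := t)" for x t
    using i by (auto simp: zero_ext_def fun_eq_iff)
  have RnU: "(zero_ext n x)(i := t) \<in> Rn n" for x t
    using i by (simp add: Rn_def zero_ext_def)
  have inner: "(\<integral>t. partial i G (zero_ext n (x(i := t))) \<partial>lborel) = 0" for x
  proof -
    let ?u = "\<lambda>t. (zero_ext n x)(i := t)"
    have D: "((\<lambda>t. G (?u t)) has_real_derivative partial i G (?u t)) (at t)" for t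
      using Ck_on_partial[OF G RnU i, of x t] by simp
    have off: "?u t \<notin> K" if "t \<notin> {- r..r}" for t
      using that r(2) i by (force simp: abs_le_iff)
    have off': "G (?u t) = 0" if "\<bar>t\<bar> > r" for t
      by (rule supp[OF RnU]) (use that off[of t] in \<open>simp add: abs_if split: if_splits\<close>)
    \<comment> \<open>The support lies in [-r, r] in coordinate i; the extra 1 puts both end points
      strictly outside it.\<close>
    have "(\<integral>t. partial i G (?u t) \<partial>lborel) = (\<integral>t. indicator {- (r + 1)..r + 1} t *\<^sub>R partial i G (?u t) \<partial>lborel)"
    proof (intro Bochner_Integration.integral_cong refl)
      fix t
      have "partial i G (?u t) = 0" if "t \<notin> {- (r + 1)..r + 1}"
        by (intro z RnU off) (use that in auto)
      then show "partial i G (?u t) = indicator {- (r + 1)..r + 1} t *\<^sub>R partial i G (?u t)"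
        by (auto simp: indicator_def)
    qed
    also have "\<dots> = G (?u (r + 1)) - G (?u (- (r + 1)))"
    proof (rule integral_FTC_atLeastAtMost)
      show "- (r + 1) \<le> r + 1" using r(1) by simp
      show "((\<lambda>t. G (?u t)) has_vector_derivative partial i G (?u t)) (at t within {- (r + 1)..r + 1})" for t
        using D[of t] by (simp add: has_real_derivative_iff_has_vector_derivative[symmetric] has_field_derivative_at_within)
      have "continuous_on {- (r + 1)..r + 1} ?u"
      proof (rule continuous_on_coordinatewise_then_product)
        fix j show "continuous_on {- (r + 1)..r + 1} (\<lambda>t. ?u t j)" by (cases "j = i") auto
      qed
      then show "continuous_on {- (r + 1)..r + 1} (\<lambda>t. partial i G (?u t))"
        by (rule continuous_on_compose2[OF cont]) (use RnU in auto)
    qed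
    also have "\<dots> = 0" using off'[of "r + 1"] off'[of "- (r + 1)"] r(1) by simp
    finally show ?thesis by (simp only: upd)
  qed
  have "(\<integral>z. partial i G (zero_ext n z) \<partial>lborel_Rn n) =
      (\<integral>x. (\<integral>t. partial i G (zero_ext n (x(i := t))) \<partial>lborel) \<partial>(\<Pi>\<^sub>M i\<in>?I. lborel))"
    using product_integral_insert[of ?I i "\<lambda>z. partial i G (zero_ext n z)"] int unfolding I by simp
  then show "(\<integral>z. partial i G (zero_ext n z) \<partial>lborel_Rn n) = 0" by (simp add: inner)
qed

definition chart_pull :: "'m chart \<Rightarrow> ('m \<Rightarrow> real) \<Rightarrow> (nat \<Rightarrow> real) \<Rightarrow> real"
  where "chart_pull c F y = (if y \<in> snd c ` fst c then F (chart_inv c y) else 0)"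

section \<open>Transfer of integrals from a chart to the model space\<close>

context manifold_ctx
begin

text \<open>\<open>riemannian_measure\<close> prescribes the measure of Borel sets inside a chart.
  This says that the restriction of \<open>vol\<close> to the chart is the image, under the inverse
  chart, of Lebesgue measure with the given density; the integral formula follows from that equality
  of measures.\<close>

lemma integral_chart:
  assumes vol: "riemannian_measure M g vol" and c: "c \<in> atlas M"
    and G: "continuous_on (fst c) (\<lambda>x. sqrt (gram_det M g c x))" "\<And>x. x \<in> fst c \<Longrightarrow> gram_det M g c x \<ge> 0"
    and F: "continuous_on (fst c) F" "\<And>x. x \<notin> fst c \<Longrightarrow> F x = 0"
  shows "(\<integral>x. F x \<partial>vol) = (\<integral>z. chart_pull c (\<lambda>x. sqrt (gram_det M g c x) * F x) (zero_ext n z) \<partial>lborel_Rn n)"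
proof -
  let ?G = "\<lambda>x. sqrt (gram_det M g c x)" and ?S = "snd c ` fst c" and ?L = "lborel_Rn n"
  note U = chart_open[OF c]
  have setsv: "sets vol = sets borel" using vol by (simp add: riemannian_measure_def)
  have spv: "space vol = UNIV" using sets_eq_imp_space_eq[OF setsv] by simp
  have Sb: "?S \<in> sets borel" using chart_image_open[OF c, of UNIV] by (intro borel_open_Rn[of n]) simp
  have hom: "continuous_on ?S (chart_inv c)" "chart_inv c ` ?S = fst c"
    using chart_homeo[OF c] by (auto simp: homeomorphism_def)
  have invS: "chart_inv c y \<in> fst c" if "y \<in> ?S" for y using that hom(2) by blast
  \<comment> \<open>\<open>\<psi>\<close> needs some value off the chart image; which one is
    immaterial, because the density \<open>w\<close> vanishes there.\<close>
  define p :: 'm where "p = undefined"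
  define \<psi> where "\<psi> z = (if zero_ext n z \<in> ?S then chart_inv c (zero_ext n z) else p)" for z
  define w where "w z = indicator ?S (zero_ext n z) *\<^sub>R ?G (chart_inv c (zero_ext n z))" for z
  have Fm: "F \<in> borel_measurable borel"
  proof -
    have "(\<lambda>x. indicator (fst c) x *\<^sub>R F x) \<in> borel_measurable borel"
      by (intro borel_measurable_continuous_on_indicator F borel_open U)
    moreover have "(\<lambda>x. indicator (fst c) x *\<^sub>R F x) = F"
    proof
      fix x show "indicator (fst c) x *\<^sub>R F x = F x" by (cases "x \<in> fst c") (simp_all add: F(2))
    qed
    ultimately show ?thesis by simp
  qed
  have "(\<lambda>y. if y \<in> ?S then chart_inv c y else p) \<in> borel_measurable borel"
    by (subst measurable_If_restrict_space_iff)
      (use Sb hom in \<open>auto intro: borel_measurable_continuous_on_restrict\<close>)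
  from measurable_compose[OF zero_ext_measurable this]
  have \<psi>m: "\<psi> \<in> measurable ?L borel" unfolding \<psi>_def by simp
  have "(\<lambda>y. indicator ?S y *\<^sub>R ?G (chart_inv c y)) \<in> borel_measurable borel"
    by (intro borel_measurable_continuous_on_indicator Sb continuous_on_compose2[OF G(1) hom(1)])
      (use hom(2) in simp)
  from measurable_compose[OF zero_ext_measurable this]
  have wm: "w \<in> borel_measurable ?L" unfolding w_def by simp
  have w0: "w z \<ge> 0" for z
    using G(2)[OF invS[of "zero_ext n z"]] by (auto simp: w_def indicator_def)
  have eq: "density vol (\<lambda>x. ennreal (indicator (fst c) x)) = distr (density ?L (\<lambda>z. ennreal (w z))) borel \<psi>"
  proof (rule measure_eqI)
    show "sets (density vol (\<lambda>x. ennreal (indicator (fst c) x))) = sets (distr (density ?L (\<lambda>z. ennreal (w z))) borel \<psi>)"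
      by (simp add: setsv)
    fix B assume "B \<in> sets (density vol (\<lambda>x. ennreal (indicator (fst c) x)))"
    then have B: "B \<in> sets borel" by (simp add: setsv)
    then have Bc: "fst c \<inter> B \<in> sets borel" using U by auto
    have "emeasure (density vol (\<lambda>x. ennreal (indicator (fst c) x))) B =
        (\<integral>\<^sup>+ x. ennreal (indicator (fst c) x) * indicator B x \<partial>vol)"
      using B U by (intro emeasure_density) (auto simp: setsv measurable_cong_sets[OF setsv refl])
    also have "\<dots> = (\<integral>\<^sup>+ x. indicator (fst c \<inter> B) x \<partial>vol)"
      by (intro nn_integral_cong) (auto simp: indicator_def)
    also have "\<dots> = emeasure vol (fst c \<inter> B)" using Bc setsv by simp
    also have "\<dots> = (\<integral>\<^sup>+ z. indicator (snd c ` (fst c \<inter> B)) (zero_ext n z) *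
               ennreal (?G (chart_inv c (zero_ext n z))) \<partial>?L)"
      using vol c Bc by (simp add: riemannian_measure_def)
    also have "\<dots> = (\<integral>\<^sup>+ z. ennreal (w z) * indicator (\<psi> -` B \<inter> space ?L) z \<partial>?L)"
    proof (rule nn_integral_cong)
      fix z assume "z \<in> space ?L"
      let ?z = "zero_ext n z"
      have "?z \<in> snd c ` (fst c \<inter> B) \<longleftrightarrow> ?z \<in> ?S \<and> chart_inv c ?z \<in> B"
        using chart_inv_left[OF c] by auto
      then show "indicator (snd c ` (fst c \<inter> B)) ?z * ennreal (?G (chart_inv c ?z)) =
          ennreal (w z) * indicator (\<psi> -` B \<inter> space ?L) z"
        using \<open>z \<in> space ?L\<close> by (auto simp: w_def \<psi>_def indicator_def)
    qed
    also have "\<dots> = emeasure (density ?L (\<lambda>z. ennreal (w z))) (\<psi> -` B \<inter> space ?L)"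
      using wm measurable_sets[OF \<psi>m B] by (intro emeasure_density[symmetric]) auto
    also have "\<dots> = emeasure (distr (density ?L (\<lambda>z. ennreal (w z))) borel \<psi>) B"
      using \<psi>m B by (subst emeasure_distr) auto
    finally show "emeasure (density vol (\<lambda>x. ennreal (indicator (fst c) x))) B = \<dots>" .
  qed
  have "(\<integral>x. F x \<partial>vol) = (\<integral>x. indicator (fst c) x *\<^sub>R F x \<partial>vol)"
  proof (intro Bochner_Integration.integral_cong refl)
    fix x show "F x = indicator (fst c) x *\<^sub>R F x" by (cases "x \<in> fst c") (simp_all add: F(2))
  qed
  also have "\<dots> = (\<integral>x. F x \<partial>density vol (\<lambda>x. ennreal (indicator (fst c) x)))"
    using Fm U by (intro integral_density[symmetric]) (auto simp: measurable_cong_sets[OF setsv refl])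
  also have "\<dots> = (\<integral>z. F (\<psi> z) \<partial>density ?L (\<lambda>z. ennreal (w z)))"
    unfolding eq using \<psi>m Fm by (intro integral_distr) auto
  also have "\<dots> = (\<integral>z. w z *\<^sub>R F (\<psi> z) \<partial>?L)"
    using wm w0 measurable_compose[OF \<psi>m Fm] by (intro integral_density) auto
  also have "\<dots> = (\<integral>z. chart_pull c (\<lambda>x. ?G x * F x) (zero_ext n z) \<partial>?L)"
    by (intro Bochner_Integration.integral_cong refl) (auto simp: w_def \<psi>_def chart_pull_def indicator_def)
  finally show ?thesis .
qed

context
  fixes c K
  assumes c: "c \<in> atlas M" and K: "compact K" "K \<subseteq> fst c"
begin

lemma chart_support: "compact (snd c ` K)" "snd c ` K \<subseteq> Rn n" "y \<notin> snd c ` K \<Longrightarrow> (\<And>x. x \<notin> K \<Longrightarrow> F x = 0) \<Longrightarrow> chart_pull c F y = 0"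
proof -
  have hom: "continuous_on (fst c) (snd c)" using chart_homeo[OF c] by (simp add: homeomorphism_def)
  show "compact (snd c ` K)" by (intro compact_continuous_image continuous_on_subset[OF hom] K)
  show "snd c ` K \<subseteq> Rn n" using openin_imp_subset[OF chart_image_open[OF c, of UNIV]] K(2) by auto
  assume y: "y \<notin> snd c ` K" and F: "\<And>x. x \<notin> K \<Longrightarrow> F x = 0"
  have "F (chart_inv c (snd c x)) = 0" if "x \<in> fst c" "y = snd c x" for x
    using F[of x] that y chart_inv_left[OF c] by auto
  then show "chart_pull c F y = 0" by (auto simp: chart_pull_def)
qed

text \<open>The model space is covered by the chart image, where the coordinate expression is
  smooth, and the complement of the compact support, where the extension is zero.\<close>

lemma chart_pull_Ck:
  assumes F: "smooth_fun_on M (fst c) F" and supp: "\<And>x. x \<notin> K \<Longrightarrow> F x = 0"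
  shows "Ck_on n m (Rn n) (chart_pull c F)"
proof (rule Ck_on_local)
  fix y assume y: "y \<in> Rn n"
  have o: "open_Rn n (snd c ` fst c)" using chart_image_open[OF c, of UNIV] by simp
  show "\<exists>T. open_Rn n T \<and> y \<in> T \<and> T \<subseteq> Rn n \<and> Ck_on n m T (chart_pull c F)"
  proof (cases "y \<in> snd c ` K")
    case True
    have "Ck_on n m (snd c ` fst c) (\<lambda>y. F (chart_inv c y))" using smooth_fun_on_Ck[OF F c] by simp
    then have "Ck_on n m (snd c ` fst c) (chart_pull c F)"
      by (rule Ck_on_cong[OF o, rotated]) (simp add: chart_pull_def)
    then show ?thesis using o True K openin_imp_subset[OF o] by (intro exI[of _ "snd c ` fst c"]) auto
  next
    case False
    have o: "open_Rn n (Rn n - snd c ` K)"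
      using compact_imp_closed[OF chart_support(1)] by (auto simp: openin_open intro!: exI[of _ "- snd c ` K"])
    have "Ck_on n m (Rn n - snd c ` K) (chart_pull c F)"
      by (rule Ck_on_cong[OF o _ Ck_on_const[OF o, of m 0]]) (use chart_support(3) supp in simp)
    then show ?thesis using o False y by blast
  qed
qed

lemma chart_pull_integrable:
  assumes "smooth_fun_on M (fst c) F" "\<And>x. x \<notin> K \<Longrightarrow> F x = 0"
  shows "integrable (lborel_Rn n) (\<lambda>z. chart_pull c F (zero_ext n z))"
proof (rule integrable_lborel_Rn[OF _ chart_support(1,2)])
  show "continuous_on (Rn n) (chart_pull c F)" using chart_pull_Ck[OF assms, of 0] by simp
qed (rule chart_support(3)[OF _ assms(2)])

lemma chart_pull_integral_eq_0:
  assumes "smooth_fun_on M (fst c) F" "\<And>x. x \<notin> K \<Longrightarrow> F x = 0" and "\<And>x. x \<in> fst c \<Longrightarrow> F x \<ge> 0"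
    and "(\<integral>z. chart_pull c F (zero_ext n z) \<partial>lborel_Rn n) = 0" and x: "x \<in> fst c"
  shows "F x = 0"
proof -
  have "chart_pull c F (snd c x) = 0"
  proof (rule continuous_nonneg_integral_eq_0[where f = "chart_pull c F", OF _ chart_support(1,2)])
    show "continuous_on (Rn n) (chart_pull c F)" using chart_pull_Ck[OF assms(1,2), of 0] by simp
    show "chart_pull c F z = 0" if "z \<in> Rn n" "z \<notin> snd c ` K" for z by (rule chart_support(3)[OF that(2) assms(2)])
    show "0 \<le> chart_pull c F z" if "z \<in> Rn n" for z using assms(3) chart_inv_left[OF c] by (auto simp: chart_pull_def)
    show "snd c x \<in> Rn n" using openin_imp_subset[OF chart_image_open[OF c, of UNIV]] x by auto
    show "(\<integral>z. chart_pull c F (zero_ext n z) \<partial>lborel_Rn n) = 0" by (rule assms(4))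
  qed
  then show ?thesis using x chart_inv_left[OF c x] by (simp add: chart_pull_def)
qed

lemma chart_pull_integral_coord_vec:
  assumes F: "smooth_fun_on M (fst c) F" and supp: "\<And>x. x \<notin> K \<Longrightarrow> F x = 0" and i: "i < n"
  shows "(\<integral>z. chart_pull c (\<lambda>x. coord_vec M c i x F) (zero_ext n z) \<partial>lborel_Rn n) = 0"
    and "integrable (lborel_Rn n) (\<lambda>z. chart_pull c (\<lambda>x. coord_vec M c i x F) (zero_ext n z))"
proof -
  have eq: "chart_pull c (\<lambda>x. coord_vec M c i x F) z = partial i (chart_pull c F) z" if z: "z \<in> Rn n" for z
  proof (cases "z \<in> snd c ` fst c")
    case True
    then obtain x where x: "x \<in> fst c" "z = snd c x" by auto
    have o: "open_Rn n (snd c ` fst c)" using chart_image_open[OF c, of UNIV] by simp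
    have "coord_vec M c i x F = partial i (\<lambda>y. F (chart_inv c y)) (snd c x)"
      by (rule coord_vec_eq[OF chart_open[OF c] x(1) F])
    also have "\<dots> = partial i (chart_pull c F) (snd c x)"
      by (rule partial_cong[OF o _ _ i]) (use x in \<open>auto simp: chart_pull_def\<close>)
    finally show ?thesis using x chart_inv_left[OF c x(1)] by (simp add: chart_pull_def)
  next
    case False
    have o: "open_Rn n (Rn n - snd c ` K)"
      using compact_imp_closed[OF chart_support(1)] by (auto simp: openin_open intro!: exI[of _ "- snd c ` K"])
    have "partial i (chart_pull c F) z = partial i (\<lambda>_. 0) z"
      by (rule partial_cong[OF o _ _ i]) (use chart_support(3) supp False K z in auto)
    then show ?thesis using False by (simp add: chart_pull_def partial_def)
  qed
  have supp': "chart_pull c F z = 0" if "z \<notin> snd c ` K" for z by (rule chart_support(3)[OF that supp])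
  have C1: "Ck_on n (Suc 0) (Rn n) (chart_pull c F)" by (rule chart_pull_Ck[OF F supp])
  note * = C1 chart_support(1,2) i
  show "(\<integral>z. chart_pull c (\<lambda>x. coord_vec M c i x F) (zero_ext n z) \<partial>lborel_Rn n) = 0"
    unfolding eq[OF zero_ext_Rn] by (rule integral_partial[OF *]) (rule supp')
  show "integrable (lborel_Rn n) (\<lambda>z. chart_pull c (\<lambda>x. coord_vec M c i x F) (zero_ext n z))"
    unfolding eq[OF zero_ext_Rn] by (rule integrable_partial[OF *]) (rule supp')
qed

end

end

section \<open>Bump functions\<close>

text \<open>Polynomials in 1/t times exp(-1/t), extended by 0. The derivatives of the standard flat
  function are all of this kind, which gives the closed family that \<open>Ck_on_comp_real\<close>
  asks for.\<close>

definition flat_exp :: "real poly \<Rightarrow> real \<Rightarrow> real"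
  where "flat_exp p t = (if t > 0 then poly p (inverse t) * exp (- inverse t) else 0)"

lemma poly_exp_tendsto_0: "((\<lambda>s. poly p s * exp (- s)) \<longlongrightarrow> 0) (at_top :: real filter)"
proof -
  have "((\<lambda>s. \<Sum>i\<le>degree p. coeff p i * (s ^ i / exp s)) \<longlongrightarrow> (\<Sum>i\<le>degree p. coeff p i * 0)) (at_top :: real filter)"
    by (intro tendsto_sum tendsto_mult tendsto_const tendsto_power_div_exp_0)
  then show ?thesis
    by (simp add: poly_altdef exp_minus divide_inverse sum_distrib_right mult.assoc)
qed

text \<open>With s = 1/t the derivative of p(s) exp(-s) is s^2 (p(s) - p'(s)) exp(-s), which
  explains the polynomial. At 0 the difference quotient is of the same kind with s p(s) on the right
  and is zero on the left, so both one-sided limits are 0.\<close>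

lemma DERIV_flat_exp: "(flat_exp p has_real_derivative flat_exp ([:0, 0, 1:] * (p - pderiv p)) t) (at t)"
proof -
  let ?q = "[:0, 0, 1:] * (p - pderiv p)"
  consider "t < 0" | "t = 0" | "t > 0" by linarith
  then show ?thesis
  proof cases
    case 1
    have "\<forall>\<^sub>F s in nhds t. 0 = flat_exp p s"
      using eventually_nhds_in_open[of "{..<0}" t] 1 by (auto simp: flat_exp_def elim: eventually_mono)
    then have "(flat_exp p has_real_derivative 0) (at t)"
      by (rule DERIV_cong_ev[OF refl _ refl, THEN iffD1]) simp
    then show ?thesis using 1 by (simp add: flat_exp_def)
  next
    case 2
    have "((\<lambda>h. flat_exp p h / h) \<longlongrightarrow> 0) (at_left 0)"
    proof (rule tendsto_eventually)
      show "\<forall>\<^sub>F h in at_left 0. flat_exp p h / h = 0"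
        by (rule eventually_at_leftI[of "-1"]) (auto simp: flat_exp_def)
    qed
    moreover have "((\<lambda>h. flat_exp p h / h) \<longlongrightarrow> 0) (at_right 0)"
    proof -
      have "((\<lambda>h. poly ([:0, 1:] * p) (inverse h) * exp (- inverse h)) \<longlongrightarrow> 0) (at_right 0)"
        by (rule filterlim_compose[OF poly_exp_tendsto_0 filterlim_inverse_at_top_right])
      moreover have "\<forall>\<^sub>F h in at_right 0. poly ([:0, 1:] * p) (inverse h) * exp (- inverse h) = flat_exp p h / h"
        by (rule eventually_at_rightI[of _ 1]) (auto simp: flat_exp_def field_simps)
      ultimately show ?thesis by (rule Lim_transform_eventually)
    qed
    ultimately have "((\<lambda>h. flat_exp p h / h) \<longlongrightarrow> 0) (at 0)"
      by (simp add: filterlim_at_split)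
    then show ?thesis using 2 by (simp add: DERIV_def flat_exp_def)
  next
    case 3
    have "((\<lambda>s. poly p (inverse s) * exp (- inverse s)) has_real_derivative flat_exp ?q t) (at t)"
      using 3 by (auto intro!: derivative_eq_intros DERIV_chain2[OF poly_DERIV]
          simp: flat_exp_def power2_eq_square field_simps)
    moreover have "\<forall>\<^sub>F s in nhds t. poly p (inverse s) * exp (- inverse s) = flat_exp p s"
      using eventually_nhds_in_open[of "{0<..}" t] 3 by (auto simp: flat_exp_def elim: eventually_mono)
    ultimately show ?thesis by (subst (asm) DERIV_cong_ev[OF refl _ refl]) auto
  qed
qed

text \<open>Tychonoff: the cube is a product of closed intervals, with \<open>{0}\<close> as the
  factor for every index from n on.\<close>

lemma compact_cube_Rn: "compact {z \<in> Rn n. \<forall>i<n. \<bar>z i - y i\<bar> \<le> r}"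
proof -
  let ?C = "\<lambda>i::nat. if i < n then {y i - r..y i + r} else {0}"
  have "compactin (product_topology (\<lambda>i. euclidean) UNIV) (PiE UNIV ?C)"
    by (subst compactin_PiE) auto
  moreover have "PiE UNIV ?C = {z \<in> Rn n. \<forall>i<n. \<bar>z i - y i\<bar> \<le> r}"
  proof (rule Set.set_eqI, goal_cases)
    case (1 z)
    have "z i \<in> ?C i \<longleftrightarrow> (if i < n then \<bar>z i - y i\<bar> \<le> r else z i = 0)" for i by auto
    then show ?case unfolding PiE_iff by (auto simp: Rn_def not_less)
  qed
  ultimately show ?thesis by (simp add: euclidean_product_topology)
qed

lemma (in manifold_ctx) ex_bump:
  assumes c: "c \<in> atlas M" and x: "x \<in> fst c"
  shows "\<exists>f K. compact K \<and> K \<subseteq> fst c \<and> smooth_fun_on M UNIV f \<and> (\<forall>y. f y \<ge> 0) \<and>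
    (\<forall>y. y \<notin> K \<longrightarrow> f y = 0) \<and> f x > 0"
proof -
  note U = chart_open[OF c]
  let ?S = "snd c ` fst c" and ?y = "snd c x"
  have o: "open_Rn n ?S" using chart_image_open[OF c, of UNIV] by simp
  obtain r where r: "r > 0" "box_Rn n ?y r \<subseteq> ?S" using o x by (auto simp: open_Rn_iff)
  define B where "B = {z \<in> Rn n. \<forall>i<n. \<bar>z i - ?y i\<bar> \<le> r / 2}"
  have BS: "B \<subseteq> ?S"
  proof
    fix z assume "z \<in> B"
    then have "z \<in> box_Rn n ?y r" using r(1) by (fastforce simp: B_def box_Rn_def)
    then show "z \<in> ?S" using r(2) by blast
  qed
  have hom: "continuous_on ?S (chart_inv c)" "chart_inv c ` ?S = fst c"
    using chart_homeo[OF c] by (auto simp: homeomorphism_def)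
  define K where "K = chart_inv c ` B"
  have K: "compact K" "K \<subseteq> fst c"
  proof -
    show "compact K" unfolding K_def B_def
      by (rule compact_continuous_image[OF _ compact_cube_Rn])
        (rule continuous_on_subset[OF hom(1) BS[unfolded B_def]])
    show "K \<subseteq> fst c" unfolding K_def using hom(2) BS by blast
  qed
  \<comment> \<open>Positive at the centre, and negative off the cube B because there a single
    coordinate already exceeds r/2. Hence \<open>flat_exp 1\<close> of q is positive at x and
    vanishes outside K.\<close>
  define q where "q y = (r / 2)\<^sup>2 - (\<Sum>i<n. (snd c y i - ?y i) * (snd c y i - ?y i))" for y
  define f where "f y = (if y \<in> fst c then flat_exp 1 (q y) else 0)" for y
  have q: "smooth_fun_on M (fst c) q"
    unfolding q_def by (intro smooth_fun_on_diff smooth_fun_on_sum smooth_fun_on_mult smooth_fun_on_const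
        smooth_fun_on_coord U c)
  have E: "smooth_fun_on M (fst c) (\<lambda>y. flat_exp 1 (q y))"
    by (rule smooth_fun_on_comp_real[OF U _ subset_UNIV _ q, where \<F> = "range flat_exp"])
      (auto intro: DERIV_flat_exp)
  have fU: "smooth_fun_on M (fst c) f" by (rule smooth_fun_on_cong[OF E U]) (simp add: f_def)
  have f0: "f y = 0" if y: "y \<notin> K" for y
  proof (cases "y \<in> fst c")
    case True
    have "snd c y \<notin> B" using y chart_inv_left[OF c True] unfolding K_def by (metis imageI)
    moreover have "snd c y \<in> Rn n" using openin_imp_subset[OF o] True by blast
    ultimately obtain i where i: "i < n" "\<bar>snd c y i - ?y i\<bar> > r / 2" by (auto simp: B_def not_le)
    have "(r / 2)\<^sup>2 < \<bar>snd c y i - ?y i\<bar>\<^sup>2" by (rule power_strict_mono) (use i r in auto)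
    also have "\<dots> = (snd c y i - ?y i) * (snd c y i - ?y i)" by (simp add: power2_eq_square)
    also have "\<dots> \<le> (\<Sum>i<n. (snd c y i - ?y i) * (snd c y i - ?y i))"
      using i by (intro member_le_sum) auto
    finally have "q y < 0" by (simp add: q_def)
    then show ?thesis by (simp add: f_def flat_exp_def)
  qed (simp add: f_def)
  have "smooth_fun_on M UNIV f"
  proof (rule smooth_fun_on_local)
    fix y
    have oK: "open (- K)" using compact_imp_closed[OF K(1)] by (simp add: open_Compl)
    have fK: "smooth_fun_on M (- K) f"
      by (rule smooth_fun_on_cong[OF smooth_fun_on_const[OF oK, of 0] oK]) (simp add: f0)
    show "\<exists>V. open V \<and> y \<in> V \<and> smooth_fun_on M V f"
    proof (cases "y \<in> fst c")
      case True
      then show ?thesis using U fU by blast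
    next
      case False
      then have "y \<in> - K" using K(2) by blast
      then show ?thesis using oK fK by blast
    qed
  qed simp
  moreover have "f x > 0" using x r(1) by (simp add: f_def q_def flat_exp_def)
  moreover have "f y \<ge> 0" for y by (simp add: f_def flat_exp_def)
  ultimately show ?thesis using K f0 by blast
qed

section \<open>The formal adjoint is the codifferential\<close>

context geo_ctx
begin

text \<open>A form is determined by its values on basis vectors: the first argument is expanded in
  the basis, and each contraction with a basis vector vanishes by induction.\<close>

lemma alt_eq_0:
  assumes e: "onbasis x e"
  shows "\<alpha> \<in> alt_forms M E k x \<Longrightarrow> (\<And>I. I \<in> idx n k \<Longrightarrow> \<alpha> (map e I) = 0) \<Longrightarrow> \<alpha> vs = 0"
proof (induction k arbitrary: \<alpha> vs)
  case 0
  have "\<alpha> [] = 0" using 0(2)[of "[]"] by simp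
  then show ?case using alt_outside[OF 0(1), of vs] by (cases "vs = []") (auto simp: tlists_def)
next
  case (Suc k)
  show ?case
  proof (cases "vs \<in> tlists M (Suc k) x")
    case True
    then obtain v us where vs: "vs = v # us" by (cases vs) (auto simp: tlists_def)
    have v: "v \<in> tangent_space M x" and us: "us \<in> tlists M k x" using True vs by (auto simp: tlists_def)
    have "\<alpha> (e i # us) = 0" if i: "i < n" for i
    proof -
      let ?\<beta> = "\<lambda>vs. if vs \<in> tlists M k x then \<alpha> (e i # vs) else 0"
      have "?\<beta> us = 0"
      proof (rule Suc.IH[of ?\<beta> us])
        show "?\<beta> \<in> alt_forms M E k x" by (rule alt_Cons[OF Suc.prems(1) onbasis_tangent[OF e i]])
        fix I assume I: "I \<in> idx n k"
        then have "i # I \<in> idx n (Suc k)" using i by (simp add: idx_def)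
        then show "?\<beta> (map e I) = 0" using Suc.prems(2)[of "i # I"] by simp
      qed
      then show ?thesis using us by simp
    qed
    moreover have "\<alpha> vs = (\<Sum>i<n. g x v (e i) *\<^sub>R \<alpha> (e i # us))"
      unfolding vs using alt_sum_Cons[OF Suc.prems(1) us, of "{..<n}" e "\<lambda>i. g x v (e i)"]
        onbasis_tangent[OF e] onbasis_expand[OF e v] by simp
    ultimately show ?thesis by simp
  qed (rule alt_outside[OF Suc.prems(1)])
qed

lemma finner_pos:
  assumes \<alpha>: "\<alpha> \<in> alt_forms M E k x" and "\<alpha> \<noteq> 0"
  shows "finner k x \<alpha> \<alpha> > 0"
proof -
  interpret psd_form "htot x" by (rule htot)
  note e = onbasis_onb[of x]
  obtain I where I: "I \<in> idx n k" "\<alpha> (map (onb M g x) I) \<noteq> 0"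
  proof -
    have "\<exists>vs. \<alpha> vs \<noteq> 0" using assms(2) by (simp add: fun_eq_iff)
    then show ?thesis using alt_eq_0[OF e \<alpha>] that by blast
  qed
  note t = map_onbasis_tlists[OF e I(1)]
  have "0 < htot x (\<alpha> (map (onb M g x) I)) (\<alpha> (map (onb M g x) I))"
    unfolding htot_alt[OF \<alpha> \<alpha> t] by (rule h_pos[OF alt_fibre[OF \<alpha> t] I(2)])
  then have "0 < (\<Sum>I\<in>idx n k. htot x (\<alpha> (map (onb M g x) I)) (\<alpha> (map (onb M g x) I)))"
    by (rule sum_pos2[OF finite_idx I(1)]) (rule H_nonneg)
  then show ?thesis unfolding finner_onbasis[OF e \<alpha> \<alpha>] by simp
qed

lemma finner_scale:
  assumes "\<alpha> \<in> alt_forms M E k x" "\<beta> \<in> alt_forms M E k x"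
  shows "finner k x (\<lambda>vs. a *\<^sub>R \<alpha> vs) \<beta> = a * finner k x \<alpha> \<beta>"
proof -
  interpret psd_form "htot x" by (rule htot)
  have "(\<lambda>vs. a *\<^sub>R \<alpha> vs) \<in> alt_forms M E k x" using alt_lincomb[OF assms(1) assms(1), of a 0] by simp
  then show ?thesis
    using ip_scale by (simp add: ip_eq_finner[OF onbasis_onb] assms)
qed

lemma finner_diff_right:
  assumes "\<alpha> \<in> alt_forms M E k x" "\<beta> \<in> alt_forms M E k x" "\<gamma> \<in> alt_forms M E k x"
  shows "finner k x \<alpha> (\<lambda>vs. \<beta> vs - \<gamma> vs) = finner k x \<alpha> \<beta> - finner k x \<alpha> \<gamma>"
proof -
  interpret psd_form "htot x" by (rule htot)
  have "(\<lambda>vs. \<beta> vs - \<gamma> vs) \<in> alt_forms M E k x" using alt_lincomb[OF assms(2,3), of 1 "- 1"] by simp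
  then show ?thesis
    using ip_diff_right by (simp add: ip_eq_finner[OF onbasis_onb] assms)
qed

lemma finner_zero:
  assumes "\<beta> \<in> alt_forms M E k x"
  shows "finner k x (\<lambda>vs. 0) \<beta> = 0"
  using finner_scale[OF assms assms, of 0] by simp

text \<open>Locality in the case of a vanishing form; it confines the integrand with the exterior
  derivative of a test form to the support of that form.\<close>

lemma d_nabla_zero:
  assumes "open W" "x \<in> W" and \<eta>: "\<And>y vs. y \<in> W \<Longrightarrow> \<eta> y vs = 0"
  shows "d_nabla M E nab k \<eta> x = (\<lambda>vs. 0)"
proof -
  let ?z = "\<lambda>y vs. (0::real) *\<^sub>R (0::'e)"
  have z: "smooth_form_on M E k W (\<lambda>y vs. 0)" by (rule form_zero)
  have s: "smooth_form_on M E k W \<eta>" by (rule form_cong[OF z]) (simp add: \<eta> fun_eq_iff)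
  have "nabla k \<eta> x v vs = 0" if v: "v \<in> tangent_space M x" and vs: "vs \<in> tlists M k x" for v vs
  proof -
    \<comment> \<open>Written as \<open>0 *\<^sub>R 0\<close>, the zero form falls under the Leibniz
      rule with the constant function 0.\<close>
    have "nabla k \<eta> x v = nabla k (\<lambda>y vs. 0 *\<^sub>R 0) x v"
      by (rule nabla_cong[OF form_cong[OF z] assms(1,2) v]) (simp_all add: \<eta> fun_eq_iff)
    then show ?thesis
      using nabla_scale[OF z assms(1,2) v smooth_fun_on_const[OF assms(1), of 0] vs] by simp
  qed
  then have "dN k \<eta> x vs = 0" for vs
    unfolding dN_def by (auto intro!: sum.neutral simp: tlists_nth tlists_omit)
  then show ?thesis unfolding d_nabla_eq_dN[OF s assms(1,2)] by (simp add: fun_eq_iff)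
qed

lemma formal_adjoint_eq_codiff:
  assumes vol: "riemannian_measure M g vol"
    and adj: "formal_adjoint M g vol E h nab (Suc k) dstar"
    and \<phi>: "smooth_form_on M E (Suc k) UNIV \<phi>"
  shows "dstar \<phi> x = codiff k \<phi> x"
proof -
  have adj': "smooth_form_on M E k UNIV (dstar \<phi>)"
    "\<And>\<eta>. smooth_form_on M E k UNIV \<eta> \<Longrightarrow> compactly_supported \<eta> \<Longrightarrow>
      (\<integral>x. finner (Suc k) x (d_nabla M E nab k \<eta> x) (\<phi> x) \<partial>vol) = (\<integral>x. finner k x (\<eta> x) (dstar \<phi> x) \<partial>vol)"
    using adj \<phi> unfolding formal_adjoint_def by auto
  define \<psi> where "\<psi> = dstar \<phi>"
  note \<psi>s = adj'(1)[folded \<psi>_def]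
  obtain c where c: "c \<in> atlas M" and x: "x \<in> fst c" using ex_chart by blast
  let ?U = "fst c" and ?G = "\<lambda>y. sqrt (gram_det M g c y)"
  note U = chart_open[OF c]
  obtain e where e: "onframe ?U e" using ex_onframe[OF c] by blast
  have ef: "vector_field_on M ?U (e i)" if "i < n" for i using e that by (simp add: onframe_def)
  have \<phi>U: "smooth_form_on M E (Suc k) ?U \<phi>" and \<psi>U: "smooth_form_on M E k ?U \<psi>"
    by (rule form_subset[OF \<phi> subset_UNIV], rule form_subset[OF \<psi>s subset_UNIV])
  have cU: "smooth_form_on M E k ?U (codiff k \<phi>)" by (rule codiff_smooth[OF e \<phi>U])
  define \<eta>0 where "\<eta>0 y vs = \<psi> y vs - codiff k \<phi> y vs" for y vs
  have \<eta>0: "smooth_form_on M E k ?U \<eta>0"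
    by (rule form_cong[OF form_add[OF \<psi>U form_scale[OF cU U smooth_fun_on_const[OF U, of "- 1"]]]])
      (simp add: \<eta>0_def fun_eq_iff)
  obtain f K where K: "compact K" "K \<subseteq> ?U" and f: "smooth_fun_on M UNIV f" "\<forall>y. f y \<ge> 0"
    "\<forall>y. y \<notin> K \<longrightarrow> f y = 0" "f x > 0"
    using ex_bump[OF c x] by (elim exE conjE)
  have fU: "smooth_fun_on M ?U f" by (rule smooth_fun_on_subset[OF f(1) subset_UNIV])
  define \<eta> where "\<eta> y vs = f y *\<^sub>R \<eta>0 y vs" for y vs
  have \<eta>U: "smooth_form_on M E k ?U \<eta>"
    by (rule form_cong[OF form_scale[OF \<eta>0 U fU]]) (simp add: \<eta>_def fun_eq_iff)
  have \<eta>K: "\<eta> y = (\<lambda>vs. 0)" if "y \<notin> K" for y using f(3) that by (simp add: \<eta>_def fun_eq_iff)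
  have oK: "open (- K)" using compact_imp_closed[OF K(1)] by (simp add: open_Compl)
  have \<eta>s: "smooth_form_on M E k UNIV \<eta>"
  proof (rule form_local)
    fix y
    show "\<exists>V. open V \<and> y \<in> V \<and> smooth_form_on M E k V \<eta>"
    proof (cases "y \<in> ?U")
      case True
      then show ?thesis using U \<eta>U by blast
    next
      case False
      then have y: "y \<in> - K" using K(2) by blast
      have "smooth_form_on M E k (- K) \<eta>" by (rule form_cong[OF form_zero]) (simp add: \<eta>K)
      then show ?thesis using oK y by blast
    qed
  qed
  have "compactly_supported \<eta>"
    unfolding compactly_supported_def using K(1) \<eta>K by (auto simp: zero_fun_def)
  note int_eq = adj'(2)[OF \<eta>s this, folded \<psi>_def]
  define N where "N y = finner k y (\<eta>0 y) (\<eta>0 y)" for y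
  define X0 where "X0 j y = finner k y (\<eta>0 y) (contract k (e j) \<phi> y)" for j y
  \<comment> \<open>On the chart the j-th frame component is the pairing of \<eta> with the
    contraction of \<phi> by \<open>e j\<close>. Keeping f as an explicit factor makes X vanish off
    K even where nothing is known about the frame.\<close>
  define X where "X y = (\<Sum>j<n. (f y * X0 j y) *\<^sub>R e j y)" for y
  define F1 where "F1 y = finner (Suc k) y (d_nabla M E nab k \<eta> y) (\<phi> y)" for y
  define F2 where "F2 y = finner k y (\<eta> y) (\<psi> y)" for y
  define H where "H l y = ?G y * X y (\<lambda>z. snd c z l)" for l y
  have cs: "smooth_form_on M E k ?U (contract k (e j) \<phi>)" if "j < n" for j
    by (rule form_Cons[OF \<phi>U ef[OF that]])
  have Ns: "smooth_fun_on M ?U N" unfolding N_def by (rule finner_smooth[OF e \<eta>0 \<eta>0])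
  have X0s: "smooth_fun_on M ?U (X0 j)" if "j < n" for j unfolding X0_def by (rule finner_smooth[OF e \<eta>0 cs[OF that]])
  have fX0: "smooth_fun_on M ?U (\<lambda>y. f y * X0 j y)" if "j < n" for j
    by (intro smooth_fun_on_mult U fU X0s that)
  have Xabs: "X = (\<lambda>y. \<Sum>j<n. (f y * X0 j y) *\<^sub>R e j y)" by (rule ext) (rule X_def)
  have Xs: "vector_field_on M ?U X"
    unfolding Xabs using fX0 ef by (intro tan.section_sum tan.section_scale U) auto
  have Gs: "smooth_fun_on M ?U ?G" by (rule sqrt_gram_det_smooth[OF c])
  have Gpos: "?G y > 0" if "y \<in> ?U" for y using gram_det_pos[OF c that] by simp
  have Hs: "smooth_fun_on M ?U (H l)" for l
    unfolding H_def by (rule smooth_fun_on_mult[OF U Gs smooth_fun_on_field[OF U Xs smooth_fun_on_coord[OF c]]])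
  have F2s: "smooth_fun_on M ?U F2" unfolding F2_def by (rule finner_smooth[OF e \<eta>U \<psi>U])
  have H0: "H l y = 0" if "y \<notin> K" for l y
    using f(3) that by (simp add: H_def X_def)
  have F20: "F2 y = 0" if "y \<notin> K" for y
    unfolding F2_def \<eta>K[OF that] by (rule finner_zero[OF form_alt[OF \<psi>s UNIV_I]])
  have F10: "F1 y = 0" if "y \<notin> K" for y
  proof -
    have "d_nabla M E nab k \<eta> y = (\<lambda>vs. 0)"
      by (rule d_nabla_zero[OF oK]) (use that \<eta>K in auto)
    then show ?thesis unfolding F1_def by (simp only: finner_zero[OF form_alt[OF \<phi> UNIV_I]])
  qed
  \<comment> \<open>As \<open>codiff k \<phi>\<close> equals \<psi> - \<eta>0, its pairing with
    \<eta> is \<open>F2 - f N\<close>; the difference to \<open>F1\<close> is the divergence of X,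
    written in coordinates after multiplication by the density.\<close>
  have pt: "?G y * F1 y = ?G y * F2 y - ?G y * (f y * N y) + (\<Sum>l<n. coord_vec M c l y (H l))"
    if y: "y \<in> ?U" for y
  proof -
    note ob = onframe_onbasis[OF e y]
    have a0: "\<eta>0 y \<in> alt_forms M E k y" and a1: "\<psi> y \<in> alt_forms M E k y" and a2: "codiff k \<phi> y \<in> alt_forms M E k y"
      by (rule form_alt[OF \<eta>0 y], rule form_alt[OF \<psi>U y], rule form_alt[OF cU y])
    have \<eta>y: "\<eta> y = (\<lambda>vs. f y *\<^sub>R \<eta>0 y vs)" by (simp add: \<eta>_def fun_eq_iff)
    have "finner k y (\<eta> y) (codiff k \<phi> y) = F2 y - f y * N y"
    proof -
      have "N y = finner k y (\<eta>0 y) (\<psi> y) - finner k y (\<eta>0 y) (codiff k \<phi> y)"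
        unfolding N_def using finner_diff_right[OF a0 a1 a2] by (simp add: \<eta>0_def[of y, abs_def])
      then show ?thesis unfolding F2_def \<eta>y finner_scale[OF a0 a1] finner_scale[OF a0 a2]
        by (simp add: right_diff_distrib)
    qed
    moreover have "F1 y - finner k y (\<eta> y) (codiff k \<phi> y) = dvg (\<lambda>i. e i y) X y"
    proof -
      have Xeq: "finner k z (\<eta> z) (contract k (e j) \<phi> z) = f z * X0 j z" if "z \<in> ?U" "j < n" for z j
        using finner_scale[OF form_alt[OF \<eta>0 that(1)] form_alt[OF cs[OF that(2)] that(1)], of "f z"]
        by (simp add: X0_def \<eta>_def[of z, abs_def])
      have "e i y (\<lambda>z. finner k z (\<eta> z) (contract k (e i) \<phi> z)) = e i y (\<lambda>z. f z * X0 i z)" if i: "i < n" for i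
        by (rule tangent_cong[OF onbasis_tangent[OF ob i] U y finner_smooth[OF e \<eta>U cs[OF i]]]) (rule Xeq[OF _ i])
      moreover have "dvg (\<lambda>i. e i y) X y = (\<Sum>i<n. e i y (\<lambda>z. f z * X0 i z)) -
          (\<Sum>i<n. \<Sum>j<n. g y (D y (e i y) (e i)) (e j y) * (f y * X0 j y))"
        unfolding Xabs by (rule dvg_frame[OF e y]) (rule fX0)
      ultimately show ?thesis
        unfolding F1_def divergence_identity[OF e y \<phi>U \<eta>U] using Xeq[OF y] by simp
    qed
    moreover have "?G y * dvg (\<lambda>i. e i y) X y = (\<Sum>l<n. coord_vec M c l y (H l))"
      unfolding H_def by (rule dvg_coord[OF ob c y U y order_refl Xs])
    ultimately have "F1 y = (F2 y - f y * N y) + dvg (\<lambda>i. e i y) X y"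
      and *: "?G y * dvg (\<lambda>i. e i y) X y = (\<Sum>l<n. coord_vec M c l y (H l))" by simp_all
    from arg_cong[OF this(1), of "\<lambda>t. ?G y * t"]
    show ?thesis unfolding *[symmetric] by (simp only: distrib_left right_diff_distrib)
  qed
  let ?D = "\<lambda>y. \<Sum>l<n. coord_vec M c l y (H l)" and ?P = "\<lambda>y. ?G y * (f y * N y)"
  have Ps: "smooth_fun_on M ?U ?P" by (intro smooth_fun_on_mult U Gs fU Ns)
  have Ds: "smooth_fun_on M ?U (\<lambda>y. coord_vec M c l y (H l))" if "l < n" for l
    using smooth_fun_on_coord_vec[OF c that U Hs] by simp
  \<comment> \<open>Continuity of \<open>F1\<close>, which contains the exterior derivative of
    \<eta>, is read off from the pointwise identity by dividing by the positive density.\<close>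
  have F1c: "continuous_on ?U F1"
  proof -
    have "smooth_fun_on M ?U (\<lambda>y. ?G y * F2 y - ?P y + ?D y)"
      using Ds by (intro smooth_fun_on_add smooth_fun_on_diff smooth_fun_on_sum smooth_fun_on_mult[OF U Gs F2s] Ps U) auto
    then have "continuous_on ?U (\<lambda>y. (?G y * F2 y - ?P y + ?D y) / ?G y)"
      using Gpos by (intro continuous_on_divide smooth_fun_on_continuous[OF U] Gs) force+
    then show ?thesis
    proof (rule continuous_on_eq)
      fix y assume y: "y \<in> ?U"
      show "(?G y * F2 y - ?P y + ?D y) / ?G y = F1 y"
        unfolding pt[OF y, symmetric] using Gpos[OF y] by simp
    qed
  qed
  let ?I = "\<lambda>F. \<integral>z. chart_pull c F (zero_ext n z) \<partial>lborel_Rn n"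
  have Gc: "continuous_on ?U ?G" by (rule smooth_fun_on_continuous[OF U Gs])
  have Gn: "gram_det M g c y \<ge> 0" if "y \<in> ?U" for y using gram_det_pos[OF c that] by simp
  have zK: "y \<notin> K" if "y \<notin> ?U" for y using K(2) that by blast
  have "?I (\<lambda>y. ?G y * F1 y) = (\<integral>y. F1 y \<partial>vol)"
    by (rule integral_chart[OF vol c Gc Gn F1c, symmetric]) (use F10 zK in auto)
  also have "\<dots> = (\<integral>y. F2 y \<partial>vol)" unfolding F1_def F2_def by (rule int_eq)
  also have "\<dots> = ?I (\<lambda>y. ?G y * F2 y)"
    by (rule integral_chart[OF vol c Gc Gn smooth_fun_on_continuous[OF U F2s]]) (use F20 zK in auto)
  finally have I1: "?I (\<lambda>y. ?G y * F1 y) = ?I (\<lambda>y. ?G y * F2 y)" .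
  have pull: "chart_pull c (\<lambda>y. ?G y * F1 y) z = chart_pull c (\<lambda>y. ?G y * F2 y) z - chart_pull c ?P z +
      (\<Sum>l<n. chart_pull c (\<lambda>y. coord_vec M c l y (H l)) z)" for z
  proof (cases "z \<in> snd c ` ?U")
    case True
    then have "chart_inv c z \<in> ?U" using chart_inv_left[OF c] by auto
    from pt[OF this] show ?thesis using True by (simp add: chart_pull_def)
  qed (simp add: chart_pull_def)
  have i2: "integrable (lborel_Rn n) (\<lambda>z. chart_pull c (\<lambda>y. ?G y * F2 y) (zero_ext n z))"
    by (rule chart_pull_integrable[OF c K smooth_fun_on_mult[OF U Gs F2s]]) (simp add: F20)
  have P0: "?P y = 0" if "y \<notin> K" for y using f(3) that by simp
  have iP: "integrable (lborel_Rn n) (\<lambda>z. chart_pull c ?P (zero_ext n z))"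
    by (rule chart_pull_integrable[OF c K Ps]) (rule P0)
  have iD: "integrable (lborel_Rn n) (\<lambda>z. chart_pull c (\<lambda>y. coord_vec M c l y (H l)) (zero_ext n z))"
    "?I (\<lambda>y. coord_vec M c l y (H l)) = 0" if "l < n" for l
    by (rule chart_pull_integral_coord_vec[OF c K Hs _ that], rule H0, assumption)+
  have "?I (\<lambda>y. ?G y * F1 y) = (\<integral>z. chart_pull c (\<lambda>y. ?G y * F2 y) (zero_ext n z) -
      chart_pull c ?P (zero_ext n z) \<partial>lborel_Rn n) +
      (\<integral>z. (\<Sum>l<n. chart_pull c (\<lambda>y. coord_vec M c l y (H l)) (zero_ext n z)) \<partial>lborel_Rn n)"
    unfolding pull using i2 iP iD(1)
    by (intro Bochner_Integration.integral_add Bochner_Integration.integrable_diff Bochner_Integration.integrable_sum) auto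
  also have "(\<integral>z. (\<Sum>l<n. chart_pull c (\<lambda>y. coord_vec M c l y (H l)) (zero_ext n z)) \<partial>lborel_Rn n) =
      (\<Sum>l<n. ?I (\<lambda>y. coord_vec M c l y (H l)))"
    by (rule Bochner_Integration.integral_sum) (simp add: iD(1))
  also have "\<dots> = 0" by (simp add: iD(2))
  finally have "?I (\<lambda>y. ?G y * F1 y) = ?I (\<lambda>y. ?G y * F2 y) - ?I ?P"
    using Bochner_Integration.integral_diff[OF i2 iP] by simp
  \<comment> \<open>The divergence has integral zero and adjointness equates the integrals with
    \<open>F1\<close> and \<open>F2\<close>, so the nonnegative term with f N is all that is
    left.\<close>
  then have "?I ?P = 0" using I1 by simp
  then have "?P x = 0"
  proof (rule chart_pull_integral_eq_0[OF c K Ps, rotated 2])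
    show "0 \<le> ?P y" if "y \<in> ?U" for y
    proof -
      have "N y = (form_norm M g h k y (\<eta>0 y))\<^sup>2"
        unfolding N_def by (rule form_norm_sq[OF form_alt[OF \<eta>0 that], symmetric])
      then show ?thesis using Gpos[OF that] f(2) by simp
    qed
  qed (use x P0 in auto)
  then have "N x = 0" using Gpos[OF x] f(4) by simp
  then have "\<eta>0 x = 0" using finner_pos[OF form_alt[OF \<eta>0 x]] unfolding N_def by fastforce
  then show ?thesis unfolding \<eta>0_def[abs_def] \<psi>_def by (simp add: fun_eq_iff)
qed

end

section \<open>The refined Kato inequality\<close>

context geo_ctx
begin

lemma finner_sym:
  assumes "\<alpha> \<in> alt_forms M E k x" "\<beta> \<in> alt_forms M E k x"
  shows "finner k x \<alpha> \<beta> = finner k x \<beta> \<alpha>"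
  using psd_form.ip_sym[OF htot(1)] assms by (simp add: ip_eq_finner[OF onbasis_onb])

text \<open>As \<phi> does not vanish at x, the norm is smooth on the open set W around x where its
  square is positive; differentiating the square there and using the metric property gives the
  formula.\<close>

lemma tangent_form_norm:
  assumes \<phi>: "smooth_form_on M E k UNIV \<phi>" and nz: "\<phi> x \<noteq> 0" and v: "v \<in> tangent_space M x"
  shows "v (\<lambda>y. form_norm M g h k y (\<phi> y)) = finner k x (nabla k \<phi> x v) (\<phi> x) / form_norm M g h k x (\<phi> x)"
proof -
  obtain c where c: "c \<in> atlas M" and xc: "x \<in> fst c" using ex_chart by blast
  note U = chart_open[OF c]
  obtain e where e: "onframe (fst c) e" using ex_onframe[OF c] by blast
  have \<phi>U: "smooth_form_on M E k (fst c) \<phi>" by (rule form_subset[OF \<phi> subset_UNIV])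
  define F where "F y = finner k y (\<phi> y) (\<phi> y)" for y
  let ?r = "\<lambda>y. form_norm M g h k y (\<phi> y)"
  have F: "smooth_fun_on M (fst c) F" unfolding F_def by (rule finner_smooth[OF e \<phi>U \<phi>U])
  have Fx: "F x > 0" unfolding F_def by (rule finner_pos[OF form_alt[OF \<phi> UNIV_I] nz])
  define W where "W = {y \<in> fst c. F y > 0}"
  have W: "open W" "x \<in> W" "W \<subseteq> fst c"
  proof -
    have "open (fst c \<inter> F -` {0<..})"
      by (rule continuous_open_preimage[OF smooth_fun_on_continuous[OF U F] U]) simp
    moreover have "fst c \<inter> F -` {0<..} = W" by (auto simp: W_def)
    ultimately show "open W" by simp
  qed (use xc Fx in \<open>auto simp: W_def\<close>)
  have FW: "smooth_fun_on M W F" by (rule smooth_fun_on_subset[OF F W(3)])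
  have Wpos: "F y > 0" if "y \<in> W" for y using that by (simp add: W_def)
  have r_sq: "?r y = sqrt (F y)" for y by (simp add: form_norm_def F_def)
  have r: "smooth_fun_on M W ?r"
    by (rule smooth_fun_on_cong[OF smooth_fun_on_powr[OF W(1) FW Wpos, of "1 / 2"] W(1)])
      (use Wpos in \<open>auto simp: powr_half_sqrt less_imp_le r_sq\<close>)
  have r0: "?r x > 0" using Fx by (simp add: r_sq)
  have "v F = v (\<lambda>y. ?r y * ?r y)"
    by (rule tangent_cong[OF v W(1,2) FW]) (use Wpos in \<open>simp add: r_sq less_imp_le\<close>)
  also have "\<dots> = v ?r * ?r x + ?r x * v ?r" by (rule tangent_mult[OF v W(1,2) r r])
  finally have "v F = 2 * ?r x * v ?r" by simp
  moreover have "v F = 2 * finner k x (nabla k \<phi> x v) (\<phi> x)"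
    unfolding F_def finner_metric[OF e \<phi>U \<phi>U xc v]
    using finner_sym[OF form_alt[OF \<phi> UNIV_I] nabla_alt[OF \<phi> open_UNIV UNIV_I v]] by simp
  ultimately show ?thesis using r0 by (simp add: field_simps)
qed

text \<open>The algebraic inequality for the components of \<nabla>\<phi> and the unit form
  \<phi>/|\<phi>|, with an arbitrary real m satisfying the two conditions in place of the minimum.
  The form \<delta> stands for the adjoint applied to \<phi>: zero in degree 0, the codifferential
  otherwise.\<close>

lemma refined_kato:
  assumes \<phi>: "smooth_form_on M E k UNIV \<phi>" and nz: "\<phi> x \<noteq> 0" and kn: "k \<le> n"
    and c: "c \<ge> 0" "cs \<ge> 0" "m \<ge> 0"
    and P: "d_nabla M E nab k \<phi> x = 0 \<and> m * real k \<le> 1 \<or> m * (1 + real k * c) \<le> c"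
    and \<delta>: "k = 0 \<Longrightarrow> \<delta> = 0" "\<And>j. k = Suc j \<Longrightarrow> \<delta> = codiff j \<phi> x"
    and Q: "\<delta> = 0 \<and> m * real (n - k) \<le> 1 \<or> m * (1 + real (n - k) * cs) \<le> cs"
  shows "(1 + m) * norm_sq_d M g (\<lambda>y. form_norm M g h k y (\<phi> y)) x \<le>
    norm_sq_nabla M g h k x (nabla k \<phi> x) + c * (form_norm M g h (k + 1) x (d_nabla M E nab k \<phi> x))\<^sup>2 +
    cs * (form_norm M g h (k - 1) x \<delta>)\<^sup>2"
proof -
  interpret psd_form "htot x" by (rule htot)
  let ?e = "onb M g x" and ?s = "form_norm M g h k x (\<phi> x)"
  note ob = onbasis_onb[of x]
  note \<phi>a = form_alt[OF \<phi> UNIV_I, of x]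
  have na: "nabla k \<phi> x (?e i) \<in> alt_forms M E k x" if "i < n" for i
    by (rule nabla_alt[OF \<phi> open_UNIV UNIV_I onbasis_tangent[OF ob that]])
  have dna: "d_nabla M E nab k \<phi> x = dN k \<phi> x" by (rule d_nabla_eq_dN[OF \<phi> open_UNIV UNIV_I])
  have da: "dN k \<phi> x \<in> alt_forms M E (Suc k) x" by (rule dN_alt[OF \<phi> open_UNIV UNIV_I])
  define T where "T i I = nabla k \<phi> x (?e i) (map ?e I)" for i I
  define f where "f I = (1 / ?s) *\<^sub>R \<phi> x (map ?e I)" for I
  have s_pos: "?s > 0" using finner_pos[OF \<phi>a nz] by (simp add: form_norm_def)
  have s_sq: "?s * ?s = ip n k (\<lambda>I. \<phi> x (map ?e I)) (\<lambda>I. \<phi> x (map ?e I))"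
    using form_norm_sq[OF \<phi>a] unfolding ip_eq_finner[OF ob \<phi>a \<phi>a] by (simp add: power2_eq_square)
  have dT: "alt_sum_omit T J = dN k \<phi> x (map ?e J)" if "J \<in> idx n (Suc k)" for J
    unfolding dN_map[OF ob that] T_def[abs_def] ..
  have main: "(1 + m) * (\<Sum>i<n. (ip n k (T i) f)\<^sup>2) \<le> (\<Sum>i<n. ip n k (T i) (T i)) +
    c * ip n (Suc k) (alt_sum_omit T) (alt_sum_omit T) +
    (if k = 0 then 0 else cs * ip n (k - 1) (\<lambda>I. \<Sum>i<n. T i (i # I)) (\<lambda>I. \<Sum>i<n. T i (i # I)))"
  proof (rule refined_kato_algebraic[OF _ _ _ kn c])
    show "swap_odd {..<n} k (T i)" if "i < n" for i
      using alt_move_odd[OF ob na[OF that]] by (simp add: T_def[abs_def])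
    show "swap_odd {..<n} k f"
      using alt_move_odd[OF ob \<phi>a] by (simp add: f_def[abs_def] swap_odd_def)
    show "ip n k f f = 1"
      using s_pos unfolding f_def[abs_def] by (simp add: ip_scale ip_scale_right s_sq[symmetric])
    show "((\<forall>J\<in>idx n (Suc k). alt_sum_omit T J = 0) \<and> m * real k \<le> 1) \<or> m * (1 + real k * c) \<le> c"
      using P by (auto simp: dT dna)
    show "((k = 0 \<or> (\<forall>I\<in>idx n (k - 1). (\<Sum>i<n. T i (i # I)) = 0)) \<and> m * real (n - k) \<le> 1) \<or>
      m * (1 + real (n - k) * cs) \<le> cs"
    proof (cases k)
      case (Suc j)
      have "(\<Sum>i<n. T i (i # I)) = - \<delta> (map ?e I)" if "I \<in> idx n j" for I
        using map_onbasis_tlists[OF ob that] Suc by (simp add: \<delta>(2)[OF Suc] codiff_def T_def)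
      then show ?thesis using Q Suc by auto
    qed (use Q in auto)
  qed
  have 1: "norm_sq_d M g (\<lambda>y. form_norm M g h k y (\<phi> y)) x = (\<Sum>i<n. (ip n k (T i) f)\<^sup>2)"
    unfolding norm_sq_d_def
  proof (intro sum.cong refl)
    fix i assume "i \<in> {..<n}"
    then have i: "i < n" by simp
    show "(?e i (\<lambda>y. form_norm M g h k y (\<phi> y)))\<^sup>2 = (ip n k (T i) f)\<^sup>2"
      unfolding tangent_form_norm[OF \<phi> nz onbasis_tangent[OF ob i]] ip_eq_finner[OF ob na[OF i] \<phi>a]
        T_def[abs_def] f_def[abs_def] by (simp add: ip_scale_right)
  qed
  have 2: "norm_sq_nabla M g h k x (nabla k \<phi> x) = (\<Sum>i<n. ip n k (T i) (T i))"
    unfolding norm_sq_nabla_def T_def[abs_def]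
    by (intro sum.cong refl) (simp add: form_norm_sq[OF na] ip_eq_finner[OF ob na na])
  have 3: "(form_norm M g h (k + 1) x (d_nabla M E nab k \<phi> x))\<^sup>2 = ip n (Suc k) (alt_sum_omit T) (alt_sum_omit T)"
  proof -
    have "ip n (Suc k) (alt_sum_omit T) (alt_sum_omit T) =
        ip n (Suc k) (\<lambda>J. dN k \<phi> x (map ?e J)) (\<lambda>J. dN k \<phi> x (map ?e J))"
      by (intro ip_cong dT)
    then show ?thesis using form_norm_sq[OF da] ip_eq_finner[OF ob da da] by (simp add: dna)
  qed
  \<comment> \<open>Only an inequality is claimed: for k = 0 the left side is 0, while the right
    side is a nonnegative term in the truncated degree \<open>k - 1 = 0\<close>.\<close>
  have 4: "(if k = 0 then 0 else cs * ip n (k - 1) (\<lambda>I. \<Sum>i<n. T i (i # I)) (\<lambda>I. \<Sum>i<n. T i (i # I))) \<le>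
      cs * (form_norm M g h (k - 1) x \<delta>)\<^sup>2"
  proof (cases k)
    case (Suc j)
    obtain ch where ch: "ch \<in> atlas M" "x \<in> fst ch" using ex_chart by blast
    obtain e where "onframe (fst ch) e" using ex_onframe[OF ch(1)] by blast
    from codiff_smooth[OF this form_subset[OF \<phi>[unfolded Suc] subset_UNIV]]
    have a: "\<delta> \<in> alt_forms M E j x" unfolding \<delta>(2)[OF Suc] by (rule form_alt[OF _ ch(2)])
    have "\<delta> (map ?e I) = - (\<Sum>i<n. T i (i # I))" if "I \<in> idx n j" for I
      using map_onbasis_tlists[OF ob that] Suc by (simp add: \<delta>(2)[OF Suc] codiff_def T_def)
    then have "ip n j (\<lambda>I. \<delta> (map ?e I)) (\<lambda>I. \<delta> (map ?e I)) =
        ip n j (\<lambda>I. - (\<Sum>i<n. T i (i # I))) (\<lambda>I. - (\<Sum>i<n. T i (i # I)))"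
      by (intro ip_cong) auto
    also have "\<dots> = ip n j (\<lambda>I. \<Sum>i<n. T i (i # I)) (\<lambda>I. \<Sum>i<n. T i (i # I))"
      by (simp add: ip_def H_minus H_minus_right)
    finally show ?thesis using Suc form_norm_sq[OF a] ip_eq_finner[OF ob a a] by simp
  qed (use c in simp)
  show ?thesis unfolding 1 2 3 using main 4 by linarith
qed

end

text \<open>Translates the bound on m by a possibly infinite constant into the division-free
  alternatives of \<open>refined_kato\<close>. If Z holds and k = 0, the constant is infinite and
  \<open>m * k \<le> 1\<close> holds trivially.\<close>

lemma ereal_le_cases:
  fixes m k c :: real
  assumes "ereal m \<le> (if Z then 1 / ereal k else ereal (c / (1 + k * c)))" "k \<ge> 0" "c \<ge> 0"
  shows "Z \<and> m * k \<le> 1 \<or> m * (1 + k * c) \<le> c"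
proof (cases Z)
  case True
  show ?thesis
  proof (cases "k = 0")
    case False
    then have "ereal m \<le> ereal (1 / k)" using assms(1) True by (simp add: one_ereal_def)
    then show ?thesis using True False assms(2) by (simp add: field_simps)
  qed (use True in simp)
next
  case False
  have "1 + k * c > 0" using assms(2,3) by (simp add: add_pos_nonneg)
  then show ?thesis using assms(1) False by (simp add: field_simps)
qed

theorem theorem1p2:
  fixes M :: "'m::{t2_space,second_countable_topology} manifold"
    and g :: "'m \<Rightarrow> 'm tvec \<Rightarrow> 'm tvec \<Rightarrow> real"
    and D :: "('m, 'm tvec) conn"
    and vol :: "'m measure"
    and E :: "('m, 'e::real_vector) vbundle"
    and h :: "'m \<Rightarrow> 'e \<Rightarrow> 'e \<Rightarrow> real"
    and nab :: "('m, 'e) conn"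
    and dstar :: "('m \<Rightarrow> 'm tvec list \<Rightarrow> 'e) \<Rightarrow> 'm \<Rightarrow> 'm tvec list \<Rightarrow> 'e"
    and n k :: nat
    and c cs :: real
    and \<phi> :: "'m \<Rightarrow> 'm tvec list \<Rightarrow> 'e"
    and x :: 'm
  assumes "smooth_manifold M"
    and "mdim M = n"
    and "riemannian_metric M g"
    and "levi_civita M g D"
    and "riemannian_measure M g vol"
    and "vector_bundle M E"
    and "fibre_metric M E h"
    and "metric_connection M E h nab"
    and "k \<le> n"
    and "formal_adjoint M g vol E h nab k dstar"
    and "c \<ge> 0"
    and "cs \<ge> 0"
    and "smooth_form_on M E k UNIV \<phi>"
    and "\<phi> x \<noteq> 0"
  shows
    "let ct = (if d_nabla M E nab k \<phi> x = 0 then 1 / ereal (real k)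
               else ereal (c / (1 + real k * c)));
         cst = (if dstar \<phi> x = 0 then 1 / ereal (real (n - k))
                else ereal (cs / (1 + real (n - k) * cs)))
     in ereal (norm_sq_nabla M g h k x (form_nabla M D nab k \<phi> x)
               + c * (form_norm M g h (k + 1) x (d_nabla M E nab k \<phi> x))\<^sup>2
               + cs * (form_norm M g h (k - 1) x (dstar \<phi> x))\<^sup>2)
        \<ge> (1 + min ct cst) * ereal (norm_sq_d M g (\<lambda>y. form_norm M g h k y (\<phi> y)) x)"
proof -
  note mn = \<open>mdim M = n\<close> and kn = \<open>k \<le> n\<close> and c = \<open>c \<ge> 0\<close> \<open>cs \<ge> 0\<close>
    and \<phi> = \<open>smooth_form_on M E k UNIV \<phi>\<close> and nz = \<open>\<phi> x \<noteq> 0\<close> and adj = \<open>formal_adjoint M g vol E h nab k dstar\<close>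
  have "connection M E nab" using \<open>metric_connection M E h nab\<close> by (simp add: metric_connection_def)
  then interpret geo_ctx M g D E h nab
    using assms by unfold_locales (auto simp: riemannian_metric_def)
  define ct where "ct = (if d_nabla M E nab k \<phi> x = 0 then 1 / ereal (real k) else ereal (c / (1 + real k * c)))"
  define cst where "cst = (if dstar \<phi> x = 0 then 1 / ereal (real (n - k))
                else ereal (cs / (1 + real (n - k) * cs)))"
  let ?L = "norm_sq_nabla M g h k x (form_nabla M D nab k \<phi> x)
      + c * (form_norm M g h (k + 1) x (d_nabla M E nab k \<phi> x))\<^sup>2
      + cs * (form_norm M g h (k - 1) x (dstar \<phi> x))\<^sup>2"
  let ?R = "norm_sq_d M g (\<lambda>y. form_norm M g h k y (\<phi> y)) x"
  have L0: "?L \<ge> 0" using c by (auto simp: norm_sq_nabla_def intro!: add_nonneg_nonneg mult_nonneg_nonneg sum_nonneg)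
  have q0: "1 / ereal (real j) \<ge> 0" for j
    by (cases "j = 0") (simp_all add: one_ereal_def zero_ereal_def)
  have ct0: "ct \<ge> 0" and cst0: "cst \<ge> 0"
    using c q0 by (auto simp: ct_def cst_def)
  have "(1 + min ct cst) * ereal ?R \<le> ereal ?L"
  proof (cases "min ct cst")
    case (real m)
    have m0: "m \<ge> 0" using ct0 cst0 real by (metis ereal_less_eq(5) min.boundedI)
    have mct: "ereal m \<le> ct" and mcst: "ereal m \<le> cst"
      unfolding real[symmetric] by simp_all
    have "(1 + m) * ?R \<le> ?L"
    proof (rule refined_kato[OF \<phi> nz _ c m0])
      show "k \<le> mdim M" using kn mn by simp
      show "d_nabla M E nab k \<phi> x = 0 \<and> m * real k \<le> 1 \<or> m * (1 + real k * c) \<le> c"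
        by (rule ereal_le_cases[OF mct[unfolded ct_def]]) (use c in auto)
      show "dstar \<phi> x = 0 \<and> m * real (mdim M - k) \<le> 1 \<or> m * (1 + real (mdim M - k) * cs) \<le> cs"
        unfolding mn by (rule ereal_le_cases[OF mcst[unfolded cst_def]]) (use c in auto)
      show "dstar \<phi> x = 0" if "k = 0" using adj \<phi> that unfolding formal_adjoint_def by (simp add: zero_fun_def)
      show "dstar \<phi> x = codiff j \<phi> x" if "k = Suc j" for j
        using formal_adjoint_eq_codiff[OF \<open>riemannian_measure M g vol\<close> adj[unfolded that] \<phi>[unfolded that]] .
    qed
    then show ?thesis unfolding real by (simp add: one_ereal_def)
  next
    case PInf
    \<comment> \<open>Both constants are infinite only if k = 0 and n - k = 0. Then n = 0, the sum
      defining \<open>norm_sq_d\<close> is empty, and the convention \<infinity> * 0 = 0 settles the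
      claim.\<close>
    have "ct = \<infinity>" "cst = \<infinity>" using PInf by (auto simp: min_def split: if_splits)
    then have "k = 0" "n - k = 0"
      by (auto simp: ct_def cst_def one_ereal_def split: if_splits)
    then have "?R = 0" using mn by (simp add: norm_sq_d_def)
    then show ?thesis using L0 by (simp add: zero_ereal_def[symmetric])
  next
    case MInf
    then show ?thesis using ct0 cst0 by (auto simp: min_def split: if_splits)
  qed
  then show ?thesis unfolding Let_def ct_def cst_def .
qed

end
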